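(* Let $d\ge 2$, $s>0$ and $\beta>\frac{1-d}{4}$. Then $$\big\||\square|^\beta \big(e^{it\phi_s(D)}f\,\overline{e^{it\phi_s(D)}g}\big)\big\|_{L^2(\mathbb{R}^{d+1})}^2\le \mathbf{KG}(\beta,d)\int_{\mathbb{R}^{2d}}|\widehat{f}(\eta_1)|^2|\widehat{g}(\eta_2)|^2\,\phi_s(|\eta_1|)\phi_s(|\eta_2|)\,\mathcal K_{\frac12}^{\frac{d-2}{2}+2\beta}(\eta_1,\eta_2)\,\mathrm d\eta_1\,\mathrm d\eta_2,$$ where the constant $$\mathbf{KG}(\beta,d):=2^{\frac{-5d+1}{2}+2\beta}\,\pi^{\frac{-5d+1}{2}}\,\frac{\Gamma(\frac{d-1}{2}+2\beta)}{\Gamma(d-1+2\beta)}$$ is optimal (i.e. the inequality, required for all $f,g$, fails if the constant is replaced by any smaller one).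
   Context: For $s>0$ and $r\ge0$, $\phi_s(r)=\sqrt{s^2+r^2}$. Spatial Fourier transform: $\widehat f(\xi)=\int_{\mathbb R^d}e^{-ix\cdot\xi}f(x)\,\mathrm dx$. $D=\sqrt{-\Delta_x}$, and the Klein--Gordon propagator is $e^{it\phi_s(D)}f(x)=(2\pi)^{-d}\int_{\mathbb R^d}e^{i(x\cdot\xi+t\phi_s(|\xi|))}\widehat f(\xi)\,\mathrm d\xi$. The operator $|\square|^\beta$ is the space-time Fourier multiplier on $\mathbb R\times\mathbb R^d$ with symbol $\big|\tau^2-|\xi|^2\big|^\beta$, where $(\tau,\xi)$ are dual to $(t,x)$ (space-time Fourier transform $\widetilde F(\tau,\xi)=\int e^{-i(t\tau+x\cdot\xi)}F(t,x)\,\mathrm dt\,\mathrm dx$). The kernel is $$\mathcal K_a^b(\eta_1,\eta_2)=\frac{\big(\phi_s(|\eta_1|)\phi_s(|\eta_2|)-\eta_1\cdot\eta_2-s^2\big)^b}{\big(\phi_s(|\eta_1|)\phi_s(|\eta_2|)-\eta_1\cdot\eta_2+s^2\big)^a},\qquad \eta_1,\eta_2\in\mathbb R^d.$$ $\Gamma$ is the gamma function. $f,g$ are sufficiently nice functions on $\mathbb R^d$ (e.g. such that the right-hand side is finite). *)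

theory Defs
  imports "HOL-Analysis.Analysis"
begin

section \<open>Fourier transform and tempered distributions\<close>

definition fourier :: "('a::euclidean_space \<Rightarrow> complex) \<Rightarrow> 'a \<Rightarrow> complex" where
  "fourier f \<xi> = (LINT x|lborel. exp (- \<i> * complex_of_real (x \<bullet> \<xi>)) * f x)"

(* D bs is the iterated partial derivative of \<psi> along the coordinate directions listed in bs.
   Requiring every D bs to be (Frechet) differentiable makes \<psi> infinitely differentiable. *)
definition schwartz :: "('a::euclidean_space \<Rightarrow> complex) \<Rightarrow> bool" where
  "schwartz \<psi> \<longleftrightarrow>
    (\<exists>D :: 'a list \<Rightarrow> 'a \<Rightarrow> complex.
       D [] = \<psi> \<and>
       (\<forall>bs\<in>lists Basis.
          (\<forall>x. (D bs has_derivative (\<lambda>h. \<Sum>b\<in>Basis. (h \<bullet> b) *\<^sub>R D (b # bs) x)) (at x)) \<and>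
          (\<forall>k. bounded (range (\<lambda>x. norm x ^ k *\<^sub>R D bs x)))))"

definition tempered_fun :: "('a::euclidean_space \<Rightarrow> complex) \<Rightarrow> bool" where
  "tempered_fun F \<longleftrightarrow> (\<forall>\<psi>. schwartz \<psi> \<longrightarrow> integrable lborel (\<lambda>x. F x * \<psi> x))"

(* The Fourier transform of F in the sense of tempered distributions is (represented by) the
   function G. For integrable F this is satisfied by G = fourier F, but the product of two
   Klein-Gordon waves is in general not integrable over space-time. *)
definition has_fourier ::
    "('a::euclidean_space \<Rightarrow> complex) \<Rightarrow> ('a \<Rightarrow> complex) \<Rightarrow> bool" where
  "has_fourier F G \<longleftrightarrow>
     tempered_fun F \<and> tempered_fun G \<and>
     (\<forall>\<psi>. schwartz \<psi> \<longrightarrow>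
        integrable lborel (\<lambda>x. F x * fourier \<psi> x) \<and>
        (LINT x|lborel. F x * fourier \<psi> x) = (LINT \<xi>|lborel. G \<xi> * \<psi> \<xi>))"

section \<open>Space-time objects; points of space-time are pairs (t, x)\<close>

(* The value at points with \<tau>\<^sup>2 = |\<xi>|\<^sup>2, where 0 powr \<beta> = 0 for every \<beta>, is irrelevant since the
   light cone is a null set. *)
definition box_symbol :: "real \<Rightarrow> real \<times> 'a::euclidean_space \<Rightarrow> real" where
  "box_symbol \<beta> = (\<lambda>(\<tau>, \<xi>). \<bar>\<tau>\<^sup>2 - (norm \<xi>)\<^sup>2\<bar> powr \<beta>)"

(* H = |box|^\<beta> F. The symbol is singular (\<beta> < 0) or not smooth, so it can multiply the
   Fourier transform of F only when the latter is a function. *)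
definition is_box_power ::
    "real \<Rightarrow> (real \<times> 'a::euclidean_space \<Rightarrow> complex) \<Rightarrow> (real \<times> 'a \<Rightarrow> complex) \<Rightarrow> bool" where
  "is_box_power \<beta> F H \<longleftrightarrow>
     (\<exists>G. has_fourier F G \<and> has_fourier H (\<lambda>p. complex_of_real (box_symbol \<beta> p) * G p))"

definition phi :: "real \<Rightarrow> real \<Rightarrow> real" where
  "phi s r = sqrt (s\<^sup>2 + r\<^sup>2)"

definition KG_propagator ::
    "real \<Rightarrow> ('a::euclidean_space \<Rightarrow> complex) \<Rightarrow> real \<Rightarrow> 'a \<Rightarrow> complex" where
  "KG_propagator s f t x =
     complex_of_real (1 / (2 * pi) ^ DIM('a)) *
     (LINT \<xi>|lborel. exp (\<i> * complex_of_real (x \<bullet> \<xi> + t * phi s (norm \<xi>))) * fourier f \<xi>)"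

definition KG_product ::
    "real \<Rightarrow> ('a::euclidean_space \<Rightarrow> complex) \<Rightarrow> ('a \<Rightarrow> complex) \<Rightarrow> real \<times> 'a \<Rightarrow> complex" where
  "KG_product s f g = (\<lambda>(t, x). KG_propagator s f t x * cnj (KG_propagator s g t x))"

section \<open>The bilinear estimate\<close>

(* The numerator base is nonnegative and vanishes only for \<eta>1 = \<eta>2; the denominator base is
   at least 2 s\<^sup>2. *)
definition KG_kernel :: "real \<Rightarrow> real \<Rightarrow> real \<Rightarrow> 'a::euclidean_space \<Rightarrow> 'a \<Rightarrow> real" where
  "KG_kernel s a b \<eta>1 \<eta>2 =
     (phi s (norm \<eta>1) * phi s (norm \<eta>2) - \<eta>1 \<bullet> \<eta>2 - s\<^sup>2) powr b /
     (phi s (norm \<eta>1) * phi s (norm \<eta>2) - \<eta>1 \<bullet> \<eta>2 + s\<^sup>2) powr a"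

definition KG_density ::
    "real \<Rightarrow> real \<Rightarrow> ('a::euclidean_space \<Rightarrow> complex) \<Rightarrow> ('a \<Rightarrow> complex) \<Rightarrow> 'a \<times> 'a \<Rightarrow> real" where
  "KG_density s \<beta> f g = (\<lambda>(\<eta>1, \<eta>2).
     (norm (fourier f \<eta>1))\<^sup>2 * (norm (fourier g \<eta>2))\<^sup>2 *
     phi s (norm \<eta>1) * phi s (norm \<eta>2) *
     KG_kernel s (1/2) ((real DIM('a) - 2) / 2 + 2 * \<beta>) \<eta>1 \<eta>2)"

(* The "sufficiently nice" data: all integrals defining the Fourier transforms, the propagators
   and the right-hand side converge absolutely. *)
definition KG_admissible ::
    "real \<Rightarrow> real \<Rightarrow> ('a::euclidean_space \<Rightarrow> complex) \<Rightarrow> ('a \<Rightarrow> complex) \<Rightarrow> bool" where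
  "KG_admissible s \<beta> f g \<longleftrightarrow>
     integrable lborel f \<and> integrable lborel (fourier f) \<and>
     integrable lborel g \<and> integrable lborel (fourier g) \<and>
     integrable lborel (KG_density s \<beta> f g)"

(* |box|^\<beta> of the product exists in L\<^sup>2 (it is unique up to null sets) and satisfies the
   estimate with constant C. *)
definition KG_estimate ::
    "real \<Rightarrow> real \<Rightarrow> real \<Rightarrow> ('a::euclidean_space \<Rightarrow> complex) \<Rightarrow> ('a \<Rightarrow> complex) \<Rightarrow> bool" where
  "KG_estimate s \<beta> C f g \<longleftrightarrow>
     (\<exists>H. is_box_power \<beta> (KG_product s f g) H \<and>
          H \<in> borel_measurable lborel \<and>
          integrable lborel (\<lambda>p. (norm (H p))\<^sup>2) \<and>
          (LINT p|lborel. (norm (H p))\<^sup>2) \<le> C * (LINT q|lborel. KG_density s \<beta> f g q))"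

definition KG_const :: "real \<Rightarrow> nat \<Rightarrow> real" where
  "KG_const \<beta> d =
     2 powr ((- 5 * real d + 1) / 2 + 2 * \<beta>) * pi powr ((- 5 * real d + 1) / 2) *
     (Gamma ((real d - 1) / 2 + 2 * \<beta>) / Gamma (real d - 1 + 2 * \<beta>))"

end

theory Submission
  imports Defs "HOL-Probability.Probability"
begin

text \<open>By Plancherel in space-time the left-hand side is a weighted \<open>L\<^sup>2\<close> norm of the spectral density of the
  product, which at \<open>(\<tau>, \<xi>)\<close> integrates the two Fourier transforms over the fibre of pairs \<open>(\<eta>1, \<eta>2)\<close> with
  \<open>\<eta>1 - \<eta>2 = \<xi>\<close> and \<open>\<phi>(\<eta>1) - \<phi>(\<eta>2) = \<tau>\<close>. Cauchy--Schwarz on the fibre, with the weights \<open>\<phi>(\<eta>1) / \<phi>(\<eta>2)\<close> and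
  \<open>\<phi>(\<eta>2) / \<phi>(\<eta>1)\<close>, bounds its square by a density of \<open>f\<close> alone times a density of \<open>g\<close> alone. Integrated over
  \<open>(\<tau>, \<xi>)\<close>, the product of these densities ties a point \<open>P1\<close> of the mass shell (from \<open>f\<close>) to a point \<open>P4\<close> (from \<open>g\<close>)
  through free points with \<open>P1 - P2 = P3 - P4\<close>, that is \<open>P1 + P4 = P2 + P3\<close>. A boost to the rest frame of
  \<open>P1 + P4\<close> turns the set of these free points into a sphere on which the symbol is a multiple of \<open>1 + e \<bullet> \<omega>\<close>, and
  the resulting spherical integral produces the kernel and the quotient of Gamma values.
  For \<open>exp (- \<phi>) / \<phi>\<close> as the Fourier transform of both functions, the two factors in Cauchy--Schwarz are
  proportional on every fibre because \<open>\<phi>(\<eta>1) - \<phi>(\<eta>2)\<close> is constant there, so that every step is an equality.\<close>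

section \<open>Measures and one-dimensional substitutions\<close>

text \<open>The weights in Cauchy-Schwarz are dictated by Lorentz invariance: they give the free
  points the measure d\<eta> / \<open>phi\<close>, the invariant measure of the mass shell. This is
  what permits the boost, and afterwards P1 and P4 enter only through the one invariant
  \<open>mgap\<close>, of which \<open>KG_kernel\<close> is a function. The obstacle is that fibres
  are null sets. They are therefore written as explicit parametrised integrals, and the exchange of
  P2 and P4 is first proved for smeared fibres. Differences of points of the mass shell satisfy
  |\<tau>| < |\<xi>|, and there the base of the symbol is \<open>mgap\<close>. The condition \<beta>
  > (1 - d) / 4 is what keeps the spherical integral finite near 1 + e \<bullet> \<omega> = 0. The
  product of two waves is in general not integrable over space-time, so its transform is identified
  by duality; uniqueness of that transform makes the equality case bind every constant. The constant
  collects (2 pi)^(2 - 2 d) from the squared transform of the product, \<open>fibC\<close> from the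
  spheres, and (2 pi)^(- d - 1) from Plancherel.\<close>

lemma nn_integral_Cc_imp_measure_eq:
  fixes M N :: "'a::euclidean_space measure"
  assumes M: "sets M = sets borel" and N: "sets N = sets borel"
    and eq: "\<And>v :: 'a \<Rightarrow> real. \<lbrakk>continuous_on UNIV v; \<And>x. 0 \<le> v x; \<And>x. v x \<le> 1; bounded {x. v x \<noteq> 0}\<rbrakk> \<Longrightarrow>
        (\<integral>\<^sup>+x. ennreal (v x) \<partial>M) = (\<integral>\<^sup>+x. ennreal (v x) \<partial>N) \<and> (\<integral>\<^sup>+x. ennreal (v x) \<partial>M) < \<infinity>"
  shows "M = N"
proof -
  have [measurable_cong]: "sets M = sets borel" "sets N = sets borel" using M N by auto
  have *: "emeasure M U = emeasure N U" if U: "open U" "bounded U" for U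
  proof -
    define V where "V = - U"
    \<comment> \<open>\<open>infdist\<close> to the empty set is 0 by convention, so the cutoffs
      below need a nonempty complement; boundedness of U provides it.\<close>
    have "V \<noteq> {}" using U unfolding V_def by (metis Compl_empty_eq double_complement not_bounded_UNIV)
    have cV: "closed V" using U by (simp add: V_def closed_def)
    \<comment> \<open>These cutoffs increase to the indicator of U, because a point of U has
      positive distance to the closed set V. Their supports lie in U and are therefore
      bounded.\<close>
    define v where "v n x = min 1 (real n * infdist x V)" for n x
    have cont: "continuous_on UNIV (v n)" for n
      unfolding v_def by (intro continuous_intros)
    have nn: "0 \<le> v n x" "v n x \<le> 1" for n x by (auto simp: v_def infdist_nonneg)
    have z: "v n x = 0" if "x \<notin> U" for n x using that by (simp add: v_def V_def)
    have bd: "bounded {x. v n x \<noteq> 0}" for n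
      by (rule bounded_subset[OF U(2)]) (use z in blast)
    have inc: "v n x \<le> v (Suc n) x" for n x
    proof -
      have "real n * infdist x V \<le> real (Suc n) * infdist x V"
        by (intro mult_right_mono) (auto simp: infdist_nonneg)
      then show ?thesis unfolding v_def by linarith
    qed
    have sup: "(SUP n. ennreal (v n x)) = indicator U x" for x
    proof (cases "x \<in> U")
      case True
      have "infdist x V > 0"
        using True cV \<open>V \<noteq> {}\<close> by (metis ComplD V_def in_closed_iff_infdist_zero infdist_nonneg order_less_le)
      then obtain n where "1 < real n * infdist x V" using reals_Archimedean3 by blast
      then have "v n x = 1" by (simp add: v_def)
      then have "(1::ennreal) \<le> (SUP n. ennreal (v n x))" by (intro SUP_upper2[of n]) auto
      moreover have "(SUP n. ennreal (v n x)) \<le> 1" by (intro SUP_least) (use nn in auto)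
      ultimately show ?thesis using True by auto
    qed (simp add: z)
    have ind: "emeasure L U = (SUP n. \<integral>\<^sup>+x. ennreal (v n x) \<partial>L)" if L: "sets L = sets borel" for L
    proof -
      have [measurable_cong]: "sets L = sets borel" by fact
      have "emeasure L U = (\<integral>\<^sup>+x. indicator U x \<partial>L)" using U L by simp
      also have "\<dots> = (\<integral>\<^sup>+x. (SUP n. ennreal (v n x)) \<partial>L)" by (simp add: sup)
      also have "\<dots> = (SUP n. \<integral>\<^sup>+x. ennreal (v n x) \<partial>L)"
      proof (rule nn_integral_monotone_convergence_SUP)
        show "incseq (\<lambda>i x. ennreal (v i x))"
          by (intro incseq_SucI le_funI ennreal_leI inc)
        have [measurable]: "v n \<in> borel_measurable borel" for n using cont by (rule borel_measurable_continuous_onI)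
        show "(\<lambda>x. ennreal (v i x)) \<in> borel_measurable L" for i by measurable
      qed
      finally show ?thesis .
    qed
    show ?thesis using ind[OF M] ind[OF N] eq[OF cont nn bd] by simp
  qed
  \<comment> \<open>Uniqueness on a generator asks for a cover by sets of finite measure. A
    continuous cutoff equal to 1 on a ball containing U gives the bound.\<close>
  have fin: "emeasure M U < \<infinity>" if U: "bounded U" "open U" for U
  proof -
    obtain r where r: "U \<subseteq> ball 0 r" using U(1) bounded_subset_ballD by blast
    define v where "v x = max 0 (min 1 (r + 1 - norm x))" for x :: 'a
    have c: "continuous_on UNIV v" unfolding v_def by (intro continuous_intros)
    have [measurable]: "v \<in> borel_measurable borel" using c by (rule borel_measurable_continuous_onI)
    have "bounded {x. v x \<noteq> 0}"
      by (rule bounded_subset[OF bounded_ball[of 0 "r+1"]]) (auto simp: v_def)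
    with eq[of v] c have "(\<integral>\<^sup>+x. ennreal (v x) \<partial>M) < \<infinity>" by (auto simp: v_def)
    moreover have "emeasure M U = (\<integral>\<^sup>+x. indicator U x \<partial>M)" using U M by simp
    moreover have "\<dots> \<le> (\<integral>\<^sup>+x. ennreal (v x) \<partial>M)"
      by (intro nn_integral_mono) (use r in \<open>auto simp: v_def indicator_def subset_eq\<close>)
    ultimately show ?thesis by simp
  qed
  let ?E = "range (\<lambda>(a, b::'a). box a b)"
  show ?thesis
  proof (rule measure_eqI_generator_eq[where E = ?E and \<Omega> = UNIV and A = "\<lambda>n::nat. box (- (real n *\<^sub>R One)) (real n *\<^sub>R One)"])
    show "Int_stable ?E" by (auto simp: Int_stable_def box_Int_box)
    show "\<And>X. X \<in> ?E \<Longrightarrow> emeasure M X = emeasure N X" using * by (auto simp: bounded_box open_box)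
    show "sets M = sigma_sets UNIV ?E" "sets N = sigma_sets UNIV ?E" using M N by (simp_all add: borel_eq_box)
    show "(\<Union>i. box (- (real i *\<^sub>R One)) (real i *\<^sub>R One)) = (UNIV::'a set)" by (rule UN_box_eq_UNIV)
    show "emeasure M (box (- (real i *\<^sub>R One)) (real i *\<^sub>R One)) \<noteq> \<infinity>" for i using fin[OF bounded_box open_box, of "- (real i *\<^sub>R One)" "real i *\<^sub>R One"] by auto
  qed auto
qed

text \<open>Measurable induction reduces \<open>ennreal\<close> integrands to indicators of Borel
  sets, for which substitution on a compact interval applies. Monotone convergence along the
  exhausting intervals then passes to I, which may be open or unbounded. Describing J by the images
  of the end points means that a nondecreasing g suffices.\<close>

lemma nn_integral_substitution_interval:
  fixes f :: "real \<Rightarrow> ennreal" and g :: "real \<Rightarrow> real"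
  assumes f: "f \<in> borel_measurable borel"
    and J: "\<And>n. a n \<le> b n" "decseq a" "incseq b"
    and I: "(\<Union>n. {a n..b n}) = I" and gI: "(\<Union>n. {g (a n)..g (b n)}) = J"
    and g: "\<And>x. x \<in> I \<Longrightarrow> (g has_real_derivative g' x) (at x)"
    and cg: "continuous_on I g'" and nn: "\<And>x. x \<in> I \<Longrightarrow> 0 \<le> g' x"
    and gm: "g \<in> borel_measurable borel" "g' \<in> borel_measurable borel"
  shows "(\<integral>\<^sup>+y. f y * indicator J y \<partial>lborel) = (\<integral>\<^sup>+x. f (g x) * ennreal (g' x) * indicator I x \<partial>lborel)"
proof -
  note [measurable] = f gm
  have sub: "{a n..b n} \<subseteq> I" for n using I by blast
  have 1: "(\<integral>\<^sup>+y. f y * indicator {g (a n)..g (b n)} y \<partial>lborel) = (\<integral>\<^sup>+x. f (g x) * ennreal (g' x) * indicator {a n..b n} x \<partial>lborel)" for n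
    using f
  proof (induction rule: borel_measurable_induct)
    case (cong f h)
    then have "f = h" by auto
    then show ?case using cong by simp
  next
    case (set A)
    note [measurable] = set
    have "(\<integral>\<^sup>+x. ennreal (indicator A x) * indicator {g (a n)..g (b n)} x \<partial>lborel) = (\<integral>\<^sup>+x. ennreal (indicator A (g x) * g' x * indicator {a n..b n} x) \<partial>lborel)"
      using nn_integral_substitution[of "g" "a n" "b n" "indicator A" g'] sub[of n] g nn J(1)[of n] continuous_on_subset[OF cg sub[of n]]
      by (auto simp: set_borel_measurable_def subset_eq ennreal_mult' ennreal_indicator simp flip: ennreal_indicator)
    also have "\<dots> = (\<integral>\<^sup>+x. indicator A (g x) * ennreal (g' x) * indicator {a n..b n} x \<partial>lborel)"
      by (intro nn_integral_cong) (auto simp: indicator_def)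
    finally show ?case by (simp add: ennreal_indicator)
  next
    case (mult u c)
    note [measurable] = mult(2)
    show ?case using mult by (simp add: mult.assoc nn_integral_cmult)
  next
    case (add u v)
    note [measurable] = add(1,3)
    show ?case using add by (simp add: distrib_right nn_integral_add)
  next
    case (seq U)
    note [measurable] = seq(1)
    have *: "incseq (\<lambda>i x. U i (h x) * c x)" for h :: "real \<Rightarrow> real" and c :: "real \<Rightarrow> ennreal"
    proof (intro incseq_SucI le_funI mult_right_mono)
      show "U i (h x) \<le> U (Suc i) (h x)" for i x using incseq_SucD[OF seq(3), of i] by (simp add: le_fun_def)
    qed auto
    have s: "(\<integral>\<^sup>+x. (SUP i. U i) (h x) * c x \<partial>lborel) = (SUP i. \<integral>\<^sup>+x. U i (h x) * c x \<partial>lborel)"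
      if [measurable]: "h \<in> borel_measurable borel" "c \<in> borel_measurable borel" for h :: "real \<Rightarrow> real" and c :: "real \<Rightarrow> ennreal"
      by (subst nn_integral_monotone_convergence_SUP[OF *, symmetric]) (auto simp: SUP_mult_right_ennreal image_comp intro!: nn_integral_cong)
    show ?case
      using s[of "\<lambda>x. x" "indicator {g (a n)..g (b n)}"] s[of g "\<lambda>x. ennreal (g' x) * indicator {a n..b n} x"] seq.IH
      by (simp add: mult.assoc)
  qed
  \<comment> \<open>Two points of I lie in a common interval of the exhaustion, so the sign of g'
    controls g between them. This makes the image intervals increase with n.\<close>
  have mg: "g x \<le> g y" if xy: "x \<in> I" "y \<in> I" "x \<le> y" for x y
  proof -
    obtain n k where "x \<in> {a n..b n}" "y \<in> {a k..b k}" using xy I by blast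
    then have "{x..y} \<subseteq> {a (max n k)..b (max n k)}"
      using decseqD[OF J(2), of n "max n k"] incseqD[OF J(3), of k "max n k"] by auto
    then have "{x..y} \<subseteq> I" using sub by blast
    then show ?thesis using xy g nn by (intro DERIV_nonneg_imp_nondecreasing[of x y g]) (meson atLeastAtMost_iff subsetD)+
  qed
  have abI: "a n \<in> I" "b n \<in> I" for n using sub[of n] J(1)[of n] by (auto simp: subset_eq)
  have incI: "incseq (\<lambda>n. {a n..b n})" using J by (auto simp: incseq_def decseq_def intro: order_trans)
  have dga: "g (a n) \<le> g (a k)" if "k \<le> n" for n k using that decseqD[OF J(2) that] by (intro mg abI)
  have iga: "g (b k) \<le> g (b n)" if "k \<le> n" for n k using that incseqD[OF J(3) that] by (intro mg abI)
  have incJ: "incseq (\<lambda>n. {g (a n)..g (b n)})"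
    unfolding incseq_def using dga iga by (fastforce intro: order_trans)
  have lim: "(SUP n. \<integral>\<^sup>+x. h x * indicator (A n) x \<partial>lborel) = (\<integral>\<^sup>+x. h x * indicator (\<Union>n. A n) x \<partial>lborel)"
    if "incseq A" and [measurable]: "h \<in> borel_measurable borel" "\<And>n. A n \<in> sets borel" for A and h :: "real \<Rightarrow> ennreal"
  proof -
    have 1: "(SUP n. h x * indicator (A n) x) = h x * indicator (\<Union>n. A n) x" for x
    proof (cases "x \<in> (\<Union>n. A n)")
      case True
      then obtain n where "x \<in> A n" by blast
      then have "h x \<le> (SUP n. h x * indicator (A n) x)" by (intro SUP_upper2[of n]) auto
      moreover have "(SUP n. h x * indicator (A n) x) \<le> h x" by (intro SUP_least) (auto simp: indicator_def)
      ultimately show ?thesis using True by auto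
    qed auto
    have "(SUP n. \<integral>\<^sup>+x. h x * indicator (A n) x \<partial>lborel) = (\<integral>\<^sup>+x. (SUP n. h x * indicator (A n) x) \<partial>lborel)"
    proof (intro nn_integral_monotone_convergence_SUP[symmetric] incseq_SucI le_funI mult_left_mono)
      show "(indicator (A i) x::ennreal) \<le> indicator (A (Suc i)) x" for i x
        using incseq_SucD[OF that(1), of i] by (auto simp: indicator_def)
    qed auto
    then show ?thesis by (simp only: 1)
  qed
  have "(\<integral>\<^sup>+y. f y * indicator J y \<partial>lborel) = (SUP n. \<integral>\<^sup>+y. f y * indicator {g (a n)..g (b n)} y \<partial>lborel)"
    by (subst lim[OF incJ]) (auto simp: gI)
  also have "\<dots> = (SUP n. \<integral>\<^sup>+x. f (g x) * ennreal (g' x) * indicator {a n..b n} x \<partial>lborel)"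
    by (simp add: 1)
  also have "\<dots> = (\<integral>\<^sup>+x. f (g x) * ennreal (g' x) * indicator I x \<partial>lborel)"
    by (subst lim[OF incI]) (auto simp: I)
  finally show ?thesis .
qed

section \<open>Schwartz functions\<close>

lemma schwartz_derivative:
  assumes "schwartz (\<psi> :: 'a::euclidean_space \<Rightarrow> complex)"
  shows "\<exists>\<psi>'. (\<forall>x. (\<psi> has_derivative (\<lambda>h. \<Sum>b\<in>Basis. (h \<bullet> b) *\<^sub>R \<psi>' b x)) (at x)) \<and>
    (\<forall>b\<in>Basis. schwartz (\<psi>' b))"
proof -
  from assms obtain D :: "'a list \<Rightarrow> 'a \<Rightarrow> complex" where D: "D [] = \<psi>"
    "\<forall>bs\<in>lists Basis. (\<forall>x. (D bs has_derivative (\<lambda>h. \<Sum>b\<in>Basis. (h \<bullet> b) *\<^sub>R D (b # bs) x)) (at x)) \<and>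
      (\<forall>k. bounded (range (\<lambda>x. norm x ^ k *\<^sub>R D bs x)))"
    unfolding schwartz_def by blast
  have "schwartz (D [b])" if "b \<in> Basis" for b
    unfolding schwartz_def
  \<comment> \<open>Later derivatives are consed at the front of the list, so appending b at its end
    makes b the direction of the first derivative.\<close>
  proof (intro exI[of _ "\<lambda>bs. D (bs @ [b])"] conjI ballI)
    fix bs :: "'a list" assume "bs \<in> lists Basis"
    then have *: "bs @ [b] \<in> lists Basis" using that by auto
    show "\<forall>x. (D (bs @ [b]) has_derivative (\<lambda>h. \<Sum>ba\<in>Basis. (h \<bullet> ba) *\<^sub>R D ((ba # bs) @ [b]) x)) (at x)"
      using D(2)[rule_format, OF *] by simp
    show "\<forall>k. bounded (range (\<lambda>x. norm x ^ k *\<^sub>R D (bs @ [b]) x))"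
      using D(2)[rule_format, OF *] by simp
  qed simp
  moreover have "(\<psi> has_derivative (\<lambda>h. \<Sum>b\<in>Basis. (h \<bullet> b) *\<^sub>R D [b] x)) (at x)" for x
    using D(1) D(2)[rule_format, OF lists.Nil] by simp
  ultimately show ?thesis by (intro exI[of _ "\<lambda>b. D [b]"]) simp
qed

lemma schwartz_continuous: "schwartz \<psi> \<Longrightarrow> continuous_on UNIV \<psi>"
  using schwartz_derivative[of \<psi>] by (auto intro!: continuous_at_imp_continuous_on dest: has_derivative_continuous)

lemma schwartz_measurable: "schwartz \<psi> \<Longrightarrow> \<psi> \<in> borel_measurable borel"
  by (simp add: schwartz_continuous borel_measurable_continuous_onI)

lemma schwartz_decay:
  assumes "schwartz (\<psi> :: 'a::euclidean_space \<Rightarrow> complex)"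
  shows "\<exists>C. \<forall>x. norm x ^ k * norm (\<psi> x) \<le> C"
proof -
  from assms obtain D :: "'a list \<Rightarrow> 'a \<Rightarrow> complex" where D: "D [] = \<psi>"
    "\<forall>bs\<in>lists Basis. \<forall>k. bounded (range (\<lambda>x. norm x ^ k *\<^sub>R D bs x))"
    unfolding schwartz_def by blast
  have "bounded (range (\<lambda>x. norm x ^ k *\<^sub>R \<psi> x))"
    using D(2)[rule_format, OF lists.Nil] D(1) by simp
  then obtain C where "\<forall>y\<in>range (\<lambda>x. norm x ^ k *\<^sub>R \<psi> x). norm y \<le> C" unfolding bounded_iff by blast
  then show ?thesis by (intro exI[of _ C]) auto
qed

text \<open>An integrable majorant in product form: its integral factors over the coordinates into
  integrals of 1 / (1 + x^2), so no polar coordinates are required to see that it is finite.\<close>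

definition jweight :: "'a::euclidean_space \<Rightarrow> real" where
  "jweight x = (\<Prod>b\<in>Basis. 1 / (1 + (x \<bullet> b)\<^sup>2))"

lemma jweight_pos: "0 < jweight x"
  unfolding jweight_def by (intro prod_pos) (auto intro: add_pos_nonneg)

lemma jweight_measurable [measurable]: "jweight \<in> borel_measurable borel"
  unfolding jweight_def by measurable

lemma integrable_jweight: "integrable lborel (jweight :: 'a::euclidean_space \<Rightarrow> real)"
proof (rule integrableI_nonneg)
  have "(\<integral>\<^sup>+x. ennreal (1 / (1 + x\<^sup>2)) \<partial>lborel) < \<infinity>"
  proof -
    have "(\<integral>\<^sup>+x. ennreal (1 / (1 + x\<^sup>2)) \<partial>lborel) = (\<integral>\<^sup>+x\<in>UNIV. ennreal (1 / (1 + x\<^sup>2)) \<partial>lborel)" by simp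
    have s: "set_integrable lborel (einterval (-\<infinity>) \<infinity>) (\<lambda>x::real. 1 / (1 + x\<^sup>2))"
    proof (rule interval_integral_FTC_nonneg(1)[where F = arctan])
      show "DERIV arctan x :> 1 / (1 + x\<^sup>2)" for x :: real
        using DERIV_arctan[of x] by (simp add: field_simps)
      show "isCont (\<lambda>x. 1 / (1 + x\<^sup>2)) x" for x :: real
        by (intro continuous_intros) (metis add_pos_nonneg less_numeral_extra(1,3) zero_le_power2)
      show "((arctan \<circ> real_of_ereal) \<longlongrightarrow> - (pi/2)) (at_right (- \<infinity>))"
        by (simp add: ereal_tendsto_simps tendsto_arctan_at_bot)
      show "((arctan \<circ> real_of_ereal) \<longlongrightarrow> pi/2) (at_left \<infinity>)"
        by (simp add: ereal_tendsto_simps tendsto_arctan_at_top)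
    qed auto
    then have "integrable lborel (\<lambda>x::real. 1 / (1 + x\<^sup>2))"
      by (simp add: set_integrable_def)
    then show ?thesis by (subst (asm) integrable_iff_bounded) (auto simp: abs_of_nonneg add_nonneg_nonneg)
  qed
  then show "(\<integral>\<^sup>+x. ennreal (jweight (x::'a)) \<partial>lborel) < \<infinity>"
    unfolding jweight_def
    by (subst prod_ennreal[symmetric], simp add: add_nonneg_nonneg)
      (subst nn_integral_lborel_prod, auto simp: power_less_top_ennreal add_nonneg_nonneg)
qed (auto simp: jweight_pos less_imp_le)

text \<open>Let u be the maximum of 1 and the largest coordinate in absolute value. Every factor 1 +
  (x \<bullet> b)^2 is at most 2 u^2, so the reciprocal of the weight is at most 2^d u^(2 d), and
  one of the two hypotheses bounds u^(2 d) times \<open>norm y\<close>, according to which term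
  attains u.\<close>

lemma jweight_bound:
  assumes "norm y \<le> A" "\<And>b. b \<in> Basis \<Longrightarrow> \<bar>x \<bullet> b\<bar> ^ (2 * DIM('a)) * norm y \<le> A"
  shows "norm y \<le> 2 ^ DIM('a) * A * jweight (x::'a::euclidean_space)"
proof -
  obtain b0 where b0: "b0 \<in> Basis" "\<And>b. b \<in> Basis \<Longrightarrow> \<bar>x \<bullet> b\<bar> \<le> \<bar>x \<bullet> b0\<bar>"
  proof -
    have "Max ((\<lambda>b. \<bar>x \<bullet> b\<bar>) ` Basis) \<in> (\<lambda>b. \<bar>x \<bullet> b\<bar>) ` (Basis::'a set)" by (intro Max_in) auto
    then obtain b0 where "b0 \<in> Basis" "Max ((\<lambda>b. \<bar>x \<bullet> b\<bar>) ` Basis) = \<bar>x \<bullet> b0\<bar>" by blast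
    then show ?thesis by (intro that[of b0]) (auto simp flip: \<open>Max _ = _\<close>)
  qed
  define u where "u = max 1 \<bar>x \<bullet> b0\<bar>"
  have "(\<Prod>b\<in>Basis. 1 + (x \<bullet> b)\<^sup>2) \<le> (\<Prod>b\<in>(Basis::'a set). 2 * u\<^sup>2)"
  proof (intro prod_mono conjI)
    fix b :: 'a assume "b \<in> Basis"
    then have "\<bar>x \<bullet> b\<bar> \<le> u" using b0 by (force simp: u_def)
    then have "(x \<bullet> b)\<^sup>2 \<le> u\<^sup>2" by (metis abs_ge_zero power2_abs power_mono)
    moreover have "1 \<le> u\<^sup>2" by (simp add: u_def)
    ultimately show "1 + (x \<bullet> b)\<^sup>2 \<le> 2 * u\<^sup>2" by linarith
  qed auto
  also have "\<dots> = 2 ^ DIM('a) * u ^ (2 * DIM('a))"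
    by (simp add: power_mult_distrib power_mult)
  finally have 1: "(\<Prod>b\<in>Basis. 1 + (x \<bullet> b)\<^sup>2) \<le> 2 ^ DIM('a) * u ^ (2 * DIM('a))" .
  have "u ^ (2 * DIM('a)) * norm y \<le> A"
    using assms b0(1) by (cases "\<bar>x \<bullet> b0\<bar> \<le> 1") (auto simp: u_def max_def)
  then have "(\<Prod>b\<in>Basis. 1 + (x \<bullet> b)\<^sup>2) * norm y \<le> 2 ^ DIM('a) * A"
    using mult_right_mono[OF 1, of "norm y"] by (simp add: mult.assoc) (smt (verit) mult_left_mono zero_le_power)
  moreover have "0 < (\<Prod>b\<in>Basis. 1 + (x \<bullet> b)\<^sup>2)" by (intro prod_pos) (auto intro: add_pos_nonneg)
  ultimately have "norm y \<le> 2 ^ DIM('a) * A / (\<Prod>b\<in>Basis. 1 + (x \<bullet> b)\<^sup>2)"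
    by (simp add: pos_le_divide_eq mult.commute)
  then show ?thesis by (simp add: jweight_def prod_dividef)
qed

lemma schwartz_jweight:
  assumes "schwartz (\<psi> :: 'a::euclidean_space \<Rightarrow> complex)"
  shows "\<exists>C. \<forall>x. norm (\<psi> x) \<le> C * jweight x"
proof -
  obtain A where A: "\<And>x. norm x ^ 0 * norm (\<psi> x) \<le> A" using schwartz_decay[OF assms] by blast
  obtain B where B: "\<And>x. norm x ^ (2 * DIM('a)) * norm (\<psi> x) \<le> B" using schwartz_decay[OF assms] by blast
  have "norm (\<psi> x) \<le> 2 ^ DIM('a) * max A B * jweight x" for x
  proof (rule jweight_bound)
    show "norm (\<psi> x) \<le> max A B" using A[of x] by simp
    fix b :: 'a assume "b \<in> Basis"
    then have "\<bar>x \<bullet> b\<bar> ^ (2 * DIM('a)) * norm (\<psi> x) \<le> norm x ^ (2 * DIM('a)) * norm (\<psi> x)"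
      by (intro mult_right_mono power_mono Basis_le_norm) auto
    then show "\<bar>x \<bullet> b\<bar> ^ (2 * DIM('a)) * norm (\<psi> x) \<le> max A B" using B[of x] by linarith
  qed
  then show ?thesis by blast
qed

lemma integrable_bound_jweight:
  fixes h :: "'a::euclidean_space \<Rightarrow> complex"
  assumes "h \<in> borel_measurable lborel" "\<And>x. norm (h x) \<le> C * jweight x"
  shows "integrable lborel h"
  by (rule Bochner_Integration.integrable_bound[of _ "\<lambda>x. C * jweight x"])
     (use assms integrable_jweight in \<open>auto intro: order_trans[OF _ abs_ge_self]\<close>)

lemma schwartz_integrable:
  assumes "schwartz \<psi>" shows "integrable lborel \<psi>"
proof -
  obtain C where "\<And>x. norm (\<psi> x) \<le> C * jweight x" using schwartz_jweight[OF assms] by blast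
  then show ?thesis by (intro integrable_bound_jweight) (simp_all add: schwartz_measurable assms)
qed

lemma fourier_norm_le:
  "norm (fourier f \<xi>) \<le> (LINT x|lborel. norm (f x))"
  unfolding fourier_def
  by (rule order_trans[OF integral_norm_bound]) (simp add: norm_mult norm_exp_eq_Re)

lemma fourier_measurable [measurable]:
  fixes f :: "'a::euclidean_space \<Rightarrow> complex"
  assumes [measurable]: "f \<in> borel_measurable lborel"
  shows "fourier f \<in> borel_measurable borel"
  unfolding fourier_def by measurable

lemma integrable_exp_mult:
  fixes f :: "'a::euclidean_space \<Rightarrow> complex"
  assumes "integrable lborel f" and [measurable]: "\<theta> \<in> borel_measurable lborel" and "\<And>x. Re (\<theta> x) = 0"
  shows "integrable lborel (\<lambda>x. exp (\<theta> x) * f x)"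
proof (rule Bochner_Integration.integrable_bound[OF assms(1)])
  have [measurable]: "f \<in> borel_measurable lborel" using assms(1) by auto
  show "(\<lambda>x. exp (\<theta> x) * f x) \<in> borel_measurable lborel" by measurable
qed (simp add: norm_mult norm_exp_eq_Re assms)

section \<open>Integration by parts and decay of Fourier transforms of Schwartz functions\<close>

lemma lborel_integral_translate:
  fixes h :: "'a::euclidean_space \<Rightarrow> 'b::{banach, second_countable_topology}"
  assumes "h \<in> borel_measurable borel"
  shows "(LINT x|lborel. h (x + c)) = (LINT x|lborel. h x)"
  using integral_distr[of "(+) c" lborel borel h] assms by (simp add: lborel_distr_plus add.commute)

lemma lborel_integrable_translate:
  fixes h :: "'a::euclidean_space \<Rightarrow> 'b::{banach, second_countable_topology}"
  assumes "integrable lborel h"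
  shows "integrable lborel (\<lambda>x. h (x + c))"
  using integrable_distr_eq[of "(+) c" lborel borel h] assms borel_measurable_integrable[OF assms]
  by (simp add: lborel_distr_plus add.commute)

text \<open>Integrating the derivative over t in [0, 1] along b gives \<Phi>(x + b) - \<Phi>(x),
  whose integral over x vanishes by translation invariance, while Fubini identifies the same double
  integral with that of \<Phi>'. In this form of integration by parts no boundary terms
  appear.\<close>

lemma integral_derivative_zero:
  fixes \<Phi> :: "'a::euclidean_space \<Rightarrow> complex"
  assumes i: "integrable lborel \<Phi>" "integrable lborel \<Phi>'"
    and d: "\<And>x. ((\<lambda>t. \<Phi> (x + t *\<^sub>R b)) has_vector_derivative \<Phi>' x) (at 0)"
    and c: "continuous_on UNIV \<Phi>'"
  shows "(LINT x|lborel. \<Phi>' x) = 0"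
proof -
  have [measurable]: "\<Phi>' \<in> borel_measurable borel" "\<Phi> \<in> borel_measurable borel" using i by auto
  have d': "((\<lambda>t. \<Phi> (x + t *\<^sub>R b)) has_vector_derivative \<Phi>' (x + t *\<^sub>R b)) (at t)" for x t
  proof -
    have "((\<lambda>t'. \<Phi> (x + t *\<^sub>R b + t' *\<^sub>R b)) has_vector_derivative \<Phi>' (x + t *\<^sub>R b)) (at ((\<lambda>u. u - t) t))"
      using d[of "x + t *\<^sub>R b"] by simp
    then have "((\<lambda>t'. \<Phi> (x + t *\<^sub>R b + t' *\<^sub>R b)) \<circ> (\<lambda>u. u - t) has_vector_derivative 1 *\<^sub>R \<Phi>' (x + t *\<^sub>R b)) (at t)"
      by (intro vector_diff_chain_at) (auto intro!: derivative_eq_intros simp: has_real_derivative_iff_has_vector_derivative[symmetric])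
    then show ?thesis by (simp add: o_def algebra_simps)
  qed
  have ftc: "(LINT t|lborel. indicator {0..1} t *\<^sub>R \<Phi>' (x + t *\<^sub>R b)) = \<Phi> (x + b) - \<Phi> x" for x
  proof -
    have "continuous_on {0..1} (\<lambda>t. \<Phi>' (x + t *\<^sub>R b))"
      by (rule continuous_on_compose2[OF c]) (auto intro!: continuous_intros)
    then show ?thesis
      using integral_FTC_Icc[of 0 1 "\<lambda>t. \<Phi> (x + t *\<^sub>R b)" "\<lambda>t. \<Phi>' (x + t *\<^sub>R b)"]
        has_vector_derivative_at_within[OF d'[of x]] by simp
  qed
  note tr = lborel_integral_translate lborel_integrable_translate
  have "integrable (lborel \<Otimes>\<^sub>M lborel) (\<lambda>(t, x). indicator {0..1::real} t *\<^sub>R \<Phi>' (x + t *\<^sub>R b))"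
  proof (rule lborel_pair.Fubini_integrable)
    have "(LINT x|lborel. norm (\<Phi>' (x + t *\<^sub>R b))) = (LINT x|lborel. norm (\<Phi>' x))" for t :: real
      using tr(1)[of "\<lambda>x. norm (\<Phi>' x)" "t *\<^sub>R b"] by simp
    then show "integrable lborel (\<lambda>t. LINT x|lborel. norm (case (t, x) of (t, x) \<Rightarrow> indicator {0..1::real} t *\<^sub>R \<Phi>' (x + t *\<^sub>R b)))"
      by simp
    show "AE t in lborel. integrable lborel (\<lambda>x. case (t, x) of (t, x) \<Rightarrow> indicator {0..1::real} t *\<^sub>R \<Phi>' (x + t *\<^sub>R b))"
      using tr(2)[OF i(2)] by (auto intro!: AE_I2)
  qed measurable
  from lborel_pair.Fubini_integral[OF this]
  have "(LINT x|lborel. LINT t|lborel. indicator {0..1} t *\<^sub>R \<Phi>' (x + t *\<^sub>R b)) = (LINT t|lborel. LINT x|lborel. indicator {0..1::real} t *\<^sub>R \<Phi>' (x + t *\<^sub>R b))"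
    by simp
  also have "\<dots> = (LINT t|lborel. indicator {0..1::real} t *\<^sub>R (LINT x|lborel. \<Phi>' x))"
    by (simp add: tr(1))
  also have "\<dots> = (LINT x|lborel. \<Phi>' x)" by simp
  finally show ?thesis using tr(1)[of \<Phi> b] tr(2)[OF i(1), of b] i(1) by (simp add: ftc)
qed

text \<open>Integration by parts: \<open>integral_derivative_zero\<close> is applied to the product
  of \<psi> with the character of frequency p.\<close>

lemma fourier_schwartz_derivative:
  fixes \<psi> :: "'a::euclidean_space \<Rightarrow> complex"
  assumes "schwartz \<psi>" and b: "b \<in> Basis"
  shows "\<exists>\<psi>'. schwartz \<psi>' \<and> (\<forall>p. fourier \<psi>' p = \<i> * of_real (p \<bullet> b) * fourier \<psi> p)"
proof -
  obtain \<psi>' where d: "\<And>x. (\<psi> has_derivative (\<lambda>h. \<Sum>b\<in>Basis. (h \<bullet> b) *\<^sub>R \<psi>' b x)) (at x)"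
    and s: "\<And>b. b \<in> Basis \<Longrightarrow> schwartz (\<psi>' b)" using schwartz_derivative[OF assms(1)] by blast
  note sb = s[OF b]
  have "fourier (\<psi>' b) p = \<i> * of_real (p \<bullet> b) * fourier \<psi> p" for p
  proof -
    let ?e = "\<lambda>x. exp (- \<i> * complex_of_real (x \<bullet> p))"
    have i1: "integrable lborel (\<lambda>x. ?e x * \<psi> x)" "integrable lborel (\<lambda>x. ?e x * \<psi>' b x)"
      by (intro integrable_exp_mult schwartz_integrable assms sb; simp)+
    have "(LINT x|lborel. - \<i> * of_real (p \<bullet> b) * (?e x * \<psi> x) + ?e x * \<psi>' b x) = 0"
    proof (rule integral_derivative_zero[where b=b and \<Phi>="\<lambda>x. ?e x * \<psi> x"])
      fix x
      have 1: "((\<lambda>t::real. \<psi> (x + t *\<^sub>R b)) has_vector_derivative \<psi>' b x) (at 0)"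
      proof -
        have "((\<lambda>t. x + t *\<^sub>R b) has_derivative (\<lambda>t. t *\<^sub>R b)) (at (0::real))"
          by (auto intro!: derivative_eq_intros)
        from diff_chain_at[OF this, of \<psi> "\<lambda>h. \<Sum>b\<in>Basis. (h \<bullet> b) *\<^sub>R \<psi>' b x"] d[of x]
        have "((\<lambda>t::real. \<psi> (x + t *\<^sub>R b)) has_derivative (\<lambda>t. \<Sum>c\<in>Basis. (t *\<^sub>R b \<bullet> c) *\<^sub>R \<psi>' c x)) (at 0)"
          by (simp add: o_def)
        moreover have "(\<Sum>c\<in>Basis. (t *\<^sub>R b \<bullet> c) *\<^sub>R \<psi>' c x) = t *\<^sub>R \<psi>' b x" for t
          using b by (simp add: inner_Basis if_distrib[of "\<lambda>u. (t * u) *\<^sub>R _"] sum.delta cong: if_cong)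
        ultimately show ?thesis by (simp add: has_vector_derivative_def)
      qed
      have 2: "((\<lambda>t::real. ?e (x + t *\<^sub>R b)) has_vector_derivative (- \<i> * of_real (p \<bullet> b) * ?e x)) (at 0)"
      proof -
        have "((\<lambda>z. exp (- \<i> * (of_real (x \<bullet> p) + z * of_real (b \<bullet> p)))) has_field_derivative (- \<i> * of_real (p \<bullet> b) * ?e x)) (at (of_real 0))"
          by (auto intro!: derivative_eq_intros simp: inner_commute)
        from has_vector_derivative_real_field[OF this] show ?thesis
          by (simp add: inner_add_left)
      qed
      show "((\<lambda>t. ?e (x + t *\<^sub>R b) * \<psi> (x + t *\<^sub>R b)) has_vector_derivative - \<i> * of_real (p \<bullet> b) * (?e x * \<psi> x) + ?e x * \<psi>' b x) (at 0)"
        using has_vector_derivative_mult[OF 2 1] by (simp add: algebra_simps)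
    next
      show "continuous_on UNIV (\<lambda>x. - \<i> * of_real (p \<bullet> b) * (?e x * \<psi> x) + ?e x * \<psi>' b x)"
        by (intro continuous_intros schwartz_continuous assms sb)
    qed (use i1 in auto)
    moreover have "(LINT x|lborel. - \<i> * of_real (p \<bullet> b) * (?e x * \<psi> x) + ?e x * \<psi>' b x) =
        - \<i> * of_real (p \<bullet> b) * fourier \<psi> p + fourier (\<psi>' b) p"
      unfolding fourier_def
      by (subst Bochner_Integration.integral_add, rule integrable_mult_right, rule i1, rule i1)
        (simp only: integral_mult_right_zero)
    ultimately have "- \<i> * of_real (p \<bullet> b) * fourier \<psi> p + fourier (\<psi>' b) p = 0" by simp
    then show ?thesis by (simp add: add_eq_0_iff)
  qed
  then show ?thesis using sb by blast
qed

text \<open>Each power of the coordinate costs one derivative of \<psi>, so the induction on k has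
  to range over all Schwartz functions at once.\<close>

lemma fourier_schwartz_decay:
  fixes \<psi> :: "'a::euclidean_space \<Rightarrow> complex"
  assumes "schwartz \<psi>" and b: "b \<in> Basis"
  shows "\<exists>C. \<forall>p. \<bar>p \<bullet> b\<bar> ^ k * norm (fourier \<psi> p) \<le> C"
  using assms(1)
proof (induction k arbitrary: \<psi>)
  case 0
  show ?case using fourier_norm_le by auto
next
  case (Suc k)
  obtain \<psi>' where "schwartz \<psi>'" "\<And>p. fourier \<psi>' p = \<i> * of_real (p \<bullet> b) * fourier \<psi> p"
    using fourier_schwartz_derivative[OF Suc(2) b] by blast
  with Suc(1)[of \<psi>'] show ?case by (simp add: norm_mult mult.assoc mult.left_commute)
qed

lemma fourier_schwartz_jweight:
  fixes \<psi> :: "'a::euclidean_space \<Rightarrow> complex"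
  assumes "schwartz \<psi>"
  shows "\<exists>C. \<forall>p. norm (fourier \<psi> p) \<le> C * jweight p"
proof -
  have "\<forall>b\<in>Basis. \<exists>C. \<forall>p. \<bar>p \<bullet> b\<bar> ^ (2 * DIM('a)) * norm (fourier \<psi> p) \<le> C"
    using fourier_schwartz_decay[OF assms] by blast
  then obtain C where C: "\<And>b p. b \<in> Basis \<Longrightarrow> \<bar>p \<bullet> b\<bar> ^ (2 * DIM('a)) * norm (fourier \<psi> p) \<le> C b"
    by metis
  define A where "A = Max (insert (LINT x|lborel. norm (\<psi> x)) (C ` Basis))"
  have "norm (fourier \<psi> p) \<le> 2 ^ DIM('a) * A * jweight p" for p
  proof (rule jweight_bound)
    show "norm (fourier \<psi> p) \<le> A" unfolding A_def by (rule order_trans[OF fourier_norm_le]) simp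
    show "\<bar>p \<bullet> b\<bar> ^ (2 * DIM('a)) * norm (fourier \<psi> p) \<le> A" if "b \<in> Basis" for b
      unfolding A_def using that by (intro order_trans[OF C[OF that]] Max_ge) auto
  qed
  then show ?thesis by blast
qed

lemma fourier_schwartz_integrable:
  assumes "schwartz \<psi>" shows "integrable lborel (fourier \<psi>)"
proof -
  obtain C where "\<And>x. norm (fourier \<psi> x) \<le> C * jweight x" using fourier_schwartz_jweight[OF assms] by blast
  then show ?thesis by (intro integrable_bound_jweight) (simp_all add: schwartz_measurable fourier_measurable assms)
qed

section \<open>Gaussians and Fourier inversion\<close>

lemma nn_integral_lborel_affine:
  fixes h :: "'a::euclidean_space \<Rightarrow> ennreal"
  assumes [measurable]: "h \<in> borel_measurable borel" and c: "c \<noteq> 0"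
  shows "(\<integral>\<^sup>+x. h x \<partial>lborel) = ennreal (\<bar>c\<bar> ^ DIM('a)) * (\<integral>\<^sup>+x. h (t + c *\<^sub>R x) \<partial>lborel)"
  by (subst lborel_affine[OF c, of t]) (simp add: nn_integral_density nn_integral_distr nn_integral_cmult)

lemma integral_lborel_affine:
  fixes h :: "'a::euclidean_space \<Rightarrow> 'b::{banach, second_countable_topology}"
  assumes [measurable]: "h \<in> borel_measurable borel" and c: "c \<noteq> 0"
  shows "(LINT x|lborel. h x) = \<bar>c\<bar> ^ DIM('a) *\<^sub>R (LINT x|lborel. h (t + c *\<^sub>R x))"
  by (subst lborel_affine[OF c, of t]) (simp add: integral_density integral_distr)

lemma nn_integral_lborel_translate:
  fixes h :: "'a::euclidean_space \<Rightarrow> ennreal"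
  assumes [measurable]: "h \<in> borel_measurable borel"
  shows "(\<integral>\<^sup>+x. h (t + x) \<partial>lborel) = (\<integral>\<^sup>+x. h x \<partial>lborel)"
  using nn_integral_lborel_affine[of h 1 t] by simp

definition gaussian :: "'a::euclidean_space \<Rightarrow> real" where
  "gaussian x = (\<Prod>b\<in>Basis. std_normal_density (x \<bullet> b))"

lemma prod_exp_coordinates:
  "(\<Prod>b\<in>Basis. exp (- (x \<bullet> b)\<^sup>2 / 2)) = exp (- (norm (x::'a::euclidean_space))\<^sup>2 / 2)"
proof -
  have "(norm x)\<^sup>2 = (\<Sum>b\<in>Basis. (x \<bullet> b)\<^sup>2)"
    unfolding power2_norm_eq_inner by (subst euclidean_inner) (simp add: power2_eq_square)
  then show ?thesis by (simp add: exp_sum[symmetric] sum_negf sum_divide_distrib)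
qed

lemma gaussian_eq: "gaussian (x::'a::euclidean_space) = exp (- (norm x)\<^sup>2 / 2) / sqrt (2 * pi) ^ DIM('a)"
proof -
  have "gaussian x = (\<Prod>b\<in>Basis. exp (- (x \<bullet> b)\<^sup>2 / 2)) / sqrt (2 * pi) ^ DIM('a)"
    by (simp add: gaussian_def std_normal_density_def prod_dividef prod_constant)
  then show ?thesis by (simp only: prod_exp_coordinates)
qed

lemma gaussian_measurable [measurable]: "gaussian \<in> borel_measurable borel"
  unfolding gaussian_def std_normal_density_def by measurable

lemma gaussian_pos: "0 < gaussian x"
  by (simp add: gaussian_eq)

lemma nn_integral_gaussian: "(\<integral>\<^sup>+x. ennreal (gaussian (x::'a::euclidean_space)) \<partial>lborel) = 1"
proof -
  have 1: "(\<integral>\<^sup>+x. ennreal (std_normal_density x) \<partial>lborel) = 1"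
    using prob_space.emeasure_space_1[OF prob_space_normal_density[of 1 0]] by (simp add: emeasure_density)
  have "(\<integral>\<^sup>+x. ennreal (gaussian (x::'a)) \<partial>lborel) = (\<integral>\<^sup>+x. (\<Prod>b\<in>Basis. ennreal (std_normal_density (x \<bullet> b))) \<partial>(lborel::'a measure))"
    by (simp add: gaussian_def prod_ennreal)
  also have "\<dots> = 1"
    by (subst nn_integral_lborel_prod) (auto simp: 1)
  finally show ?thesis .
qed

lemma integrable_gaussian: "integrable lborel gaussian"
  by (rule integrableI_nonneg) (auto simp: nn_integral_gaussian gaussian_pos less_imp_le)

lemma integral_gaussian: "(LINT x|lborel. gaussian x) = 1"
  using nn_integral_eq_integral[OF integrable_gaussian] by (simp add: nn_integral_gaussian gaussian_pos less_imp_le)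

text \<open>The integrand factors over coordinates, and each factor integrates to the characteristic
  function of the one-dimensional standard normal distribution.\<close>

lemma integral_gaussian_exp:
  "(LINT p|lborel. exp (\<i> * of_real (p \<bullet> y)) * of_real (gaussian p)) = of_real (exp (- (norm (y::'a::euclidean_space))\<^sup>2 / 2))"
proof -
  interpret product_sigma_finite "\<lambda>_::'a. lborel :: real measure" ..
  define f where "f = (\<lambda>b x. std_normal_density x *\<^sub>R iexp ((y \<bullet> b) * x))"
  have [measurable]: "f b \<in> borel_measurable borel" for b unfolding f_def by measurable
  have fi: "integrable lborel (f b)" for b
  proof -
    have "integrable std_normal_distribution (\<lambda>x. iexp ((y \<bullet> b) * x))"
      by (intro prob_space.finite_measure[THEN finite_measure.integrable_const_bound[where B=1]] prob_space_normal_density) auto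
    then show ?thesis by (subst (asm) integrable_density) (auto simp: f_def)
  qed
  have fv: "(LINT x|lborel. f b x) = of_real (exp (- (y \<bullet> b)\<^sup>2 / 2))" for b
  proof -
    have "(LINT x|lborel. f b x) = char std_normal_distribution (y \<bullet> b)"
      unfolding char_def f_def by (subst integral_density) auto
    then show ?thesis by (simp add: char_std_normal_distribution)
  qed
  have inn: "(\<Sum>b\<in>Basis. g b *\<^sub>R b) \<bullet> b = g b" if "b \<in> Basis" for g and b :: 'a using that by simp
  have "(\<Prod>b\<in>Basis. f b (p \<bullet> b)) = exp (\<i> * of_real (p \<bullet> y)) * of_real (gaussian p)" for p
    unfolding f_def gaussian_def scaleR_conv_of_real prod.distrib
    by (subst exp_sum[symmetric]) (auto simp: euclidean_inner[of p y] sum_distrib_left mult_ac)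
  then have "(LINT p|lborel. exp (\<i> * of_real (p \<bullet> y)) * of_real (gaussian p)) = (LINT p|lborel. (\<Prod>b\<in>Basis. f b (p \<bullet> b)))"
    by simp
  also have "\<dots> = (LINT g|(\<Pi>\<^sub>M b\<in>Basis. lborel). (\<Prod>b\<in>Basis. f b (g b)))"
    by (subst lborel_eq, subst integral_distr) (auto intro!: Bochner_Integration.integral_cong prod.cong simp: inn)
  also have "\<dots> = (\<Prod>b\<in>Basis. LINT x|lborel. f b x)"
    by (rule product_integral_prod) (auto simp: fi)
  also have "\<dots> = of_real (exp (- (norm (y::'a::euclidean_space))\<^sup>2 / 2))"
    by (simp only: fv of_real_prod[symmetric] prod_exp_coordinates)
  finally show ?thesis .
qed

lemma integrable_mult_bounded:
  fixes f g :: "'a::euclidean_space \<Rightarrow> complex"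
  assumes "integrable lborel f" "g \<in> borel_measurable borel" "\<And>x. norm (g x) \<le> C"
  shows "integrable lborel (\<lambda>x. f x * g x)" "integrable lborel (\<lambda>x. g x * f x)"
proof -
  show "integrable lborel (\<lambda>x. f x * g x)"
  proof (rule Bochner_Integration.integrable_bound[of _ "\<lambda>x. C *\<^sub>R f x"])
    have "0 \<le> C" using assms(3)[of undefined] norm_ge_zero order_trans by blast
    then show "AE x in lborel. norm (f x * g x) \<le> norm (C *\<^sub>R f x)"
      using assms(3) by (intro AE_I2) (simp add: norm_mult, subst mult.commute, rule mult_right_mono, auto)
  qed (use assms in auto)
  then show "integrable lborel (\<lambda>x. g x * f x)" by (simp add: mult.commute)
qed

lemma cnj_measurable [measurable]: "cnj \<in> borel_measurable borel"
  by (intro borel_measurable_continuous_onI continuous_intros)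

text \<open>Both sides are the double integral of exp(- i x \<bullet> y) f(x) g(y), evaluated in the
  two possible orders.\<close>

lemma fourier_mult_formula:
  fixes f g :: "'a::euclidean_space \<Rightarrow> complex"
  assumes f: "integrable lborel f" and g: "integrable lborel g"
  shows "(LINT x|lborel. fourier f x * g x) = (LINT x|lborel. f x * fourier g x)"
proof -
  have [measurable]: "f \<in> borel_measurable borel" "g \<in> borel_measurable borel" using f g by auto
  let ?h = "\<lambda>(x, y). exp (- \<i> * complex_of_real (x \<bullet> y)) * f x * g y"
  have "integrable (lborel \<Otimes>\<^sub>M lborel) ?h"
  proof (rule lborel_pair.Fubini_integrable)
    show "integrable lborel (\<lambda>x. LINT y|lborel. norm (?h (x, y)))"
      using f by (simp add: norm_mult mult.assoc integrable_norm)
    show "AE x in lborel. integrable lborel (\<lambda>y. ?h (x, y))"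
    proof (rule AE_I2)
      fix x
      have "integrable lborel (\<lambda>y. exp (- \<i> * complex_of_real (x \<bullet> y)) * (f x * g y))"
        by (rule integrable_exp_mult) (use g in auto)
      then show "integrable lborel (\<lambda>y. ?h (x, y))" by (simp add: mult.assoc)
    qed
  qed measurable
  from lborel_pair.Fubini_integral[OF this]
  have "(LINT y|lborel. LINT x|lborel. ?h (x, y)) = (LINT x|lborel. LINT y|lborel. ?h (x, y))" by simp
  moreover have "(LINT x|lborel. ?h (x, y)) = fourier f y * g y" for y
    by (simp add: fourier_def)
  moreover have "(LINT y|lborel. ?h (x, y)) = f x * fourier g x" for x
  proof -
    have "(LINT y|lborel. ?h (x, y)) = (LINT y|lborel. f x * (exp (- \<i> * complex_of_real (y \<bullet> x)) * g y))"
      by (simp add: mult_ac inner_commute)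
    then show ?thesis by (simp add: fourier_def)
  qed
  ultimately show ?thesis by (simp only:)
qed

lemma integrable_gaussian_scaled:
  assumes r: "0 < r"
  shows "integrable lborel (\<lambda>p::'a::euclidean_space. exp (- r\<^sup>2 * (norm p)\<^sup>2 / 2))"
proof -
  have e: "exp (- r\<^sup>2 * (norm p)\<^sup>2 / 2) = sqrt (2 * pi) ^ DIM('a) * gaussian (r *\<^sub>R p)" for p :: 'a
    using r by (simp add: gaussian_eq power_mult_distrib)
  have "integrable lborel (\<lambda>p::'a. gaussian (r *\<^sub>R p))"
  proof (rule integrableI_nonneg)
    have "(\<integral>\<^sup>+p. ennreal (gaussian (r *\<^sub>R (p::'a))) \<partial>lborel) * ennreal (r ^ DIM('a)) = 1"
      using nn_integral_lborel_affine[of "\<lambda>p::'a. ennreal (gaussian p)" r 0] r by (simp add: nn_integral_gaussian mult.commute)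
    then show "(\<integral>\<^sup>+p. ennreal (gaussian (r *\<^sub>R (p::'a))) \<partial>lborel) < \<infinity>"
      using r by (auto simp: less_top[symmetric] ennreal_top_mult)
  qed (auto simp: gaussian_pos less_imp_le)
  then show ?thesis unfolding e by auto
qed

text \<open>Inversion up to a Gaussian average of width r, valid for every integrable k. The
  multiplication formula moves the transform from k to a modulated Gaussian, whose transform is a
  Gaussian centred at y.\<close>

lemma fourier_gaussian_smoothing:
  fixes k :: "'a::euclidean_space \<Rightarrow> complex"
  assumes k: "integrable lborel k" and r: "0 < r"
  shows "(LINT p|lborel. exp (\<i> * of_real (p \<bullet> y)) * fourier k p * of_real (exp (- r\<^sup>2 * (norm p)\<^sup>2 / 2)))
     = of_real ((2 * pi) ^ DIM('a)) * (LINT z|lborel. k (y + r *\<^sub>R z) * of_real (gaussian z))"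
proof -
  have [measurable]: "k \<in> borel_measurable borel" using k by auto
  \<comment> \<open>The total mass of exp(- r^2 |p|^2 / 2). It cancels against the scaling factor
    r^d and the normalisation of \<open>gaussian\<close>, leaving (2 pi)^d.\<close>
  define c where "c = sqrt (2 * pi) ^ DIM('a) / r ^ DIM('a)"
  define G where "G p = exp (\<i> * of_real (p \<bullet> y)) * complex_of_real (exp (- r\<^sup>2 * (norm p)\<^sup>2 / 2))" for p :: 'a
  have eG: "exp (- r\<^sup>2 * (norm p)\<^sup>2 / 2) = sqrt (2 * pi) ^ DIM('a) * gaussian (r *\<^sub>R p)" for p :: 'a
    using r by (simp add: gaussian_eq power_mult_distrib)
  have sc: "(LINT p|lborel. exp (\<i> * of_real (p \<bullet> u)) * complex_of_real (exp (- r\<^sup>2 * (norm p)\<^sup>2 / 2))) =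
     of_real (c * exp (- (norm u)\<^sup>2 / (2 * r\<^sup>2)))" for u :: 'a
  proof -
    have "(LINT p|lborel. exp (\<i> * of_real (p \<bullet> u)) * complex_of_real (exp (- r\<^sup>2 * (norm p)\<^sup>2 / 2)))
      = (LINT p|lborel. of_real (sqrt (2 * pi) ^ DIM('a)) * (exp (\<i> * of_real ((r *\<^sub>R p) \<bullet> (u /\<^sub>R r))) * of_real (gaussian (r *\<^sub>R p))))"
    proof (intro Bochner_Integration.integral_cong refl)
      fix p
      have "(r *\<^sub>R p) \<bullet> (u /\<^sub>R r) = p \<bullet> u" using r by simp
      then show "exp (\<i> * of_real (p \<bullet> u)) * complex_of_real (exp (- r\<^sup>2 * (norm p)\<^sup>2 / 2)) =
         of_real (sqrt (2 * pi) ^ DIM('a)) * (exp (\<i> * of_real ((r *\<^sub>R p) \<bullet> (u /\<^sub>R r))) * of_real (gaussian (r *\<^sub>R p)))"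
        by (simp only: eG of_real_mult mult_ac)
    qed
    also have "\<dots> = of_real (sqrt (2 * pi) ^ DIM('a)) * (LINT p|lborel. exp (\<i> * of_real ((r *\<^sub>R p) \<bullet> (u /\<^sub>R r))) * of_real (gaussian (r *\<^sub>R p)))"
      by (rule integral_mult_right_zero)
    also have "(LINT p|lborel. exp (\<i> * of_real ((r *\<^sub>R p) \<bullet> (u /\<^sub>R r))) * complex_of_real (gaussian (r *\<^sub>R p))) =
       (1 / r ^ DIM('a)) *\<^sub>R (LINT p|lborel. exp (\<i> * of_real (p \<bullet> (u /\<^sub>R r))) * complex_of_real (gaussian p))"
      using r by (subst integral_lborel_affine[of "\<lambda>p. exp (\<i> * of_real (p \<bullet> (u /\<^sub>R r))) * complex_of_real (gaussian p)" r 0]) auto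
    also have "\<dots> = (1 / r ^ DIM('a)) *\<^sub>R of_real (exp (- (norm u)\<^sup>2 / (2 * r\<^sup>2)))"
      unfolding integral_gaussian_exp using r by (simp add: power_divide power_mult_distrib field_simps)
    finally show ?thesis by (simp add: c_def scaleR_conv_of_real)
  qed
  have Gi: "integrable lborel G"
    unfolding G_def
    by (rule integrable_exp_mult) (use integrable_gaussian_scaled[OF r, where ?'a='a] in auto)
  have fG: "fourier G x = of_real (c * exp (- (norm (y - x))\<^sup>2 / (2 * r\<^sup>2)))" for x
  proof -
    have "fourier G x = (LINT p|lborel. exp (\<i> * of_real (p \<bullet> (y - x))) * complex_of_real (exp (- r\<^sup>2 * (norm p)\<^sup>2 / 2)))"
      unfolding fourier_def G_def
      by (intro Bochner_Integration.integral_cong refl) (simp add: exp_add[symmetric] mult.assoc[symmetric] inner_diff_right algebra_simps)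
    then show ?thesis by (simp only: sc)
  qed
  have "(LINT p|lborel. exp (\<i> * of_real (p \<bullet> y)) * fourier k p * of_real (exp (- r\<^sup>2 * (norm p)\<^sup>2 / 2))) = (LINT p|lborel. fourier k p * G p)"
    by (intro Bochner_Integration.integral_cong refl) (simp add: G_def mult_ac)
  also have "\<dots> = (LINT x|lborel. k x * fourier G x)" by (rule fourier_mult_formula[OF k Gi])
  also have "\<dots> = (LINT x|lborel. k x * of_real (c * exp (- (norm (y - x))\<^sup>2 / (2 * r\<^sup>2))))" by (simp only: fG)
  also have "\<dots> = r ^ DIM('a) *\<^sub>R (LINT z|lborel. k (y + r *\<^sub>R z) * of_real (c * exp (- (norm (y - (y + r *\<^sub>R z)))\<^sup>2 / (2 * r\<^sup>2))))"
    using r by (subst integral_lborel_affine[where c=r and t=y]) auto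
  also have "\<dots> = r ^ DIM('a) *\<^sub>R (LINT z|lborel. of_real (c * sqrt (2 * pi) ^ DIM('a)) * (k (y + r *\<^sub>R z) * of_real (gaussian z)))"
    using r by (intro arg_cong[where f="\<lambda>u. _ *\<^sub>R u"] Bochner_Integration.integral_cong refl)
      (simp add: gaussian_eq power_mult_distrib)
  also have "\<dots> = of_real (r ^ DIM('a) * (c * sqrt (2 * pi) ^ DIM('a))) * (LINT z|lborel. (k (y + r *\<^sub>R z) * of_real (gaussian z)))"
    by (simp add: scaleR_conv_of_real)
  also have "r ^ DIM('a) * (c * sqrt (2 * pi) ^ DIM('a)) = (2 * pi) ^ DIM('a)"
  proof -
    have "sqrt (2 * pi) ^ DIM('a) * sqrt (2 * pi) ^ DIM('a) = (2 * pi) ^ DIM('a)"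
      by (simp only: power_mult_distrib[symmetric] real_sqrt_mult_self) simp
    then show ?thesis using r by (simp add: c_def)
  qed
  finally show ?thesis .
qed

text \<open>The limit r \<rightarrow> 0 of \<open>fourier_gaussian_smoothing\<close>. Domination is
  by the integrable transform of \<psi> on one side and by the boundedness of \<psi> on the other;
  continuity of \<psi> identifies the limit of the averages.\<close>

lemma fourier_inversion_schwartz:
  fixes \<psi> :: "'a::euclidean_space \<Rightarrow> complex"
  assumes s: "schwartz \<psi>"
  shows "(LINT p|lborel. exp (\<i> * of_real (p \<bullet> y)) * fourier \<psi> p) = of_real ((2 * pi) ^ DIM('a)) * \<psi> y"
proof -
  have [measurable]: "\<psi> \<in> borel_measurable borel" using s by (rule schwartz_measurable)
  obtain C where C: "\<And>x. norm (\<psi> x) \<le> C" using schwartz_decay[OF s, of 0] by auto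
  define r where "r n = 1 / real (Suc n)" for n
  have r0: "r \<longlonglongrightarrow> 0" unfolding r_def by (rule LIMSEQ_Suc) (rule lim_1_over_n)
  have rpos: "0 < r n" for n by (simp add: r_def)
  have fi: "integrable lborel (\<lambda>p. exp (\<i> * of_real (p \<bullet> y)) * fourier \<psi> p)"
    by (rule integrable_exp_mult) (auto simp: fourier_schwartz_integrable s)
  have "(\<lambda>n. LINT p|lborel. exp (\<i> * of_real (p \<bullet> y)) * fourier \<psi> p * of_real (exp (- (r n)\<^sup>2 * (norm p)\<^sup>2 / 2)))
     \<longlonglongrightarrow> (LINT p|lborel. exp (\<i> * of_real (p \<bullet> y)) * fourier \<psi> p)"
  proof (rule integral_dominated_convergence[where w="\<lambda>p. norm (exp (\<i> * of_real (p \<bullet> y)) * fourier \<psi> p)"])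
    show "AE p in lborel. (\<lambda>n. exp (\<i> * of_real (p \<bullet> y)) * fourier \<psi> p * of_real (exp (- (r n)\<^sup>2 * (norm p)\<^sup>2 / 2))) \<longlonglongrightarrow> exp (\<i> * of_real (p \<bullet> y)) * fourier \<psi> p"
    proof (rule AE_I2)
      fix p :: 'a
      have "(\<lambda>n. exp (- (r n)\<^sup>2 * (norm p)\<^sup>2 / 2)) \<longlonglongrightarrow> exp (- 0\<^sup>2 * (norm p)\<^sup>2 / 2)"
        by (intro tendsto_intros r0) auto
      then show "(\<lambda>n. exp (\<i> * of_real (p \<bullet> y)) * fourier \<psi> p * of_real (exp (- (r n)\<^sup>2 * (norm p)\<^sup>2 / 2))) \<longlonglongrightarrow> exp (\<i> * of_real (p \<bullet> y)) * fourier \<psi> p"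
        using tendsto_mult[OF tendsto_const tendsto_of_real] by fastforce
    qed
  qed (use fi integrable_norm[OF fourier_schwartz_integrable[OF s]] in \<open>auto simp: norm_mult mult_left_le\<close>)
  moreover have "(\<lambda>n. LINT z|lborel. \<psi> (y + r n *\<^sub>R z) * of_real (gaussian z)) \<longlonglongrightarrow> (LINT z|lborel. \<psi> y * of_real (gaussian (z::'a)))"
  proof (rule integral_dominated_convergence[where w="\<lambda>z::'a. C * gaussian z"])
    show "AE z in lborel. (\<lambda>n. \<psi> (y + r n *\<^sub>R z) * of_real (gaussian z)) \<longlonglongrightarrow> \<psi> y * of_real (gaussian z)"
    proof (intro AE_I2 tendsto_intros)
      fix z
      have "(\<lambda>n. y + r n *\<^sub>R z) \<longlonglongrightarrow> y + 0 *\<^sub>R z" by (intro tendsto_intros r0)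
      then show "(\<lambda>n. \<psi> (y + r n *\<^sub>R z)) \<longlonglongrightarrow> \<psi> y"
        using continuous_on_tendsto_compose[OF schwartz_continuous[OF s]] by force
    qed
  qed (use C in \<open>auto simp: norm_mult integrable_gaussian gaussian_pos less_imp_le intro!: mult_right_mono\<close>)
  then have "(\<lambda>n. of_real ((2 * pi) ^ DIM('a)) * (LINT z|lborel. \<psi> (y + r n *\<^sub>R z) * of_real (gaussian z))) \<longlonglongrightarrow> of_real ((2 * pi) ^ DIM('a)) * \<psi> y"
    by (intro tendsto_intros) (simp add: integral_complex_of_real integral_gaussian)
  ultimately show ?thesis
    by (simp only: fourier_gaussian_smoothing[OF schwartz_integrable[OF s] rpos]) (rule LIMSEQ_unique)
qed

section \<open>Bessel's inequality for the Fourier transform\<close>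

lemma ennreal_am_gm:
  assumes "0 \<le> a" "0 \<le> b"
  shows "ennreal a * ennreal b \<le> ennreal (1/2) * (ennreal (a\<^sup>2) + ennreal (b\<^sup>2))"
proof -
  have "a * b \<le> 1/2 * (a\<^sup>2 + b\<^sup>2)" using sum_squares_bound[of a b] by simp
  then have "ennreal (a * b) \<le> ennreal (1/2 * (a\<^sup>2 + b\<^sup>2))" by (rule ennreal_leI)
  also have "\<dots> = ennreal (1/2) * ennreal (a\<^sup>2 + b\<^sup>2)" by (rule ennreal_mult) auto
  also have "ennreal (a\<^sup>2 + b\<^sup>2) = ennreal (a\<^sup>2) + ennreal (b\<^sup>2)" by (rule ennreal_plus) auto
  also have "ennreal (a * b) = ennreal a * ennreal b" by (rule ennreal_mult) (use assms in auto)
  finally show ?thesis .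
qed

lemma ennreal_half_double: "ennreal (1/2) * (x + x) = x"
proof -
  have "ennreal (1/2) * (x + x) = (ennreal (1/2) * ennreal 2) * x"
    by (simp only: mult_2[symmetric] mult.assoc ennreal_numeral)
  also have "ennreal (1/2) * ennreal 2 = ennreal (1/2 * 2)" by (rule ennreal_mult[symmetric]) auto
  finally show ?thesis by simp
qed

text \<open>One direction of Plancherel. With a Gaussian damping factor, the squared norm of the
  transform is a pairing of k with a Gaussian average of its conjugate, and translation invariance
  bounds that pairing by the squared norm of k. Fatou's lemma removes the damping. Applied to the
  transform and to its inverse, this inequality later provides both directions.\<close>

lemma fourier_bessel:
  fixes k :: "'a::euclidean_space \<Rightarrow> complex"
  assumes k: "integrable lborel k" and k2: "(\<integral>\<^sup>+x. ennreal ((norm (k x))\<^sup>2) \<partial>lborel) < \<infinity>"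
  shows "(\<integral>\<^sup>+p. ennreal ((norm (fourier k p))\<^sup>2) \<partial>lborel) \<le> ennreal ((2 * pi) ^ DIM('a)) * (\<integral>\<^sup>+x. ennreal ((norm (k x))\<^sup>2) \<partial>lborel)"
proof -
  have [measurable]: "k \<in> borel_measurable borel" using k by auto
  let ?N = "\<integral>\<^sup>+x. ennreal ((norm (k x))\<^sup>2) \<partial>lborel"
  let ?g = "\<lambda>r p. exp (- r\<^sup>2 * (norm (p::'a))\<^sup>2 / 2)"
  have main: "(\<integral>\<^sup>+p. ennreal ((norm (fourier k p))\<^sup>2 * ?g r p) \<partial>lborel) \<le> ennreal ((2 * pi) ^ DIM('a)) * ?N" if r: "0 < r" for r
  proof -
    have gi: "integrable lborel (\<lambda>p::'a. complex_of_real (?g r p))"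
      using integrable_gaussian_scaled[OF r, where ?'a='a] by (rule integrable_of_real)
    \<comment> \<open>Chosen so that pairing \<open>fourier k\<close> with h gives the damped
      squared modulus. By \<open>fourier_gaussian_smoothing\<close> the transform of h is the
      conjugate of (2 pi)^d times a Gaussian average of k.\<close>
    define h where "h p = cnj (fourier k p) * of_real (?g r p)" for p
    have hi: "integrable lborel h"
      unfolding h_def by (rule integrable_mult_bounded(2)[OF gi]) (use fourier_norm_le[of k] in auto)
    have fh: "fourier h x = cnj (of_real ((2 * pi) ^ DIM('a)) * (LINT z|lborel. k (x + r *\<^sub>R z) * of_real (gaussian z)))" for x
      unfolding fourier_gaussian_smoothing[OF k r, symmetric] fourier_def[of h]
      by (subst Bochner_Integration.integral_cnj[symmetric]) (intro Bochner_Integration.integral_cong refl, simp add: h_def exp_cnj mult_ac inner_commute)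
    have e: "(norm (fourier k p))\<^sup>2 * ?g r p = norm (fourier k p * h p)" for p
      by (simp add: h_def norm_mult power2_eq_square)
    have fhp: "fourier k p * h p = of_real ((norm (fourier k p))\<^sup>2 * ?g r p)" for p
      by (simp add: h_def complex_norm_square[symmetric] mult.assoc[symmetric])
    have i: "integrable lborel (\<lambda>p. fourier k p * h p)"
      by (rule integrable_mult_bounded(2)[OF hi]) (use fourier_norm_le[of k] in auto)
    have "ennreal ((2 * pi) ^ DIM('a)) * ?N < \<infinity>" using k2 by (auto simp: ennreal_mult_less_top)
    have "(\<integral>\<^sup>+p. ennreal ((norm (fourier k p))\<^sup>2 * ?g r p) \<partial>lborel) = ennreal (LINT p|lborel. norm (fourier k p * h p))"
      unfolding e by (rule nn_integral_eq_integral) (use i in auto)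
    also have "(LINT p|lborel. norm (fourier k p * h p)) = norm (LINT p|lborel. fourier k p * h p)"
      unfolding fhp integral_complex_of_real norm_of_real by (simp add: abs_of_nonneg)
    also have "(LINT p|lborel. fourier k p * h p) = (LINT x|lborel. k x * fourier h x)" by (rule fourier_mult_formula[OF k hi])
    also have "ennreal (norm (LINT x|lborel. k x * fourier h x)) \<le> (\<integral>\<^sup>+x. ennreal (norm (k x * fourier h x)) \<partial>lborel)"
      by (rule integral_norm_bound_ennreal, rule integrable_mult_bounded(1)[OF k]) (use hi fourier_norm_le[of h] in auto)
    also have "\<dots> \<le> (\<integral>\<^sup>+x. \<integral>\<^sup>+z. ennreal ((2 * pi) ^ DIM('a)) * (ennreal (norm (k x)) * ennreal (norm (k (x + r *\<^sub>R z))) * ennreal (gaussian z)) \<partial>lborel \<partial>lborel)"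
    proof (rule nn_integral_mono)
      fix x
      have "ennreal (norm (LINT z|lborel. k (x + r *\<^sub>R z) * complex_of_real (gaussian z))) \<le> (\<integral>\<^sup>+z. ennreal (norm (k (x + r *\<^sub>R z))) * ennreal (gaussian z) \<partial>lborel)"
      proof (cases "integrable lborel (\<lambda>z. k (x + r *\<^sub>R z) * complex_of_real (gaussian z))")
        case True
        from integral_norm_bound_ennreal[OF this] show ?thesis
          by (simp add: norm_mult ennreal_mult gaussian_pos less_imp_le)
      qed (simp add: not_integrable_integral_eq)
      then have "ennreal ((2 * pi) ^ DIM('a)) * (ennreal (norm (k x)) * ennreal (norm (LINT z|lborel. k (x + r *\<^sub>R z) * complex_of_real (gaussian z)))) \<le>
        ennreal ((2 * pi) ^ DIM('a)) * (ennreal (norm (k x)) * (\<integral>\<^sup>+z. ennreal (norm (k (x + r *\<^sub>R z))) * ennreal (gaussian z) \<partial>lborel))"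
        by (intro mult_left_mono) auto
      also have "\<dots> = (\<integral>\<^sup>+z. ennreal ((2 * pi) ^ DIM('a)) * (ennreal (norm (k x)) * ennreal (norm (k (x + r *\<^sub>R z))) * ennreal (gaussian z)) \<partial>lborel)"
        by (simp add: nn_integral_cmult mult.assoc)
      also have "ennreal ((2 * pi) ^ DIM('a)) * (ennreal (norm (k x)) * ennreal (norm (LINT z|lborel. k (x + r *\<^sub>R z) * complex_of_real (gaussian z)))) = ennreal (norm (k x * fourier h x))"
        by (simp add: fh norm_mult norm_power power_mult_distrib ennreal_mult[symmetric] mult_ac)
      finally show "ennreal (norm (k x * fourier h x)) \<le> (\<integral>\<^sup>+z. ennreal ((2 * pi) ^ DIM('a)) * (ennreal (norm (k x)) * ennreal (norm (k (x + r *\<^sub>R z))) * ennreal (gaussian z)) \<partial>lborel)" .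
    qed
    also have "\<dots> = ennreal ((2 * pi) ^ DIM('a)) * (\<integral>\<^sup>+x. \<integral>\<^sup>+z. (ennreal (norm (k x)) * ennreal (norm (k (x + r *\<^sub>R z))) * ennreal (gaussian z)) \<partial>lborel \<partial>lborel)"
      by (simp add: nn_integral_cmult)
    also have "(\<integral>\<^sup>+x. \<integral>\<^sup>+z. (ennreal (norm (k x)) * ennreal (norm (k (x + r *\<^sub>R z))) * ennreal (gaussian z)) \<partial>lborel \<partial>lborel)
       = (\<integral>\<^sup>+z. \<integral>\<^sup>+x. (ennreal (norm (k x)) * ennreal (norm (k (x + r *\<^sub>R z))) * ennreal (gaussian z)) \<partial>lborel \<partial>lborel)"
      by (rule lborel_pair.Fubini') measurable
    also have "\<dots> \<le> (\<integral>\<^sup>+z. ?N * ennreal (gaussian (z::'a)) \<partial>lborel)"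
    proof (rule nn_integral_mono)
      fix z :: 'a
      \<comment> \<open>For each fixed shift, the inequality of arithmetic and geometric means
        splits the correlation into two squared norms, which agree by translation
        invariance.\<close>
      have "(\<integral>\<^sup>+x. ennreal (norm (k x)) * ennreal (norm (k (x + r *\<^sub>R z))) \<partial>lborel)
         \<le> (\<integral>\<^sup>+x. ennreal (1/2) * (ennreal ((norm (k x))\<^sup>2) + ennreal ((norm (k (r *\<^sub>R z + x)))\<^sup>2)) \<partial>lborel)"
        by (intro nn_integral_mono) (simp only: add.commute[of "r *\<^sub>R z"] ennreal_am_gm norm_ge_zero)
      also have "\<dots> = ennreal (1/2) * (?N + ?N)"
        using nn_integral_lborel_translate[of "\<lambda>x. ennreal ((norm (k x))\<^sup>2)" "r *\<^sub>R z"]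
        by (simp add: nn_integral_cmult nn_integral_add)
      also have "\<dots> = ?N"
        by (rule ennreal_half_double)
      finally show "(\<integral>\<^sup>+x. ennreal (norm (k x)) * ennreal (norm (k (x + r *\<^sub>R z))) * ennreal (gaussian z) \<partial>lborel) \<le> ?N * ennreal (gaussian z)"
        by (simp add: nn_integral_multc mult_right_mono)
    qed
    also have "\<dots> = ?N" by (simp add: nn_integral_cmult nn_integral_gaussian)
    finally show ?thesis by (simp add: mult_left_mono)
  qed
  have "(\<integral>\<^sup>+p. ennreal ((norm (fourier k p))\<^sup>2) \<partial>lborel) = (\<integral>\<^sup>+p. liminf (\<lambda>n. ennreal ((norm (fourier k p))\<^sup>2 * ?g (1 / real (Suc n)) p)) \<partial>lborel)"
  proof (rule nn_integral_cong)
    fix p :: 'a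
    have "(\<lambda>n. 1 / real (Suc n)) \<longlonglongrightarrow> 0" by (rule LIMSEQ_Suc) (rule lim_1_over_n)
    then have "(\<lambda>n. (norm (fourier k p))\<^sup>2 * ?g (1 / real (Suc n)) p) \<longlonglongrightarrow> (norm (fourier k p))\<^sup>2 * ?g 0 p"
      by (intro tendsto_intros) auto
    then have "(\<lambda>n. ennreal ((norm (fourier k p))\<^sup>2 * ?g (1 / real (Suc n)) p)) \<longlonglongrightarrow> ennreal ((norm (fourier k p))\<^sup>2)"
      by (intro tendsto_ennrealI) simp
    then show "ennreal ((norm (fourier k p))\<^sup>2) = liminf (\<lambda>n. ennreal ((norm (fourier k p))\<^sup>2 * ?g (1 / real (Suc n)) p))"
      by (intro lim_imp_Liminf[symmetric]) auto
  qed
  also have "\<dots> \<le> liminf (\<lambda>n. \<integral>\<^sup>+p. ennreal ((norm (fourier k p))\<^sup>2 * ?g (1 / real (Suc n)) p) \<partial>lborel)"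
    by (rule nn_integral_liminf) measurable
  also have "\<dots> \<le> ennreal ((2 * pi) ^ DIM('a)) * ?N"
    by (rule Liminf_le[OF _ always_eventually], simp, intro allI main, simp)
  finally show ?thesis .
qed

section \<open>Fourier transforms of square-integrable functions\<close>

text \<open>A bounded integrable g is square integrable, since |g|^2 is at most C |g|; then 2 |f g|
  is at most |f|^2 + |g|^2.\<close>

lemma L2_mult_integrable:
  fixes f g :: "'a::euclidean_space \<Rightarrow> complex"
  assumes [measurable]: "f \<in> borel_measurable borel" and f: "(\<integral>\<^sup>+x. ennreal ((norm (f x))\<^sup>2) \<partial>lborel) < \<infinity>"
    and g: "integrable lborel g" "\<And>x. norm (g x) \<le> C"
  shows "integrable lborel (\<lambda>x. f x * g x)"
proof -
  have [measurable]: "g \<in> borel_measurable borel" using g by auto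
  have i: "integrable lborel (\<lambda>x. (norm (f x))\<^sup>2)"
    using f by (intro integrableI_nonneg) auto
  show ?thesis
  proof (rule Bochner_Integration.integrable_bound[of _ "\<lambda>x. (norm (f x))\<^sup>2 + C * norm (g x)"])
    show "integrable lborel (\<lambda>x. (norm (f x))\<^sup>2 + C * norm (g x))" using i g by auto
    show "AE x in lborel. norm (f x * g x) \<le> norm ((norm (f x))\<^sup>2 + C * norm (g x))"
    proof (rule AE_I2)
      fix x
      have "2 * (norm (f x) * norm (g x)) \<le> (norm (f x))\<^sup>2 + (norm (g x))\<^sup>2"
        using sum_squares_bound[of "norm (f x)" "norm (g x)"] by (simp add: mult.assoc)
      moreover have "(norm (g x))\<^sup>2 \<le> C * norm (g x)"
        unfolding power2_eq_square by (intro mult_right_mono g) auto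
      moreover have "0 \<le> (norm (f x))\<^sup>2" "0 \<le> (norm (g x))\<^sup>2" by auto
      ultimately show "norm (f x * g x) \<le> norm ((norm (f x))\<^sup>2 + C * norm (g x))"
        unfolding norm_mult real_norm_def by (smt (verit) mult_nonneg_nonneg norm_ge_zero)
    qed
  qed auto
qed

lemma fourier_diff:
  assumes "integrable lborel f" "integrable lborel g"
  shows "fourier (\<lambda>x. f x - g x) p = fourier f p - fourier g p"
  unfolding fourier_def right_diff_distrib
  by (intro Bochner_Integration.integral_diff integrable_exp_mult assms) auto

text \<open>Completeness of \<open>L\<^sup>2\<close> is not needed: the truncations of \<open>K\<close> are spaced so that consecutive ones differ by at
  most \<open>8 ^ (- j)\<close> in squared norm, and then their transforms converge almost everywhere below an \<open>L\<^sup>2\<close> majorant.\<close>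

lemma fourier_L2:
  fixes K :: "'a::euclidean_space \<Rightarrow> complex"
  assumes K[measurable]: "K \<in> borel_measurable borel" and K2: "(\<integral>\<^sup>+x. ennreal ((norm (K x))\<^sup>2) \<partial>lborel) < \<infinity>"
  shows "\<exists>H\<in>borel_measurable borel.
    (\<integral>\<^sup>+p. ennreal ((norm (H p))\<^sup>2) \<partial>lborel) \<le> ennreal ((2 * pi) ^ DIM('a)) * (\<integral>\<^sup>+x. ennreal ((norm (K x))\<^sup>2) \<partial>lborel) \<and>
    (\<forall>\<psi> C. integrable lborel \<psi> \<longrightarrow> (\<forall>x. norm (\<psi> x) \<le> C) \<longrightarrow> integrable lborel (fourier \<psi>) \<longrightarrow>
       (LINT p|lborel. H p * \<psi> p) = (LINT x|lborel. K x * fourier \<psi> x))"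
proof -
  define tail where "tail N = (\<integral>\<^sup>+x. ennreal ((norm (K x))\<^sup>2) * indicator (- ball 0 N) x \<partial>lborel)" for N :: real
  have "(\<lambda>n. tail (real n)) \<longlonglongrightarrow> (\<integral>\<^sup>+x. 0 \<partial>(lborel::'a measure))"
    unfolding tail_def
  proof (rule nn_integral_dominated_convergence[where w="\<lambda>x. ennreal ((norm (K x))\<^sup>2)"])
    show "AE x in lborel. (\<lambda>n. ennreal ((norm (K x))\<^sup>2) * indicator (- ball 0 (real n)) x) \<longlonglongrightarrow> 0"
    proof (intro AE_I2)
      fix x :: 'a
      obtain n0 where "norm x < real n0" using reals_Archimedean2 by blast
      then have "\<forall>n\<ge>n0. ennreal ((norm (K x))\<^sup>2) * indicator (- ball 0 (real n)) x = 0"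
        by (auto simp: indicator_def)
      then show "(\<lambda>n. ennreal ((norm (K x))\<^sup>2) * indicator (- ball 0 (real n)) x) \<longlonglongrightarrow> 0"
        by (intro tendsto_eventually) (auto simp: eventually_sequentially)
    qed
  qed (use K2 in \<open>auto simp: indicator_def\<close>)
  then have t0: "(\<lambda>n. tail (real n)) \<longlonglongrightarrow> 0" by simp
  have "\<exists>n\<ge>j. tail (real n) \<le> ennreal ((1/8) ^ j)" for j :: nat
  proof -
    have "eventually (\<lambda>n. tail (real n) < ennreal ((1/8) ^ j)) sequentially"
      by (rule order_tendstoD(2)[OF t0]) simp
    then have "eventually (\<lambda>n. j \<le> n \<and> tail (real n) \<le> ennreal ((1/8) ^ j)) sequentially"
      using eventually_ge_at_top[of j] by eventually_elim auto
    then show ?thesis by (auto simp: eventually_sequentially)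
  qed
  then obtain N where N: "\<And>j. j \<le> N j" "\<And>j. tail (real (N j)) \<le> ennreal ((1/8) ^ j)" by metis
  \<comment> \<open>Summation makes the radii monotone, and since M j is at least N j the tail bound
    survives.\<close>
  define M where "M j = (\<Sum>i\<le>j. N i)" for j
  have NM: "N j \<le> M j" for j unfolding M_def by (rule member_le_sum) auto
  have Mmono: "M i \<le> M j" if "i \<le> j" for i j unfolding M_def using that by (intro sum_mono2) auto
  have tM: "tail (real (M j)) \<le> ennreal ((1/8) ^ j)" for j
  proof -
    have "tail (real (M j)) \<le> tail (real (N j))"
      unfolding tail_def using NM[of j] by (intro nn_integral_mono mult_left_mono) (auto simp: indicator_def)
    then show ?thesis using N(2)[of j] by simp
  qed
  have [measurable]: "ball (0::'a) r \<in> sets borel" for r by simp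
  define Kc where "Kc j x = K x * indicator (ball 0 (real (M j))) x" for j x
  have [measurable]: "Kc j \<in> borel_measurable borel" for j unfolding Kc_def by measurable
  have Kci: "integrable lborel (Kc j)" for j
  proof -
    have "integrable lborel (\<lambda>x::'a. complex_of_real (indicator (ball 0 (real (M j))) x))"
      by (intro integrable_of_real integrable_real_indicator) (use emeasure_lborel_ball_finite[of "0::'a" "real (M j)"] in auto)
    then have "integrable lborel (\<lambda>x. K x * complex_of_real (indicator (ball 0 (real (M j))) x))"
      by (rule L2_mult_integrable[OF K K2, of _ 1]) (auto simp: indicator_def)
    moreover have "Kc j = (\<lambda>x. K x * complex_of_real (indicator (ball 0 (real (M j))) x))"
      by (auto simp: Kc_def indicator_def)
    ultimately show ?thesis by simp
  qed
  have Kcle: "norm (Kc j x) \<le> norm (K x)" for j x by (simp add: Kc_def indicator_def)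
  define F where "F j = fourier (Kc j)" for j
  have [measurable]: "F j \<in> borel_measurable borel" for j unfolding F_def by measurable
  define D where "D j p = F (Suc j) p - F j p" for j p
  have [measurable]: "D j \<in> borel_measurable borel" for j unfolding D_def by measurable
  let ?c = "ennreal ((2 * pi) ^ DIM('a))"
  have D2: "(\<integral>\<^sup>+p. ennreal ((norm (D j p))\<^sup>2) \<partial>lborel) \<le> ?c * ennreal ((1/8) ^ j)" for j
  proof -
    have le: "(norm (Kc (Suc j) x - Kc j x))\<^sup>2 \<le> (norm (K x))\<^sup>2 * indicator (- ball 0 (real (M j))) x" for x
      using Mmono[of j "Suc j"] by (auto simp: Kc_def indicator_def)
    have a: "(\<integral>\<^sup>+x. ennreal ((norm (Kc (Suc j) x - Kc j x))\<^sup>2) \<partial>lborel) \<le> tail (real (M j))"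
      unfolding tail_def using le
      by (intro nn_integral_mono) (metis ennreal_indicator ennreal_leI ennreal_mult' ennreal_mult'' indicator_pos_le zero_le_power2)
    also note tM
    finally have b: "(\<integral>\<^sup>+x. ennreal ((norm (Kc (Suc j) x - Kc j x))\<^sup>2) \<partial>lborel) \<le> ennreal ((1/8) ^ j)" .
    have "D j = fourier (\<lambda>x. Kc (Suc j) x - Kc j x)"
      by (rule ext) (simp add: D_def F_def fourier_diff Kci)
    moreover have "(\<integral>\<^sup>+p. ennreal ((norm (fourier (\<lambda>x. Kc (Suc j) x - Kc j x) p))\<^sup>2) \<partial>lborel) \<le> ?c * (\<integral>\<^sup>+x. ennreal ((norm (Kc (Suc j) x - Kc j x))\<^sup>2) \<partial>lborel)"
      by (rule fourier_bessel) (use b Kci in \<open>auto intro: le_less_trans\<close>)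
    ultimately show ?thesis using mult_left_mono[OF b, of ?c] by (auto intro: order_trans)
  qed
  \<comment> \<open>The weight 2^j still leaves a convergent series against the bounds 8^(- j), and
    it is what turns square summability of the differences into summability of their moduli in
    \<open>am\<close>.\<close>
  define S where "S p = (\<Sum>j. ennreal (2 ^ j * (norm (D j p))\<^sup>2))" for p
  have [measurable]: "S \<in> borel_measurable borel" unfolding S_def by measurable
  have "(\<integral>\<^sup>+p. S p \<partial>lborel) = (\<Sum>j. \<integral>\<^sup>+p. ennreal (2 ^ j * (norm (D j p))\<^sup>2) \<partial>lborel)"
    unfolding S_def by (rule nn_integral_suminf) measurable
  also have "\<dots> \<le> (\<Sum>j. ?c * ennreal ((1/4) ^ j))"
  proof (rule suminf_le)
    fix j
    have "(\<integral>\<^sup>+p. ennreal (2 ^ j * (norm (D j p))\<^sup>2) \<partial>lborel) = ennreal (2 ^ j) * (\<integral>\<^sup>+p. ennreal ((norm (D j p))\<^sup>2) \<partial>lborel)"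
      by (simp add: ennreal_mult nn_integral_cmult)
    also have "\<dots> \<le> ennreal (2 ^ j) * (?c * ennreal ((1/8) ^ j))" by (intro mult_left_mono D2) auto
    also have "\<dots> = ?c * ennreal (2 ^ j * (1/8) ^ j)" by (simp add: ennreal_mult mult_ac)
    also have "(2::real) ^ j * (1/8) ^ j = (1/4) ^ j" by (simp add: power_mult_distrib[symmetric])
    finally show "(\<integral>\<^sup>+p. ennreal (2 ^ j * (norm (D j p))\<^sup>2) \<partial>lborel) \<le> ?c * ennreal ((1/4) ^ j)" .
  qed auto
  also have "\<dots> = ?c * ennreal (\<Sum>j. (1/4) ^ j)"
    by (subst ennreal_suminf_cmult, subst suminf_ennreal2) (auto intro: summable_geometric)
  also have "\<dots> < \<infinity>" by (simp add: ennreal_mult_less_top)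
  finally have Sfin: "(\<integral>\<^sup>+p. S p \<partial>lborel) < \<infinity>" .
  have AES: "AE p in lborel. S p \<noteq> \<infinity>" by (rule nn_integral_PInf_AE) (use Sfin in auto)
  define T where "T p = norm (F 0 p) + 1 + enn2real (S p)" for p
  have [measurable]: "T \<in> borel_measurable borel" unfolding T_def by measurable
  have key: "convergent (\<lambda>j. F j p) \<and> (\<forall>j. norm (F j p) \<le> T p)" if p: "S p \<noteq> \<infinity>" for p
  proof -
    have sm: "summable (\<lambda>j. 2 ^ j * (norm (D j p))\<^sup>2)"
      by (rule summable_suminf_not_top) (use p in \<open>auto simp: S_def\<close>)
    have Sv: "enn2real (S p) = (\<Sum>j. 2 ^ j * (norm (D j p))\<^sup>2)"
      unfolding S_def by (subst suminf_ennreal2[OF _ sm]) (auto intro!: enn2real_ennreal suminf_nonneg sm)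
    \<comment> \<open>Expand (1 - 2^j |D|)^2 / 2^j, which is nonnegative.\<close>
    have am: "norm (D j p) \<le> ((1/2) ^ j + 2 ^ j * (norm (D j p))\<^sup>2) / 2" for j
    proof -
      define t where "t = (2::real) ^ j"
      have t: "t > 0" by (simp add: t_def)
      have "0 \<le> (1 - t * norm (D j p))\<^sup>2 / t" using t by simp
      also have "\<dots> = 1 / t + t * (norm (D j p))\<^sup>2 - 2 * norm (D j p)"
        using t by (simp add: field_simps power2_eq_square)
      finally show ?thesis by (simp add: t_def power_one_over)
    qed
    have s2: "summable (\<lambda>j. ((1/2) ^ j + 2 ^ j * (norm (D j p))\<^sup>2) / 2)"
      by (intro summable_divide summable_add summable_geometric sm) auto
    have sD: "summable (\<lambda>j. norm (D j p))"
      by (rule summable_comparison_test[OF _ s2]) (use am in auto)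
    have tel: "F j p = F 0 p + (\<Sum>i<j. D i p)" for j
      using sum_lessThan_telescope[of "\<lambda>j. F j p" j] by (simp add: D_def)
    have "convergent (\<lambda>j. \<Sum>i<j. D i p)"
      using summable_norm_cancel[OF sD] by (simp add: summable_iff_convergent)
    then have "convergent (\<lambda>j. F 0 p + (\<Sum>i<j. D i p))"
      by (intro convergent_add convergent_const)
    then have c: "convergent (\<lambda>j. F j p)" by (simp only: tel[symmetric])
    have "norm (F j p) \<le> T p" for j
    proof -
      have "norm (F j p) \<le> norm (F 0 p) + (\<Sum>i<j. norm (D i p))"
        unfolding tel[of j] by (intro order_trans[OF norm_triangle_ineq] add_left_mono norm_sum)
      also have "(\<Sum>i<j. norm (D i p)) \<le> (\<Sum>i. norm (D i p))" by (rule sum_le_suminf[OF sD]) auto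
      also have "\<dots> \<le> (\<Sum>j. ((1/2) ^ j + 2 ^ j * (norm (D j p))\<^sup>2) / 2)" by (rule suminf_le[OF am sD s2])
      also have "\<dots> = ((\<Sum>j. (1/2) ^ j) + (\<Sum>j. 2 ^ j * (norm (D j p))\<^sup>2)) / 2"
        by (subst suminf_divide, intro summable_add summable_geometric sm, simp, subst suminf_add[symmetric]) (auto intro: summable_geometric sm)
      also have "(\<Sum>j. (1/2::real) ^ j) = 2" by (subst suminf_geometric) auto
      also have "(2 + (\<Sum>j. 2 ^ j * (norm (D j p))\<^sup>2)) / 2 \<le> 1 + enn2real (S p)"
        unfolding Sv[symmetric] by (simp add: field_simps)
      finally show ?thesis by (simp add: T_def)
    qed
    with c show ?thesis by auto
  qed
  define H where "H p = lim (\<lambda>j. F j p)" for p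
  have [measurable]: "H \<in> borel_measurable borel" unfolding H_def by measurable
  have AEH: "AE p in lborel. (\<lambda>j. F j p) \<longlonglongrightarrow> H p"
    using AES by eventually_elim (use key in \<open>auto simp: H_def convergent_LIMSEQ_iff\<close>)
  have AET: "AE p in lborel. norm (F j p) \<le> T p" for j
    using AES by eventually_elim (use key in auto)
  have F2: "(\<integral>\<^sup>+p. ennreal ((norm (F j p))\<^sup>2) \<partial>lborel) \<le> ?c * (\<integral>\<^sup>+x. ennreal ((norm (K x))\<^sup>2) \<partial>lborel)" for j
  proof -
    have le: "(\<integral>\<^sup>+x. ennreal ((norm (Kc j x))\<^sup>2) \<partial>lborel) \<le> (\<integral>\<^sup>+x. ennreal ((norm (K x))\<^sup>2) \<partial>lborel)"
      by (intro nn_integral_mono ennreal_leI power_mono Kcle) auto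
    have "(\<integral>\<^sup>+p. ennreal ((norm (F j p))\<^sup>2) \<partial>lborel) \<le> ?c * (\<integral>\<^sup>+x. ennreal ((norm (Kc j x))\<^sup>2) \<partial>lborel)"
      unfolding F_def by (rule fourier_bessel[OF Kci le_less_trans[OF le K2]])
    also have "\<dots> \<le> ?c * (\<integral>\<^sup>+x. ennreal ((norm (K x))\<^sup>2) \<partial>lborel)" by (intro mult_left_mono le) auto
    finally show ?thesis .
  qed
  have H2: "(\<integral>\<^sup>+p. ennreal ((norm (H p))\<^sup>2) \<partial>lborel) \<le> ?c * (\<integral>\<^sup>+x. ennreal ((norm (K x))\<^sup>2) \<partial>lborel)"
  proof -
    have "(\<integral>\<^sup>+p. ennreal ((norm (H p))\<^sup>2) \<partial>lborel) = (\<integral>\<^sup>+p. liminf (\<lambda>j. ennreal ((norm (F j p))\<^sup>2)) \<partial>lborel)"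
    proof (rule nn_integral_cong_AE, use AEH in eventually_elim)
      fix p assume "(\<lambda>j. F j p) \<longlonglongrightarrow> H p"
      then have "(\<lambda>j. ennreal ((norm (F j p))\<^sup>2)) \<longlonglongrightarrow> ennreal ((norm (H p))\<^sup>2)" by (intro tendsto_intros tendsto_ennrealI)
      then show "ennreal ((norm (H p))\<^sup>2) = liminf (\<lambda>j. ennreal ((norm (F j p))\<^sup>2))"
        by (intro lim_imp_Liminf[symmetric]) auto
    qed
    also have "\<dots> \<le> liminf (\<lambda>j. \<integral>\<^sup>+p. ennreal ((norm (F j p))\<^sup>2) \<partial>lborel)" by (rule nn_integral_liminf) measurable
    also have "\<dots> \<le> ?c * (\<integral>\<^sup>+x. ennreal ((norm (K x))\<^sup>2) \<partial>lborel)"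
      by (rule Liminf_le[OF _ always_eventually], simp, intro allI F2)
    finally show ?thesis .
  qed
  have "(LINT p|lborel. H p * \<psi> p) = (LINT x|lborel. K x * fourier \<psi> x)"
    if \<psi>: "integrable lborel \<psi>" "\<forall>x. norm (\<psi> x) \<le> C" "integrable lborel (fourier \<psi>)" for \<psi> C
  proof -
    have [measurable]: "\<psi> \<in> borel_measurable borel" using \<psi> by auto
    have "(\<lambda>j. LINT p|lborel. F j p * \<psi> p) \<longlonglongrightarrow> (LINT p|lborel. H p * \<psi> p)"
    \<comment> \<open>The majorant T splits into a bounded part, paired with the integrable \<psi>,
      and the integrable part \<open>enn2real (S p)\<close>, paired with the bound C of
      \<psi>.\<close>
    proof (rule integral_dominated_convergence[where w="\<lambda>p. ((LINT x|lborel. norm (Kc 0 x)) + 1) * norm (\<psi> p) + enn2real (S p) * C"])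
      have Si: "integrable lborel (\<lambda>p. enn2real (S p))"
      proof (rule integrableI_nonneg)
        have "(\<integral>\<^sup>+p. ennreal (enn2real (S p)) \<partial>lborel) \<le> (\<integral>\<^sup>+p. S p \<partial>lborel)"
          by (intro nn_integral_mono) (metis ennreal_enn2real_if top_greatest order_refl zero_le)
        then show "(\<integral>\<^sup>+p. ennreal (enn2real (S p)) \<partial>lborel) < \<infinity>" using Sfin by (auto intro: le_less_trans)
      qed auto
      show "integrable lborel (\<lambda>p. ((LINT x|lborel. norm (Kc 0 x)) + 1) * norm (\<psi> p) + enn2real (S p) * C)"
        using Si \<psi>(1) by auto
      show "AE p in lborel. (\<lambda>j. F j p * \<psi> p) \<longlonglongrightarrow> H p * \<psi> p"
        using AEH by eventually_elim (intro tendsto_intros)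
      show "AE p in lborel. norm (F j p * \<psi> p) \<le> ((LINT x|lborel. norm (Kc 0 x)) + 1) * norm (\<psi> p) + enn2real (S p) * C" for j
        using AET[of j]
      proof eventually_elim
        fix p assume "norm (F j p) \<le> T p"
        then have "norm (F j p * \<psi> p) \<le> T p * norm (\<psi> p)" by (simp add: norm_mult mult_right_mono)
        also have "\<dots> = (norm (F 0 p) + 1) * norm (\<psi> p) + enn2real (S p) * norm (\<psi> p)" by (simp add: T_def algebra_simps)
        also have "\<dots> \<le> ((LINT x|lborel. norm (Kc 0 x)) + 1) * norm (\<psi> p) + enn2real (S p) * C"
          using \<psi>(2) fourier_norm_le[of "Kc 0" p] by (intro add_mono mult_mono mult_left_mono) (auto simp: F_def)
        finally show "norm (F j p * \<psi> p) \<le> ((LINT x|lborel. norm (Kc 0 x)) + 1) * norm (\<psi> p) + enn2real (S p) * C" .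
      qed
    qed measurable
    moreover have "(\<lambda>j. LINT x|lborel. Kc j x * fourier \<psi> x) \<longlonglongrightarrow> (LINT x|lborel. K x * fourier \<psi> x)"
    proof (rule integral_dominated_convergence[where w="\<lambda>x. norm (K x * fourier \<psi> x)"])
      show "integrable lborel (\<lambda>x. norm (K x * fourier \<psi> x))"
        by (intro integrable_norm L2_mult_integrable[OF K K2 \<psi>(3) fourier_norm_le])
      show "AE x in lborel. (\<lambda>j. Kc j x * fourier \<psi> x) \<longlonglongrightarrow> K x * fourier \<psi> x"
      proof (intro AE_I2 tendsto_mult tendsto_const)
        fix x :: 'a
        obtain n0 where n0: "norm x < real n0" using reals_Archimedean2 by blast
        have "Kc j x = K x" if "n0 \<le> j" for j
          using that n0 N(1)[of j] NM[of j] by (auto simp: Kc_def indicator_def)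
        then show "(\<lambda>j. Kc j x) \<longlonglongrightarrow> K x"
          by (intro tendsto_eventually) (auto simp: eventually_sequentially)
      qed
      show "AE x in lborel. norm (Kc j x * fourier \<psi> x) \<le> norm (K x * fourier \<psi> x)" for j
        by (intro AE_I2) (simp add: norm_mult mult_right_mono Kcle)
    qed measurable
    moreover have "(LINT p|lborel. F j p * \<psi> p) = (LINT x|lborel. Kc j x * fourier \<psi> x)" for j
      unfolding F_def by (rule fourier_mult_formula[OF Kci \<psi>(1)])
    ultimately show ?thesis by (auto intro: LIMSEQ_unique)
  qed
  then show ?thesis using H2 by (intro bexI[of _ H]) auto
qed

text \<open>The closure of a base function under the operations that differentiation produces: stability under
  derivatives and rapid decay then only need to be checked for the base function.\<close>

inductive_set sclass :: "real \<Rightarrow> ('a::euclidean_space \<Rightarrow> complex) \<Rightarrow> ('a \<Rightarrow> complex) set"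
  for s :: real and G :: "'a \<Rightarrow> complex" where
  base: "G \<in> sclass s G"
| coord: "u \<in> sclass s G \<Longrightarrow> b \<in> Basis \<Longrightarrow> (\<lambda>x. of_real (x \<bullet> b) * u x) \<in> sclass s G"
| phi: "u \<in> sclass s G \<Longrightarrow> (\<lambda>x. of_real (1 / phi s (norm x)) * u x) \<in> sclass s G"
| scal: "u \<in> sclass s G \<Longrightarrow> (\<lambda>x. c * u x) \<in> sclass s G"
| add: "u \<in> sclass s G \<Longrightarrow> v \<in> sclass s G \<Longrightarrow> (\<lambda>x. u x + v x) \<in> sclass s G"

section \<open>Schwartz functions built from the Klein--Gordon symbol\<close>

lemma phi_pos: "0 < s \<Longrightarrow> 0 < phi s r"
  unfolding phi_def by (simp add: add_pos_nonneg)

lemma phi_ge: "0 \<le> r \<Longrightarrow> r \<le> phi s r"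
  unfolding phi_def by (rule real_le_rsqrt) simp

lemma phi_ge_mass: "0 < s \<Longrightarrow> s \<le> phi s r"
  unfolding phi_def by (rule real_le_rsqrt) simp

lemma phi_power2: "(phi s r)\<^sup>2 = s\<^sup>2 + r\<^sup>2"
  unfolding phi_def by simp

lemma has_derivative_phi:
  fixes x :: "'a::euclidean_space"
  assumes "0 < s"
  shows "((\<lambda>x. phi s (norm x)) has_derivative (\<lambda>h. (x \<bullet> h) / phi s (norm x))) (at x)"
proof -
  have e: "phi s (norm y) = sqrt (s\<^sup>2 + y \<bullet> y)" for y :: 'a by (simp add: phi_def power2_norm_eq_inner)
  have p: "0 < s\<^sup>2 + x \<bullet> x" using assms by (simp add: add_pos_nonneg)
  have "((\<lambda>y. s\<^sup>2 + y \<bullet> y) has_derivative (\<lambda>h. 2 * (x \<bullet> h))) (at x)"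
    by (auto intro!: derivative_eq_intros simp: inner_commute)
  from has_derivative_real_sqrt[OF p this] show ?thesis
    unfolding e by (rule has_derivative_eq_rhs) (auto simp: field_simps)
qed

lemma has_derivative_inverse_phi:
  fixes x :: "'a::euclidean_space"
  assumes s: "0 < s"
  shows "((\<lambda>x. complex_of_real (1 / phi s (norm x))) has_derivative
    (\<lambda>h. of_real (- (x \<bullet> h) / (phi s (norm x)) ^ 3))) (at x)"
proof -
  have p: "phi s (norm x) \<noteq> 0" using phi_pos[OF s] by (simp add: less_le)
  have "((\<lambda>x. 1 / phi s (norm x)) has_derivative (\<lambda>h. - (x \<bullet> h) / (phi s (norm x)) ^ 3)) (at x)"
    using has_derivative_divide[OF has_derivative_const[of 1] has_derivative_phi[OF s, of x] p]
    by (rule has_derivative_eq_rhs) (use p in \<open>auto simp: field_simps power2_eq_square power3_eq_cube\<close>)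
  then show ?thesis by (rule has_derivative_of_real)
qed

definition sderiv :: "('a::euclidean_space \<Rightarrow> complex) \<Rightarrow> ('a \<Rightarrow> 'a \<Rightarrow> complex) \<Rightarrow> bool" where
  "sderiv u u' \<longleftrightarrow> (\<forall>x. (u has_derivative (\<lambda>h. \<Sum>b\<in>Basis. (h \<bullet> b) *\<^sub>R u' b x)) (at x))"

lemma sclass_deriv:
  fixes G :: "'a::euclidean_space \<Rightarrow> complex"
  assumes s: "0 < s" and G: "sderiv G G'" "\<And>b. b \<in> Basis \<Longrightarrow> G' b \<in> sclass s G"
    and u: "u \<in> sclass s G"
  shows "\<exists>u'. sderiv u u' \<and> (\<forall>b\<in>Basis. u' b \<in> sclass s G)"
  using u
proof induction
  case base
  then show ?case using G by blast
next
  case (coord u c)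
  then obtain u' where u': "sderiv u u'" "\<And>b. b \<in> Basis \<Longrightarrow> u' b \<in> sclass s G" by blast
  define w where "w b x = of_real (if b = c then 1 else 0) * u x + of_real (x \<bullet> c) * u' b x" for b x
  have "sderiv (\<lambda>x. of_real (x \<bullet> c) * u x) w"
    unfolding sderiv_def
  proof
    fix x :: 'a
    have 1: "((\<lambda>x. complex_of_real (x \<bullet> c)) has_derivative (\<lambda>h. of_real (h \<bullet> c))) (at x)"
      by (auto intro!: derivative_eq_intros)
    have "(\<Sum>b\<in>Basis. (h \<bullet> b) *\<^sub>R w b x) = of_real (x \<bullet> c) * (\<Sum>b\<in>Basis. (h \<bullet> b) *\<^sub>R u' b x) + of_real (h \<bullet> c) * u x" for h
    proof -
      have "(\<Sum>b\<in>Basis. (h \<bullet> b) *\<^sub>R (of_real (if b = c then 1 else 0) * u x)) = (\<Sum>b\<in>Basis. if b = c then of_real (h \<bullet> c) * u x else 0)"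
        by (intro sum.cong) (auto simp: scaleR_conv_of_real)
      also have "\<dots> = of_real (h \<bullet> c) * u x" using coord(2) by simp
      finally show ?thesis
        by (simp add: w_def scaleR_add_right sum.distrib sum_distrib_left mult_scaleR_right)
    qed
    then show "((\<lambda>x. of_real (x \<bullet> c) * u x) has_derivative (\<lambda>h. \<Sum>b\<in>Basis. (h \<bullet> b) *\<^sub>R w b x)) (at x)"
      using has_derivative_mult[OF 1 u'(1)[unfolded sderiv_def, rule_format, of x]] by simp
  qed
  moreover have "w b \<in> sclass s G" if "b \<in> Basis" for b
    unfolding w_def[abs_def] using that coord by (intro sclass.intros u')
  ultimately show ?case by blast
next
  case (phi u)
  then obtain u' where u': "sderiv u u'" "\<And>b. b \<in> Basis \<Longrightarrow> u' b \<in> sclass s G" by blast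
  \<comment> \<open>The partial derivative of 1 / \<open>phi\<close> is - x_b /
    \<open>phi\<close>^3. The cube is produced by three uses of the constructor \<open>phi\<close>
    and the coordinate by one use of \<open>coord\<close>.\<close>
  define w where "w b x = (- 1) * (of_real (x \<bullet> b) * (of_real (1 / phi s (norm x)) * (of_real (1 / phi s (norm x)) * (of_real (1 / phi s (norm x)) * u x))))
     + of_real (1 / phi s (norm x)) * u' b x" for b x
  have "sderiv (\<lambda>x. of_real (1 / phi s (norm x)) * u x) w"
    unfolding sderiv_def
  proof
    fix x :: 'a
    let ?p = "complex_of_real (1 / phi s (norm x))"
    have "(\<Sum>b\<in>Basis. (h \<bullet> b) *\<^sub>R w b x) = ?p * (\<Sum>b\<in>Basis. (h \<bullet> b) *\<^sub>R u' b x) + of_real (- (x \<bullet> h) / (phi s (norm x)) ^ 3) * u x" for h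
    proof -
      have "(\<Sum>b\<in>Basis. (h \<bullet> b) *\<^sub>R ((- 1) * (of_real (x \<bullet> b) * (?p * (?p * (?p * u x)))))) = (\<Sum>b\<in>Basis. of_real ((x \<bullet> b) * (h \<bullet> b)) * (- (?p ^ 3 * u x)))"
        by (intro sum.cong) (auto simp: scaleR_conv_of_real power3_eq_cube mult_ac)
      also have "\<dots> = of_real (x \<bullet> h) * (- (?p ^ 3 * u x))"
        by (subst euclidean_inner[of x h]) (simp only: of_real_sum sum_distrib_right)
      also have "\<dots> = of_real (- (x \<bullet> h) / (phi s (norm x)) ^ 3) * u x"
        by (simp add: power_divide)
      finally show ?thesis
        by (simp only: w_def scaleR_add_right sum.distrib sum_distrib_left mult_scaleR_right add.commute)
    qed
    then show "((\<lambda>x. of_real (1 / phi s (norm x)) * u x) has_derivative (\<lambda>h. \<Sum>b\<in>Basis. (h \<bullet> b) *\<^sub>R w b x)) (at x)"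
      using has_derivative_mult[OF has_derivative_inverse_phi[OF s] u'(1)[unfolded sderiv_def, rule_format, of x]] by simp
  qed
  moreover have "w b \<in> sclass s G" if "b \<in> Basis" for b
    unfolding w_def[abs_def] using that phi by (intro sclass.intros u')
  ultimately show ?case by blast
next
  case (scal u c)
  then obtain u' where u': "sderiv u u'" "\<And>b. b \<in> Basis \<Longrightarrow> u' b \<in> sclass s G" by blast
  have "sderiv (\<lambda>x. c * u x) (\<lambda>b x. c * u' b x)"
    unfolding sderiv_def
  proof
    fix x
    show "((\<lambda>x. c * u x) has_derivative (\<lambda>h. \<Sum>b\<in>Basis. (h \<bullet> b) *\<^sub>R (c * u' b x))) (at x)"
      using has_derivative_mult_right[OF u'(1)[unfolded sderiv_def, rule_format, of x], of c]
      by (simp add: sum_distrib_left)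
  qed
  then show ?case using u'(2) by (intro exI[of _ "\<lambda>b x. c * u' b x"]) (auto intro: sclass.intros)
next
  case (add u v)
  then obtain u' v' where u': "sderiv u u'" "\<And>b. b \<in> Basis \<Longrightarrow> u' b \<in> sclass s G"
    and v': "sderiv v v'" "\<And>b. b \<in> Basis \<Longrightarrow> v' b \<in> sclass s G" by blast
  have "sderiv (\<lambda>x. u x + v x) (\<lambda>b x. u' b x + v' b x)"
    unfolding sderiv_def
  proof
    fix x
    show "((\<lambda>x. u x + v x) has_derivative (\<lambda>h. \<Sum>b\<in>Basis. (h \<bullet> b) *\<^sub>R (u' b x + v' b x))) (at x)"
      using has_derivative_add[OF u'(1)[unfolded sderiv_def, rule_format, of x] v'(1)[unfolded sderiv_def, rule_format, of x]]
      by (simp add: scaleR_add_right sum.distrib)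
  qed
  then show ?case using u'(2) v'(2) by (intro exI[of _ "\<lambda>b x. u' b x + v' b x"]) (auto intro: sclass.intros)
qed

lemma sclass_decay:
  fixes G :: "'a::euclidean_space \<Rightarrow> complex"
  assumes s: "0 < s" and G: "\<And>k. \<exists>C. \<forall>x. norm x ^ k * norm (G x) \<le> C"
    and u: "u \<in> sclass s G"
  shows "\<exists>C. \<forall>x. norm x ^ k * norm (u x) \<le> C"
  using u
proof (induction arbitrary: k)
  case base
  then show ?case using G by blast
next
  case (coord u b)
  obtain C where C: "\<And>x. norm x ^ Suc k * norm (u x) \<le> C" using coord(3) by blast
  have "norm x ^ k * norm (complex_of_real (x \<bullet> b) * u x) \<le> C" for x
  proof -
    have "\<bar>x \<bullet> b\<bar> * norm (u x) \<le> norm x * norm (u x)"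
      by (intro mult_right_mono Basis_le_norm coord) auto
    then have "norm x ^ k * (\<bar>x \<bullet> b\<bar> * norm (u x)) \<le> norm x ^ k * (norm x * norm (u x))"
      by (intro mult_left_mono) auto
    then show ?thesis using C[of x] by (simp add: norm_mult mult_ac)
  qed
  then show ?case by blast
next
  case (phi u)
  obtain C where C: "\<And>x. norm x ^ k * norm (u x) \<le> C" using phi(2) by blast
  have "norm x ^ k * norm (complex_of_real (1 / phi s (norm x)) * u x) \<le> C / s" for x
  proof -
    have "norm (complex_of_real (1 / phi s (norm x))) \<le> 1 / s"
      using phi_ge_mass[OF s, of "norm x"] phi_pos[OF s, of "norm x"] s by (simp add: frac_le norm_divide)
    then have "norm (complex_of_real (1 / phi s (norm x))) * (norm x ^ k * norm (u x)) \<le> (1 / s) * C"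
      using s by (intro mult_mono C) auto
    then show ?thesis by (simp only: norm_mult mult_ac) simp
  qed
  then show ?case by blast
next
  case (scal u c)
  obtain C where C: "\<And>x. norm x ^ k * norm (u x) \<le> C" using scal(2) by blast
  have "norm x ^ k * norm (c * u x) \<le> norm c * C" for x
    using mult_left_mono[OF C[of x], of "norm c"] by (simp add: norm_mult mult_ac)
  then show ?case by blast
next
  case (add u v)
  obtain C where C: "\<And>x. norm x ^ k * norm (u x) \<le> C" using add(3) by blast
  obtain C' where C': "\<And>x. norm x ^ k * norm (v x) \<le> C'" using add(4) by blast
  have "norm x ^ k * norm (u x + v x) \<le> C + C'" for x
  proof -
    have "norm x ^ k * norm (u x + v x) \<le> norm x ^ k * (norm (u x) + norm (v x))"
      by (intro mult_left_mono norm_triangle_ineq) auto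
    then show ?thesis using C[of x] C'[of x] by (simp add: distrib_left)
  qed
  then show ?case by blast
qed

text \<open>Since the class is closed under partial derivatives, a choice of derivative that stays
  in the class can be iterated along the list of directions. This is the family D that
  \<open>schwartz\<close> asks for, and \<open>sclass_decay\<close> bounds all its members.\<close>

lemma sclass_schwartz:
  fixes G :: "'a::euclidean_space \<Rightarrow> complex"
  assumes s: "0 < s" and dec: "\<And>k. \<exists>C. \<forall>x. norm x ^ k * norm (G x) \<le> C"
    and G: "sderiv G G'" "\<And>b. b \<in> Basis \<Longrightarrow> G' b \<in> sclass s G"
    and u: "u \<in> sclass s G"
  shows "schwartz u"
proof -
  have "\<forall>u\<in>sclass s G. \<exists>u'. sderiv u u' \<and> (\<forall>b\<in>Basis. u' b \<in> sclass s G)"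
    using sclass_deriv[OF s G] by blast
  then obtain \<delta> where \<delta>: "\<And>u. u \<in> sclass s G \<Longrightarrow> sderiv u (\<delta> u)" "\<And>u b. u \<in> sclass s G \<Longrightarrow> b \<in> Basis \<Longrightarrow> \<delta> u b \<in> sclass s G"
    by metis
  define D where "D = rec_list u (\<lambda>b _ r. \<delta> r b)"
  have D: "D [] = u" "D (b # bs) = \<delta> (D bs) b" for b bs by (simp_all add: D_def)
  have Dc: "D bs \<in> sclass s G" if "bs \<in> lists Basis" for bs
    using that by induction (auto simp: D u \<delta>)
  show ?thesis
    unfolding schwartz_def
  proof (intro exI[of _ D] conjI ballI allI)
    fix bs :: "'a list" assume bs: "bs \<in> lists Basis"
    show "(D bs has_derivative (\<lambda>h. \<Sum>b\<in>Basis. (h \<bullet> b) *\<^sub>R D (b # bs) x)) (at x)" for x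
      using \<delta>(1)[OF Dc[OF bs]] unfolding sderiv_def D(2) by blast
    fix k :: nat
    obtain C where "\<And>x. norm x ^ k * norm (D bs x) \<le> C" using sclass_decay[OF s dec Dc[OF bs]] by blast
    then show "bounded (range (\<lambda>x. norm x ^ k *\<^sub>R D bs x))" by (auto simp: bounded_iff)
  qed (simp add: D)
qed

lemma power_le_fact_exp:
  assumes "0 \<le> (r::real)"
  shows "r ^ k \<le> fact k * exp r"
proof -
  have "(\<Sum>n\<in>{k}. r ^ n /\<^sub>R fact n) \<le> (\<Sum>n. r ^ n /\<^sub>R fact n)"
    by (intro sum_le_suminf summable_exp_generic) (use assms in auto)
  then show ?thesis by (simp add: exp_def field_simps)
qed

lemma schwartz_gaussian:
  fixes a :: "'a::euclidean_space"
  assumes l: "0 < l"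
  shows "schwartz (\<lambda>x. complex_of_real (exp (a \<bullet> x - l * (norm x)\<^sup>2)))"
proof (rule sclass_schwartz[OF zero_less_one _ _ _ sclass.base])
  let ?G = "\<lambda>x. complex_of_real (exp (a \<bullet> x - l * (norm x)\<^sup>2))"
  define G' where "G' b x = of_real (a \<bullet> b) * ?G x + of_real (- 2 * l) * (of_real (x \<bullet> b) * ?G x)" for b x
  show "sderiv ?G G'"
    unfolding sderiv_def
  proof
    fix x
    have "((\<lambda>x. a \<bullet> x - l * (x \<bullet> x)) has_derivative (\<lambda>h. a \<bullet> h - l * (2 * (x \<bullet> h)))) (at x)"
      by (auto intro!: derivative_eq_intros simp: inner_commute)
    then have "((\<lambda>x. exp (a \<bullet> x - l * (x \<bullet> x))) has_derivative (\<lambda>h. exp (a \<bullet> x - l * (x \<bullet> x)) * (a \<bullet> h - l * (2 * (x \<bullet> h))))) (at x)"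
      by (rule has_derivative_exp[THEN has_derivative_eq_rhs]) (simp add: mult_ac)
    from has_derivative_of_real[OF this]
    have 1: "(?G has_derivative (\<lambda>h. complex_of_real (exp (a \<bullet> x - l * (x \<bullet> x)) * (a \<bullet> h - l * (2 * (x \<bullet> h)))))) (at x)"
      by (simp only: power2_norm_eq_inner)
    have "(\<Sum>b\<in>Basis. (h \<bullet> b) *\<^sub>R G' b x) = complex_of_real (exp (a \<bullet> x - l * (x \<bullet> x)) * (a \<bullet> h - l * (2 * (x \<bullet> h))))" for h
    proof -
      have "(\<Sum>b\<in>Basis. (h \<bullet> b) *\<^sub>R G' b x) = (\<Sum>b\<in>Basis. of_real (exp (a \<bullet> x - l * (x \<bullet> x)) * ((a \<bullet> b) * (h \<bullet> b) - l * (2 * ((x \<bullet> b) * (h \<bullet> b))))))"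
        by (intro sum.cong) (auto simp: G'_def scaleR_conv_of_real power2_norm_eq_inner algebra_simps)
      then show ?thesis
        by (simp only: of_real_sum[symmetric] sum_distrib_left[symmetric] sum_subtractf euclidean_inner[symmetric])
    qed
    then show "(?G has_derivative (\<lambda>h. \<Sum>b\<in>Basis. (h \<bullet> b) *\<^sub>R G' b x)) (at x)" using 1 by (simp only:)
  qed
  show "G' b \<in> sclass 1 ?G" if "b \<in> Basis" for b
    unfolding G'_def[abs_def] using that by (intro sclass.intros)
  fix k
  show "\<exists>C. \<forall>x. norm x ^ k * norm (?G x) \<le> C"
  proof (intro exI allI)
    fix x
    have "a \<bullet> x \<le> norm a * norm x" by (rule norm_cauchy_schwarz)
    \<comment> \<open>Completing the square with \<open>norm a + 1\<close> instead of
      \<open>norm a\<close> leaves a spare factor exp(- |x|), which absorbs every power of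
      |x|.\<close>
    moreover have "0 \<le> (2 * l * norm x - (norm a + 1))\<^sup>2 / (4 * l)" using l by simp
    then have "norm a * norm x + norm x - l * (norm x)\<^sup>2 \<le> (norm a + 1)\<^sup>2 / (4 * l)"
      using l by (simp add: field_simps power2_eq_square)
    ultimately have "a \<bullet> x - l * (norm x)\<^sup>2 \<le> (norm a + 1)\<^sup>2 / (4 * l) - norm x" by linarith
    then have "exp (a \<bullet> x - l * (norm x)\<^sup>2) \<le> exp ((norm a + 1)\<^sup>2 / (4 * l) - norm x)" by simp
    then have "norm x ^ k * norm (?G x) \<le> (fact k * exp (norm x)) * exp ((norm a + 1)\<^sup>2 / (4 * l) - norm x)"
      by (intro mult_mono power_le_fact_exp) auto
    also have "\<dots> = fact k * exp ((norm a + 1)\<^sup>2 / (4 * l))" by (simp add: exp_diff)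
    finally show "norm x ^ k * norm (?G x) \<le> fact k * exp ((norm a + 1)\<^sup>2 / (4 * l))" .
  qed
qed

text \<open>This function is the Fourier transform of the extremiser. It is \<open>phi\<close>
  applied to the base exp(- \<open>phi\<close>), whose partial derivatives - x_b /
  \<open>phi\<close> times the base stay in the class.\<close>

lemma schwartz_exp_phi:
  assumes s: "0 < s"
  shows "schwartz (\<lambda>x::'a::euclidean_space. complex_of_real (exp (- phi s (norm x)) / phi s (norm x)))"
proof -
  let ?G = "\<lambda>x::'a. complex_of_real (exp (- phi s (norm x)))"
  define G' where "G' b x = (- 1) * (of_real (x \<bullet> b) * (of_real (1 / phi s (norm x)) * ?G x))" for b x
  have "schwartz (\<lambda>x. of_real (1 / phi s (norm x)) * ?G x)"
  proof (rule sclass_schwartz[OF s _ _ _ sclass.phi[OF sclass.base]])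
    show "sderiv ?G G'"
      unfolding sderiv_def
    proof
      fix x :: 'a
      have "((\<lambda>x. exp (- phi s (norm x))) has_derivative (\<lambda>h. exp (- phi s (norm x)) * (- ((x \<bullet> h) / phi s (norm x))))) (at x)"
        using has_derivative_exp[OF has_derivative_minus[OF has_derivative_phi[OF s, of x]]] by (simp add: mult.commute)
      from has_derivative_of_real[OF this]
      have 1: "(?G has_derivative (\<lambda>h. complex_of_real (exp (- phi s (norm x)) * (- ((x \<bullet> h) / phi s (norm x)))))) (at x)" .
      have "(\<Sum>b\<in>Basis. (h \<bullet> b) *\<^sub>R G' b x) = complex_of_real (exp (- phi s (norm x)) * (- ((x \<bullet> h) / phi s (norm x))))" for h
      proof -
        have "(\<Sum>b\<in>Basis. (h \<bullet> b) *\<^sub>R G' b x) = (\<Sum>b\<in>Basis. of_real (- exp (- phi s (norm x)) / phi s (norm x) * ((x \<bullet> b) * (h \<bullet> b))))"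
          by (intro sum.cong) (auto simp: G'_def scaleR_conv_of_real)
        also have "\<dots> = of_real (- exp (- phi s (norm x)) / phi s (norm x) * (x \<bullet> h))"
          by (simp only: of_real_sum[symmetric] sum_distrib_left[symmetric] euclidean_inner[symmetric])
        finally show ?thesis by simp
      qed
      then show "(?G has_derivative (\<lambda>h. \<Sum>b\<in>Basis. (h \<bullet> b) *\<^sub>R G' b x)) (at x)" using 1 by (simp only:)
    qed
    show "G' b \<in> sclass s ?G" if "b \<in> Basis" for b
      unfolding G'_def[abs_def] using that by (intro sclass.intros)
    fix k
    show "\<exists>C. \<forall>x. norm x ^ k * norm (?G x) \<le> C"
    proof (intro exI allI)
      fix x :: 'a
      have "norm x ^ k * norm (?G x) \<le> (fact k * exp (norm x)) * exp (- norm x)"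
        using phi_ge[of "norm x" s] by (intro mult_mono power_le_fact_exp) auto
      also have "\<dots> = fact k" by (simp add: exp_minus)
      finally show "norm x ^ k * norm (?G x) \<le> fact k" .
    qed
  qed
  then show ?thesis by simp
qed

section \<open>Uniqueness and Plancherel bounds for distributional transforms\<close>

lemma nn_integral_gaussian_smoothing_tendsto:
  fixes v :: "'a::euclidean_space \<Rightarrow> real"
  assumes c: "continuous_on UNIV v" and v: "\<And>x. 0 \<le> v x" "\<And>x. v x \<le> 1" and r: "r \<longlonglongrightarrow> 0"
  shows "(\<lambda>n. \<integral>\<^sup>+z. ennreal (v (x + r n *\<^sub>R z)) * ennreal (gaussian z) \<partial>lborel) \<longlonglongrightarrow> ennreal (v x)"
proof -
  have [measurable]: "v \<in> borel_measurable borel" using c by (rule borel_measurable_continuous_onI)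
  have "(\<lambda>n. \<integral>\<^sup>+z. ennreal (v (x + r n *\<^sub>R z)) * ennreal (gaussian z) \<partial>lborel) \<longlonglongrightarrow> (\<integral>\<^sup>+z. ennreal (v x) * ennreal (gaussian (z::'a)) \<partial>lborel)"
  proof (rule nn_integral_dominated_convergence[where w="\<lambda>z. ennreal (gaussian z)"])
    show "AE z in lborel. (\<lambda>n. ennreal (v (x + r n *\<^sub>R z)) * ennreal (gaussian z)) \<longlonglongrightarrow> ennreal (v x) * ennreal (gaussian z)"
    proof (rule AE_I2)
      fix z :: 'a
      have "(\<lambda>n. x + r n *\<^sub>R z) \<longlonglongrightarrow> x + 0 *\<^sub>R z" by (intro tendsto_intros r)
      then have "(\<lambda>n. v (x + r n *\<^sub>R z)) \<longlonglongrightarrow> v x"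
        using continuous_on_tendsto_compose[OF c] by force
      then have "(\<lambda>n. ennreal (v (x + r n *\<^sub>R z) * gaussian z)) \<longlonglongrightarrow> ennreal (v x * gaussian z)"
        by (intro tendsto_intros)
      then show "(\<lambda>n. ennreal (v (x + r n *\<^sub>R z)) * ennreal (gaussian z)) \<longlonglongrightarrow> ennreal (v x) * ennreal (gaussian z)"
        by (simp add: ennreal_mult v gaussian_pos less_imp_le)
    qed
    show "AE z in lborel. ennreal (v (x + r n *\<^sub>R z)) * ennreal (gaussian z) \<le> ennreal (gaussian z)" for n
    proof (rule AE_I2)
      fix z
      have "ennreal (v (x + r n *\<^sub>R z)) * ennreal (gaussian z) \<le> 1 * ennreal (gaussian z)"
        by (intro mult_right_mono) (auto simp: v)
      then show "ennreal (v (x + r n *\<^sub>R z)) * ennreal (gaussian z) \<le> ennreal (gaussian z)" by simp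
    qed
  qed (auto simp: nn_integral_gaussian)
  then show ?thesis by (simp add: nn_integral_cmult nn_integral_gaussian)
qed

text \<open>Integrating the Gaussian averages of w at scale r against a continuous v with values in
  [0, 1] gives, after Tonelli, the integral of w against the Gaussian average of v, which tends to
  the integral of w v. Equal averages thus make the measures with densities w1 and w2 agree on all
  such v.\<close>

lemma gaussian_tests_determine:
  fixes w1 w2 :: "'a::euclidean_space \<Rightarrow> real"
  assumes i: "integrable lborel w1" "integrable lborel w2" and nn: "\<And>x. 0 \<le> w1 x" "\<And>x. 0 \<le> w2 x"
    and eq: "\<And>y r. 0 < r \<Longrightarrow> (\<integral>\<^sup>+x. ennreal (w1 x) * ennreal (gaussian ((y - x) /\<^sub>R r)) \<partial>lborel) =
        (\<integral>\<^sup>+x. ennreal (w2 x) * ennreal (gaussian ((y - x) /\<^sub>R r)) \<partial>lborel)"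
  shows "AE x in lborel. w1 x = w2 x"
proof -
  have [measurable]: "w1 \<in> borel_measurable borel" "w2 \<in> borel_measurable borel" using i by auto
  define r where "r n = 1 / real (Suc n)" for n
  have r0: "r \<longlonglongrightarrow> 0" unfolding r_def by (rule LIMSEQ_Suc) (rule lim_1_over_n)
  have rpos: "0 < r n" for n by (simp add: r_def)
  have lim: "(\<lambda>n. \<integral>\<^sup>+y. ennreal (v y) * ennreal (1 / r n ^ DIM('a)) * (\<integral>\<^sup>+x. ennreal (w x) * ennreal (gaussian ((y - x) /\<^sub>R r n)) \<partial>lborel) \<partial>lborel)
      \<longlonglongrightarrow> (\<integral>\<^sup>+x. ennreal (v x) \<partial>density lborel (\<lambda>x. ennreal (w x)))"
      and fin: "(\<integral>\<^sup>+x. ennreal (v x) \<partial>density lborel (\<lambda>x. ennreal (w x))) < \<infinity>"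
    if v: "continuous_on UNIV v" "\<And>x. 0 \<le> v x" "\<And>x. v x \<le> 1" and w: "integrable lborel w" "\<And>x. 0 \<le> w x"
    for v w :: "'a \<Rightarrow> real"
  proof -
    have [measurable]: "v \<in> borel_measurable borel" "w \<in> borel_measurable borel"
      using v(1) w(1) by (auto intro: borel_measurable_continuous_onI)
    have wf: "(\<integral>\<^sup>+x. ennreal (w x) \<partial>lborel) < \<infinity>"
      using nn_integral_eq_integral[OF w(1)] w(2) by simp
    have d: "(\<integral>\<^sup>+x. ennreal (v x) \<partial>density lborel (\<lambda>x. ennreal (w x))) = (\<integral>\<^sup>+x. ennreal (w x) * ennreal (v x) \<partial>lborel)"
      by (subst nn_integral_density) auto
    have "(\<integral>\<^sup>+x. ennreal (w x) * ennreal (v x) \<partial>lborel) \<le> (\<integral>\<^sup>+x. ennreal (w x) * 1 \<partial>lborel)"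
      by (intro nn_integral_mono mult_left_mono) (auto simp: v)
    then show "(\<integral>\<^sup>+x. ennreal (v x) \<partial>density lborel (\<lambda>x. ennreal (w x))) < \<infinity>"
      unfolding d using wf by (auto intro: le_less_trans)
    have sub: "(\<integral>\<^sup>+y. ennreal (v y) * ennreal (1 / r n ^ DIM('a)) * (\<integral>\<^sup>+x. ennreal (w x) * ennreal (gaussian ((y - x) /\<^sub>R r n)) \<partial>lborel) \<partial>lborel)
      = (\<integral>\<^sup>+x. ennreal (w x) * (\<integral>\<^sup>+z. ennreal (v (x + r n *\<^sub>R z)) * ennreal (gaussian z) \<partial>lborel) \<partial>lborel)" for n
    proof -
      have "(\<integral>\<^sup>+y. ennreal (v y) * ennreal (1 / r n ^ DIM('a)) * (\<integral>\<^sup>+x. ennreal (w x) * ennreal (gaussian ((y - x) /\<^sub>R r n)) \<partial>lborel) \<partial>lborel)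
         = (\<integral>\<^sup>+y. (\<integral>\<^sup>+x. ennreal (w x) * (ennreal (1 / r n ^ DIM('a)) * (ennreal (v y) * ennreal (gaussian ((y - x) /\<^sub>R r n)))) \<partial>lborel) \<partial>lborel)"
        by (subst nn_integral_cmult[symmetric]) (auto simp: mult_ac intro!: nn_integral_cong)
      also have "\<dots> = (\<integral>\<^sup>+x. (\<integral>\<^sup>+y. ennreal (w x) * (ennreal (1 / r n ^ DIM('a)) * (ennreal (v y) * ennreal (gaussian ((y - x) /\<^sub>R r n)))) \<partial>lborel) \<partial>lborel)"
        by (rule lborel_pair.Fubini') measurable
      also have "\<dots> = (\<integral>\<^sup>+x. ennreal (w x) * (\<integral>\<^sup>+z. ennreal (v (x + r n *\<^sub>R z)) * ennreal (gaussian z) \<partial>lborel) \<partial>lborel)"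
      proof (rule nn_integral_cong)
        fix x :: 'a
        have "(\<integral>\<^sup>+y. ennreal (v y) * ennreal (gaussian ((y - x) /\<^sub>R r n)) \<partial>lborel) =
          ennreal (r n ^ DIM('a)) * (\<integral>\<^sup>+z. ennreal (v (x + r n *\<^sub>R z)) * ennreal (gaussian z) \<partial>lborel)"
          using rpos[of n] by (subst nn_integral_lborel_affine[where c="r n" and t=x]) auto
        moreover have "ennreal (1 / r n ^ DIM('a)) * ennreal (r n ^ DIM('a)) = 1"
          using rpos[of n] by (simp add: ennreal_mult[symmetric])
        ultimately show "(\<integral>\<^sup>+y. ennreal (w x) * (ennreal (1 / r n ^ DIM('a)) * (ennreal (v y) * ennreal (gaussian ((y - x) /\<^sub>R r n)))) \<partial>lborel) =
           ennreal (w x) * (\<integral>\<^sup>+z. ennreal (v (x + r n *\<^sub>R z)) * ennreal (gaussian z) \<partial>lborel)"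
          by (subst nn_integral_cmult, simp, subst nn_integral_cmult, simp)
            (simp only: mult.assoc[symmetric] mult_1_left)
      qed
      finally show ?thesis .
    qed
    have "(\<lambda>n. \<integral>\<^sup>+x. ennreal (w x) * (\<integral>\<^sup>+z. ennreal (v (x + r n *\<^sub>R z)) * ennreal (gaussian z) \<partial>lborel) \<partial>lborel) \<longlonglongrightarrow> (\<integral>\<^sup>+x. ennreal (w x) * ennreal (v x) \<partial>lborel)"
    proof (rule nn_integral_dominated_convergence[where w="\<lambda>x. ennreal (w x)"])
      show "AE x in lborel. (\<lambda>n. ennreal (w x) * (\<integral>\<^sup>+z. ennreal (v (x + r n *\<^sub>R z)) * ennreal (gaussian z) \<partial>lborel)) \<longlonglongrightarrow> ennreal (w x) * ennreal (v x)"
        by (intro AE_I2 ennreal_tendsto_cmult nn_integral_gaussian_smoothing_tendsto v r0) auto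
      show "AE x in lborel. ennreal (w x) * (\<integral>\<^sup>+z. ennreal (v (x + r n *\<^sub>R z)) * ennreal (gaussian z) \<partial>lborel) \<le> ennreal (w x)" for n
      proof (rule AE_I2)
        fix x :: 'a
        have "(\<integral>\<^sup>+z. ennreal (v (x + r n *\<^sub>R z)) * ennreal (gaussian z) \<partial>lborel) \<le> (\<integral>\<^sup>+z. 1 * ennreal (gaussian (z::'a)) \<partial>lborel)"
          by (intro nn_integral_mono mult_right_mono) (auto simp: v)
        then have "(\<integral>\<^sup>+z. ennreal (v (x + r n *\<^sub>R z)) * ennreal (gaussian z) \<partial>lborel) \<le> 1" by (simp add: nn_integral_gaussian)
        from mult_left_mono[OF this, of "ennreal (w x)"] show "ennreal (w x) * (\<integral>\<^sup>+z. ennreal (v (x + r n *\<^sub>R z)) * ennreal (gaussian z) \<partial>lborel) \<le> ennreal (w x)" by simp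
      qed
    qed (use wf in auto)
    then show "(\<lambda>n. \<integral>\<^sup>+y. ennreal (v y) * ennreal (1 / r n ^ DIM('a)) * (\<integral>\<^sup>+x. ennreal (w x) * ennreal (gaussian ((y - x) /\<^sub>R r n)) \<partial>lborel) \<partial>lborel)
      \<longlonglongrightarrow> (\<integral>\<^sup>+x. ennreal (v x) \<partial>density lborel (\<lambda>x. ennreal (w x)))"
      by (simp only: sub d)
  qed
  have "density lborel (\<lambda>x. ennreal (w1 x)) = density lborel (\<lambda>x. ennreal (w2 x))"
  proof (rule nn_integral_Cc_imp_measure_eq)
    fix v :: "'a \<Rightarrow> real" assume v: "continuous_on UNIV v" "\<And>x. 0 \<le> v x" "\<And>x. v x \<le> 1"
    show "(\<integral>\<^sup>+x. ennreal (v x) \<partial>density lborel (\<lambda>x. ennreal (w1 x))) = (\<integral>\<^sup>+x. ennreal (v x) \<partial>density lborel (\<lambda>x. ennreal (w2 x))) \<and>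
       (\<integral>\<^sup>+x. ennreal (v x) \<partial>density lborel (\<lambda>x. ennreal (w1 x))) < \<infinity>"
      using LIMSEQ_unique[OF lim[OF v i(1) nn(1)] lim[OF v i(2) nn(2), folded eq[OF rpos]]] fin[OF v i(1) nn(1)] by simp
  qed auto
  from sigma_finite_measure.density_unique[OF sigma_finite_lborel _ _ this]
  have "AE x in lborel. ennreal (w1 x) = ennreal (w2 x)" by simp
  then show ?thesis by eventually_elim (simp add: nn)
qed

text \<open>A Gaussian centred at y times exp(- |x|^2) is a constant multiple of a test function of
  the form in \<open>schwartz_gaussian\<close>, with a = y / r^2 and l = 1 + 1 / (2 r^2).\<close>

lemma gaussian_gaussian:
  assumes r: "0 < r"
  shows "exp (- (norm x)\<^sup>2) * gaussian ((y - x) /\<^sub>R r) =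
    (exp (- (norm (y::'a::euclidean_space))\<^sup>2 / (2 * r\<^sup>2)) / sqrt (2 * pi) ^ DIM('a)) * exp ((y /\<^sub>R r\<^sup>2) \<bullet> x - (1 + 1 / (2 * r\<^sup>2)) * (norm x)\<^sup>2)"
proof -
  have n: "(norm (y - x))\<^sup>2 = (norm y)\<^sup>2 - 2 * (y \<bullet> x) + (norm x)\<^sup>2"
    by (simp add: power2_norm_eq_inner inner_diff_left inner_diff_right inner_commute algebra_simps)
  have e: "- (norm x)\<^sup>2 + - (norm ((y - x) /\<^sub>R r))\<^sup>2 / 2 = - (norm y)\<^sup>2 / (2 * r\<^sup>2) + ((y /\<^sub>R r\<^sup>2) \<bullet> x - (1 + 1 / (2 * r\<^sup>2)) * (norm x)\<^sup>2)"
  proof -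
    have "(norm ((y - x) /\<^sub>R r))\<^sup>2 = (norm (y - x))\<^sup>2 / r\<^sup>2"
      using r by (simp add: power_mult_distrib power_inverse divide_inverse)
    then show ?thesis unfolding n using r by (simp only:) (simp add: field_simps)
  qed
  have "exp (- (norm x)\<^sup>2) * exp (- (norm ((y - x) /\<^sub>R r))\<^sup>2 / 2) = exp (- (norm y)\<^sup>2 / (2 * r\<^sup>2)) * exp ((y /\<^sub>R r\<^sup>2) \<bullet> x - (1 + 1 / (2 * r\<^sup>2)) * (norm x)\<^sup>2)"
    by (simp only: exp_add[symmetric] e)
  then show ?thesis unfolding gaussian_eq by simp
qed

lemma schwartz_tests_determine_real:
  fixes d :: "'a::euclidean_space \<Rightarrow> real"
  assumes i: "\<And>a l. 0 < l \<Longrightarrow> integrable lborel (\<lambda>x. d x * exp (a \<bullet> x - l * (norm x)\<^sup>2))"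
    and z: "\<And>a l. 0 < l \<Longrightarrow> (LINT x|lborel. d x * exp (a \<bullet> x - l * (norm x)\<^sup>2)) = 0"
  shows "AE x in lborel. d x = 0"
proof -
  \<comment> \<open>Since d itself need not be integrable, it is damped first. The positive and
    negative parts of e are integrable and have the same Gaussian averages, hence coincide almost
    everywhere, which forces e = 0.\<close>
  define e where "e x = d x * exp (- (norm x)\<^sup>2)" for x
  have ei: "integrable lborel e" using i[of 1 0] by (simp add: e_def[abs_def])
  then have [measurable]: "e \<in> borel_measurable borel" by auto
  have "AE x in lborel. max 0 (e x) = max 0 (- e x)"
  proof (rule gaussian_tests_determine)
    fix y :: 'a and r :: real assume r: "0 < r"
    let ?g = "\<lambda>x. gaussian ((y - x) /\<^sub>R r)"
    have l: "0 < 1 + 1 / (2 * r\<^sup>2)" by (intro add_pos_nonneg) auto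
    have eg: "e x * ?g x = (exp (- (norm y)\<^sup>2 / (2 * r\<^sup>2)) / sqrt (2 * pi) ^ DIM('a)) * (d x * exp ((y /\<^sub>R r\<^sup>2) \<bullet> x - (1 + 1 / (2 * r\<^sup>2)) * (norm x)\<^sup>2))" for x
      using gaussian_gaussian[OF r, of x y] by (simp add: e_def mult_ac)
    have gi: "integrable lborel (\<lambda>x. e x * ?g x)"
      unfolding eg by (intro integrable_mult_right i l)
    have gz: "(LINT x|lborel. e x * ?g x) = 0"
      unfolding eg integral_mult_right_zero by (simp only: z[OF l] mult_zero_right)
    have ip: "integrable lborel (\<lambda>x. max 0 (e x * ?g x))" "integrable lborel (\<lambda>x. max 0 (- (e x * ?g x)))"
      using gi by (auto intro!: integrable_max)
    have "(LINT x|lborel. max 0 (e x * ?g x)) - (LINT x|lborel. max 0 (- (e x * ?g x))) = (LINT x|lborel. e x * ?g x)"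
      by (subst Bochner_Integration.integral_diff[symmetric, OF ip]) (auto intro!: Bochner_Integration.integral_cong simp: max_def)
    then have "(LINT x|lborel. max 0 (e x * ?g x)) = (LINT x|lborel. max 0 (- (e x * ?g x)))" using gz by simp
    then have "(\<integral>\<^sup>+x. ennreal (max 0 (e x * ?g x)) \<partial>lborel) = (\<integral>\<^sup>+x. ennreal (max 0 (- (e x * ?g x))) \<partial>lborel)"
      using nn_integral_eq_integral[OF ip(1)] nn_integral_eq_integral[OF ip(2)] by (simp del: ennreal_max_0 ennreal_max_0')
    moreover have "ennreal (max 0 c) * ennreal (?g x) = ennreal (max 0 (c * ?g x))" for c x
    proof -
      have "max 0 c * ?g x = max 0 (c * ?g x)" using gaussian_pos[of "(y - x) /\<^sub>R r"]
        by (auto simp: max_def zero_le_mult_iff mult_le_0_iff)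
      moreover have "ennreal (max 0 c) * ennreal (?g x) = ennreal (max 0 c * ?g x)"
        by (rule ennreal_mult[symmetric]) (auto simp: gaussian_pos less_imp_le)
      ultimately show ?thesis by (simp only:)
    qed
    from this[of "e _"] this[of "- e _"]
    have "ennreal (max 0 (e x)) * ennreal (?g x) = ennreal (max 0 (e x * ?g x))"
      "ennreal (max 0 (- e x)) * ennreal (?g x) = ennreal (max 0 (- (e x * ?g x)))" for x by simp_all
    ultimately show "(\<integral>\<^sup>+x. ennreal (max 0 (e x)) * ennreal (?g x) \<partial>lborel) = (\<integral>\<^sup>+x. ennreal (max 0 (- e x)) * ennreal (?g x) \<partial>lborel)"
      by (simp only:)
  qed (use ei in \<open>auto intro!: integrable_max\<close>)
  then show ?thesis by eventually_elim (auto simp: e_def max_def split: if_splits)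
qed

lemma schwartz_tests_determine:
  fixes D :: "'a::euclidean_space \<Rightarrow> complex"
  assumes i: "\<And>\<psi>. schwartz \<psi> \<Longrightarrow> integrable lborel (\<lambda>x. D x * \<psi> x)"
    and z: "\<And>\<psi>. schwartz \<psi> \<Longrightarrow> (LINT x|lborel. D x * \<psi> x) = 0"
  shows "AE x in lborel. D x = 0"
proof -
  let ?g = "\<lambda>a l x. exp (a \<bullet> x - l * (norm (x::'a))\<^sup>2)"
  have gi: "integrable lborel (\<lambda>x. D x * complex_of_real (?g a l x))" "(LINT x|lborel. D x * complex_of_real (?g a l x)) = 0" if "0 < l" for a l
    using i[OF schwartz_gaussian[OF that]] z[OF schwartz_gaussian[OF that]] by auto
  have "AE x in lborel. Re (D x) = 0"
  proof (rule schwartz_tests_determine_real)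
    fix a :: 'a and l :: real assume l: "0 < l"
    show "integrable lborel (\<lambda>x. Re (D x) * ?g a l x)" using integrable_Re[OF gi(1)[OF l, of a]] by simp
    show "(LINT x|lborel. Re (D x) * ?g a l x) = 0" using integral_Re[OF gi(1)[OF l, of a]] gi(2)[OF l, of a] by simp
  qed
  moreover have "AE x in lborel. Im (D x) = 0"
  proof (rule schwartz_tests_determine_real)
    fix a :: 'a and l :: real assume l: "0 < l"
    show "integrable lborel (\<lambda>x. Im (D x) * ?g a l x)" using integrable_Im[OF gi(1)[OF l, of a]] by simp
    show "(LINT x|lborel. Im (D x) * ?g a l x) = 0" using integral_Im[OF gi(1)[OF l, of a]] gi(2)[OF l, of a] by simp
  qed
  ultimately show ?thesis by eventually_elim (simp add: complex_eq_iff)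
qed

text \<open>Makes the existential G in \<open>is_box_power\<close> unambiguous up to null sets, so
  that sharpness can be tested on any H offered by \<open>KG_estimate\<close>.\<close>

lemma has_fourier_unique:
  assumes "has_fourier F G" "has_fourier F G'"
  shows "AE x in lborel. G x = G' x"
proof -
  have "AE x in lborel. G x - G' x = 0"
  proof (rule schwartz_tests_determine)
    fix \<psi> :: "'a \<Rightarrow> complex" assume s: "schwartz \<psi>"
    have i: "integrable lborel (\<lambda>x. G x * \<psi> x)" "integrable lborel (\<lambda>x. G' x * \<psi> x)"
      using assms s unfolding has_fourier_def tempered_fun_def by auto
    show "integrable lborel (\<lambda>x. (G x - G' x) * \<psi> x)" using i by (simp add: left_diff_distrib)
    have "(LINT x|lborel. G x * \<psi> x) = (LINT x|lborel. G' x * \<psi> x)"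
      using assms s unfolding has_fourier_def by metis
    then show "(LINT x|lborel. (G x - G' x) * \<psi> x) = 0" using i by (simp add: left_diff_distrib)
  qed
  then show ?thesis by eventually_elim simp
qed

lemma L2_schwartz_integrable:
  assumes "K \<in> borel_measurable borel" "(\<integral>\<^sup>+x. ennreal ((norm (K x))\<^sup>2) \<partial>lborel) < \<infinity>" "schwartz \<psi>"
  shows "integrable lborel (\<lambda>x. K x * \<psi> x)" "integrable lborel (\<lambda>x. K x * fourier \<psi> x)"
proof -
  obtain C where "\<And>x. norm (\<psi> x) \<le> C" using schwartz_decay[OF assms(3), of 0] by auto
  then show "integrable lborel (\<lambda>x. K x * \<psi> x)"
    by (intro L2_mult_integrable[OF assms(1,2) schwartz_integrable[OF assms(3)]])
  show "integrable lborel (\<lambda>x. K x * fourier \<psi> x)"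
    by (intro L2_mult_integrable[OF assms(1,2) fourier_schwartz_integrable[OF assms(3)] fourier_norm_le])
qed

text \<open>\<open>fourier_L2\<close> produces some square-integrable transform of H with this
  bound; uniqueness identifies it with the given K.\<close>

lemma has_fourier_L2_bound:
  fixes H K :: "'a::euclidean_space \<Rightarrow> complex"
  assumes H: "H \<in> borel_measurable borel" "(\<integral>\<^sup>+x. ennreal ((norm (H x))\<^sup>2) \<partial>lborel) < \<infinity>" and hf: "has_fourier H K"
  shows "(\<integral>\<^sup>+p. ennreal ((norm (K p))\<^sup>2) \<partial>lborel) \<le> ennreal ((2 * pi) ^ DIM('a)) * (\<integral>\<^sup>+x. ennreal ((norm (H x))\<^sup>2) \<partial>lborel)"
proof -
  from fourier_L2[OF H] obtain K1 where K1: "K1 \<in> borel_measurable borel"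
    "(\<integral>\<^sup>+p. ennreal ((norm (K1 p))\<^sup>2) \<partial>lborel) \<le> ennreal ((2 * pi) ^ DIM('a)) * (\<integral>\<^sup>+x. ennreal ((norm (H x))\<^sup>2) \<partial>lborel)"
    "\<And>\<psi> C. integrable lborel \<psi> \<Longrightarrow> (\<forall>x. norm (\<psi> x) \<le> C) \<Longrightarrow> integrable lborel (fourier \<psi>) \<Longrightarrow>
       (LINT p|lborel. K1 p * \<psi> p) = (LINT x|lborel. H x * fourier \<psi> x)" by blast
  have fin: "(\<integral>\<^sup>+p. ennreal ((norm (K1 p))\<^sup>2) \<partial>lborel) < \<infinity>"
    using K1(2) H(2) by (auto intro!: le_less_trans[OF K1(2)] simp: ennreal_mult_less_top)
  have "has_fourier H K1"
    unfolding has_fourier_def tempered_fun_def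
  proof (intro conjI allI impI)
    fix \<psi> :: "'a \<Rightarrow> complex" assume s: "schwartz \<psi>"
    show "integrable lborel (\<lambda>x. H x * \<psi> x)" "integrable lborel (\<lambda>x. H x * fourier \<psi> x)" "integrable lborel (\<lambda>x. K1 x * \<psi> x)"
      by (intro L2_schwartz_integrable H K1(1) fin s)+
    obtain C where "\<And>x. norm (\<psi> x) \<le> C" using schwartz_decay[OF s, of 0] by auto
    then show "(LINT x|lborel. H x * fourier \<psi> x) = (LINT \<xi>|lborel. K1 \<xi> * \<psi> \<xi>)"
      using K1(3)[of \<psi> C] schwartz_integrable[OF s] fourier_schwartz_integrable[OF s] by simp
  qed
  from has_fourier_unique[OF hf this] have ae: "AE x in lborel. K x = K1 x" .
  have "(\<integral>\<^sup>+p. ennreal ((norm (K p))\<^sup>2) \<partial>lborel) = (\<integral>\<^sup>+p. ennreal ((norm (K1 p))\<^sup>2) \<partial>lborel)"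
    by (rule nn_integral_cong_AE, use ae in eventually_elim) simp
  then show ?thesis using K1(2) by simp
qed

lemma L2_has_fourier:
  fixes K :: "'a::euclidean_space \<Rightarrow> complex"
  assumes K: "K \<in> borel_measurable borel" "(\<integral>\<^sup>+x. ennreal ((norm (K x))\<^sup>2) \<partial>lborel) < \<infinity>"
  shows "\<exists>H\<in>borel_measurable borel. has_fourier H K \<and>
    (\<integral>\<^sup>+x. ennreal ((norm (H x))\<^sup>2) \<partial>lborel) \<le> ennreal (1 / (2 * pi) ^ DIM('a)) * (\<integral>\<^sup>+p. ennreal ((norm (K p))\<^sup>2) \<partial>lborel)"
proof -
  let ?c = "(2 * pi) ^ DIM('a)"
  have c: "?c > 0" by simp
  from fourier_L2[OF K] obtain L where L[measurable]: "L \<in> borel_measurable borel"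
    and L2: "(\<integral>\<^sup>+p. ennreal ((norm (L p))\<^sup>2) \<partial>lborel) \<le> ennreal ?c * (\<integral>\<^sup>+x. ennreal ((norm (K x))\<^sup>2) \<partial>lborel)"
    and L3: "\<And>\<psi> C. integrable lborel \<psi> \<Longrightarrow> (\<forall>x. norm (\<psi> x) \<le> C) \<Longrightarrow> integrable lborel (fourier \<psi>) \<Longrightarrow>
       (LINT p|lborel. L p * \<psi> p) = (LINT x|lborel. K x * fourier \<psi> x)" by blast
  \<comment> \<open>The inverse transform is the reflected transform divided by (2 pi)^d. Its
    squared norm picks up (2 pi)^(- 2 d) from the factor and (2 pi)^d from
    \<open>fourier_L2\<close>.\<close>
  define H where "H x = of_real (1 / ?c) * L (- x)" for x
  have [measurable]: "H \<in> borel_measurable borel" unfolding H_def by measurable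
  have "(\<integral>\<^sup>+x. ennreal ((norm (H x))\<^sup>2) \<partial>lborel) = (\<integral>\<^sup>+x. ennreal ((1 / ?c)\<^sup>2) * ennreal ((norm (L (- x)))\<^sup>2) \<partial>lborel)"
    by (intro nn_integral_cong) (simp add: H_def norm_mult norm_divide norm_power power_mult_distrib power_divide ennreal_mult[symmetric])
  also have "\<dots> = ennreal ((1 / ?c)\<^sup>2) * (\<integral>\<^sup>+x. ennreal ((norm (L x))\<^sup>2) \<partial>lborel)"
    using nn_integral_lborel_affine[of "\<lambda>x. ennreal ((norm (L x))\<^sup>2)" "-1" 0] by (simp add: nn_integral_cmult)
  also have "\<dots> \<le> ennreal ((1 / ?c)\<^sup>2) * (ennreal ?c * (\<integral>\<^sup>+x. ennreal ((norm (K x))\<^sup>2) \<partial>lborel))"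
    by (intro mult_left_mono L2) auto
  also have "\<dots> = ennreal ((1 / ?c)\<^sup>2 * ?c) * (\<integral>\<^sup>+x. ennreal ((norm (K x))\<^sup>2) \<partial>lborel)"
    by (subst ennreal_mult) (auto simp: mult.assoc)
  also have "(1 / ?c)\<^sup>2 * ?c = 1 / ?c" using c by (simp only: power2_eq_square) (simp add: field_simps)
  finally have H2: "(\<integral>\<^sup>+x. ennreal ((norm (H x))\<^sup>2) \<partial>lborel) \<le> ennreal (1 / ?c) * (\<integral>\<^sup>+p. ennreal ((norm (K p))\<^sup>2) \<partial>lborel)" .
  have fin: "(\<integral>\<^sup>+x. ennreal ((norm (H x))\<^sup>2) \<partial>lborel) < \<infinity>"
    by (rule le_less_trans[OF H2]) (use K(2) in \<open>auto simp: ennreal_mult_less_top\<close>)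
  have "has_fourier H K"
    unfolding has_fourier_def tempered_fun_def
  proof (intro conjI allI impI)
    fix \<psi> :: "'a \<Rightarrow> complex" assume s: "schwartz \<psi>"
    note [measurable] = schwartz_measurable[OF s]
    show "integrable lborel (\<lambda>x. H x * \<psi> x)" "integrable lborel (\<lambda>x. H x * fourier \<psi> x)" "integrable lborel (\<lambda>x. K x * \<psi> x)"
      by (intro L2_schwartz_integrable K fin s \<open>H \<in> borel_measurable borel\<close>)+
    \<comment> \<open>By inversion the transform of w is (2 pi)^d \<psi>, so pairing L with w
      returns the pairing of K with \<psi>.\<close>
    define w where "w x = fourier \<psi> (- x)" for x
    have fchi: "fourier w p = of_real ?c * \<psi> p" for p
    proof -
      have "fourier w p = (LINT x|lborel. exp (\<i> * of_real (x \<bullet> p)) * fourier \<psi> x)"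
        unfolding fourier_def[of w] w_def
        by (subst integral_lborel_affine[where c="-1" and t=0]) auto
      then show ?thesis using fourier_inversion_schwartz[OF s] by simp
    qed
    have "integrable lborel w"
    proof -
      have "integrable lborel (fourier \<psi>)" by (rule fourier_schwartz_integrable[OF s])
      moreover have "lborel = distr lborel borel (uminus :: 'a \<Rightarrow> 'a)"
        using lborel_affine[of "-1" "0::'a"] by (simp add: density_1)
      ultimately show ?thesis
        using integrable_distr_eq[of "uminus :: 'a \<Rightarrow> 'a" lborel borel "fourier \<psi>"] by (simp add: w_def[abs_def])
    qed
    moreover have "integrable lborel (fourier w)"
      unfolding fchi using schwartz_integrable[OF s] by auto
    ultimately have "(LINT p|lborel. L p * w p) = (LINT x|lborel. K x * fourier w x)"
      by (intro L3[where C="LINT x|lborel. norm (\<psi> x)"] allI) (assumption, simp only: w_def fourier_norm_le, assumption)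
    also have "\<dots> = of_real ?c * (LINT x|lborel. K x * \<psi> x)"
      unfolding fchi by (subst integral_mult_right_zero[symmetric]) (simp add: mult_ac)
    finally have 1: "(LINT p|lborel. L p * w p) = of_real ?c * (LINT x|lborel. K x * \<psi> x)" .
    have "(LINT x|lborel. H x * fourier \<psi> x) = of_real (1 / ?c) * (LINT x|lborel. L (- x) * fourier \<psi> x)"
      by (subst integral_mult_right_zero[symmetric]) (simp add: H_def mult_ac)
    also have "(LINT x|lborel. L (- x) * fourier \<psi> x) = (LINT p|lborel. L p * w p)"
      unfolding w_def by (subst integral_lborel_affine[where c="-1" and t=0]) auto
    finally show "(LINT x|lborel. H x * fourier \<psi> x) = (LINT \<xi>|lborel. K \<xi> * \<psi> \<xi>)"
      using 1 c by simp
  qed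
  then show ?thesis using H2 by auto
qed

section \<open>Lorentz boosts\<close>

lemma nn_integral_substitution_image:
  fixes f :: "real \<Rightarrow> ennreal" and g :: "real \<Rightarrow> real"
  assumes f: "f \<in> borel_measurable borel"
    and J: "\<And>n. a n \<le> b n" "decseq a" "incseq b" and I: "(\<Union>n. {a n..b n}) = I"
    and g: "\<And>x. x \<in> I \<Longrightarrow> (g has_real_derivative g' x) (at x)"
    and cg: "continuous_on I g'" and nn: "\<And>x. x \<in> I \<Longrightarrow> 0 \<le> g' x"
    and gm: "g \<in> borel_measurable borel" "g' \<in> borel_measurable borel"
  shows "(\<integral>\<^sup>+y. f y * indicator (g ` I) y \<partial>lborel) = (\<integral>\<^sup>+x. f (g x) * ennreal (g' x) * indicator I x \<partial>lborel)"
proof (rule nn_integral_substitution_interval[OF f J I _ g cg nn gm])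
  have sub: "{a n..b n} \<subseteq> I" for n using I by blast
  show "(\<Union>n. {g (a n)..g (b n)}) = g ` I"
  proof (intro equalityI subsetI)
    fix y assume "y \<in> (\<Union>n. {g (a n)..g (b n)})"
    then obtain n where "g (a n) \<le> y" "y \<le> g (b n)" by auto
    moreover have "continuous_on {a n..b n} g"
      using g sub[of n] by (intro continuous_at_imp_continuous_on) (auto intro: DERIV_isCont)
    ultimately obtain x where "a n \<le> x" "x \<le> b n" "g x = y" using IVT'[of g "a n" y "b n"] J(1)[of n] by auto
    then show "y \<in> g ` I" using sub[of n] by auto
  next
    fix y assume "y \<in> g ` I"
    then obtain x n where x: "y = g x" "a n \<le> x" "x \<le> b n" using I by fastforce
    have "g (a n) \<le> g x"
      by (rule DERIV_nonneg_imp_nondecreasing[of _ _ g]) (use x sub[of n] g nn in \<open>auto simp: subset_eq\<close>, meson atLeastAtMost_iff order_trans)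
    moreover have "g x \<le> g (b n)"
      by (rule DERIV_nonneg_imp_nondecreasing[of _ _ g]) (use x sub[of n] g nn in \<open>auto simp: subset_eq\<close>, meson atLeastAtMost_iff order_trans)
    ultimately show "y \<in> (\<Union>n. {g (a n)..g (b n)})" using x by auto
  qed
qed auto

lemma UN_Icc_UNIV: "(\<Union>n. {- real n..real n}) = UNIV"
proof (intro equalityI subsetI UNIV_I)
  fix x :: real
  obtain n where "\<bar>x\<bar> \<le> real n" using real_arch_simple by blast
  then show "x \<in> (\<Union>n. {- real n..real n})" by (intro UN_I[of n]) auto
qed

lemma UN_Icc_Ioi: "(\<Union>n. {1 / real (Suc n)..real (Suc n)}) = {0<..}"
proof (intro equalityI subsetI)
  fix x :: real assume x: "x \<in> {0<..}"
  obtain n where n: "max x (1 / x) \<le> real n" using real_arch_simple by blast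
  then have "x \<le> real (Suc n)" "1 / x \<le> real (Suc n)" by auto
  then have "1 / real (Suc n) \<le> x" using x by (simp add: field_simps)
  then show "x \<in> (\<Union>n. {1 / real (Suc n)..real (Suc n)})" using \<open>x \<le> real (Suc n)\<close> by (intro UN_I[of n]) auto
next
  fix x :: real assume "x \<in> (\<Union>n. {1 / real (Suc n)..real (Suc n)})"
  then obtain n where "1 / real (Suc n) \<le> x" by auto
  moreover have "0 < 1 / real (Suc n)" by simp
  ultimately show "x \<in> {0<..}" by (simp only: greaterThan_iff)
qed

lemma nn_integral_substitution_UNIV:
  fixes f :: "real \<Rightarrow> ennreal" and g :: "real \<Rightarrow> real"
  assumes f: "f \<in> borel_measurable borel"
    and g: "\<And>x. (g has_real_derivative g' x) (at x)"
    and cg: "continuous_on UNIV g'" and nn: "\<And>x. 0 \<le> g' x" and s: "surj g"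
  shows "(\<integral>\<^sup>+y. f y \<partial>lborel) = (\<integral>\<^sup>+x. f (g x) * ennreal (g' x) \<partial>lborel)"
proof -
  have gm: "g \<in> borel_measurable borel" "g' \<in> borel_measurable borel"
    using cg g by (auto intro!: borel_measurable_continuous_onI continuous_at_imp_continuous_on DERIV_isCont)
  have "(\<integral>\<^sup>+y. f y * indicator (g ` UNIV) y \<partial>lborel) = (\<integral>\<^sup>+x. f (g x) * ennreal (g' x) * indicator UNIV x \<partial>lborel)"
    by (rule nn_integral_substitution_image[OF f _ _ _ UN_Icc_UNIV g cg nn gm]) (auto simp: incseq_def decseq_def)
  then show ?thesis using s by simp
qed

lemma nn_integral_substitution_Ioi:
  fixes f :: "real \<Rightarrow> ennreal" and g :: "real \<Rightarrow> real"
  assumes f: "f \<in> borel_measurable borel"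
    and g: "\<And>x. 0 < x \<Longrightarrow> (g has_real_derivative g' x) (at x)"
    and cg: "continuous_on {0<..} g'" and nn: "\<And>x. 0 < x \<Longrightarrow> 0 \<le> g' x"
    and gm: "g \<in> borel_measurable borel" "g' \<in> borel_measurable borel"
  shows "(\<integral>\<^sup>+y. f y * indicator (g ` {0<..}) y \<partial>lborel) = (\<integral>\<^sup>+x. f (g x) * ennreal (g' x) * indicator {0<..} x \<partial>lborel)"
proof (rule nn_integral_substitution_image[OF f _ _ _ UN_Icc_Ioi])
  show "decseq (\<lambda>n. 1 / real (Suc n))" by (auto simp: decseq_def frac_le)
  show "1 / real (Suc n) \<le> real (Suc n)" for n
    by (rule order_trans[of _ 1]) auto
qed (use assms in \<open>auto simp: incseq_def\<close>)

lemma nn_integral_inversion: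
  fixes h :: "real \<Rightarrow> ennreal"
  assumes [measurable]: "h \<in> borel_measurable borel"
  shows "(\<integral>\<^sup>+l. h l * indicator {0<..} l \<partial>lborel) = (\<integral>\<^sup>+l. h (1 / l) * ennreal (1 / l\<^sup>2) * indicator {0<..} l \<partial>lborel)"
proof -
  \<comment> \<open>The substitution rule asks for a nondecreasing map, hence - 1 / x followed by a
    reflection instead of 1 / x.\<close>
  have im: "(\<lambda>x::real. - 1 / x) ` {0<..} = {..<0}"
  proof (intro equalityI subsetI)
    fix x :: real assume "x \<in> {..<0}"
    then show "x \<in> (\<lambda>x. - 1 / x) ` {0<..}" by (intro image_eqI[of _ _ "- 1 / x"]) (auto simp: divide_neg_neg)
  qed auto
  have "(\<integral>\<^sup>+l. h l * indicator {0<..} l \<partial>lborel) = (\<integral>\<^sup>+y. h (- y) * indicator {..<0} y \<partial>lborel)"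
    by (subst nn_integral_real_affine[where c="-1" and t=0]) (auto intro!: nn_integral_cong simp: indicator_def)
  also have "\<dots> = (\<integral>\<^sup>+x. h (- (- 1 / x)) * ennreal (1 / x\<^sup>2) * indicator {0<..} x \<partial>lborel)"
    unfolding im[symmetric]
    by (rule nn_integral_substitution_Ioi) (auto intro!: derivative_eq_intros continuous_intros simp: power2_eq_square)
  finally show ?thesis by simp
qed

text \<open>With r = sqrt(S + y^2), the map (r, y) \<mapsto> ((E r + q y) / M, (E y + q r) / M) is a
  hyperbolic rotation, because E^2 - q^2 = M^2. It preserves r^2 - y^2 = S, and |q| < E keeps the
  first component positive.\<close>

lemma boost_key:
  assumes S: "0 < S" and E: "\<bar>q\<bar> < E" and M: "M = sqrt (E\<^sup>2 - q\<^sup>2)"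
  shows "sqrt (S + ((E * y + q * sqrt (S + y\<^sup>2)) / M)\<^sup>2) = (E * sqrt (S + y\<^sup>2) + q * y) / M"
    and "0 < (E * sqrt (S + y\<^sup>2) + q * y) / M"
proof -
  define g where "g y = (E * y + q * sqrt (S + y\<^sup>2)) / M" for y
  define e where "e y = (E * sqrt (S + y\<^sup>2) + q * y) / M" for y
  have q2: "q\<^sup>2 < E\<^sup>2" using E by (metis abs_ge_zero abs_of_nonneg order_le_less_trans power2_abs power_strict_mono pos2)
  have M0: "0 < M" "M\<^sup>2 = E\<^sup>2 - q\<^sup>2" using q2 M by auto
  have Sp: "0 < S + y\<^sup>2" for y using S by (simp add: add_pos_nonneg)
  have r2: "(sqrt (S + y\<^sup>2))\<^sup>2 = S + y\<^sup>2" for y using Sp[of y] by simp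
  have yr: "\<bar>y\<bar> < sqrt (S + y\<^sup>2)" for y using S by (intro real_less_rsqrt) simp
  have epos: "0 < e y" for y
  proof -
    have "\<bar>q * y\<bar> \<le> \<bar>q\<bar> * sqrt (S + y\<^sup>2)" unfolding abs_mult using yr[of y] by (intro mult_left_mono) auto
    also have "\<dots> < E * sqrt (S + y\<^sup>2)" using E Sp[of y] by (intro mult_strict_right_mono) auto
    finally show ?thesis using M0 by (auto simp: e_def)
  qed
  have key: "S + (g y)\<^sup>2 = (e y)\<^sup>2" for y
  proof -
    define r where "r = sqrt (S + y\<^sup>2)"
    have r: "r\<^sup>2 = S + y\<^sup>2" using r2[of y] by (simp add: r_def)
    have "M\<^sup>2 * (S + ((E * y + q * r) / M)\<^sup>2) = M\<^sup>2 * S + (E * y + q * r)\<^sup>2"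
      using M0(1) by (simp add: power_divide distrib_left)
    also have "\<dots> = (E\<^sup>2 - q\<^sup>2) * S + (E * y + q * r)\<^sup>2" by (simp only: M0(2))
    also have "\<dots> = (E * r + q * y)\<^sup>2 + (E\<^sup>2 - q\<^sup>2) * (S + y\<^sup>2 - r\<^sup>2)"
      by (simp add: power2_eq_square algebra_simps)
    also have "\<dots> = M\<^sup>2 * ((E * r + q * y) / M)\<^sup>2" using M0(1) r by (simp add: power_divide)
    finally show ?thesis using M0(1) by (simp add: g_def e_def r_def)
  qed
  then have key': "sqrt (S + (g y)\<^sup>2) = e y" for y using epos[of y] by simp
  show "sqrt (S + ((E * y + q * sqrt (S + y\<^sup>2)) / M)\<^sup>2) = (E * sqrt (S + y\<^sup>2) + q * y) / M"
    using key'[of y] by (simp only: g_def e_def)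
  show "0 < (E * sqrt (S + y\<^sup>2) + q * y) / M" using epos[of y] by (simp only: e_def)
qed

text \<open>dx / sqrt(S + x^2) is the rapidity measure on a branch of a hyperbola, and a boost only
  translates the rapidity. Concretely, the derivative of the substitution is the quotient of the new
  root by the old one.\<close>

lemma nn_integral_boost:
  fixes F :: "real \<Rightarrow> ennreal"
  assumes F[measurable]: "F \<in> borel_measurable borel" and S: "0 < S" and E: "\<bar>q\<bar> < E" and M: "M = sqrt (E\<^sup>2 - q\<^sup>2)"
  shows "(\<integral>\<^sup>+x. F x * ennreal (1 / sqrt (S + x\<^sup>2)) \<partial>lborel) =
    (\<integral>\<^sup>+y. F ((E * y + q * sqrt (S + y\<^sup>2)) / M) * ennreal (1 / sqrt (S + y\<^sup>2)) \<partial>lborel)"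
proof -
  define g where "g y = (E * y + q * sqrt (S + y\<^sup>2)) / M" for y
  define e where "e y = (E * sqrt (S + y\<^sup>2) + q * y) / M" for y
  have q2: "q\<^sup>2 < E\<^sup>2" using E by (metis abs_ge_zero abs_of_nonneg order_le_less_trans power2_abs power_strict_mono pos2)
  have M0: "0 < M" "M\<^sup>2 = E\<^sup>2 - q\<^sup>2" using q2 M by auto
  have Sp: "0 < S + y\<^sup>2" for y using S by (simp add: add_pos_nonneg)
  have r2: "(sqrt (S + y\<^sup>2))\<^sup>2 = S + y\<^sup>2" for y using Sp[of y] by simp
  have yr: "\<bar>y\<bar> < sqrt (S + y\<^sup>2)" for y using S by (intro real_less_rsqrt) simp
  have epos: "0 < e y" and key': "sqrt (S + (g y)\<^sup>2) = e y" for y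
    using boost_key[OF S E M, of y] by (simp_all only: g_def e_def)
  have deriv: "(g has_real_derivative e y / sqrt (S + y\<^sup>2)) (at y)" for y
    unfolding g_def[abs_def] e_def using Sp[of y] M0(1)
    by (auto intro!: derivative_eq_intros simp: field_simps)
  have cont: "continuous_on UNIV (\<lambda>y. e y / sqrt (S + y\<^sup>2))"
    unfolding e_def using Sp M0(1) by (intro continuous_intros) (auto simp: less_le)
  \<comment> \<open>The preimage is the boost of opposite velocity, with q replaced by - q.\<close>
  have sur: "surj g"
  proof (rule surjI)
    fix x :: real
    define r where "r = sqrt (S + x\<^sup>2)"
    define y where "y = (E * x - q * r) / M"
    have r: "r\<^sup>2 = S + x\<^sup>2" using r2[of x] by (simp add: r_def)
    have p: "0 \<le> (E * r - q * x) / M"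
    proof -
      have "\<bar>q * x\<bar> \<le> \<bar>q\<bar> * r" unfolding abs_mult r_def using yr[of x] by (intro mult_left_mono) auto
      also have "\<dots> \<le> E * r" using E Sp[of x] unfolding r_def by (intro mult_right_mono) auto
      finally show ?thesis using M0 by auto
    qed
    have "M\<^sup>2 * (S + y\<^sup>2) = M\<^sup>2 * S + (E * x - q * r)\<^sup>2"
      using M0(1) by (simp add: y_def power_divide distrib_left)
    also have "\<dots> = (E\<^sup>2 - q\<^sup>2) * S + (E * x - q * r)\<^sup>2" by (simp only: M0(2))
    also have "\<dots> = (E * r - q * x)\<^sup>2 + (E\<^sup>2 - q\<^sup>2) * (S + x\<^sup>2 - r\<^sup>2)"
      by (simp add: power2_eq_square algebra_simps)
    also have "\<dots> = M\<^sup>2 * ((E * r - q * x) / M)\<^sup>2" using M0(1) r by (simp add: power_divide)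
    finally have "S + y\<^sup>2 = ((E * r - q * x) / M)\<^sup>2" using M0(1) by simp
    then have "sqrt (S + y\<^sup>2) = (E * r - q * x) / M" by (simp only: real_sqrt_abs abs_of_nonneg[OF p])
    then have "g y = (E * ((E * x - q * r) / M) + q * ((E * r - q * x) / M)) / M" by (simp add: g_def y_def)
    also have "\<dots> = (E\<^sup>2 - q\<^sup>2) * x / M\<^sup>2" using M0(1) by (simp add: field_simps power2_eq_square)
    also have "\<dots> = x" using M0(1) by (simp add: M0(2)[symmetric])
    finally show "g ((\<lambda>x. (E * x - q * sqrt (S + x\<^sup>2)) / M) x) = x" by (simp add: y_def r_def)
  qed
  have "(\<integral>\<^sup>+x. F x * ennreal (1 / sqrt (S + x\<^sup>2)) \<partial>lborel) =
     (\<integral>\<^sup>+y. F (g y) * ennreal (1 / sqrt (S + (g y)\<^sup>2)) * ennreal (e y / sqrt (S + y\<^sup>2)) \<partial>lborel)"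
    by (rule nn_integral_substitution_UNIV[OF _ deriv cont _ sur]) (use epos Sp in \<open>auto simp: less_imp_le\<close>)
  also have "\<dots> = (\<integral>\<^sup>+y. F (g y) * ennreal (1 / sqrt (S + y\<^sup>2)) \<partial>lborel)"
  proof (rule nn_integral_cong)
    fix y
    have "ennreal (1 / e y) * ennreal (e y / sqrt (S + y\<^sup>2)) = ennreal (1 / sqrt (S + y\<^sup>2))"
      using epos[of y] Sp[of y] by (subst ennreal_mult[symmetric]) (auto simp: less_imp_le)
    then show "F (g y) * ennreal (1 / sqrt (S + (g y)\<^sup>2)) * ennreal (e y / sqrt (S + y\<^sup>2)) = F (g y) * ennreal (1 / sqrt (S + y\<^sup>2))"
      by (simp only: key' mult.assoc)
  qed
  finally show ?thesis by (simp add: g_def)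
qed

section \<open>Integration along parallel lines, and boosts in several dimensions\<close>

definition perp :: "'a::euclidean_space \<Rightarrow> 'a \<Rightarrow> 'a" where
  "perp \<xi> \<eta> = \<eta> - ((\<eta> \<bullet> \<xi>) / (\<xi> \<bullet> \<xi>)) *\<^sub>R \<xi>"

text \<open>Weighting by one period in the direction \<open>\<xi>\<close> turns an integral over the hyperplane orthogonal to \<open>\<xi>\<close> into an
  integral over the whole space, so that no coordinates adapted to \<open>\<xi>\<close> are needed.\<close>

definition slab :: "'a::euclidean_space \<Rightarrow> 'a \<Rightarrow> real" where
  "slab \<xi> \<eta> = (norm \<xi>)\<^sup>2 * indicator {0..1} (\<eta> \<bullet> \<xi>)"

lemma slab_nonneg: "0 \<le> slab \<xi> \<eta>"
  by (simp add: slab_def)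

lemma slab_measurable [measurable (raw)]:
  assumes [measurable]: "f \<in> borel_measurable M" "g \<in> borel_measurable M"
  shows "(\<lambda>x. slab (f x :: 'a::euclidean_space) (g x)) \<in> borel_measurable M"
  unfolding slab_def by measurable

lemma perp_measurable [measurable (raw)]:
  assumes [measurable]: "f \<in> borel_measurable M" "g \<in> borel_measurable M"
  shows "(\<lambda>x. perp (f x :: 'a::euclidean_space) (g x)) \<in> borel_measurable M"
  unfolding perp_def by measurable

lemma perp_inner: "perp \<xi> \<eta> \<bullet> \<xi> = 0"
  by (cases "\<xi> = 0") (auto simp: perp_def inner_diff_left)

lemma norm_perp_add: "(norm (perp \<xi> \<eta> + x *\<^sub>R \<xi>))\<^sup>2 = (norm (perp \<xi> \<eta>))\<^sup>2 + x\<^sup>2 * (norm \<xi>)\<^sup>2"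
proof -
  have "perp \<xi> \<eta> \<bullet> \<xi> = 0" "\<xi> \<bullet> perp \<xi> \<eta> = 0" using perp_inner[of \<xi> \<eta>] by (simp_all add: inner_commute)
  then have "(perp \<xi> \<eta> + x *\<^sub>R \<xi>) \<bullet> (perp \<xi> \<eta> + x *\<^sub>R \<xi>) = perp \<xi> \<eta> \<bullet> perp \<xi> \<eta> + x * (x * (\<xi> \<bullet> \<xi>))"
    by (simp add: inner_add_left inner_add_right)
  then show ?thesis by (simp add: power2_norm_eq_inner power2_eq_square[of x] mult.assoc)
qed

text \<open>On each line, \<open>perp \<xi> \<eta>\<close> may be replaced by \<eta> after a shift
  of x. Exchanging the integrals and translating \<eta> by x \<xi> moves the shift into
  \<open>slab\<close>, whose integral over x is 1.\<close>

lemma nn_integral_lines: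
  fixes \<Theta> :: "'a::euclidean_space \<Rightarrow> ennreal"
  assumes [measurable]: "\<Theta> \<in> borel_measurable borel" and \<xi>: "\<xi> \<noteq> 0"
  shows "(\<integral>\<^sup>+z. \<Theta> z \<partial>lborel) = (\<integral>\<^sup>+\<eta>. ennreal (slab \<xi> \<eta>) * (\<integral>\<^sup>+x. \<Theta> (perp \<xi> \<eta> + x *\<^sub>R \<xi>) \<partial>lborel) \<partial>lborel)"
proof -
  have 1: "(\<integral>\<^sup>+x. \<Theta> (perp \<xi> \<eta> + x *\<^sub>R \<xi>) \<partial>lborel) = (\<integral>\<^sup>+x. \<Theta> (\<eta> + x *\<^sub>R \<xi>) \<partial>lborel)" for \<eta>
    using nn_integral_lborel_translate[of "\<lambda>x. \<Theta> (\<eta> + x *\<^sub>R \<xi>)" "- (\<eta> \<bullet> \<xi>) / (\<xi> \<bullet> \<xi>)"]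
    by (simp add: perp_def algebra_simps)
  \<comment> \<open>The set of x with 0 \<le> \<eta> \<bullet> \<xi> - x |\<xi>|^2 \<le> 1 has
    length 1 / |\<xi>|^2, which the factor in \<open>slab\<close> compensates.\<close>
  have 2: "(\<integral>\<^sup>+x. ennreal (slab \<xi> (\<eta> - x *\<^sub>R \<xi>)) \<partial>lborel) = 1" for \<eta>
  proof -
    have c: "- (norm \<xi>)\<^sup>2 \<noteq> 0" using \<xi> by simp
    have "1 = (\<integral>\<^sup>+x. indicator {0..1::real} x \<partial>lborel)" by simp
    also have "\<dots> = ennreal ((norm \<xi>)\<^sup>2) * (\<integral>\<^sup>+x. indicator {0..1} (\<eta> \<bullet> \<xi> + - (norm \<xi>)\<^sup>2 * x) \<partial>lborel)"
      by (subst nn_integral_real_affine[OF _ c, of _ "\<eta> \<bullet> \<xi>"]) auto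
    also have "\<dots> = (\<integral>\<^sup>+x. ennreal ((norm \<xi>)\<^sup>2) * indicator {0..1} (\<eta> \<bullet> \<xi> + - (norm \<xi>)\<^sup>2 * x) \<partial>lborel)"
      by (subst nn_integral_cmult) auto
    also have "\<dots> = (\<integral>\<^sup>+x. ennreal (slab \<xi> (\<eta> - x *\<^sub>R \<xi>)) \<partial>lborel)"
      by (intro nn_integral_cong)
        (auto simp: slab_def ennreal_mult ennreal_indicator inner_diff_left power2_norm_eq_inner mult.commute indicator_def)
    finally show ?thesis by simp
  qed
  have "(\<integral>\<^sup>+\<eta>. ennreal (slab \<xi> \<eta>) * (\<integral>\<^sup>+x. \<Theta> (perp \<xi> \<eta> + x *\<^sub>R \<xi>) \<partial>lborel) \<partial>lborel)
     = (\<integral>\<^sup>+\<eta>. (\<integral>\<^sup>+x. ennreal (slab \<xi> \<eta>) * \<Theta> (\<eta> + x *\<^sub>R \<xi>) \<partial>lborel) \<partial>lborel)"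
    by (simp add: 1 nn_integral_cmult)
  also have "\<dots> = (\<integral>\<^sup>+x. (\<integral>\<^sup>+\<eta>. ennreal (slab \<xi> \<eta>) * \<Theta> (\<eta> + x *\<^sub>R \<xi>) \<partial>lborel) \<partial>lborel)"
    by (rule lborel_pair.Fubini') measurable
  also have "\<dots> = (\<integral>\<^sup>+x. (\<integral>\<^sup>+\<eta>. ennreal (slab \<xi> (\<eta> - x *\<^sub>R \<xi>)) * \<Theta> \<eta> \<partial>lborel) \<partial>lborel)"
  proof (rule nn_integral_cong)
    fix x
    show "(\<integral>\<^sup>+\<eta>. ennreal (slab \<xi> \<eta>) * \<Theta> (\<eta> + x *\<^sub>R \<xi>) \<partial>lborel) = (\<integral>\<^sup>+\<eta>. ennreal (slab \<xi> (\<eta> - x *\<^sub>R \<xi>)) * \<Theta> \<eta> \<partial>lborel)"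
      using nn_integral_lborel_translate[of "\<lambda>\<eta>. ennreal (slab \<xi> (\<eta> - x *\<^sub>R \<xi>)) * \<Theta> \<eta>" "x *\<^sub>R \<xi>"]
      by (simp add: add.commute)
  qed
  also have "\<dots> = (\<integral>\<^sup>+\<eta>. (\<integral>\<^sup>+x. ennreal (slab \<xi> (\<eta> - x *\<^sub>R \<xi>)) * \<Theta> \<eta> \<partial>lborel) \<partial>lborel)"
    by (rule lborel_pair.Fubini') measurable
  also have "\<dots> = (\<integral>\<^sup>+z. \<Theta> z \<partial>lborel)" by (simp add: nn_integral_multc 2)
  finally show ?thesis by simp
qed

text \<open>The spatial part of the Lorentz boost that maps the direction of the time axis to that of \<open>(E, p)\<close>, acting on
  the point of the mass shell above \<open>k\<close>.\<close>

definition boost :: "real \<Rightarrow> real \<Rightarrow> 'a::euclidean_space \<Rightarrow> 'a \<Rightarrow> 'a" where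
  "boost s E p k = (let M = sqrt (E\<^sup>2 - (norm p)\<^sup>2) in k + ((p \<bullet> k) / (M * (E + M)) + phi s (norm k) / M) *\<^sub>R p)"

lemma phi_measurable [measurable (raw)]:
  assumes [measurable]: "f \<in> borel_measurable M"
  shows "(\<lambda>x. phi s (f x)) \<in> borel_measurable M"
  unfolding phi_def by measurable

lemma boost_measurable [measurable (raw)]:
  assumes [measurable]: "e \<in> borel_measurable M" "f \<in> borel_measurable M" "g \<in> borel_measurable M"
  shows "(\<lambda>x. boost s (e x) (f x :: 'a::euclidean_space) (g x)) \<in> borel_measurable M"
  unfolding boost_def Let_def by measurable

text \<open>The image stays on the mass shell: the right-hand side is the time component of the
  boosted four-vector. The computation rests on p \<bullet> p = (E - M) (E + M), which clears the
  factor E + M in \<open>boost\<close>.\<close>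

lemma phi_boost:
  assumes E: "norm p < E" and M: "M = sqrt (E\<^sup>2 - (norm p)\<^sup>2)"
  shows "phi s (norm (boost s E p k)) = (E * phi s (norm k) + p \<bullet> k) / M"
proof -
  have p2: "(norm p)\<^sup>2 < E\<^sup>2" using E by (intro power_strict_mono) auto
  have M0: "0 < M" "M\<^sup>2 = E\<^sup>2 - (norm p)\<^sup>2" using p2 M by auto
  have EM: "E + M > 0" using E M0 norm_ge_zero[of p] by linarith
  define f where "f = phi s (norm k)"
  define a where "a = p \<bullet> k"
  define c where "c = a / (M * (E + M)) + f / M"
  have f2: "f\<^sup>2 = s\<^sup>2 + k \<bullet> k" by (simp add: f_def phi_power2 power2_norm_eq_inner)
  have pp: "p \<bullet> p = (E - M) * (E + M)"
    using M0(2) unfolding power2_norm_eq_inner by (simp add: algebra_simps power2_eq_square)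
  have b: "boost s E p k = k + c *\<^sub>R p" by (simp add: boost_def Let_def c_def f_def a_def M)
  have cM: "c * (p \<bullet> p) = (E - M) * (a + f * (E + M)) / M"
  proof -
    define N where "N = E + M"
    have "N > 0" using EM by (simp add: N_def)
    then show ?thesis unfolding c_def pp N_def[symmetric] using M0(1) by (simp add: field_simps)
  qed
  have cm2: "c * M * (E + M) = a + f * (E + M)"
  proof -
    define N where "N = E + M"
    have "N > 0" using EM by (simp add: N_def)
    then show ?thesis unfolding c_def N_def[symmetric] using M0(1) by (simp add: field_simps)
  qed
  have "(norm (boost s E p k))\<^sup>2 = k \<bullet> k + 2 * c * a + c\<^sup>2 * (p \<bullet> p)"
    by (simp only: b power2_norm_eq_inner)
      (simp add: inner_add_left inner_add_right inner_commute a_def algebra_simps power2_eq_square)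
  then have "s\<^sup>2 + (norm (boost s E p k))\<^sup>2 = f\<^sup>2 + 2 * c * a + c * (c * (p \<bullet> p))" using f2 by (simp add: power2_eq_square)
  also have "\<dots> = ((E * f + a) / M)\<^sup>2"
  proof -
    define x where "x = a + f * (E + M)"
    have c': "c = x / (M * (E + M))" using cm2 M0(1) EM by (simp add: x_def nonzero_eq_divide_eq mult.assoc)
    have "f\<^sup>2 + 2 * c * a + c * (c * (p \<bullet> p)) = f\<^sup>2 + 2 * (x / (M * (E + M))) * (x - f * (E + M)) + (x / (M * (E + M))) * ((E - M) * x / M)"
      using cM unfolding c'[symmetric] by (simp add: x_def)
    also have "\<dots> = ((x - f * M) / M)\<^sup>2"
    proof -
      define N where "N = E + M"
      have N: "N > 0" "E = N - M" using EM by (simp_all add: N_def)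
      have "f\<^sup>2 + 2 * (x / (M * N)) * (x - f * N) + (x / (M * N)) * ((N - M - M) * x / M) = ((x - f * M) / M)\<^sup>2"
        using M0(1) N(1) by (simp add: field_simps power2_eq_square)
      then show ?thesis unfolding N(2) by simp
    qed
    also have "x - f * M = E * f + a" by (simp add: x_def algebra_simps)
    finally show ?thesis .
  qed
  finally have "phi s (norm (boost s E p k)) = \<bar>(E * f + a) / M\<bar>" by (simp add: phi_def)
  moreover have "0 \<le> (E * f + a) / M"
  proof -
    have "\<bar>a\<bar> \<le> norm p * norm k" unfolding a_def by (rule Cauchy_Schwarz_ineq2)
    also have "\<dots> \<le> E * f" unfolding f_def using E phi_ge[OF norm_ge_zero[of k], of s] norm_ge_zero[of p] norm_ge_zero[of k] by (intro mult_mono) linarith+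
    finally show ?thesis using M0 by auto
  qed
  ultimately have "phi s (norm (boost s E p k)) = (E * f + a) / M" by (simp only: abs_of_nonneg)
  then show ?thesis by (simp only: f_def a_def)
qed

text \<open>d\<eta> / \<open>phi\<close> is the Lorentz-invariant measure of the mass shell. On each
  line parallel to p the boost fixes the transverse part and acts as the one-dimensional boost, with
  the transverse mass squared \<open>Sq \<eta>\<close> in the role of S.\<close>

lemma nn_integral_boost_invariant:
  fixes F :: "'a::euclidean_space \<Rightarrow> ennreal"
  assumes [measurable]: "F \<in> borel_measurable borel" and s: "0 < s" and E: "norm p < E"
  shows "(\<integral>\<^sup>+\<eta>. F \<eta> * ennreal (1 / phi s (norm \<eta>)) \<partial>lborel) = (\<integral>\<^sup>+k. F (boost s E p k) * ennreal (1 / phi s (norm k)) \<partial>lborel)"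
proof (cases "p = 0")
  case True
  then show ?thesis by (simp add: boost_def Let_def)
next
  case False
  define M where "M = sqrt (E\<^sup>2 - (norm p)\<^sup>2)"
  define P where "P = norm p"
  have P0: "0 < P" "P < E" "\<bar>P\<bar> < E" using False E by (auto simp: P_def)
  have p2: "P\<^sup>2 < E\<^sup>2" using P0 by (intro power_strict_mono) auto
  have M0: "0 < M" "M\<^sup>2 = E\<^sup>2 - P\<^sup>2" using p2 by (auto simp: M_def P_def)
  have EM: "E + M > 0" using P0 M0 by linarith
  define Sq where "Sq \<eta> = s\<^sup>2 + (norm (perp p \<eta>))\<^sup>2" for \<eta>
  have Sq0: "0 < Sq \<eta>" for \<eta> using s by (simp add: Sq_def add_pos_nonneg)
  have ph: "phi s (norm (perp p \<eta> + (X / P) *\<^sub>R p)) = sqrt (Sq \<eta> + X\<^sup>2)" for X \<eta>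
    using P0 norm_perp_add[of p \<eta> "X / P"] by (simp add: phi_def Sq_def P_def power_divide add.assoc)
  \<comment> \<open>In the coordinate y / |p| along p, the spatial boost formula is exactly the
    substitution of \<open>nn_integral_boost\<close> with q = |p|.\<close>
  have bst: "boost s E p (perp p \<eta> + (y / P) *\<^sub>R p) = perp p \<eta> + (((E * y + P * sqrt (Sq \<eta> + y\<^sup>2)) / M) / P) *\<^sub>R p" for \<eta> y
  proof -
    have pin: "p \<bullet> (perp p \<eta> + (y / P) *\<^sub>R p) = y * P"
      using perp_inner[of p \<eta>] P0 by (simp add: inner_add_right inner_commute P_def power2_norm_eq_inner[symmetric] power2_eq_square)
    have "y / P + (y * P / (M * (E + M)) + sqrt (Sq \<eta> + y\<^sup>2) / M) = ((E * y + P * sqrt (Sq \<eta> + y\<^sup>2)) / M) / P"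
    proof -
      define N where "N = E + M"
      have N: "N > 0" using EM by (simp add: N_def)
      have "y / P + y * P / (M * N) = y * (M * N + P\<^sup>2) / (P * (M * N))"
        using P0(1) M0(1) N by (simp add: field_simps power2_eq_square)
      also have "M * N + P\<^sup>2 = E * N" using M0(2) by (simp add: N_def algebra_simps power2_eq_square)
      also have "y * (E * N) / (P * (M * N)) = y * E / (P * M)" using N by simp
      finally have "y / P + (y * P / (M * (E + M)) + sqrt (Sq \<eta> + y\<^sup>2) / M) = y * E / (P * M) + sqrt (Sq \<eta> + y\<^sup>2) / M"
        by (simp only: N_def add.assoc[symmetric])
      also have "\<dots> = ((E * y + P * sqrt (Sq \<eta> + y\<^sup>2)) / M) / P" using P0(1) M0(1) by (simp add: field_simps)
      finally show ?thesis .
    qed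
    then show ?thesis
      unfolding boost_def Let_def pin ph M_def[symmetric] by (simp add: algebra_simps flip: scaleR_add_left)
  qed
  have resc: "(\<integral>\<^sup>+x. h x \<partial>lborel) = ennreal (1 / P) * (\<integral>\<^sup>+X. h (X / P) \<partial>lborel)" if "h \<in> borel_measurable borel" for h :: "real \<Rightarrow> ennreal"
    using nn_integral_real_affine[OF that, of "1 / P" 0] P0 by simp
  have "(\<integral>\<^sup>+\<eta>. F \<eta> * ennreal (1 / phi s (norm \<eta>)) \<partial>lborel) =
    (\<integral>\<^sup>+\<eta>. ennreal (slab p \<eta>) * (ennreal (1 / P) * (\<integral>\<^sup>+X. F (perp p \<eta> + (X / P) *\<^sub>R p) * ennreal (1 / sqrt (Sq \<eta> + X\<^sup>2)) \<partial>lborel)) \<partial>lborel)"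
    by (subst nn_integral_lines[OF _ False], measurable, subst resc) (auto simp: ph)
  also have "\<dots> = (\<integral>\<^sup>+\<eta>. ennreal (slab p \<eta>) * (ennreal (1 / P) * (\<integral>\<^sup>+y. F (boost s E p (perp p \<eta> + (y / P) *\<^sub>R p)) * ennreal (1 / sqrt (Sq \<eta> + y\<^sup>2)) \<partial>lborel)) \<partial>lborel)"
    by (subst nn_integral_boost[OF _ Sq0 P0(3) M_def[folded P_def]]) (auto simp: bst)
  also have "\<dots> = (\<integral>\<^sup>+k. F (boost s E p k) * ennreal (1 / phi s (norm k)) \<partial>lborel)"
    by (subst (2) nn_integral_lines[OF _ False], measurable, subst resc) (auto simp: ph)
  finally show ?thesis .
qed

section \<open>Radial and spherical integrals\<close>

lemma nn_integral_Gamma: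
  assumes a: "0 < a" and b: "0 < b"
  shows "(\<integral>\<^sup>+t. ennreal (t powr (a - 1) * exp (- b * t)) * indicator {0<..} t \<partial>lborel) = ennreal (Gamma a / b powr a)"
proof -
  have "ennreal (Gamma a) = (\<integral>\<^sup>+t. ennreal (indicator {0..} t * t powr (a - 1) / exp t) \<partial>lborel)"
    by (rule Gamma_conv_nn_integral_real[OF a])
  also have "\<dots> = ennreal b * (\<integral>\<^sup>+t. ennreal (indicator {0..} (b * t) * (b * t) powr (a - 1) / exp (b * t)) \<partial>lborel)"
    using b by (subst nn_integral_real_affine[where c=b and t=0]) auto
  also have "\<dots> = (\<integral>\<^sup>+t. ennreal (b powr a) * (ennreal (t powr (a - 1) * exp (- b * t)) * indicator {0<..} t) \<partial>lborel)"
  proof (subst nn_integral_cmult[symmetric], measurable, rule nn_integral_cong)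
    fix t :: real
    show "ennreal b * ennreal (indicator {0..} (b * t) * (b * t) powr (a - 1) / exp (b * t)) =
       ennreal (b powr a) * (ennreal (t powr (a - 1) * exp (- b * t)) * indicator {0<..} t)"
    proof (cases "0 < t")
      case True
      have "b * (b * t) powr (a - 1) = b powr a * t powr (a - 1)"
        using True b by (simp add: powr_mult powr_diff)
      then show ?thesis
        using True b by (simp add: ennreal_mult[symmetric] exp_minus field_simps)
    qed (use b in \<open>auto simp: indicator_def zero_le_mult_iff\<close>)
  qed
  also have "\<dots> = ennreal (b powr a) * (\<integral>\<^sup>+t. ennreal (t powr (a - 1) * exp (- b * t)) * indicator {0<..} t \<partial>lborel)"
    by (rule nn_integral_cmult) measurable
  finally have *: "ennreal (Gamma a) = ennreal (b powr a) * (\<integral>\<^sup>+t. ennreal (t powr (a - 1) * exp (- b * t)) * indicator {0<..} t \<partial>lborel)" .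
  have "ennreal (Gamma a / b powr a) = ennreal (1 / b powr a) * ennreal (Gamma a)"
    using b by (simp add: ennreal_mult'[symmetric])
  also have "\<dots> = (ennreal (1 / b powr a) * ennreal (b powr a)) * (\<integral>\<^sup>+t. ennreal (t powr (a - 1) * exp (- b * t)) * indicator {0<..} t \<partial>lborel)"
    unfolding * by (simp add: mult.assoc)
  also have "ennreal (1 / b powr a) * ennreal (b powr a) = 1"
    using b by (simp add: ennreal_mult[symmetric])
  finally show ?thesis by simp
qed

text \<open>Polar coordinates without a surface measure: the unit sphere is replaced by the whole space with weight
  \<open>exp (- |v|)\<close>, whose radial part has total mass \<open>(d - 1)!\<close>.\<close>

lemma nn_integral_radial:
  fixes \<Phi> :: "'a::euclidean_space \<Rightarrow> ennreal"
  assumes [measurable]: "\<Phi> \<in> borel_measurable borel"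
  shows "ennreal (fact (DIM('a) - 1)) * (\<integral>\<^sup>+k. \<Phi> k \<partial>lborel) =
    (\<integral>\<^sup>+v. ennreal (exp (- norm v) * norm v ^ DIM('a)) * (\<integral>\<^sup>+l. ennreal (l ^ (DIM('a) - 1)) * \<Phi> (l *\<^sub>R v) * indicator {0<..} l \<partial>lborel) \<partial>lborel)"
proof -
  let ?d = "DIM('a)"
  define g where "g v = exp (- norm v) * norm v ^ ?d" for v :: 'a
  have [measurable]: "g \<in> borel_measurable borel" unfolding g_def by measurable
  have d: "0 < ?d" by simp
  \<comment> \<open>After l \<mapsto> 1 / l the argument of \<Phi> is v / l, so for each fixed l the
    substitution v = l z is a dilation of the whole space and leaves \<Phi>(z). The remaining
    integral over l only sees the weight.\<close>
  have inv: "(\<integral>\<^sup>+l. ennreal (l ^ (?d - 1)) * \<Phi> (l *\<^sub>R v) * indicator {0<..} l \<partial>lborel) =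
     (\<integral>\<^sup>+l. ennreal (1 / l ^ (?d + 1)) * \<Phi> ((1 / l) *\<^sub>R v) * indicator {0<..} l \<partial>lborel)" for v
  proof -
    have "ennreal ((1 / l) ^ (?d - 1)) * \<Phi> ((1 / l) *\<^sub>R v) * ennreal (1 / l\<^sup>2) * indicator {0<..} l = ennreal (1 / l ^ (?d + 1)) * \<Phi> ((1 / l) *\<^sub>R v) * indicator {0<..} l" for l
    proof (cases "0 < l")
      case True
      have "(1 / l) ^ (?d - 1) * (1 / l\<^sup>2) = 1 / l ^ (?d - 1 + 2)"
        by (simp only: power_one_over power_add times_divide_times_eq mult_1_left)
      also have "?d - 1 + 2 = ?d + 1" using d by linarith
      finally have "ennreal (1 / l ^ (?d + 1)) = ennreal ((1 / l) ^ (?d - 1)) * ennreal (1 / l\<^sup>2)"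
        using True by (subst ennreal_mult[symmetric]) auto
      then show ?thesis by (simp add: mult_ac)
    qed auto
    then show ?thesis by (subst nn_integral_inversion) auto
  qed
  have one: "(\<integral>\<^sup>+l. ennreal (g (l *\<^sub>R z) / l) * indicator {0<..} l \<partial>lborel) = ennreal (fact (?d - 1))" if z: "z \<noteq> 0" for z
  proof -
    define V where "V = norm z"
    have V: "V > 0" using z by (simp add: V_def)
    have "(\<integral>\<^sup>+l. ennreal (g (l *\<^sub>R z) / l) * indicator {0<..} l \<partial>lborel) =
       ennreal (1 / V) * (\<integral>\<^sup>+l. ennreal (g (((1 / V) * l) *\<^sub>R z) / ((1 / V) * l)) * indicator {0<..} ((1 / V) * l) \<partial>lborel)"
      using V by (subst nn_integral_real_affine[where c="1/V" and t=0]) auto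
    also have "\<dots> = (\<integral>\<^sup>+l. ennreal (l powr (real ?d - 1) * exp (- 1 * l)) * indicator {0<..} l \<partial>lborel)"
    proof (subst nn_integral_cmult[symmetric], measurable, rule nn_integral_cong)
      fix l :: real
      show "ennreal (1 / V) * (ennreal (g (((1 / V) * l) *\<^sub>R z) / ((1 / V) * l)) * indicator {0<..} ((1 / V) * l)) =
        ennreal (l powr (real ?d - 1) * exp (- 1 * l)) * indicator {0<..} l"
      proof (cases "0 < l")
        case True
        have "l powr (real ?d - 1) = l ^ ?d / l" using True d by (simp add: powr_diff powr_realpow)
        moreover have "norm (((1 / V) * l) *\<^sub>R z) = l" using True V by (simp add: V_def)
        ultimately have "(1 / V) * (g (((1 / V) * l) *\<^sub>R z) / ((1 / V) * l)) = l powr (real ?d - 1) * exp (- 1 * l)"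
          using V True by (simp only: g_def) (simp add: field_simps)
        then show ?thesis using True V by (simp add: ennreal_mult'[symmetric])
      qed (use V in \<open>auto simp: indicator_def zero_less_divide_iff\<close>)
    qed
    also have "\<dots> = ennreal (Gamma (real ?d))" using d by (subst nn_integral_Gamma) auto
    also have "Gamma (real ?d) = fact (?d - 1)" using d by (cases "?d") (auto simp: Gamma_fact[symmetric] add.commute)
    finally show ?thesis .
  qed
  have "(\<integral>\<^sup>+v. ennreal (g v) * (\<integral>\<^sup>+l. ennreal (l ^ (?d - 1)) * \<Phi> (l *\<^sub>R v) * indicator {0<..} l \<partial>lborel) \<partial>lborel)
    = (\<integral>\<^sup>+v. (\<integral>\<^sup>+l. ennreal (g v) * (ennreal (1 / l ^ (?d + 1)) * \<Phi> ((1 / l) *\<^sub>R v) * indicator {0<..} l) \<partial>lborel) \<partial>lborel)"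
    by (subst nn_integral_cmult, measurable) (simp only: inv)
  also have "\<dots> = (\<integral>\<^sup>+l. (\<integral>\<^sup>+v. ennreal (g v) * (ennreal (1 / l ^ (?d + 1)) * \<Phi> ((1 / l) *\<^sub>R v) * indicator {0<..} l) \<partial>lborel) \<partial>lborel)"
    by (rule lborel_pair.Fubini') measurable
  also have "\<dots> = (\<integral>\<^sup>+l. (\<integral>\<^sup>+z. \<Phi> z * (ennreal (g (l *\<^sub>R z) / l) * indicator {0<..} l) \<partial>lborel) \<partial>lborel)"
  proof (rule nn_integral_cong)
    fix l :: real
    show "(\<integral>\<^sup>+v. ennreal (g v) * (ennreal (1 / l ^ (?d + 1)) * \<Phi> ((1 / l) *\<^sub>R v) * indicator {0<..} l) \<partial>lborel) =
      (\<integral>\<^sup>+z. \<Phi> z * (ennreal (g (l *\<^sub>R z) / l) * indicator {0<..} l) \<partial>lborel)"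
    proof (cases "0 < l")
      case True
      have "(\<integral>\<^sup>+v. ennreal (g v) * (ennreal (1 / l ^ (?d + 1)) * \<Phi> ((1 / l) *\<^sub>R v) * indicator {0<..} l) \<partial>lborel)
        = ennreal (l ^ ?d) * (\<integral>\<^sup>+z. ennreal (g (l *\<^sub>R z)) * (ennreal (1 / l ^ (?d + 1)) * \<Phi> z) \<partial>lborel)"
        using True by (subst nn_integral_lborel_affine[where c=l and t=0]) auto
      also have "\<dots> = (\<integral>\<^sup>+z. \<Phi> z * (ennreal (g (l *\<^sub>R z) / l) * indicator {0<..} l) \<partial>lborel)"
      proof (subst nn_integral_cmult[symmetric], measurable, rule nn_integral_cong)
        fix z :: 'a
        have "l ^ ?d * (g (l *\<^sub>R z) * (1 / l ^ (?d + 1))) = g (l *\<^sub>R z) / l" using True by simp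
        moreover have "0 \<le> g (l *\<^sub>R z)" by (simp add: g_def)
        ultimately have "ennreal (l ^ ?d) * (ennreal (g (l *\<^sub>R z)) * ennreal (1 / l ^ (?d + 1))) = ennreal (g (l *\<^sub>R z) / l)"
          using True by (simp add: ennreal_mult[symmetric])
        then show "ennreal (l ^ ?d) * (ennreal (g (l *\<^sub>R z)) * (ennreal (1 / l ^ (?d + 1)) * \<Phi> z)) = \<Phi> z * (ennreal (g (l *\<^sub>R z) / l) * indicator {0<..} l)"
          using True by (simp add: mult_ac)
      qed
      finally show ?thesis .
    qed auto
  qed
  also have "\<dots> = (\<integral>\<^sup>+z. (\<integral>\<^sup>+l. \<Phi> z * (ennreal (g (l *\<^sub>R z) / l) * indicator {0<..} l) \<partial>lborel) \<partial>lborel)"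
    by (rule lborel_pair.Fubini') measurable
  also have "\<dots> = (\<integral>\<^sup>+z. \<Phi> z * ennreal (fact (?d - 1)) \<partial>lborel)"
    by (rule nn_integral_cong_AE, use AE_lborel_singleton[of 0] in eventually_elim) (subst nn_integral_cmult, simp_all add: one)
  also have "\<dots> = ennreal (fact (?d - 1)) * (\<integral>\<^sup>+z. \<Phi> z \<partial>lborel)"
    by (subst nn_integral_multc) (auto simp: mult.commute)
  finally show ?thesis by (simp add: g_def)
qed

section \<open>Spherical power integrals through Gaussians\<close>

lemma nn_integral_exp_norm2:
  assumes v: "0 < v"
  shows "(\<integral>\<^sup>+z. ennreal (exp (- (norm (z::'a::euclidean_space))\<^sup>2 / (2 * v))) \<partial>lborel) = ennreal (sqrt (2 * pi * v) ^ DIM('a))"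
proof -
  have e: "exp (- (norm (sqrt v *\<^sub>R z))\<^sup>2 / (2 * v)) = sqrt (2 * pi) ^ DIM('a) * gaussian z" for z :: 'a
    using v by (simp add: gaussian_eq power_mult_distrib)
  have "(\<integral>\<^sup>+z. ennreal (exp (- (norm (z::'a))\<^sup>2 / (2 * v))) \<partial>lborel) = ennreal (sqrt v ^ DIM('a)) * (\<integral>\<^sup>+z. ennreal (exp (- (norm (sqrt v *\<^sub>R (z::'a)))\<^sup>2 / (2 * v))) \<partial>lborel)"
    using v by (subst nn_integral_lborel_affine[where c="sqrt v" and t=0]) auto
  also have "\<dots> = ennreal (sqrt v ^ DIM('a)) * (\<integral>\<^sup>+z. ennreal (sqrt (2 * pi) ^ DIM('a)) * ennreal (gaussian (z::'a)) \<partial>lborel)"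
    unfolding e by (simp add: ennreal_mult' )
  also have "\<dots> = ennreal (sqrt v ^ DIM('a) * sqrt (2 * pi) ^ DIM('a))"
    using v by (subst nn_integral_cmult) (auto simp: nn_integral_gaussian ennreal_mult)
  also have "sqrt v ^ DIM('a) * sqrt (2 * pi) ^ DIM('a) = sqrt (2 * pi * v) ^ DIM('a)"
    by (simp only: power_mult_distrib[symmetric] real_sqrt_mult[symmetric] mult_ac)
  finally show ?thesis .
qed

text \<open>The Gaussian factors along and across e. Dividing the integral over the whole space by
  the one-dimensional integral along e leaves the hyperplane integral.\<close>

lemma nn_integral_slab_gaussian:
  fixes e :: "'a::euclidean_space"
  assumes e: "norm e = 1" and v: "0 < v"
  shows "(\<integral>\<^sup>+\<eta>. ennreal (slab e \<eta>) * ennreal (exp (- (norm (perp e \<eta>))\<^sup>2 / (2 * v))) \<partial>lborel) = ennreal (sqrt (2 * pi * v) ^ (DIM('a) - 1))"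
proof -
  let ?A = "\<integral>\<^sup>+\<eta>. ennreal (slab e \<eta>) * ennreal (exp (- (norm (perp e \<eta>))\<^sup>2 / (2 * v))) \<partial>lborel"
  define c where "c = sqrt (2 * pi * v)"
  have c: "0 < c" using v by (simp add: c_def)
  have e0: "e \<noteq> 0" using e by auto
  have ex: "exp (- (norm (perp e \<eta> + x *\<^sub>R e))\<^sup>2 / (2 * v)) = exp (- (norm (perp e \<eta>))\<^sup>2 / (2 * v)) * exp (- (norm x)\<^sup>2 / (2 * v))" for \<eta> and x :: real
    unfolding norm_perp_add e using v by (simp add: exp_add[symmetric] add_divide_distrib diff_divide_distrib)
  have "ennreal (c ^ DIM('a)) = (\<integral>\<^sup>+z. ennreal (exp (- (norm (z::'a))\<^sup>2 / (2 * v))) \<partial>lborel)"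
    using nn_integral_exp_norm2[OF v, where ?'a='a] by (simp add: c_def)
  also have "\<dots> = (\<integral>\<^sup>+\<eta>. ennreal (slab e \<eta>) * (\<integral>\<^sup>+x. ennreal (exp (- (norm (perp e \<eta> + x *\<^sub>R e))\<^sup>2 / (2 * v))) \<partial>lborel) \<partial>lborel)"
    by (rule nn_integral_lines[OF _ e0]) measurable
  also have "\<dots> = (\<integral>\<^sup>+\<eta>. ennreal (slab e \<eta>) * (ennreal (exp (- (norm (perp e \<eta>))\<^sup>2 / (2 * v))) * ennreal c) \<partial>lborel)"
    unfolding ex using nn_integral_exp_norm2[OF v, where ?'a=real]
    by (simp add: ennreal_mult nn_integral_cmult c_def)
  also have "\<dots> = ?A * ennreal c" by (simp add: mult.assoc[symmetric] nn_integral_multc)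
  finally have *: "?A * ennreal c = ennreal (c ^ DIM('a))" by simp
  have "?A = ?A * ennreal c * ennreal (1 / c)" using c by (simp add: mult.assoc ennreal_mult[symmetric])
  also have "\<dots> = ennreal (c ^ DIM('a) * (1 / c))" unfolding * using c by (intro ennreal_mult[symmetric]) auto
  also have "c ^ DIM('a) * (1 / c) = c ^ (DIM('a) - 1)" using c by (cases "DIM('a)") auto
  finally show ?thesis by (simp add: c_def)
qed

text \<open>The light-cone coordinate v = sqrt(S + x^2) + x turns dx / sqrt(S + x^2) into dv / v,
  while sqrt(S + x^2) = (v + S / v) / 2. The point is that S then occurs only in exp(- S / (2 v)), a
  Gaussian in the transverse variable.\<close>

lemma nn_integral_line_substitution:
  fixes S b :: real
  assumes S: "0 \<le> S"
  shows "(\<integral>\<^sup>+x. ennreal (exp (- sqrt (S + x\<^sup>2)) / sqrt (S + x\<^sup>2) * (sqrt (S + x\<^sup>2) + x) powr b) \<partial>lborel) =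
    (\<integral>\<^sup>+v. ennreal (v powr (b - 1) * exp (- v / 2) * exp (- S / (2 * v))) * indicator {0<..} v \<partial>lborel)"
proof -
  define f where "f x = ennreal (exp (- sqrt (S + x\<^sup>2)) / sqrt (S + x\<^sup>2) * (sqrt (S + x\<^sup>2) + x) powr b)" for x
  have [measurable]: "f \<in> borel_measurable borel" unfolding f_def by measurable
  define g where "g v = (v - S / v) / 2" for v :: real
  have sq: "sqrt (S + (g v)\<^sup>2) = (v + S / v) / 2" if v: "0 < v" for v
  proof -
    have "S + (g v)\<^sup>2 = ((v + S / v) / 2)\<^sup>2"
      using v by (simp add: g_def power2_eq_square field_simps)
    then show ?thesis using v S by simp
  qed
  have "f y = f y * indicator (g ` {0<..}) y" for y
  proof (cases "0 < sqrt (S + y\<^sup>2) + y")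
    case True
    define v where "v = sqrt (S + y\<^sup>2) + y"
    have "v\<^sup>2 = S + y\<^sup>2 + 2 * y * sqrt (S + y\<^sup>2) + y\<^sup>2"
      using S by (simp add: v_def power2_sum)
    also have "\<dots> = S + 2 * y * v" by (simp add: v_def algebra_simps power2_eq_square)
    finally have "g v = y" using True unfolding v_def[symmetric] by (simp add: g_def field_simps power2_eq_square)
    then have "y \<in> g ` {0<..}" using True by (intro image_eqI[of _ _ v]) (auto simp: v_def)
    then show ?thesis by simp
  next
    case False
    moreover have "\<bar>y\<bar> \<le> sqrt (S + y\<^sup>2)" using S by (intro real_le_rsqrt) simp
    \<comment> \<open>This happens only for S = 0 and y \<le> 0; there the integrand is 0 because 0
      powr b = 0.\<close>
    ultimately have "sqrt (S + y\<^sup>2) + y = 0" by linarith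
    then show ?thesis by (simp add: f_def)
  qed
  then have "(\<integral>\<^sup>+x. f x \<partial>lborel) = (\<integral>\<^sup>+x. f x * indicator (g ` {0<..}) x \<partial>lborel)" by simp
  also have "\<dots> = (\<integral>\<^sup>+v. f (g v) * ennreal ((1 + S / v\<^sup>2) / 2) * indicator {0<..} v \<partial>lborel)"
  proof (rule nn_integral_substitution_Ioi)
    show "(g has_real_derivative (1 + S / x\<^sup>2) / 2) (at x)" if "0 < x" for x
      unfolding g_def[abs_def] using that by (auto intro!: derivative_eq_intros simp: field_simps power2_eq_square)
    show "g \<in> borel_measurable borel" unfolding g_def by measurable
  qed (use S in \<open>auto intro!: continuous_intros add_nonneg_nonneg\<close>)
  also have "\<dots> = (\<integral>\<^sup>+v. ennreal (v powr (b - 1) * exp (- v / 2) * exp (- S / (2 * v))) * indicator {0<..} v \<partial>lborel)"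
  proof (rule nn_integral_cong)
    fix v :: real
    show "f (g v) * ennreal ((1 + S / v\<^sup>2) / 2) * indicator {0<..} v = ennreal (v powr (b - 1) * exp (- v / 2) * exp (- S / (2 * v))) * indicator {0<..} v"
    proof (cases "0 < v")
      case True
      define w where "w = (v + S / v) / 2"
      have w: "0 < w" using True S by (simp add: w_def add_pos_nonneg)
      have a: "sqrt (S + (g v)\<^sup>2) + g v = v" using sq[OF True] by (simp add: g_def field_simps)
      have e: "exp (- w) = exp (- v / 2) * exp (- S / (2 * v))"
        unfolding w_def exp_add[symmetric] by (simp add: field_simps)
      have "(1 + S / v\<^sup>2) / 2 = w / v" using True by (simp add: w_def field_simps power2_eq_square)
      then have "(exp (- w) / w * v powr b) * ((1 + S / v\<^sup>2) / 2) = v powr (b - 1) * exp (- v / 2) * exp (- S / (2 * v))"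
        using True w by (simp add: e powr_diff)
      moreover have "f (g v) = ennreal (exp (- w) / w * v powr b)"
        unfolding f_def a by (simp only: sq[OF True] w_def)
      moreover have "0 \<le> (1 + S / v\<^sup>2) / 2" using S by simp
      ultimately have "f (g v) * ennreal ((1 + S / v\<^sup>2) / 2) = ennreal (v powr (b - 1) * exp (- v / 2) * exp (- S / (2 * v)))"
        using w by (simp add: ennreal_mult[symmetric] del: times_divide_eq_left times_divide_eq_right)
      then show ?thesis by simp
    qed auto
  qed
  finally show ?thesis by (simp add: f_def)
qed

text \<open>On lines parallel to e, the light-cone coordinate makes the transverse integral a
  Gaussian of variance v, which contributes v^((d - 1) / 2) and leaves a Gamma integral in v. The
  hypothesis on b says precisely that its exponent b + (d - 1) / 2 is positive.\<close>

lemma nn_integral_cone: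
  fixes e :: "'a::euclidean_space"
  assumes e: "norm e = 1" and b: "- (real DIM('a) - 1) / 2 < b"
  shows "(\<integral>\<^sup>+z. ennreal (exp (- norm z) / norm z * (norm z + e \<bullet> z) powr b) \<partial>lborel) =
    ennreal ((2 * pi) powr ((real DIM('a) - 1) / 2) * (Gamma (b + (real DIM('a) - 1) / 2) * 2 powr (b + (real DIM('a) - 1) / 2)))"
proof -
  let ?d = "DIM('a)"
  define \<nu> where "\<nu> = (real ?d - 1) / 2"
  have \<nu>: "0 < b + \<nu>" using b by (simp add: \<nu>_def field_simps)
  have e0: "e \<noteq> 0" using e by auto
  define S where "S \<eta> = (norm (perp e \<eta>))\<^sup>2" for \<eta>
  have S0: "0 \<le> S \<eta>" for \<eta> by (simp add: S_def)
  have [measurable]: "S \<in> borel_measurable borel" unfolding S_def by measurable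
  have n: "norm (perp e \<eta> + x *\<^sub>R e) = sqrt (S \<eta> + x\<^sup>2)" for \<eta> x
    using norm_perp_add[of e \<eta> x] e by (simp add: S_def real_sqrt_unique)
  have i: "e \<bullet> (perp e \<eta> + x *\<^sub>R e) = x" for \<eta> x
    using perp_inner[of e \<eta>] e by (simp add: inner_add_right inner_commute power2_norm_eq_inner[symmetric])
  have "(\<integral>\<^sup>+z. ennreal (exp (- norm z) / norm z * (norm z + e \<bullet> z) powr b) \<partial>lborel) =
     (\<integral>\<^sup>+\<eta>. ennreal (slab e \<eta>) * (\<integral>\<^sup>+x. ennreal (exp (- sqrt (S \<eta> + x\<^sup>2)) / sqrt (S \<eta> + x\<^sup>2) * (sqrt (S \<eta> + x\<^sup>2) + x) powr b) \<partial>lborel) \<partial>lborel)"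
    by (subst nn_integral_lines[OF _ e0]) (simp_all only: n i, measurable)
  also have "\<dots> = (\<integral>\<^sup>+\<eta>. (\<integral>\<^sup>+v. ennreal (slab e \<eta>) * (ennreal (v powr (b - 1) * exp (- v / 2) * exp (- S \<eta> / (2 * v))) * indicator {0<..} v) \<partial>lborel) \<partial>lborel)"
    by (simp only: nn_integral_line_substitution[OF S0]) (simp add: nn_integral_cmult)
  also have "\<dots> = (\<integral>\<^sup>+v. (\<integral>\<^sup>+\<eta>. ennreal (slab e \<eta>) * (ennreal (v powr (b - 1) * exp (- v / 2) * exp (- S \<eta> / (2 * v))) * indicator {0<..} v) \<partial>lborel) \<partial>lborel)"
    by (rule lborel_pair.Fubini') measurable
  also have "\<dots> = (\<integral>\<^sup>+v. ennreal ((2 * pi) powr \<nu>) * (ennreal (v powr (b + \<nu> - 1) * exp (- (1/2) * v)) * indicator {0<..} v) \<partial>lborel)"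
  proof (rule nn_integral_cong)
    fix v :: real
    show "(\<integral>\<^sup>+\<eta>. ennreal (slab e \<eta>) * (ennreal (v powr (b - 1) * exp (- v / 2) * exp (- S \<eta> / (2 * v))) * indicator {0<..} v) \<partial>lborel) =
      ennreal ((2 * pi) powr \<nu>) * (ennreal (v powr (b + \<nu> - 1) * exp (- (1/2) * v)) * indicator {0<..} v)"
    proof (cases "0 < v")
      case True
      have "(\<integral>\<^sup>+\<eta>. ennreal (slab e \<eta>) * (ennreal (v powr (b - 1) * exp (- v / 2) * exp (- S \<eta> / (2 * v))) * indicator {0<..} v) \<partial>lborel) =
        (\<integral>\<^sup>+\<eta>. ennreal (v powr (b - 1) * exp (- v / 2)) * (ennreal (slab e \<eta>) * ennreal (exp (- (norm (perp e \<eta>))\<^sup>2 / (2 * v)))) \<partial>lborel)"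
        using True by (intro nn_integral_cong) (simp add: S_def ennreal_mult mult_ac)
      also have "\<dots> = ennreal (v powr (b - 1) * exp (- v / 2)) * ennreal (sqrt (2 * pi * v) ^ (?d - 1))"
        by (subst nn_integral_cmult, measurable) (simp only: nn_integral_slab_gaussian[OF e True])
      also have "\<dots> = ennreal (v powr (b - 1) * exp (- v / 2) * sqrt (2 * pi * v) ^ (?d - 1))"
        using True by (subst ennreal_mult) auto
      also have "sqrt (2 * pi * v) ^ (?d - 1) = (2 * pi) powr \<nu> * v powr \<nu>"
      proof -
        have "sqrt (2 * pi * v) ^ (?d - 1) = sqrt (2 * pi * v) powr (real (?d - 1))"
          by (rule powr_realpow[symmetric]) (use True in simp)
        also have "\<dots> = (2 * pi * v) powr \<nu>"
          using True by (simp add: powr_half_sqrt[symmetric] powr_powr \<nu>_def of_nat_diff Suc_leI)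
        finally show ?thesis using True by (simp add: powr_mult)
      qed
      also have "v powr (b - 1) * exp (- v / 2) * ((2 * pi) powr \<nu> * v powr \<nu>) = (2 * pi) powr \<nu> * (v powr (b + \<nu> - 1) * exp (- (1/2) * v))"
        using True by (simp add: powr_diff powr_add)
      finally show ?thesis using True by (simp add: ennreal_mult)
    qed auto
  qed
  also have "\<dots> = ennreal ((2 * pi) powr \<nu>) * ennreal (Gamma (b + \<nu>) / (1/2) powr (b + \<nu>))"
    by (subst nn_integral_cmult, measurable, subst nn_integral_Gamma[OF \<nu>]) auto
  also have "\<dots> = ennreal ((2 * pi) powr \<nu> * (Gamma (b + \<nu>) * 2 powr (b + \<nu>)))"
    using \<nu> by (subst ennreal_mult[symmetric]) (auto simp: powr_divide Gamma_real_pos)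
  finally show ?thesis by (simp add: \<nu>_def)
qed

text \<open>The quotient of Gamma values arises by evaluating the cone integral twice:
  \<open>nn_integral_cone\<close> gives the numerator, and in polar coordinates homogeneity gives
  Gamma(d - 1 + b) times the spherical integral.\<close>

lemma nn_integral_sphere_power:
  fixes e :: "'a::euclidean_space"
  assumes e: "norm e = 1" and b: "- (real DIM('a) - 1) / 2 < b" and d: "2 \<le> DIM('a)"
  shows "(\<integral>\<^sup>+v. ennreal (exp (- norm v)) * ennreal ((1 + e \<bullet> (v /\<^sub>R norm v)) powr b) \<partial>lborel) =
    ennreal (fact (DIM('a) - 1)) * ennreal ((2 * pi) powr ((real DIM('a) - 1) / 2) *
      (Gamma (b + (real DIM('a) - 1) / 2) * 2 powr (b + (real DIM('a) - 1) / 2)) / Gamma (real DIM('a) - 1 + b))"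
proof -
  let ?d = "DIM('a)"
  define G where "G = Gamma (real ?d - 1 + b)"
  have db: "0 < real ?d - 1 + b" using b d by (simp add: field_simps)
  have G: "0 < G" using db by (simp add: G_def Gamma_real_pos)
  define A where "A = (2 * pi) powr ((real ?d - 1) / 2) * (Gamma (b + (real ?d - 1) / 2) * 2 powr (b + (real ?d - 1) / 2))"
  have A: "0 \<le> A" unfolding A_def using b by (intro mult_nonneg_nonneg) (auto intro!: Gamma_real_nonneg simp: field_simps)
  have "ennreal (fact (?d - 1)) * ennreal A = ennreal (fact (?d - 1)) * (\<integral>\<^sup>+z. ennreal (exp (- norm z) / norm z * (norm z + e \<bullet> z) powr b) \<partial>lborel)"
    by (simp only: nn_integral_cone[OF e b] A_def)
  also have "\<dots> = (\<integral>\<^sup>+v. ennreal (exp (- norm v) * norm v ^ ?d) *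
     (\<integral>\<^sup>+l. ennreal (l ^ (?d - 1)) * ennreal (exp (- norm (l *\<^sub>R v)) / norm (l *\<^sub>R v) * (norm (l *\<^sub>R v) + e \<bullet> (l *\<^sub>R v)) powr b) * indicator {0<..} l \<partial>lborel) \<partial>lborel)"
    by (rule nn_integral_radial) measurable
  also have "\<dots> = (\<integral>\<^sup>+v. ennreal G * (ennreal (exp (- norm v)) * ennreal ((1 + e \<bullet> (v /\<^sub>R norm v)) powr b)) \<partial>lborel)"
  proof (rule nn_integral_cong_AE, use AE_lborel_singleton[of 0] in eventually_elim)
    fix v :: 'a assume v: "v \<noteq> 0"
    define V where "V = norm v"
    have V: "0 < V" using v by (simp add: V_def)
    define c where "c = (1 + e \<bullet> (v /\<^sub>R norm v)) powr b"
    have c1: "0 \<le> 1 + e \<bullet> (v /\<^sub>R norm v)"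
    proof -
      have "\<bar>e \<bullet> (v /\<^sub>R norm v)\<bar> \<le> norm e * norm (v /\<^sub>R norm v)" by (rule Cauchy_Schwarz_ineq2)
      also have "\<dots> = 1" using e v by simp
      finally show ?thesis by linarith
    qed
    have "(\<integral>\<^sup>+l. ennreal (l ^ (?d - 1)) * ennreal (exp (- norm (l *\<^sub>R v)) / norm (l *\<^sub>R v) * (norm (l *\<^sub>R v) + e \<bullet> (l *\<^sub>R v)) powr b) * indicator {0<..} l \<partial>lborel)
      = (\<integral>\<^sup>+l. ennreal (V powr (b - 1) * c) * (ennreal (l powr (real ?d - 1 + b - 1) * exp (- V * l)) * indicator {0<..} l) \<partial>lborel)"
    proof (rule nn_integral_cong)
      fix l :: real
      show "ennreal (l ^ (?d - 1)) * ennreal (exp (- norm (l *\<^sub>R v)) / norm (l *\<^sub>R v) * (norm (l *\<^sub>R v) + e \<bullet> (l *\<^sub>R v)) powr b) * indicator {0<..} l =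
        ennreal (V powr (b - 1) * c) * (ennreal (l powr (real ?d - 1 + b - 1) * exp (- V * l)) * indicator {0<..} l)"
      proof (cases "0 < l")
        case True
        have "norm (l *\<^sub>R v) + e \<bullet> (l *\<^sub>R v) = (l * V) * (1 + e \<bullet> (v /\<^sub>R norm v))"
          using True V by (simp add: V_def field_simps)
        then have 1: "(norm (l *\<^sub>R v) + e \<bullet> (l *\<^sub>R v)) powr b = l powr b * V powr b * c"
          using True V c1 by (simp add: powr_mult c_def)
        have "l ^ (?d - 1) = l powr (real ?d - 1)" using True d by (simp add: powr_realpow[symmetric] of_nat_diff)
        then have "l ^ (?d - 1) * (exp (- norm (l *\<^sub>R v)) / norm (l *\<^sub>R v) * (norm (l *\<^sub>R v) + e \<bullet> (l *\<^sub>R v)) powr b) =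
          (V powr (b - 1) * c) * (l powr (real ?d - 1 + b - 1) * exp (- V * l))"
          unfolding 1 using True V by (simp add: V_def[symmetric] powr_diff powr_add mult_ac power2_eq_square)
        moreover have "0 \<le> c" by (simp add: c_def)
        ultimately have "ennreal (l ^ (?d - 1)) * ennreal (exp (- norm (l *\<^sub>R v)) / norm (l *\<^sub>R v) * (norm (l *\<^sub>R v) + e \<bullet> (l *\<^sub>R v)) powr b) =
          ennreal (V powr (b - 1) * c) * ennreal (l powr (real ?d - 1 + b - 1) * exp (- V * l))"
          using True by (simp only: ennreal_mult'[symmetric] zero_le_power less_imp_le mult_nonneg_nonneg powr_ge_zero)
        then show ?thesis using True by (simp add: mult.assoc)
      qed auto
    qed
    also have "\<dots> = ennreal (V powr (b - 1) * c) * ennreal (G / V powr (real ?d - 1 + b))"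
      unfolding G_def by (subst nn_integral_cmult, measurable, subst nn_integral_Gamma[OF db V]) auto
    also have "\<dots> = ennreal ((V powr (b - 1) * c) * (G / V powr (real ?d - 1 + b)))"
      using G by (subst ennreal_mult) (auto simp: c_def)
    finally have in1: "(\<integral>\<^sup>+l. ennreal (l ^ (?d - 1)) * ennreal (exp (- norm (l *\<^sub>R v)) / norm (l *\<^sub>R v) * (norm (l *\<^sub>R v) + e \<bullet> (l *\<^sub>R v)) powr b) * indicator {0<..} l \<partial>lborel) =
      ennreal ((V powr (b - 1) * c) * (G / V powr (real ?d - 1 + b)))" .
    have "V ^ ?d = V powr (real ?d)" using V by (simp add: powr_realpow)
    then have "exp (- norm v) * norm v ^ ?d * ((V powr (b - 1) * c) * (G / V powr (real ?d - 1 + b))) = G * (exp (- norm v) * c)"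
      using V by (simp add: V_def[symmetric] powr_diff powr_add field_simps)
    then show "ennreal (exp (- norm v) * norm v ^ ?d) * (\<integral>\<^sup>+l. ennreal (l ^ (?d - 1)) * ennreal (exp (- norm (l *\<^sub>R v)) / norm (l *\<^sub>R v) * (norm (l *\<^sub>R v) + e \<bullet> (l *\<^sub>R v)) powr b) * indicator {0<..} l \<partial>lborel)
       = ennreal G * (ennreal (exp (- norm v)) * ennreal ((1 + e \<bullet> (v /\<^sub>R norm v)) powr b))"
      unfolding in1 c_def[symmetric] using G by (simp add: ennreal_mult'[symmetric] c_def)
  qed
  also have "\<dots> = ennreal G * (\<integral>\<^sup>+v. ennreal (exp (- norm v)) * ennreal ((1 + e \<bullet> (v /\<^sub>R norm v)) powr b) \<partial>lborel)"
    by (rule nn_integral_cmult) measurable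
  finally have *: "ennreal (fact (?d - 1)) * ennreal A = ennreal G * (\<integral>\<^sup>+v. ennreal (exp (- norm v)) * ennreal ((1 + e \<bullet> (v /\<^sub>R norm v)) powr b) \<partial>lborel)" .
  have "ennreal (fact (?d - 1)) * ennreal (A / G) = ennreal (1 / G) * (ennreal (fact (?d - 1)) * ennreal A)"
    using A G by (simp add: ennreal_mult[symmetric])
  also have "\<dots> = (ennreal (1 / G) * ennreal G) * (\<integral>\<^sup>+v. ennreal (exp (- norm v)) * ennreal ((1 + e \<bullet> (v /\<^sub>R norm v)) powr b) \<partial>lborel)"
    unfolding * by (simp add: mult.assoc)
  also have "ennreal (1 / G) * ennreal G = 1" using G by (simp add: ennreal_mult[symmetric])
  finally show ?thesis by (simp add: A_def G_def)
qed

section \<open>Fibres of the difference map on the mass shell\<close>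

text \<open>Minus the Lorentz square of the difference of the points above \<eta>1 and \<eta>2
  (\<open>mgap_eq\<close>), and twice the numerator base of \<open>KG_kernel\<close>. It links the
  box symbol to the kernel.\<close>

definition mgap :: "real \<Rightarrow> 'a::euclidean_space \<Rightarrow> 'a \<Rightarrow> real" where
  "mgap s \<eta>1 \<eta>2 = 2 * (phi s (norm \<eta>1) * phi s (norm \<eta>2) - \<eta>1 \<bullet> \<eta>2 - s\<^sup>2)"

lemma mgap_measurable [measurable (raw)]:
  assumes [measurable]: "f \<in> borel_measurable M" "g \<in> borel_measurable M"
  shows "(\<lambda>x. mgap s (f x :: 'a::euclidean_space) (g x)) \<in> borel_measurable M"
  unfolding mgap_def by measurable

lemma phi_gt: "0 < s \<Longrightarrow> 0 \<le> r \<Longrightarrow> r < phi s r"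
  unfolding phi_def by (rule real_less_rsqrt) simp

lemma phi_norm_power2: "(phi s (norm \<eta>))\<^sup>2 = s\<^sup>2 + \<eta> \<bullet> \<eta>"
  by (simp add: phi_power2 power2_norm_eq_inner)

lemma phi_mono: "0 \<le> r \<Longrightarrow> r \<le> r' \<Longrightarrow> phi s r \<le> phi s r'"
  unfolding phi_def by (intro real_sqrt_le_mono add_left_mono power_mono)

lemma mgap_eq: "mgap s \<eta>1 \<eta>2 = (norm (\<eta>1 - \<eta>2))\<^sup>2 - (phi s (norm \<eta>1) - phi s (norm \<eta>2))\<^sup>2"
proof -
  have "(phi s (norm \<eta>1) - phi s (norm \<eta>2))\<^sup>2 = (phi s (norm \<eta>1))\<^sup>2 + (phi s (norm \<eta>2))\<^sup>2 - 2 * phi s (norm \<eta>1) * phi s (norm \<eta>2)"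
    by (simp add: power2_diff)
  moreover have "(norm (\<eta>1 - \<eta>2))\<^sup>2 = \<eta>1 \<bullet> \<eta>1 + \<eta>2 \<bullet> \<eta>2 - 2 * (\<eta>1 \<bullet> \<eta>2)"
    by (simp add: power2_norm_eq_inner inner_diff_left inner_diff_right inner_commute)
  ultimately show ?thesis by (simp add: phi_norm_power2 mgap_def algebra_simps)
qed

text \<open>The difference of squares of the two energies is (\<eta>1 - \<eta>2) \<bullet> (\<eta>1
  + \<eta>2), and |\<eta>1| + |\<eta>2| is strictly less than the sum of the energies. Consequently
  the spectrum of the product lies in |\<tau>| < |\<xi>|.\<close>

lemma phi_diff_less:
  assumes s: "0 < s" and ne: "\<eta>1 \<noteq> \<eta>2"
  shows "\<bar>phi s (norm \<eta>1) - phi s (norm \<eta>2)\<bar> < norm (\<eta>1 - (\<eta>2::'a::euclidean_space))"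
proof -
  let ?f = "phi s (norm \<eta>1)" and ?g = "phi s (norm \<eta>2)"
  have fg: "0 < ?f + ?g" using phi_pos[OF s] by (simp add: add_pos_pos)
  have "(?f - ?g) * (?f + ?g) = (\<eta>1 - \<eta>2) \<bullet> (\<eta>1 + \<eta>2)"
  proof -
    have "(?f - ?g) * (?f + ?g) = ?f\<^sup>2 - ?g\<^sup>2" by (simp add: power2_eq_square algebra_simps)
    then show ?thesis by (simp add: phi_norm_power2 inner_diff_left inner_diff_right inner_add_left inner_add_right inner_commute)
  qed
  then have "\<bar>?f - ?g\<bar> * (?f + ?g) = \<bar>(\<eta>1 - \<eta>2) \<bullet> (\<eta>1 + \<eta>2)\<bar>" using fg by (metis abs_mult abs_of_pos)
  also have "\<dots> \<le> norm (\<eta>1 - \<eta>2) * norm (\<eta>1 + \<eta>2)" by (rule Cauchy_Schwarz_ineq2)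
  also have "\<dots> \<le> norm (\<eta>1 - \<eta>2) * (norm \<eta>1 + norm \<eta>2)" by (intro mult_left_mono norm_triangle_ineq) auto
  also have "\<dots> < norm (\<eta>1 - \<eta>2) * (?f + ?g)"
    using ne phi_gt[OF s norm_ge_zero, of \<eta>1] phi_gt[OF s norm_ge_zero, of \<eta>2] by (intro mult_strict_left_mono) auto
  finally show ?thesis using fg by simp
qed

lemma mgap_pos:
  assumes "0 < s" "\<eta>1 \<noteq> \<eta>2" shows "0 < mgap s \<eta>1 \<eta>2"
proof -
  have "(phi s (norm \<eta>1) - phi s (norm \<eta>2))\<^sup>2 < (norm (\<eta>1 - \<eta>2))\<^sup>2"
    using phi_diff_less[OF assms] by (metis abs_ge_zero power2_abs power_strict_mono pos2)
  then show ?thesis by (simp add: mgap_eq)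
qed

lemma mgap_same: "mgap s \<eta> \<eta> = 0"
  by (simp add: mgap_eq)

lemma mgap_nonneg: "0 < s \<Longrightarrow> 0 \<le> mgap s \<eta>1 \<eta>2"
  using mgap_pos[of s \<eta>1 \<eta>2] mgap_same[of s \<eta>1] by (cases "\<eta>1 = \<eta>2") auto

text \<open>The point on the line \<open>perp \<xi> \<eta> + \<real> \<xi>\<close> whose Lorentz product with \<open>(\<tau>, \<xi>)\<close> is \<open>y\<close> times the Lorentz length of
  \<open>(\<tau>, \<xi>)\<close>; see \<open>apt_energy\<close>.\<close>

definition apt :: "real \<Rightarrow> 'a::euclidean_space \<Rightarrow> real \<Rightarrow> 'a \<Rightarrow> real \<Rightarrow> 'a" where
  "apt s \<xi> \<tau> \<eta> y = perp \<xi> \<eta> + ((norm \<xi> * y + \<tau> * sqrt (s\<^sup>2 + (norm (perp \<xi> \<eta>))\<^sup>2 + y\<^sup>2))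
     / (sqrt ((norm \<xi>)\<^sup>2 - \<tau>\<^sup>2) * norm \<xi>)) *\<^sub>R \<xi>"

lemma apt_measurable [measurable (raw)]:
  assumes [measurable]: "f \<in> borel_measurable M" "g \<in> borel_measurable M" "h \<in> borel_measurable M" "k \<in> borel_measurable M"
  shows "(\<lambda>x. apt s (f x :: 'a::euclidean_space) (g x) (h x) (k x)) \<in> borel_measurable M"
  unfolding apt_def by measurable

text \<open>\<open>boost_key\<close> with E = |\<xi>| and q = \<tau>, where S is s^2 plus the
  squared transverse part.\<close>

lemma phi_apt:
  assumes s: "0 < s" and \<tau>: "\<bar>\<tau>\<bar> < norm \<xi>"
  shows "phi s (norm (apt s \<xi> \<tau> \<eta> y)) = (norm \<xi> * sqrt (s\<^sup>2 + (norm (perp \<xi> \<eta>))\<^sup>2 + y\<^sup>2) + \<tau> * y) / sqrt ((norm \<xi>)\<^sup>2 - \<tau>\<^sup>2)"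
proof -
  define R where "R = norm \<xi>"
  have R: "0 < R" unfolding R_def by (rule order_le_less_trans[OF abs_ge_zero \<tau>])
  define S where "S = s\<^sup>2 + (norm (perp \<xi> \<eta>))\<^sup>2"
  have S: "0 < S" using s by (simp add: S_def add_pos_nonneg)
  define M where "M = sqrt (R\<^sup>2 - \<tau>\<^sup>2)"
  have "phi s (norm (apt s \<xi> \<tau> \<eta> y)) = sqrt (S + ((R * y + \<tau> * sqrt (S + y\<^sup>2)) / M)\<^sup>2)"
    unfolding phi_def apt_def norm_perp_add using R by (simp add: S_def R_def M_def power_divide power_mult_distrib)
  also have "\<dots> = (R * sqrt (S + y\<^sup>2) + \<tau> * y) / M"
    by (rule boost_key(1)[OF S _ M_def]) (use \<tau> in \<open>simp add: R_def\<close>)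
  finally show ?thesis by (simp add: S_def R_def M_def)
qed

lemma apt_energy:
  assumes s: "0 < s" and \<tau>: "\<bar>\<tau>\<bar> < norm \<xi>"
  shows "apt s \<xi> \<tau> \<eta> y \<bullet> \<xi> - \<tau> * phi s (norm (apt s \<xi> \<tau> \<eta> y)) = sqrt ((norm \<xi>)\<^sup>2 - \<tau>\<^sup>2) * y"
proof -
  define R where "R = norm \<xi>"
  have R: "0 < R" unfolding R_def by (rule order_le_less_trans[OF abs_ge_zero \<tau>])
  define r where "r = sqrt (s\<^sup>2 + (norm (perp \<xi> \<eta>))\<^sup>2 + y\<^sup>2)"
  define M where "M = sqrt (R\<^sup>2 - \<tau>\<^sup>2)"
  have t2: "\<tau>\<^sup>2 < R\<^sup>2" using \<tau> unfolding R_def by (metis abs_ge_zero power2_abs power_strict_mono pos2)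
  have M: "0 < M" "M * M = R\<^sup>2 - \<tau>\<^sup>2" using t2 by (simp_all add: M_def)
  have "apt s \<xi> \<tau> \<eta> y \<bullet> \<xi> = ((R * y + \<tau> * r) / (M * R)) * (R * R)"
    unfolding apt_def by (simp add: inner_add_left perp_inner R_def r_def M_def power2_norm_eq_inner[symmetric] power2_eq_square)
  also have "\<dots> = (R * y + \<tau> * r) * R / M" using R M by (simp add: field_simps)
  finally have "apt s \<xi> \<tau> \<eta> y \<bullet> \<xi> - \<tau> * phi s (norm (apt s \<xi> \<tau> \<eta> y)) = (R * y + \<tau> * r) * R / M - \<tau> * ((R * r + \<tau> * y) / M)"
    unfolding phi_apt[OF assms] by (simp add: R_def r_def M_def)
  also have "\<dots> = (R\<^sup>2 - \<tau>\<^sup>2) * y / M" using M(1) by (simp add: field_simps power2_eq_square)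
  also have "\<dots> = M * y" using M(1) unfolding M(2)[symmetric] by simp
  finally show ?thesis by (simp add: M_def R_def)
qed

lemma norm_perp_le_apt: "norm (perp \<xi> \<eta>) \<le> norm (apt s \<xi> \<tau> \<eta> y)"
proof -
  have "(norm (perp \<xi> \<eta>))\<^sup>2 \<le> (norm (apt s \<xi> \<tau> \<eta> y))\<^sup>2"
    unfolding apt_def norm_perp_add by simp
  then show ?thesis by (rule power2_le_imp_le) simp
qed

text \<open>The integral over each line is written against the invariant measure dX /
  \<open>phi\<close>, at the price of the extra factor \<open>phi\<close>, and then boosted by
  \<open>nn_integral_boost\<close>. In the new variable y the Lorentz product with (\<tau>, \<xi>)
  is linear (\<open>apt_energy\<close>).\<close>

lemma nn_integral_apt:
  fixes \<Theta> :: "'a::euclidean_space \<Rightarrow> ennreal"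
  assumes [measurable]: "\<Theta> \<in> borel_measurable borel" and s: "0 < s" and \<tau>: "\<bar>\<tau>\<bar> < norm \<xi>"
  shows "(\<integral>\<^sup>+z. \<Theta> z \<partial>lborel) = (\<integral>\<^sup>+\<eta>. ennreal (slab \<xi> \<eta>) * (\<integral>\<^sup>+y. \<Theta> (apt s \<xi> \<tau> \<eta> y) *
     ennreal (phi s (norm (apt s \<xi> \<tau> \<eta> y)) / (norm \<xi> * sqrt (s\<^sup>2 + (norm (perp \<xi> \<eta>))\<^sup>2 + y\<^sup>2))) \<partial>lborel) \<partial>lborel)"
proof -
  define R where "R = norm \<xi>"
  have R: "0 < R" "\<xi> \<noteq> 0" using order_le_less_trans[OF abs_ge_zero \<tau>] by (auto simp: R_def)
  define M where "M = sqrt (R\<^sup>2 - \<tau>\<^sup>2)"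
  show ?thesis
  proof (subst nn_integral_lines[OF _ R(2)], measurable, rule nn_integral_cong)
    fix \<eta> :: 'a
    define S where "S = s\<^sup>2 + (norm (perp \<xi> \<eta>))\<^sup>2"
    have S: "0 < S" using s by (simp add: S_def add_pos_nonneg)
    have ap: "apt s \<xi> \<tau> \<eta> y = perp \<xi> \<eta> + (((R * y + \<tau> * sqrt (S + y\<^sup>2)) / M) / R) *\<^sub>R \<xi>" for y
      by (simp add: apt_def R_def M_def S_def)
    have pX: "phi s (norm (perp \<xi> \<eta> + (X / R) *\<^sub>R \<xi>)) = sqrt (S + X\<^sup>2)" for X
      unfolding phi_def norm_perp_add using R by (simp add: S_def R_def power_divide)
    have Sp: "0 < sqrt (S + X\<^sup>2)" for X using S by (simp add: add_pos_nonneg)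
    have "(\<integral>\<^sup>+x. \<Theta> (perp \<xi> \<eta> + x *\<^sub>R \<xi>) \<partial>lborel) = ennreal (1 / R) * (\<integral>\<^sup>+X. \<Theta> (perp \<xi> \<eta> + (X / R) *\<^sub>R \<xi>) \<partial>lborel)"
      using nn_integral_real_affine[of "\<lambda>x. \<Theta> (perp \<xi> \<eta> + x *\<^sub>R \<xi>)" "1 / R" 0] R by simp
    also have "(\<integral>\<^sup>+X. \<Theta> (perp \<xi> \<eta> + (X / R) *\<^sub>R \<xi>) \<partial>lborel) =
      (\<integral>\<^sup>+X. (\<Theta> (perp \<xi> \<eta> + (X / R) *\<^sub>R \<xi>) * ennreal (phi s (norm (perp \<xi> \<eta> + (X / R) *\<^sub>R \<xi>)))) * ennreal (1 / sqrt (S + X\<^sup>2)) \<partial>lborel)"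
    proof (rule nn_integral_cong)
      fix X
      have "ennreal (sqrt (S + X\<^sup>2)) * ennreal (1 / sqrt (S + X\<^sup>2)) = 1"
        using Sp[of X] by (subst ennreal_mult[symmetric]) auto
      then show "\<Theta> (perp \<xi> \<eta> + (X / R) *\<^sub>R \<xi>) = (\<Theta> (perp \<xi> \<eta> + (X / R) *\<^sub>R \<xi>) * ennreal (phi s (norm (perp \<xi> \<eta> + (X / R) *\<^sub>R \<xi>)))) * ennreal (1 / sqrt (S + X\<^sup>2))"
        by (simp only: pX mult.assoc mult_1_right)
    qed
    also have "\<dots> = (\<integral>\<^sup>+y. (\<Theta> (apt s \<xi> \<tau> \<eta> y) * ennreal (phi s (norm (apt s \<xi> \<tau> \<eta> y)))) * ennreal (1 / sqrt (S + y\<^sup>2)) \<partial>lborel)"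
      unfolding ap by (rule nn_integral_boost[OF _ S _ M_def]) (use \<tau> in \<open>auto simp: R_def\<close>)
    also have "ennreal (1 / R) * \<dots> = (\<integral>\<^sup>+y. \<Theta> (apt s \<xi> \<tau> \<eta> y) *
     ennreal (phi s (norm (apt s \<xi> \<tau> \<eta> y)) / (norm \<xi> * sqrt (s\<^sup>2 + (norm (perp \<xi> \<eta>))\<^sup>2 + y\<^sup>2))) \<partial>lborel)"
    proof (subst nn_integral_cmult[symmetric], measurable, rule nn_integral_cong)
      fix y
      have "ennreal (1 / R) * (ennreal (phi s (norm (apt s \<xi> \<tau> \<eta> y))) * ennreal (1 / sqrt (S + y\<^sup>2))) = ennreal (phi s (norm (apt s \<xi> \<tau> \<eta> y)) / (R * sqrt (S + y\<^sup>2)))"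
        using R(1) Sp[of y] phi_pos[OF s, of "norm (apt s \<xi> \<tau> \<eta> y)"] by (simp add: ennreal_mult[symmetric] less_imp_le)
      then show "ennreal (1 / R) * (\<Theta> (apt s \<xi> \<tau> \<eta> y) * ennreal (phi s (norm (apt s \<xi> \<tau> \<eta> y))) * ennreal (1 / sqrt (S + y\<^sup>2))) =
         \<Theta> (apt s \<xi> \<tau> \<eta> y) * ennreal (phi s (norm (apt s \<xi> \<tau> \<eta> y)) / (norm \<xi> * sqrt (s\<^sup>2 + (norm (perp \<xi> \<eta>))\<^sup>2 + y\<^sup>2)))"
        unfolding R_def S_def by (simp only: mult.assoc mult.left_commute[of _ "\<Theta> _"])
    qed
    finally show "ennreal (slab \<xi> \<eta>) * (\<integral>\<^sup>+x. \<Theta> (perp \<xi> \<eta> + x *\<^sub>R \<xi>) \<partial>lborel) = ennreal (slab \<xi> \<eta>) * (\<integral>\<^sup>+y. \<Theta> (apt s \<xi> \<tau> \<eta> y) *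
     ennreal (phi s (norm (apt s \<xi> \<tau> \<eta> y)) / (norm \<xi> * sqrt (s\<^sup>2 + (norm (perp \<xi> \<eta>))\<^sup>2 + y\<^sup>2))) \<partial>lborel)" by simp
  qed
qed

text \<open>A one-sided approximation of the Dirac mass at 0. Only arguments c > 0 are charged, and
  for these the radius in \<open>nn_integral_radial_delta\<close> is strictly positive even in the
  degenerate case M = 2 s.\<close>

definition delta :: "real \<Rightarrow> real \<Rightarrow> ennreal" where
  "delta \<epsilon> u = ennreal (1 / \<epsilon>) * indicator {0<..\<epsilon>} u"

lemma delta_measurable [measurable (raw)]:
  assumes [measurable]: "f \<in> borel_measurable M"
  shows "(\<lambda>x. delta \<epsilon> (f x)) \<in> borel_measurable M"
  unfolding delta_def by measurable

lemma nn_integral_delta: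
  assumes [measurable]: "h \<in> borel_measurable borel" and \<epsilon>: "0 < \<epsilon>" and b: "0 < b"
  shows "(\<integral>\<^sup>+y. h y * delta \<epsilon> (m + b * y) \<partial>lborel) = ennreal (1 / b) * (\<integral>\<^sup>+\<sigma>. h ((\<epsilon> * \<sigma> - m) / b) * indicator {0<..1} \<sigma> \<partial>lborel)"
proof -
  have "(\<integral>\<^sup>+y. h y * delta \<epsilon> (m + b * y) \<partial>lborel) = ennreal (\<epsilon> / b) * (\<integral>\<^sup>+\<sigma>. h (- m / b + (\<epsilon> / b) * \<sigma>) * delta \<epsilon> (m + b * (- m / b + (\<epsilon> / b) * \<sigma>)) \<partial>lborel)"
    using \<epsilon> b by (subst nn_integral_real_affine[where c="\<epsilon> / b" and t="- m / b"]) auto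
  also have "\<dots> = ennreal (\<epsilon> / b) * (\<integral>\<^sup>+\<sigma>. ennreal (1 / \<epsilon>) * (h ((\<epsilon> * \<sigma> - m) / b) * indicator {0<..1} \<sigma>) \<partial>lborel)"
  proof (intro arg_cong[where f="\<lambda>x. _ * x"] nn_integral_cong)
    fix \<sigma> :: real
    have "m + b * (- m / b + (\<epsilon> / b) * \<sigma>) = \<epsilon> * \<sigma>" "- m / b + (\<epsilon> / b) * \<sigma> = (\<epsilon> * \<sigma> - m) / b" using b by (simp_all add: field_simps)
    moreover have "indicator {0<..\<epsilon>} (\<epsilon> * \<sigma>) = (indicator {0<..1} \<sigma> :: ennreal)" using \<epsilon> by (auto simp: indicator_def zero_less_mult_iff)
    ultimately show "h (- m / b + (\<epsilon> / b) * \<sigma>) * delta \<epsilon> (m + b * (- m / b + (\<epsilon> / b) * \<sigma>)) = ennreal (1 / \<epsilon>) * (h ((\<epsilon> * \<sigma> - m) / b) * indicator {0<..1} \<sigma>)"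
      by (simp add: delta_def mult_ac)
  qed
  also have "\<dots> = (ennreal (\<epsilon> / b) * ennreal (1 / \<epsilon>)) * (\<integral>\<^sup>+\<sigma>. h ((\<epsilon> * \<sigma> - m) / b) * indicator {0<..1} \<sigma> \<partial>lborel)"
    by (subst nn_integral_cmult) (auto simp: mult.assoc)
  also have "ennreal (\<epsilon> / b) * ennreal (1 / \<epsilon>) = ennreal (1 / b)" using \<epsilon> b by (simp add: ennreal_mult[symmetric])
  finally show ?thesis .
qed

text \<open>The Lorentz product of (E, p) with a boosted point equals the product of (M, 0) with the
  original point, so that it depends only on the length of k.\<close>

lemma boost_energy:
  assumes E: "norm p < E" and M: "M = sqrt (E\<^sup>2 - (norm p)\<^sup>2)"
  shows "E * phi s (norm (boost s E p k)) - p \<bullet> boost s E p k = M * phi s (norm k)"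
proof -
  have p2: "(norm p)\<^sup>2 < E\<^sup>2" using E by (intro power_strict_mono) auto
  have M0: "0 < M" "M\<^sup>2 = E\<^sup>2 - (norm p)\<^sup>2" using p2 M by auto
  define N where "N = E + M"
  have N: "N > 0" unfolding N_def using E M0(1) norm_ge_zero[of p] by linarith
  define f where "f = phi s (norm k)"
  define a where "a = p \<bullet> k"
  have pp: "p \<bullet> p = (E - M) * N"
    using M0(2) unfolding power2_norm_eq_inner N_def by (simp add: algebra_simps power2_eq_square)
  have "p \<bullet> boost s E p k = a + (a / (M * N) + f / M) * (p \<bullet> p)"
    unfolding boost_def Let_def M[symmetric] N_def[symmetric] by (simp add: inner_add_right a_def f_def)
  also have "\<dots> = a + (E - M) * (a + f * N) / M" unfolding pp using M0(1) N by (simp add: field_simps)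
  finally have "E * phi s (norm (boost s E p k)) - p \<bullet> boost s E p k = E * ((E * f + a) / M) - (a + (E - M) * (a + f * N) / M)"
    unfolding phi_boost[OF E M] by (simp add: f_def a_def)
  also have "\<dots> = f * (E\<^sup>2 - (E - M) * N) / M" using M0(1) by (simp add: field_simps power2_eq_square)
  also have "E\<^sup>2 - (E - M) * N = M\<^sup>2" by (simp add: N_def algebra_simps power2_eq_square)
  finally show ?thesis using M0(1) by (simp add: f_def power2_eq_square mult.commute)
qed

text \<open>The argument c of \<open>delta\<close> becomes the variable of integration. The
  derivative of the radius contributes \<open>phi\<close> / (2 M R), which cancels the
  \<open>phi\<close> in the invariant measure and lowers the power of R from d - 1 to d - 2. The
  rescaling c = \<epsilon> \<sigma> then puts the dependence on \<epsilon> into the integrand over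
  (0, 1].\<close>

lemma nn_integral_radial_delta:
  fixes h :: "real \<Rightarrow> ennreal"
  assumes [measurable]: "h \<in> borel_measurable borel" and s: "0 < s" and \<epsilon>: "0 < \<epsilon>" and V: "0 < V" and M: "2 * s \<le> M" and d: "2 \<le> d"
  defines "R \<equiv> \<lambda>c. sqrt ((M / 2 + c / (2 * M))\<^sup>2 - s\<^sup>2)"
  shows "(\<integral>\<^sup>+l. ennreal (l ^ (d - 1) / phi s (l * V)) * h l * delta \<epsilon> (2 * M * phi s (l * V) - M\<^sup>2) * indicator {0<..} l \<partial>lborel) =
    ennreal (1 / V ^ d) * (\<integral>\<^sup>+\<sigma>. ennreal (R (\<epsilon> * \<sigma>) ^ (d - 2) / (2 * M)) * h (R (\<epsilon> * \<sigma>) / V) * indicator {0<..1} \<sigma> \<partial>lborel)"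
proof -
  have M0: "0 < M" using s M by simp
  \<comment> \<open>The value of \<open>phi\<close> for which 2 M \<open>phi\<close> - M^2 equals c;
    R c is the corresponding radius on the mass shell.\<close>
  define w where "w c = M / 2 + c / (2 * M)" for c
  have ws: "s < w c" if "0 < c" for c
    unfolding w_def using M divide_pos_pos[OF that, of "2 * M"] M0 by linarith
  have w0: "0 < w c" if "0 < c" for c using ws[OF that] s by linarith
  have ws2: "0 < (w c)\<^sup>2 - s\<^sup>2" if "0 < c" for c
    using power_strict_mono[OF ws[OF that], of 2] s by simp
  have Rw: "R c = sqrt ((w c)\<^sup>2 - s\<^sup>2)" for c by (simp add: R_def w_def)
  have R0: "0 < R c" if "0 < c" for c unfolding Rw using ws2[OF that] by simp
  have [measurable]: "R \<in> borel_measurable borel" unfolding R_def by measurable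
  define g where "g c = R c / V" for c
  have g0: "0 < g c" if "0 < c" for c using R0[OF that] V by (simp add: g_def)
  have ph: "phi s (g c * V) = w c" if "0 < c" for c
    using that V ws2[OF that] w0[OF that] by (simp add: g_def phi_def Rw)
  let ?f = "\<lambda>l. ennreal (l ^ (d - 1) / phi s (l * V)) * h l * delta \<epsilon> (2 * M * phi s (l * V) - M\<^sup>2)"
  \<comment> \<open>The image of g consists of the l > 0 for which the argument of
    \<open>delta\<close> is positive; elsewhere \<open>delta\<close> vanishes.\<close>
  have im: "?f l * indicator {0<..} l = ?f l * indicator (g ` {0<..}) l" for l
  proof (cases "0 < l \<and> 0 < 2 * M * phi s (l * V) - M\<^sup>2")
    case True
    define c where "c = 2 * M * phi s (l * V) - M\<^sup>2"
    have c: "0 < c" using True by (simp add: c_def)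
    have "w c = phi s (l * V)" using M0 by (simp add: w_def c_def field_simps power2_eq_square)
    then have "(w c)\<^sup>2 - s\<^sup>2 = (l * V)\<^sup>2" by (simp add: phi_power2)
    then have "R c = l * V" using True V by (simp add: Rw)
    then have "g c = l" using V by (simp add: g_def)
    then have "l \<in> g ` {0<..}" using c by (intro image_eqI[of _ _ c]) auto
    then show ?thesis using True by simp
  next
    case False
    show ?thesis
    proof (cases "0 < l")
      case True
      then show ?thesis using False by (simp add: delta_def)
    next
      case False
      then have "l \<notin> g ` {0<..}" using g0 by auto
      then show ?thesis using False by simp
    qed
  qed
  have dv: "(g has_real_derivative w c / (2 * M * (R c * V))) (at c)" if c: "0 < c" for c
  proof -
    have "((\<lambda>c. (w c)\<^sup>2 - s\<^sup>2) has_real_derivative w c / M) (at c)"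
      unfolding w_def using M0 by (auto intro!: derivative_eq_intros simp: field_simps power2_eq_square power4_eq_xxxx)
    from DERIV_chain2[where f=sqrt and g="\<lambda>c. (w c)\<^sup>2 - s\<^sup>2", OF DERIV_real_sqrt[OF ws2[OF c]] this]
    have "(R has_real_derivative inverse (R c) / 2 * (w c / M)) (at c)"
      by (simp add: Rw[abs_def])
    from DERIV_cdivide[OF this, of V] show ?thesis
      unfolding g_def[abs_def] by (simp add: field_simps)
  qed
  have "(\<integral>\<^sup>+l. ?f l * indicator {0<..} l \<partial>lborel) = (\<integral>\<^sup>+l. ?f l * indicator (g ` {0<..}) l \<partial>lborel)" by (simp only: im)
  also have "\<dots> = (\<integral>\<^sup>+c. ?f (g c) * ennreal (w c / (2 * M * (R c * V))) * indicator {0<..} c \<partial>lborel)"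
  proof (rule nn_integral_substitution_Ioi[OF _ dv])
    show "continuous_on {0<..} (\<lambda>c. w c / (2 * M * (R c * V)))"
    proof (intro continuous_on_divide continuous_on_mult continuous_on_const)
      show "continuous_on {0<..} w" unfolding w_def[abs_def] using M0 by (intro continuous_intros) auto
      show "continuous_on {0<..} R" unfolding R_def using M0 by (intro continuous_intros) auto
      show "\<forall>c\<in>{0<..}. 2 * M * (R c * V) \<noteq> 0"
      proof
        fix c :: real assume "c \<in> {0<..}"
        then show "2 * M * (R c * V) \<noteq> 0" using R0[of c] V M0 by simp
      qed
    qed
    show "0 \<le> w c / (2 * M * (R c * V))" if "0 < c" for c
      using w0[OF that] R0[OF that] V M0 by (intro divide_nonneg_nonneg mult_nonneg_nonneg) auto
    show "g \<in> borel_measurable borel" unfolding g_def by measurable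
    show "(\<lambda>c. w c / (2 * M * (R c * V))) \<in> borel_measurable borel" unfolding w_def by measurable
  qed auto
  also have "\<dots> = (\<integral>\<^sup>+c. (ennreal (1 / V ^ d) * (ennreal (R c ^ (d - 2) / (2 * M)) * h (R c / V))) * delta \<epsilon> (0 + 1 * c) \<partial>lborel)"
  proof (rule nn_integral_cong)
    fix c :: real
    show "?f (g c) * ennreal (w c / (2 * M * (R c * V))) * indicator {0<..} c = (ennreal (1 / V ^ d) * (ennreal (R c ^ (d - 2) / (2 * M)) * h (R c / V))) * delta \<epsilon> (0 + 1 * c)"
    proof (cases "0 < c")
      case True
      note pos = w0[OF True] R0[OF True] V M0
      obtain d' where d': "d = Suc (Suc d')" using d by (metis add_2_eq_Suc le_Suc_ex)
      have "2 * M * w c - M\<^sup>2 = c" using M0 by (simp add: w_def field_simps power2_eq_square)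
      then have u: "2 * M * phi s (g c * V) - M\<^sup>2 = c" using ph[OF True] by simp
      have gw: "(g c ^ (d - 1) / w c) * (w c / (2 * M * (R c * V))) = (1 / V ^ d) * (R c ^ (d - 2) / (2 * M))"
        using pos by (simp add: g_def d' power_divide field_simps)
      have "ennreal (g c ^ (d - 1) / w c) * ennreal (w c / (2 * M * (R c * V))) = ennreal (1 / V ^ d) * ennreal (R c ^ (d - 2) / (2 * M))"
      proof -
        have "0 \<le> g c ^ (d - 1) / w c" "0 \<le> 1 / V ^ d" using pos g0[OF True] by simp_all
        then show ?thesis by (simp only: ennreal_mult'[symmetric] gw)
      qed
      then have "?f (g c) * ennreal (w c / (2 * M * (R c * V))) = (ennreal (1 / V ^ d) * ennreal (R c ^ (d - 2) / (2 * M))) * h (g c) * delta \<epsilon> c"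
        unfolding u unfolding ph[OF True] by (metis mult.assoc mult.commute)
      then show ?thesis using True by (simp add: g_def mult_ac)
    qed (simp add: delta_def)
  qed
  also have "\<dots> = (\<integral>\<^sup>+\<sigma>. (ennreal (1 / V ^ d) * (ennreal (R (\<epsilon> * \<sigma>) ^ (d - 2) / (2 * M)) * h (R (\<epsilon> * \<sigma>) / V))) * indicator {0<..1} \<sigma> \<partial>lborel)"
    by (subst nn_integral_delta[OF _ \<epsilon>]) auto
  also have "\<dots> = ennreal (1 / V ^ d) * (\<integral>\<^sup>+\<sigma>. ennreal (R (\<epsilon> * \<sigma>) ^ (d - 2) / (2 * M)) * h (R (\<epsilon> * \<sigma>) / V) * indicator {0<..1} \<sigma> \<partial>lborel)"
    by (subst nn_integral_cmult[symmetric]) (auto simp: mult.assoc)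
  finally show ?thesis .
qed

section \<open>Fibres over P1 and P2, parametrised by lines\<close>

lemma nn_integral_lborel_pair:
  fixes f :: "'a::euclidean_space \<times> 'b::euclidean_space \<Rightarrow> ennreal"
  assumes "f \<in> borel_measurable borel"
  shows "(\<integral>\<^sup>+p. f p \<partial>lborel) = (\<integral>\<^sup>+x. \<integral>\<^sup>+y. f (x, y) \<partial>lborel \<partial>lborel)"
proof -
  have "f \<in> borel_measurable (lborel \<Otimes>\<^sub>M lborel)" using assms by (simp add: lborel_prod)
  from lborel.nn_integral_fst[OF this] show ?thesis by (simp add: lborel_prod)
qed

lemma nn_integral_lborel_triple:
  fixes f :: "'a::euclidean_space \<times> 'b::euclidean_space \<times> 'c::euclidean_space \<Rightarrow> ennreal"
  assumes f: "f \<in> borel_measurable borel"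
  shows "(\<integral>\<^sup>+p. f p \<partial>lborel) = (\<integral>\<^sup>+x. \<integral>\<^sup>+y. \<integral>\<^sup>+z. f (x, y, z) \<partial>lborel \<partial>lborel \<partial>lborel)"
proof -
  have "(\<lambda>q. f (x, q)) \<in> borel_measurable borel" for x
    by (rule measurable_compose[OF _ f]) (intro borel_measurable_continuous_onI continuous_intros)
  then show ?thesis by (simp only: nn_integral_lborel_pair[OF f] nn_integral_lborel_pair)
qed

text \<open>The defect of \<open>P1 - P2 + P4\<close> from the mass shell, where \<open>P1\<close>, \<open>P2\<close>, \<open>P4\<close> lie on it above \<open>a\<close>, \<open>\<eta>2\<close>, \<open>\<eta>4\<close>.\<close>

definition resU :: "real \<Rightarrow> 'a::euclidean_space \<Rightarrow> 'a \<Rightarrow> 'a \<Rightarrow> real" where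
  "resU s a \<eta>2 \<eta>4 = mgap s a \<eta>2 + 2 * (\<eta>4 \<bullet> (a - \<eta>2) - (phi s (norm a) - phi s (norm \<eta>2)) * phi s (norm \<eta>4))"

lemma resU_measurable [measurable (raw)]:
  assumes [measurable]: "f \<in> borel_measurable M" "g \<in> borel_measurable M" "h \<in> borel_measurable M"
  shows "(\<lambda>x. resU s (f x :: 'a::euclidean_space) (g x) (h x)) \<in> borel_measurable M"
  unfolding resU_def by measurable

definition ptA :: "real \<Rightarrow> 'a::euclidean_space \<Rightarrow> 'a \<Rightarrow> 'a \<Rightarrow> real \<Rightarrow> 'a" where
  "ptA s a \<eta>2 \<eta> y = apt s (a - \<eta>2) (phi s (norm a) - phi s (norm \<eta>2)) \<eta> y"

text \<open>The Jacobian of \<open>nn_integral_apt\<close> combined with the prefactor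
  sqrt(\<open>mgap\<close>) / \<open>phi\<close> of \<open>smeared_fibre_lines\<close> and the slope
  2 sqrt(\<open>mgap\<close>) of the constraint. The two roots cancel; this is why that prefactor is
  carried.\<close>

definition wtA :: "real \<Rightarrow> 'a::euclidean_space \<Rightarrow> 'a \<Rightarrow> 'a \<Rightarrow> real \<Rightarrow> real" where
  "wtA s a \<eta>2 \<eta> y = slab (a - \<eta>2) \<eta> / (2 * phi s (norm \<eta>2)) *
     (phi s (norm (ptA s a \<eta>2 \<eta> y)) / (norm (a - \<eta>2) * sqrt (s\<^sup>2 + (norm (perp (a - \<eta>2) \<eta>))\<^sup>2 + y\<^sup>2)))"

lemma ptA_measurable [measurable (raw)]:
  assumes [measurable]: "f \<in> borel_measurable M" "g \<in> borel_measurable M" "h \<in> borel_measurable M" "k \<in> borel_measurable M"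
  shows "(\<lambda>x. ptA s (f x :: 'a::euclidean_space) (g x) (h x) (k x)) \<in> borel_measurable M"
  unfolding ptA_def by measurable

lemma wtA_measurable [measurable (raw)]:
  assumes [measurable]: "f \<in> borel_measurable M" "g \<in> borel_measurable M" "h \<in> borel_measurable M" "k \<in> borel_measurable M"
  shows "(\<lambda>x. wtA s (f x :: 'a::euclidean_space) (g x) (h x) (k x)) \<in> borel_measurable M"
  unfolding wtA_def by measurable

lemma wtA_nonneg: "0 < s \<Longrightarrow> 0 \<le> wtA s a \<eta>2 \<eta> y"
  unfolding wtA_def using phi_pos[of s] slab_nonneg by (intro mult_nonneg_nonneg divide_nonneg_nonneg) (auto simp: less_imp_le)

text \<open>Along \<open>apt\<close>, with (\<tau>, \<xi>) the difference of P1 and P2, the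
  constraint \<open>resU\<close> is the affine function m + 2 sqrt(m) y by
  \<open>apt_energy\<close>, so \<open>nn_integral_delta\<close> applies. At \<eta>2 = a both sides
  are 0.\<close>

lemma smeared_fibre_lines:
  fixes a :: "'a::euclidean_space" and v :: "'a \<times> 'a \<Rightarrow> real"
  assumes s: "0 < s" and \<epsilon>: "0 < \<epsilon>" and v[measurable]: "v \<in> borel_measurable borel" and v0: "\<And>x. 0 \<le> v x"
  shows "ennreal (sqrt (mgap s a \<eta>2) / phi s (norm \<eta>2)) * (\<integral>\<^sup>+\<eta>4. ennreal (v (\<eta>2, \<eta>4)) * delta \<epsilon> (resU s a \<eta>2 \<eta>4) \<partial>lborel) =
    (\<integral>\<^sup>+\<eta>. \<integral>\<^sup>+\<sigma>. ennreal (wtA s a \<eta>2 \<eta> ((\<epsilon> * \<sigma> - mgap s a \<eta>2) / (2 * sqrt (mgap s a \<eta>2))) *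
       v (\<eta>2, ptA s a \<eta>2 \<eta> ((\<epsilon> * \<sigma> - mgap s a \<eta>2) / (2 * sqrt (mgap s a \<eta>2))))) * indicator {0<..1} \<sigma> \<partial>lborel \<partial>lborel)"
proof (cases "\<eta>2 = a")
  case True
  then show ?thesis by (simp add: mgap_same wtA_def slab_def)
next
  case False
  define \<xi> where "\<xi> = a - \<eta>2"
  define \<tau> where "\<tau> = phi s (norm a) - phi s (norm \<eta>2)"
  define m where "m = mgap s a \<eta>2"
  have \<tau>: "\<bar>\<tau>\<bar> < norm \<xi>" unfolding \<tau>_def \<xi>_def by (rule phi_diff_less[OF s]) (use False in auto)
  have m: "0 < m" unfolding m_def by (rule mgap_pos[OF s]) (use False in auto)
  have mM: "(norm \<xi>)\<^sup>2 - \<tau>\<^sup>2 = m" by (simp add: m_def mgap_eq \<xi>_def \<tau>_def)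
  define w where "w \<eta> y = phi s (norm (apt s \<xi> \<tau> \<eta> y)) / (norm \<xi> * sqrt (s\<^sup>2 + (norm (perp \<xi> \<eta>))\<^sup>2 + y\<^sup>2))" for \<eta> y
  have [measurable]: "(\<lambda>y. w \<eta> y) \<in> borel_measurable borel" for \<eta> unfolding w_def by measurable
  have w0: "0 \<le> w \<eta> y" for \<eta> y unfolding w_def using phi_pos[OF s] by (intro divide_nonneg_nonneg) (auto simp: less_imp_le)
  have U: "resU s a \<eta>2 (apt s \<xi> \<tau> \<eta> y) = m + (2 * sqrt m) * y" for \<eta> y
    using apt_energy[OF s \<tau>, of \<eta> y] unfolding mM by (simp add: resU_def m_def \<xi>_def \<tau>_def)
  have f2: "0 < phi s (norm \<eta>2)" by (rule phi_pos[OF s])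
  have "(\<integral>\<^sup>+\<eta>4. ennreal (v (\<eta>2, \<eta>4)) * delta \<epsilon> (resU s a \<eta>2 \<eta>4) \<partial>lborel) =
    (\<integral>\<^sup>+\<eta>. ennreal (slab \<xi> \<eta>) * (\<integral>\<^sup>+y. (ennreal (v (\<eta>2, apt s \<xi> \<tau> \<eta> y)) * ennreal (w \<eta> y)) * delta \<epsilon> (m + (2 * sqrt m) * y) \<partial>lborel) \<partial>lborel)"
    by (subst nn_integral_apt[OF _ s \<tau>], measurable) (simp add: U w_def mult_ac)
  also have "\<dots> = (\<integral>\<^sup>+\<eta>. ennreal (slab \<xi> \<eta>) * (ennreal (1 / (2 * sqrt m)) * (\<integral>\<^sup>+\<sigma>. ennreal (v (\<eta>2, apt s \<xi> \<tau> \<eta> ((\<epsilon> * \<sigma> - m) / (2 * sqrt m)))) *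
     ennreal (w \<eta> ((\<epsilon> * \<sigma> - m) / (2 * sqrt m))) * indicator {0<..1} \<sigma> \<partial>lborel)) \<partial>lborel)"
    using m by (subst nn_integral_delta[OF _ \<epsilon>]) auto
  finally have 1: "(\<integral>\<^sup>+\<eta>4. ennreal (v (\<eta>2, \<eta>4)) * delta \<epsilon> (resU s a \<eta>2 \<eta>4) \<partial>lborel) = (\<integral>\<^sup>+\<eta>. ennreal (slab \<xi> \<eta>) * (ennreal (1 / (2 * sqrt m)) * (\<integral>\<^sup>+\<sigma>. ennreal (v (\<eta>2, apt s \<xi> \<tau> \<eta> ((\<epsilon> * \<sigma> - m) / (2 * sqrt m)))) *
     ennreal (w \<eta> ((\<epsilon> * \<sigma> - m) / (2 * sqrt m))) * indicator {0<..1} \<sigma> \<partial>lborel)) \<partial>lborel)" .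
  have "ennreal (sqrt (mgap s a \<eta>2) / phi s (norm \<eta>2)) * (\<integral>\<^sup>+\<eta>. ennreal (slab \<xi> \<eta>) * (ennreal (1 / (2 * sqrt m)) * (\<integral>\<^sup>+\<sigma>. ennreal (v (\<eta>2, apt s \<xi> \<tau> \<eta> ((\<epsilon> * \<sigma> - m) / (2 * sqrt m)))) *
     ennreal (w \<eta> ((\<epsilon> * \<sigma> - m) / (2 * sqrt m))) * indicator {0<..1} \<sigma> \<partial>lborel)) \<partial>lborel) = (\<integral>\<^sup>+\<eta>. \<integral>\<^sup>+\<sigma>. ennreal (wtA s a \<eta>2 \<eta> ((\<epsilon> * \<sigma> - mgap s a \<eta>2) / (2 * sqrt (mgap s a \<eta>2))) *
       v (\<eta>2, ptA s a \<eta>2 \<eta> ((\<epsilon> * \<sigma> - mgap s a \<eta>2) / (2 * sqrt (mgap s a \<eta>2))))) * indicator {0<..1} \<sigma> \<partial>lborel \<partial>lborel)"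
  proof (subst nn_integral_cmult[symmetric], (unfold w_def)[1], measurable, rule nn_integral_cong)
    fix \<eta> :: 'a
    let ?y = "\<lambda>\<sigma>. (\<epsilon> * \<sigma> - m) / (2 * sqrt m)"
    let ?q = "slab \<xi> \<eta> / (2 * phi s (norm \<eta>2))"
    have "ennreal (sqrt (mgap s a \<eta>2) / phi s (norm \<eta>2)) * (ennreal (slab \<xi> \<eta>) * ennreal (1 / (2 * sqrt m))) = ennreal ?q"
      using m f2 slab_nonneg[of \<xi> \<eta>] by (simp add: ennreal_mult[symmetric] m_def[symmetric])
    moreover have "ennreal ?q * (\<integral>\<^sup>+\<sigma>. ennreal (v (\<eta>2, apt s \<xi> \<tau> \<eta> (?y \<sigma>))) *
     ennreal (w \<eta> (?y \<sigma>)) * indicator {0<..1} \<sigma> \<partial>lborel) = (\<integral>\<^sup>+\<sigma>. ennreal (wtA s a \<eta>2 \<eta> (?y \<sigma>) * v (\<eta>2, ptA s a \<eta>2 \<eta> (?y \<sigma>))) * indicator {0<..1} \<sigma> \<partial>lborel)"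
    proof (subst nn_integral_cmult[symmetric], measurable, rule nn_integral_cong)
      fix \<sigma> :: real
      have "0 \<le> ?q" using f2 slab_nonneg[of \<xi> \<eta>] by simp
      then have "ennreal ?q * (ennreal (v (\<eta>2, apt s \<xi> \<tau> \<eta> (?y \<sigma>))) * ennreal (w \<eta> (?y \<sigma>))) = ennreal (?q * (v (\<eta>2, apt s \<xi> \<tau> \<eta> (?y \<sigma>)) * w \<eta> (?y \<sigma>)))"
        by (simp only: ennreal_mult[OF _ mult_nonneg_nonneg[OF v0 w0]] ennreal_mult[OF v0 w0])
      also have "?q * (v (\<eta>2, apt s \<xi> \<tau> \<eta> (?y \<sigma>)) * w \<eta> (?y \<sigma>)) = wtA s a \<eta>2 \<eta> (?y \<sigma>) * v (\<eta>2, ptA s a \<eta>2 \<eta> (?y \<sigma>))"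
        by (simp add: wtA_def ptA_def w_def \<xi>_def \<tau>_def)
      finally show "ennreal ?q * (ennreal (v (\<eta>2, apt s \<xi> \<tau> \<eta> (?y \<sigma>))) * ennreal (w \<eta> (?y \<sigma>)) * indicator {0<..1} \<sigma>) =
        ennreal (wtA s a \<eta>2 \<eta> (?y \<sigma>) * v (\<eta>2, ptA s a \<eta>2 \<eta> (?y \<sigma>))) * indicator {0<..1} \<sigma>"
        by (simp only: mult.assoc[symmetric])
    qed
    ultimately show "ennreal (sqrt (mgap s a \<eta>2) / phi s (norm \<eta>2)) * (ennreal (slab \<xi> \<eta>) * (ennreal (1 / (2 * sqrt m)) * (\<integral>\<^sup>+\<sigma>. ennreal (v (\<eta>2, apt s \<xi> \<tau> \<eta> (?y \<sigma>))) *
     ennreal (w \<eta> (?y \<sigma>)) * indicator {0<..1} \<sigma> \<partial>lborel))) = (\<integral>\<^sup>+\<sigma>. ennreal (wtA s a \<eta>2 \<eta> ((\<epsilon> * \<sigma> - mgap s a \<eta>2) / (2 * sqrt (mgap s a \<eta>2))) *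
       v (\<eta>2, ptA s a \<eta>2 \<eta> ((\<epsilon> * \<sigma> - mgap s a \<eta>2) / (2 * sqrt (mgap s a \<eta>2))))) * indicator {0<..1} \<sigma> \<partial>lborel)"
      by (simp only: m_def mult.assoc[symmetric])
  qed
  then show ?thesis by (simp only: 1)
qed

text \<open>\<open>slab\<close> divided by |\<xi>| is the area measure of the hyperplane orthogonal
  to \<xi>. Thickening a disc of radius \<rho> by length 1 along \<xi> keeps it in the ball of
  radius \<rho> + 1, which gives a bound uniform in \<xi>.\<close>

lemma slab_section_bound:
  fixes \<xi> :: "'a::euclidean_space"
  shows "(\<integral>\<^sup>+\<eta>. ennreal (slab \<xi> \<eta> / norm \<xi>) * indicator (cball 0 \<rho>) (perp \<xi> \<eta>) \<partial>lborel) \<le> emeasure lborel (cball (0::'a) (\<rho> + 1))"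
proof (cases "\<xi> = 0")
  case False
  define R where "R = norm \<xi>"
  have R: "0 < R" using False by (simp add: R_def)
  have [measurable]: "cball (0::'a) r \<in> sets borel" for r by simp
  have "emeasure lborel (cball (0::'a) (\<rho> + 1)) = (\<integral>\<^sup>+z. indicator (cball (0::'a) (\<rho> + 1)) z \<partial>lborel)" by simp
  also have "\<dots> = (\<integral>\<^sup>+\<eta>. ennreal (slab \<xi> \<eta>) * (\<integral>\<^sup>+x. indicator (cball 0 (\<rho> + 1)) (perp \<xi> \<eta> + x *\<^sub>R \<xi>) \<partial>lborel) \<partial>lborel)"
    by (rule nn_integral_lines[OF _ False]) measurable
  also have "\<dots> \<ge> (\<integral>\<^sup>+\<eta>. ennreal (slab \<xi> \<eta>) * (ennreal (1 / R) * indicator (cball 0 \<rho>) (perp \<xi> \<eta>)) \<partial>lborel)"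
  proof (intro nn_integral_mono mult_left_mono)
    fix \<eta> :: 'a
    show "ennreal (1 / R) * indicator (cball 0 \<rho>) (perp \<xi> \<eta>) \<le> (\<integral>\<^sup>+x. indicator (cball 0 (\<rho> + 1)) (perp \<xi> \<eta> + x *\<^sub>R \<xi>) \<partial>lborel)"
    proof (cases "perp \<xi> \<eta> \<in> cball 0 \<rho>")
      case True
      have "ennreal (1 / R) = (\<integral>\<^sup>+x. indicator {0..1 / R} x \<partial>lborel)" using R by simp
      also have "\<dots> \<le> (\<integral>\<^sup>+x. indicator (cball 0 (\<rho> + 1)) (perp \<xi> \<eta> + x *\<^sub>R \<xi>) \<partial>lborel)"
      proof (rule nn_integral_mono)
        fix x :: real
        have "norm (perp \<xi> \<eta> + x *\<^sub>R \<xi>) \<le> \<rho> + 1" if "0 \<le> x" "x \<le> 1 / R"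
        proof -
          have "norm (x *\<^sub>R \<xi>) \<le> 1" using that R by (simp add: R_def[symmetric] field_simps)
          then show ?thesis using True norm_triangle_ineq[of "perp \<xi> \<eta>" "x *\<^sub>R \<xi>"] by simp
        qed
        then show "indicator {0..1 / R} x \<le> (indicator (cball 0 (\<rho> + 1)) (perp \<xi> \<eta> + x *\<^sub>R \<xi>) :: ennreal)"
          by (auto simp: indicator_def)
      qed
      finally show ?thesis using True by simp
    qed simp
  qed simp
  also have "(\<integral>\<^sup>+\<eta>. ennreal (slab \<xi> \<eta>) * (ennreal (1 / R) * indicator (cball 0 \<rho>) (perp \<xi> \<eta>)) \<partial>lborel) =
     (\<integral>\<^sup>+\<eta>. ennreal (slab \<xi> \<eta> / norm \<xi>) * indicator (cball 0 \<rho>) (perp \<xi> \<eta>) \<partial>lborel)"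
  proof (rule nn_integral_cong)
    fix \<eta> :: 'a
    have "ennreal (slab \<xi> \<eta> / norm \<xi>) = ennreal (slab \<xi> \<eta>) * ennreal (1 / R)"
      using R slab_nonneg[of \<xi> \<eta>] by (subst ennreal_mult[symmetric]) (auto simp: R_def)
    then show "ennreal (slab \<xi> \<eta>) * (ennreal (1 / R) * indicator (cball 0 \<rho>) (perp \<xi> \<eta>)) = ennreal (slab \<xi> \<eta> / norm \<xi>) * indicator (cball 0 \<rho>) (perp \<xi> \<eta>)"
      by (simp only: mult.assoc)
  qed
  finally show ?thesis .
qed (simp add: slab_def)

text \<open>Dominated convergence. On the support of v the weights \<open>wtA\<close> are bounded by
  a multiple of \<open>slab\<close> / |\<xi>|, uniformly in the smearing width, and
  \<open>slab_section_bound\<close> makes this majorant integrable also near \<eta>2 = a.\<close>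

lemma smeared_fibre_lines_limit:
  fixes a :: "'a::euclidean_space" and v :: "'a \<times> 'a \<Rightarrow> real"
  assumes s: "0 < s" and c: "continuous_on UNIV v" and v0: "\<And>x. 0 \<le> v x" "\<And>x. v x \<le> 1"
    and bd: "\<And>x. v x \<noteq> 0 \<Longrightarrow> norm (fst x) \<le> \<rho> \<and> norm (snd x) \<le> \<rho>"
    and e: "e \<longlonglongrightarrow> 0" "\<And>n. 0 < e n"
  defines "L \<equiv> \<integral>\<^sup>+\<eta>2. \<integral>\<^sup>+\<eta>. ennreal (wtA s a \<eta>2 \<eta> (- mgap s a \<eta>2 / (2 * sqrt (mgap s a \<eta>2))) *
       v (\<eta>2, ptA s a \<eta>2 \<eta> (- mgap s a \<eta>2 / (2 * sqrt (mgap s a \<eta>2))))) \<partial>lborel \<partial>lborel"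
  shows "(\<lambda>n. \<integral>\<^sup>+\<eta>2. ennreal (sqrt (mgap s a \<eta>2) / phi s (norm \<eta>2)) * (\<integral>\<^sup>+\<eta>4. ennreal (v (\<eta>2, \<eta>4)) * delta (e n) (resU s a \<eta>2 \<eta>4) \<partial>lborel) \<partial>lborel) \<longlonglongrightarrow> L"
    and "L < \<infinity>"
proof -
  have vm[measurable]: "v \<in> borel_measurable borel" using c by (rule borel_measurable_continuous_onI)
  have [measurable]: "cball (0::'a) r \<in> sets borel" for r by simp
  define F where "F t = (\<lambda>(\<eta>2, \<eta>, \<sigma>). wtA s a \<eta>2 \<eta> ((t * \<sigma> - mgap s a \<eta>2) / (2 * sqrt (mgap s a \<eta>2))) *
       v (\<eta>2, ptA s a \<eta>2 \<eta> ((t * \<sigma> - mgap s a \<eta>2) / (2 * sqrt (mgap s a \<eta>2)))))" for t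
  have [measurable]: "v \<in> borel_measurable (borel \<Otimes>\<^sub>M borel)" by (simp add: borel_prod)
  have [measurable]: "F t \<in> borel_measurable borel" for t unfolding F_def borel_prod[symmetric] by measurable
  define I where "I = (\<lambda>(\<eta>2::'a, \<eta>::'a, \<sigma>::real). indicator {0<..1} \<sigma> :: ennreal)"
  have [measurable]: "I \<in> borel_measurable borel" unfolding I_def borel_prod[symmetric] by measurable
  have seq: "(\<integral>\<^sup>+\<eta>2. ennreal (sqrt (mgap s a \<eta>2) / phi s (norm \<eta>2)) * (\<integral>\<^sup>+\<eta>4. ennreal (v (\<eta>2, \<eta>4)) * delta t (resU s a \<eta>2 \<eta>4) \<partial>lborel) \<partial>lborel) =
     (\<integral>\<^sup>+p. ennreal (F t p) * I p \<partial>lborel)" if "0 < t" for t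
    by (subst nn_integral_lborel_triple, measurable) (simp add: smeared_fibre_lines[OF s that vm v0(1)] F_def I_def)
  \<comment> \<open>At width 0 the integrand no longer depends on \<sigma>, and (0, 1] has length
    1.\<close>
  have L: "L = (\<integral>\<^sup>+p. ennreal (F 0 p) * I p \<partial>lborel)"
    by (subst nn_integral_lborel_triple, measurable) (simp add: L_def F_def I_def nn_integral_cmult)
  \<comment> \<open>From the lower bound s for \<open>phi\<close> and for the root in the
    denominator of \<open>wtA\<close>, and from the upper bound \<open>phi s \<rho>\<close> on the
    support of v.\<close>
  define B where "B = phi s \<rho> / (2 * s * s)"
  define W where "W = (\<lambda>(\<eta>2::'a, \<eta>, \<sigma>). ennreal B * (indicator (cball 0 \<rho>) \<eta>2 * (ennreal (slab (a - \<eta>2) \<eta> / norm (a - \<eta>2)) * indicator (cball 0 \<rho>) (perp (a - \<eta>2) \<eta>))) * indicator {0<..1::real} \<sigma>)"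
  have [measurable]: "W \<in> borel_measurable borel" unfolding W_def borel_prod[symmetric] by measurable
  have bound: "ennreal (F t p) * I p \<le> W p" for t p
  proof -
    obtain \<eta>2 \<eta> \<sigma> where p: "p = (\<eta>2, \<eta>, \<sigma>)" by (cases p) auto
    define y where "y = (t * \<sigma> - mgap s a \<eta>2) / (2 * sqrt (mgap s a \<eta>2))"
    define q where "q = ptA s a \<eta>2 \<eta> y"
    have F: "F t p = wtA s a \<eta>2 \<eta> y * v (\<eta>2, q)" by (simp add: F_def p y_def q_def)
    show ?thesis
    proof (cases "v (\<eta>2, q) = 0")
      case False
      then have b: "norm \<eta>2 \<le> \<rho>" "norm q \<le> \<rho>" using bd[of "(\<eta>2, q)"] by auto
      have pb: "norm (perp (a - \<eta>2) \<eta>) \<le> \<rho>"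
        using norm_perp_le_apt b(2) unfolding q_def ptA_def by (rule order_trans)
      have "F t p \<le> wtA s a \<eta>2 \<eta> y * 1" unfolding F by (intro mult_left_mono v0 wtA_nonneg s)
      also have "\<dots> \<le> B * (slab (a - \<eta>2) \<eta> / norm (a - \<eta>2))"
      proof -
        have "s \<le> sqrt (s\<^sup>2 + (norm (perp (a - \<eta>2) \<eta>))\<^sup>2 + y\<^sup>2)" by (rule real_le_rsqrt) simp
        moreover have "phi s (norm q) \<le> phi s \<rho>" using b by (intro phi_mono) auto
        moreover have "s \<le> phi s (norm \<eta>2)" by (rule phi_ge_mass[OF s])
        ultimately have "1 / (2 * phi s (norm \<eta>2)) * (phi s (norm q) / sqrt (s\<^sup>2 + (norm (perp (a - \<eta>2) \<eta>))\<^sup>2 + y\<^sup>2)) \<le> 1 / (2 * s) * (phi s \<rho> / s)"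
          using s phi_pos[OF s, of "norm q"] phi_pos[OF s, of \<rho>] by (intro mult_mono frac_le) auto
        then have "(1 / (2 * phi s (norm \<eta>2)) * (phi s (norm q) / sqrt (s\<^sup>2 + (norm (perp (a - \<eta>2) \<eta>))\<^sup>2 + y\<^sup>2))) * (slab (a - \<eta>2) \<eta> / norm (a - \<eta>2)) \<le> B * (slab (a - \<eta>2) \<eta> / norm (a - \<eta>2))"
          unfolding B_def using slab_nonneg[of "a - \<eta>2" \<eta>] by (intro mult_right_mono) auto
        then show ?thesis by (simp add: wtA_def q_def mult_ac)
      qed
      finally have "ennreal (F t p) \<le> ennreal B * ennreal (slab (a - \<eta>2) \<eta> / norm (a - \<eta>2))"
        using phi_pos[OF s, of \<rho>] s slab_nonneg[of "a - \<eta>2" \<eta>] by (subst ennreal_mult[symmetric]) (auto simp: B_def ennreal_leI less_imp_le)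
      then show ?thesis using b pb by (simp add: W_def I_def p mult_right_mono)
    qed (simp add: F)
  qed
  have Wfin: "(\<integral>\<^sup>+p. W p \<partial>lborel) < \<infinity>"
  proof -
    let ?K = "emeasure lborel (cball (0::'a) (\<rho> + 1))"
    have K: "?K < \<infinity>" by (rule emeasure_lborel_cball_finite)
    have "(\<integral>\<^sup>+p. W p \<partial>lborel) = (\<integral>\<^sup>+\<eta>2. ennreal B * (indicator (cball 0 \<rho>) \<eta>2 * (\<integral>\<^sup>+\<eta>. ennreal (slab (a - \<eta>2) \<eta> / norm (a - \<eta>2)) * indicator (cball 0 \<rho>) (perp (a - \<eta>2) \<eta>) \<partial>lborel)) \<partial>lborel)"
      by (subst nn_integral_lborel_triple, measurable) (simp add: W_def nn_integral_cmult)
    also have "\<dots> \<le> (\<integral>\<^sup>+\<eta>2. ennreal B * (indicator (cball (0::'a) \<rho>) \<eta>2 * ?K) \<partial>lborel)"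
      by (intro nn_integral_mono mult_left_mono slab_section_bound) auto
    also have "\<dots> = ennreal B * (emeasure lborel (cball (0::'a) \<rho>) * ?K)"
      by (simp add: nn_integral_cmult nn_integral_multc)
    also have "\<dots> < \<infinity>" using K emeasure_lborel_cball_finite[of "0::'a" \<rho>] by (simp add: ennreal_mult_less_top)
    finally show ?thesis .
  qed
  have Ftend: "(\<lambda>n. F (e n) p) \<longlonglongrightarrow> F 0 p" for p
  proof -
    obtain \<eta>2 \<eta> \<sigma> where p: "p = (\<eta>2, \<eta>, \<sigma>)" by (cases p) auto
    show ?thesis
    proof (cases "\<eta>2 = a")
      case True
      then show ?thesis by (simp add: F_def p wtA_def slab_def)
    next
      case False
      define y where "y t = (t * \<sigma> - mgap s a \<eta>2) / (2 * sqrt (mgap s a \<eta>2))" for t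
      have m: "0 < mgap s a \<eta>2" by (rule mgap_pos[OF s]) (use False in auto)
      have y: "(\<lambda>n. y (e n)) \<longlonglongrightarrow> y 0" unfolding y_def using m by (intro tendsto_intros e) auto
      have q: "(\<lambda>n. ptA s a \<eta>2 \<eta> (y (e n))) \<longlonglongrightarrow> ptA s a \<eta>2 \<eta> (y 0)"
      proof -
        have "sqrt ((norm (a - \<eta>2))\<^sup>2 - (phi s (norm a) - phi s (norm \<eta>2))\<^sup>2) * norm (a - \<eta>2) \<noteq> 0"
          using m False by (simp add: mgap_eq)
        then show ?thesis unfolding ptA_def apt_def by (intro tendsto_intros y)
      qed
      have ph: "(\<lambda>n. phi s (norm (ptA s a \<eta>2 \<eta> (y (e n))))) \<longlonglongrightarrow> phi s (norm (ptA s a \<eta>2 \<eta> (y 0)))"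
        unfolding phi_def by (intro tendsto_intros q)
      have "norm (a - \<eta>2) * sqrt (s\<^sup>2 + (norm (perp (a - \<eta>2) \<eta>))\<^sup>2 + (y 0)\<^sup>2) \<noteq> 0"
        using False s by (simp add: add_pos_nonneg less_imp_neq[symmetric])
      then have w: "(\<lambda>n. wtA s a \<eta>2 \<eta> (y (e n))) \<longlonglongrightarrow> wtA s a \<eta>2 \<eta> (y 0)"
        unfolding wtA_def by (intro tendsto_intros y ph)
      have "(\<lambda>n. v (\<eta>2, ptA s a \<eta>2 \<eta> (y (e n)))) \<longlonglongrightarrow> v (\<eta>2, ptA s a \<eta>2 \<eta> (y 0))"
        by (rule continuous_on_tendsto_compose[OF c]) (auto intro!: tendsto_intros q)
      from tendsto_mult[OF w this] show ?thesis by (simp add: F_def p y_def)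
    qed
  qed
  have "(\<lambda>n. \<integral>\<^sup>+p. ennreal (F (e n) p) * I p \<partial>lborel) \<longlonglongrightarrow> (\<integral>\<^sup>+p. ennreal (F 0 p) * I p \<partial>lborel)"
  proof (rule nn_integral_dominated_convergence[where w=W])
    show "AE p in lborel. (\<lambda>n. ennreal (F (e n) p) * I p) \<longlonglongrightarrow> ennreal (F 0 p) * I p"
      by (intro AE_I2 tendsto_mult_ennreal tendsto_ennrealI Ftend tendsto_const) (auto simp: I_def indicator_def of_bool_def split: if_splits)
  qed (use bound Wfin in auto)
  then show "(\<lambda>n. \<integral>\<^sup>+\<eta>2. ennreal (sqrt (mgap s a \<eta>2) / phi s (norm \<eta>2)) * (\<integral>\<^sup>+\<eta>4. ennreal (v (\<eta>2, \<eta>4)) * delta (e n) (resU s a \<eta>2 \<eta>4) \<partial>lborel) \<partial>lborel) \<longlonglongrightarrow> L"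
    unfolding L by (simp only: seq[OF e(2)])
  have "L \<le> (\<integral>\<^sup>+p. W p \<partial>lborel)" unfolding L by (intro nn_integral_mono bound)
  then show "L < \<infinity>" using Wfin by (rule le_less_trans)
qed

section \<open>Fibres over P1 and P4, parametrised by spheres\<close>

text \<open>\<open>cmass\<close> is the Lorentz length of \<open>P1 + P4\<close>. In the rest frame of this vector the equation \<open>resU = c\<close> for \<open>P2\<close>
  describes the sphere of radius \<open>radB\<close>.\<close>

definition cmass :: "real \<Rightarrow> 'a::euclidean_space \<Rightarrow> 'a \<Rightarrow> real" where
  "cmass s a \<eta>4 = sqrt ((phi s (norm a) + phi s (norm \<eta>4))\<^sup>2 - (norm (a + \<eta>4))\<^sup>2)"

definition radB :: "real \<Rightarrow> 'a::euclidean_space \<Rightarrow> 'a \<Rightarrow> real \<Rightarrow> real" where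
  "radB s a \<eta>4 c = sqrt ((cmass s a \<eta>4 / 2 + c / (2 * cmass s a \<eta>4))\<^sup>2 - s\<^sup>2)"

definition ptB :: "real \<Rightarrow> 'a::euclidean_space \<Rightarrow> 'a \<Rightarrow> real \<Rightarrow> 'a \<Rightarrow> 'a" where
  "ptB s a \<eta>4 c v = boost s (phi s (norm a) + phi s (norm \<eta>4)) (a + \<eta>4) ((radB s a \<eta>4 c / norm v) *\<^sub>R v)"

text \<open>Only the direction of v enters \<open>ptB\<close>; exp(- |v|) is the weight by which the
  whole space replaces the unit sphere. The power of the radius over 2 \<open>cmass\<close> is the
  Jacobian of \<open>nn_integral_radial_delta\<close>, and the root is the prefactor shared with the
  line parametrisation.\<close>

definition wtB :: "real \<Rightarrow> 'a::euclidean_space \<Rightarrow> 'a \<Rightarrow> real \<Rightarrow> 'a \<Rightarrow> real" where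
  "wtB s a \<eta>4 c v = exp (- norm v) * (radB s a \<eta>4 c ^ (DIM('a) - 2) / (2 * cmass s a \<eta>4)) * sqrt (mgap s a (ptB s a \<eta>4 c v))"

lemma cmass_measurable [measurable (raw)]:
  assumes [measurable]: "f \<in> borel_measurable M" "g \<in> borel_measurable M"
  shows "(\<lambda>x. cmass s (f x :: 'a::euclidean_space) (g x)) \<in> borel_measurable M"
  unfolding cmass_def by measurable

lemma radB_measurable [measurable (raw)]:
  assumes [measurable]: "f \<in> borel_measurable M" "g \<in> borel_measurable M" "h \<in> borel_measurable M"
  shows "(\<lambda>x. radB s (f x :: 'a::euclidean_space) (g x) (h x)) \<in> borel_measurable M"
  unfolding radB_def by measurable

lemma ptB_measurable [measurable (raw)]:
  assumes [measurable]: "f \<in> borel_measurable M" "g \<in> borel_measurable M" "h \<in> borel_measurable M" "k \<in> borel_measurable M"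
  shows "(\<lambda>x. ptB s (f x :: 'a::euclidean_space) (g x) (h x) (k x)) \<in> borel_measurable M"
  unfolding ptB_def by measurable

lemma wtB_measurable [measurable (raw)]:
  assumes [measurable]: "f \<in> borel_measurable M" "g \<in> borel_measurable M" "h \<in> borel_measurable M" "k \<in> borel_measurable M"
  shows "(\<lambda>x. wtB s (f x :: 'a::euclidean_space) (g x) (h x) (k x)) \<in> borel_measurable M"
  unfolding wtB_def by measurable

lemma cmass_power2:
  assumes s: "0 < s"
  shows "(cmass s a \<eta>4)\<^sup>2 = 4 * s\<^sup>2 + mgap s a \<eta>4" "2 * s \<le> cmass s a \<eta>4"
proof -
  have "(norm (a + \<eta>4))\<^sup>2 = a \<bullet> a + \<eta>4 \<bullet> \<eta>4 + 2 * (a \<bullet> \<eta>4)"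
    by (simp add: power2_norm_eq_inner inner_add_left inner_add_right inner_commute)
  then have e: "(phi s (norm a) + phi s (norm \<eta>4))\<^sup>2 - (norm (a + \<eta>4))\<^sup>2 = 4 * s\<^sup>2 + mgap s a \<eta>4"
    by (simp add: power2_sum phi_norm_power2 mgap_def algebra_simps)
  then show "(cmass s a \<eta>4)\<^sup>2 = 4 * s\<^sup>2 + mgap s a \<eta>4"
    unfolding cmass_def using mgap_nonneg[OF s, of a \<eta>4] by simp
  have "(2 * s)\<^sup>2 \<le> 4 * s\<^sup>2 + mgap s a \<eta>4" using mgap_nonneg[OF s, of a \<eta>4] by (simp add: power_mult_distrib)
  then show "2 * s \<le> cmass s a \<eta>4" unfolding cmass_def e by (rule real_le_rsqrt)
qed

lemma norm_add_less_phi: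
  assumes s: "0 < s" shows "norm (a + \<eta>4) < phi s (norm a) + phi s (norm \<eta>4)"
  using norm_triangle_ineq[of a \<eta>4] phi_gt[OF s norm_ge_zero, of a] phi_gt[OF s norm_ge_zero, of \<eta>4] by linarith

text \<open>As a function of P2, \<open>resU\<close> is twice the Lorentz product of P1 + P4 with
  P2, minus the square of \<open>cmass\<close>. By \<open>boost_energy\<close> this depends only on
  the energy in the rest frame.\<close>

lemma resU_boost:
  assumes s: "0 < s"
  shows "resU s a (boost s (phi s (norm a) + phi s (norm \<eta>4)) (a + \<eta>4) k) \<eta>4 = 2 * cmass s a \<eta>4 * phi s (norm k) - (cmass s a \<eta>4)\<^sup>2"
proof -
  define E where "E = phi s (norm a) + phi s (norm \<eta>4)"
  define b where "b = boost s E (a + \<eta>4) k"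
  have "resU s a b \<eta>4 = 2 * (E * phi s (norm b) - (a + \<eta>4) \<bullet> b) - (4 * s\<^sup>2 + mgap s a \<eta>4)"
    by (simp add: resU_def mgap_def E_def inner_diff_right inner_add_left inner_commute algebra_simps)
  also have "E * phi s (norm b) - (a + \<eta>4) \<bullet> b = cmass s a \<eta>4 * phi s (norm k)"
    unfolding b_def by (rule boost_energy) (simp_all add: E_def norm_add_less_phi[OF s] cmass_def)
  finally show ?thesis by (simp add: b_def E_def cmass_power2(1)[OF s])
qed

lemma radB_nonneg:
  assumes s: "0 < s" and c: "0 \<le> c"
  shows "0 \<le> radB s a \<eta>4 c" "radB s a \<eta>4 c \<le> cmass s a \<eta>4 / 2 + c / (2 * cmass s a \<eta>4)"
proof -
  define W where "W = cmass s a \<eta>4 / 2 + c / (2 * cmass s a \<eta>4)"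
  have M: "2 * s \<le> cmass s a \<eta>4" by (rule cmass_power2(2)[OF s])
  have "0 \<le> c / (2 * cmass s a \<eta>4)" using M s c by (intro divide_nonneg_nonneg) auto
  then have w: "s \<le> W" unfolding W_def using M by linarith
  have r: "radB s a \<eta>4 c = sqrt (W\<^sup>2 - s\<^sup>2)" by (simp add: radB_def W_def)
  have "s\<^sup>2 \<le> W\<^sup>2" using s w by (intro power_mono) auto
  then show "0 \<le> radB s a \<eta>4 c" by (simp add: r)
  have "sqrt (W\<^sup>2 - s\<^sup>2) \<le> sqrt (W\<^sup>2)" by (intro real_sqrt_le_mono) simp
  also have "\<dots> = W" using s w by simp
  finally show "radB s a \<eta>4 c \<le> cmass s a \<eta>4 / 2 + c / (2 * cmass s a \<eta>4)" unfolding r by (simp add: W_def)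
qed

text \<open>Boost invariance moves P2 to the rest frame of P1 + P4, where the constraint is radial.
  \<open>nn_integral_radial\<close> and \<open>nn_integral_radial_delta\<close> then reduce the
  smeared integral to directions and the rescaled \<sigma>.\<close>

lemma smeared_fibre_spheres:
  fixes a :: "'a::euclidean_space" and v :: "'a \<times> 'a \<Rightarrow> real"
  assumes s: "0 < s" and \<epsilon>: "0 < \<epsilon>" and vm[measurable]: "v \<in> borel_measurable borel" and v0: "\<And>x. 0 \<le> v x" and d: "2 \<le> DIM('a)"
  shows "ennreal (fact (DIM('a) - 1)) * (\<integral>\<^sup>+\<eta>2. ennreal (sqrt (mgap s a \<eta>2) / phi s (norm \<eta>2)) * (ennreal (v (\<eta>2, \<eta>4)) * delta \<epsilon> (resU s a \<eta>2 \<eta>4)) \<partial>lborel) =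
    (\<integral>\<^sup>+z. \<integral>\<^sup>+\<sigma>. ennreal (wtB s a \<eta>4 (\<epsilon> * \<sigma>) z * v (ptB s a \<eta>4 (\<epsilon> * \<sigma>) z, \<eta>4)) * indicator {0<..1} \<sigma> \<partial>lborel \<partial>lborel)"
proof -
  define E where "E = phi s (norm a) + phi s (norm \<eta>4)"
  define p where "p = a + \<eta>4"
  define M where "M = cmass s a \<eta>4"
  have pE: "norm p < E" unfolding p_def E_def by (rule norm_add_less_phi[OF s])
  have M: "2 * s \<le> M" "0 < M" using cmass_power2(2)[OF s, of a \<eta>4] s by (auto simp: M_def)
  have f0: "0 < phi s (norm k)" for k :: 'a by (rule phi_pos[OF s])
  define G where "G k = ennreal (sqrt (mgap s a k) * v (k, \<eta>4))" for k
  have G: "G k = ennreal (sqrt (mgap s a k)) * ennreal (v (k, \<eta>4))" for k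
    unfolding G_def using mgap_nonneg[OF s] v0 by (intro ennreal_mult) auto
  have [measurable]: "G \<in> borel_measurable borel" unfolding G_def by measurable
  have "(\<integral>\<^sup>+\<eta>2. ennreal (sqrt (mgap s a \<eta>2) / phi s (norm \<eta>2)) * (ennreal (v (\<eta>2, \<eta>4)) * delta \<epsilon> (resU s a \<eta>2 \<eta>4)) \<partial>lborel)
    = (\<integral>\<^sup>+\<eta>2. (G \<eta>2 * delta \<epsilon> (resU s a \<eta>2 \<eta>4)) * ennreal (1 / phi s (norm \<eta>2)) \<partial>lborel)"
  proof (rule nn_integral_cong)
    fix \<eta>2 :: 'a
    have "ennreal (sqrt (mgap s a \<eta>2) / phi s (norm \<eta>2)) = ennreal (sqrt (mgap s a \<eta>2)) * ennreal (1 / phi s (norm \<eta>2))"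
      using f0[of \<eta>2] mgap_nonneg[OF s, of a \<eta>2] by (subst ennreal_mult[symmetric]) auto
    then show "ennreal (sqrt (mgap s a \<eta>2) / phi s (norm \<eta>2)) * (ennreal (v (\<eta>2, \<eta>4)) * delta \<epsilon> (resU s a \<eta>2 \<eta>4)) = (G \<eta>2 * delta \<epsilon> (resU s a \<eta>2 \<eta>4)) * ennreal (1 / phi s (norm \<eta>2))"
      by (simp only: G mult_ac)
  qed
  also have "\<dots> = (\<integral>\<^sup>+k. (G (boost s E p k) * delta \<epsilon> (resU s a (boost s E p k) \<eta>4)) * ennreal (1 / phi s (norm k)) \<partial>lborel)"
    by (rule nn_integral_boost_invariant[OF _ s pE]) measurable
  also have "\<dots> = (\<integral>\<^sup>+k. G (boost s E p k) * delta \<epsilon> (2 * M * phi s (norm k) - M\<^sup>2) * ennreal (1 / phi s (norm k)) \<partial>lborel)"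
    unfolding E_def p_def M_def by (simp only: resU_boost[OF s])
  finally have 1: "(\<integral>\<^sup>+\<eta>2. ennreal (sqrt (mgap s a \<eta>2) / phi s (norm \<eta>2)) * (ennreal (v (\<eta>2, \<eta>4)) * delta \<epsilon> (resU s a \<eta>2 \<eta>4)) \<partial>lborel)
    = (\<integral>\<^sup>+k. G (boost s E p k) * delta \<epsilon> (2 * M * phi s (norm k) - M\<^sup>2) * ennreal (1 / phi s (norm k)) \<partial>lborel)" .
  have 2: "ennreal (fact (DIM('a) - 1)) * (\<integral>\<^sup>+k. G (boost s E p k) * delta \<epsilon> (2 * M * phi s (norm k) - M\<^sup>2) * ennreal (1 / phi s (norm k)) \<partial>lborel) =
    (\<integral>\<^sup>+z. ennreal (exp (- norm z) * norm z ^ DIM('a)) * (\<integral>\<^sup>+l. ennreal (l ^ (DIM('a) - 1)) *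
       (G (boost s E p (l *\<^sub>R z)) * delta \<epsilon> (2 * M * phi s (norm (l *\<^sub>R z)) - M\<^sup>2) * ennreal (1 / phi s (norm (l *\<^sub>R z)))) * indicator {0<..} l \<partial>lborel) \<partial>lborel)"
    by (rule nn_integral_radial) measurable
  have 3: "(\<integral>\<^sup>+z. ennreal (exp (- norm z) * norm z ^ DIM('a)) * (\<integral>\<^sup>+l. ennreal (l ^ (DIM('a) - 1)) *
       (G (boost s E p (l *\<^sub>R z)) * delta \<epsilon> (2 * M * phi s (norm (l *\<^sub>R z)) - M\<^sup>2) * ennreal (1 / phi s (norm (l *\<^sub>R z)))) * indicator {0<..} l \<partial>lborel) \<partial>lborel) =
    (\<integral>\<^sup>+z. \<integral>\<^sup>+\<sigma>. ennreal (wtB s a \<eta>4 (\<epsilon> * \<sigma>) z * v (ptB s a \<eta>4 (\<epsilon> * \<sigma>) z, \<eta>4)) * indicator {0<..1} \<sigma> \<partial>lborel \<partial>lborel)"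
  proof (rule nn_integral_cong_AE, use AE_lborel_singleton[of 0] in eventually_elim)
    fix z :: 'a assume z: "z \<noteq> 0"
    define V where "V = norm z"
    have V: "0 < V" using z by (simp add: V_def)
    have "(\<integral>\<^sup>+l. ennreal (l ^ (DIM('a) - 1)) *
       (G (boost s E p (l *\<^sub>R z)) * delta \<epsilon> (2 * M * phi s (norm (l *\<^sub>R z)) - M\<^sup>2) * ennreal (1 / phi s (norm (l *\<^sub>R z)))) * indicator {0<..} l \<partial>lborel) =
       (\<integral>\<^sup>+l. ennreal (l ^ (DIM('a) - 1) / phi s (l * V)) * G (boost s E p (l *\<^sub>R z)) * delta \<epsilon> (2 * M * phi s (l * V) - M\<^sup>2) * indicator {0<..} l \<partial>lborel)"
    proof (rule nn_integral_cong)
      fix l :: real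
      show "ennreal (l ^ (DIM('a) - 1)) * (G (boost s E p (l *\<^sub>R z)) * delta \<epsilon> (2 * M * phi s (norm (l *\<^sub>R z)) - M\<^sup>2) * ennreal (1 / phi s (norm (l *\<^sub>R z)))) * indicator {0<..} l =
        ennreal (l ^ (DIM('a) - 1) / phi s (l * V)) * G (boost s E p (l *\<^sub>R z)) * delta \<epsilon> (2 * M * phi s (l * V) - M\<^sup>2) * indicator {0<..} l"
      proof (cases "0 < l")
        case True
        then have n: "norm (l *\<^sub>R z) = l * V" by (simp add: V_def)
        have "ennreal (l ^ (DIM('a) - 1) / phi s (l * V)) = ennreal (l ^ (DIM('a) - 1)) * ennreal (1 / phi s (l * V))"
          using phi_pos[OF s, of "l * V"] True by (subst ennreal_mult[symmetric]) auto
        then show ?thesis by (simp only: n mult_ac)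
      qed simp
    qed
    also have "\<dots> = ennreal (1 / V ^ DIM('a)) * (\<integral>\<^sup>+\<sigma>. ennreal (radB s a \<eta>4 (\<epsilon> * \<sigma>) ^ (DIM('a) - 2) / (2 * M)) * G (boost s E p ((radB s a \<eta>4 (\<epsilon> * \<sigma>) / V) *\<^sub>R z)) * indicator {0<..1} \<sigma> \<partial>lborel)"
      unfolding radB_def M_def[symmetric] by (rule nn_integral_radial_delta[OF _ s \<epsilon> V M(1) d]) measurable
    finally have in1: "(\<integral>\<^sup>+l. ennreal (l ^ (DIM('a) - 1)) *
       (G (boost s E p (l *\<^sub>R z)) * delta \<epsilon> (2 * M * phi s (norm (l *\<^sub>R z)) - M\<^sup>2) * ennreal (1 / phi s (norm (l *\<^sub>R z)))) * indicator {0<..} l \<partial>lborel) =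
       ennreal (1 / V ^ DIM('a)) * (\<integral>\<^sup>+\<sigma>. ennreal (radB s a \<eta>4 (\<epsilon> * \<sigma>) ^ (DIM('a) - 2) / (2 * M)) * G (boost s E p ((radB s a \<eta>4 (\<epsilon> * \<sigma>) / V) *\<^sub>R z)) * indicator {0<..1} \<sigma> \<partial>lborel)" .
    have c: "ennreal (exp (- norm z) * norm z ^ DIM('a)) * (ennreal (1 / V ^ DIM('a)) * x) = ennreal (exp (- norm z)) * x" for x
    proof -
      have "ennreal (exp (- norm z) * norm z ^ DIM('a)) * ennreal (1 / V ^ DIM('a)) = ennreal (exp (- norm z))"
        using V by (subst ennreal_mult[symmetric]) (auto simp: V_def)
      then show ?thesis by (simp only: mult.assoc[symmetric])
    qed
    have in2: "ennreal (exp (- norm z)) * (\<integral>\<^sup>+\<sigma>. ennreal (radB s a \<eta>4 (\<epsilon> * \<sigma>) ^ (DIM('a) - 2) / (2 * M)) * G (boost s E p ((radB s a \<eta>4 (\<epsilon> * \<sigma>) / V) *\<^sub>R z)) * indicator {0<..1} \<sigma> \<partial>lborel)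
      = (\<integral>\<^sup>+\<sigma>. ennreal (wtB s a \<eta>4 (\<epsilon> * \<sigma>) z * v (ptB s a \<eta>4 (\<epsilon> * \<sigma>) z, \<eta>4)) * indicator {0<..1} \<sigma> \<partial>lborel)"
    proof (subst nn_integral_cmult[symmetric], measurable, rule nn_integral_cong)
      fix \<sigma> :: real
      show "ennreal (exp (- norm z)) * (ennreal (radB s a \<eta>4 (\<epsilon> * \<sigma>) ^ (DIM('a) - 2) / (2 * M)) * G (boost s E p ((radB s a \<eta>4 (\<epsilon> * \<sigma>) / V) *\<^sub>R z)) * indicator {0<..1} \<sigma>)
        = ennreal (wtB s a \<eta>4 (\<epsilon> * \<sigma>) z * v (ptB s a \<eta>4 (\<epsilon> * \<sigma>) z, \<eta>4)) * indicator {0<..1} \<sigma>"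
      proof (cases "\<sigma> \<in> {0<..1}")
        case True
        then have r: "0 \<le> radB s a \<eta>4 (\<epsilon> * \<sigma>)" using \<epsilon> by (intro radB_nonneg s) auto
        have b: "boost s E p ((radB s a \<eta>4 (\<epsilon> * \<sigma>) / V) *\<^sub>R z) = ptB s a \<eta>4 (\<epsilon> * \<sigma>) z"
          by (simp add: ptB_def E_def p_def V_def)
        have n2: "0 \<le> radB s a \<eta>4 (\<epsilon> * \<sigma>) ^ (DIM('a) - 2) / (2 * M)" using r M(2) by simp
        have "ennreal (exp (- norm z)) * (ennreal (radB s a \<eta>4 (\<epsilon> * \<sigma>) ^ (DIM('a) - 2) / (2 * M)) * G (ptB s a \<eta>4 (\<epsilon> * \<sigma>) z)) =
          ennreal (exp (- norm z) * (radB s a \<eta>4 (\<epsilon> * \<sigma>) ^ (DIM('a) - 2) / (2 * M) * (sqrt (mgap s a (ptB s a \<eta>4 (\<epsilon> * \<sigma>) z)) * v (ptB s a \<eta>4 (\<epsilon> * \<sigma>) z, \<eta>4))))"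
          unfolding G_def by (simp only: ennreal_mult'[OF n2] ennreal_mult'[OF exp_ge_zero])
        also have "exp (- norm z) * (radB s a \<eta>4 (\<epsilon> * \<sigma>) ^ (DIM('a) - 2) / (2 * M) * (sqrt (mgap s a (ptB s a \<eta>4 (\<epsilon> * \<sigma>) z)) * v (ptB s a \<eta>4 (\<epsilon> * \<sigma>) z, \<eta>4))) =
          wtB s a \<eta>4 (\<epsilon> * \<sigma>) z * v (ptB s a \<eta>4 (\<epsilon> * \<sigma>) z, \<eta>4)"
          by (simp only: wtB_def M_def mult.assoc)
        finally show ?thesis using True by (simp only: b mult.assoc[symmetric])
      qed simp
    qed
    show "ennreal (exp (- norm z) * norm z ^ DIM('a)) * (\<integral>\<^sup>+l. ennreal (l ^ (DIM('a) - 1)) *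
       (G (boost s E p (l *\<^sub>R z)) * delta \<epsilon> (2 * M * phi s (norm (l *\<^sub>R z)) - M\<^sup>2) * ennreal (1 / phi s (norm (l *\<^sub>R z)))) * indicator {0<..} l \<partial>lborel) =
      (\<integral>\<^sup>+\<sigma>. ennreal (wtB s a \<eta>4 (\<epsilon> * \<sigma>) z * v (ptB s a \<eta>4 (\<epsilon> * \<sigma>) z, \<eta>4)) * indicator {0<..1} \<sigma> \<partial>lborel)"
      by (simp only: in1 c in2)
  qed
  show ?thesis by (simp only: 1 2 3)
qed

lemma nn_integral_exp_norm: "(\<integral>\<^sup>+v. ennreal (exp (- norm (v::'a::euclidean_space))) \<partial>lborel) < \<infinity>"
proof -
  let ?A = "fact (2 * DIM('a)) :: real"
  have b: "exp (- norm v) \<le> 2 ^ DIM('a) * ?A * jweight v" for v :: 'a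
  proof -
    have "norm (exp (- norm v)) \<le> 2 ^ DIM('a) * ?A * jweight v"
    proof (rule jweight_bound)
      have "exp (- norm v) \<le> 1" by simp
      also have "1 \<le> ?A" by (rule fact_ge_1)
      finally show "norm (exp (- norm v)) \<le> ?A" by simp
      fix b :: 'a assume "b \<in> Basis"
      then have "\<bar>v \<bullet> b\<bar> ^ (2 * DIM('a)) \<le> norm v ^ (2 * DIM('a))" by (intro power_mono Basis_le_norm) auto
      also have "\<dots> \<le> ?A * exp (norm v)" by (rule power_le_fact_exp) simp
      finally have "\<bar>v \<bullet> b\<bar> ^ (2 * DIM('a)) * exp (- norm v) \<le> ?A * exp (norm v) * exp (- norm v)" by (rule mult_right_mono) simp
      then show "\<bar>v \<bullet> b\<bar> ^ (2 * DIM('a)) * norm (exp (- norm v)) \<le> ?A" by (simp add: mult.assoc exp_minus)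
    qed
    then show ?thesis by simp
  qed
  have "integrable lborel (\<lambda>v::'a. exp (- norm v))"
    by (rule Bochner_Integration.integrable_bound[of _ "\<lambda>v. 2 ^ DIM('a) * ?A * jweight v"])
      (use b integrable_jweight in \<open>auto intro: order_trans[OF _ abs_ge_self]\<close>)
  then show ?thesis by (subst (asm) integrable_iff_bounded) simp
qed

lemma mgap_bound_arith:
  fixes A A' x x' y :: real
  assumes "A \<le> A'" "- x \<le> x'" "0 \<le> y"
  shows "2 * (A - x - y) \<le> 2 * (A' + x')"
  using assms by simp

lemma boost_tendsto:
  assumes k: "k \<longlonglongrightarrow> l"
  shows "(\<lambda>n. boost s E p (k n)) \<longlonglongrightarrow> boost s E p l"
  unfolding boost_def Let_def phi_def divide_inverse
  by (rule tendsto_add[OF k]) (intro tendsto_intros k)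

text \<open>Dominated convergence with a constant multiple of exp(- |z|) as majorant: for P2 and P4
  in a bounded set and widths at most 1, radius and \<open>mgap\<close> stay bounded while
  \<open>cmass\<close> is at least 2 s.\<close>

lemma smeared_fibre_spheres_limit:
  fixes a :: "'a::euclidean_space" and v :: "'a \<times> 'a \<Rightarrow> real"
  assumes s: "0 < s" and c: "continuous_on UNIV v" and v0: "\<And>x. 0 \<le> v x" "\<And>x. v x \<le> 1" and d: "2 \<le> DIM('a)"
    and bd: "\<And>x. v x \<noteq> 0 \<Longrightarrow> norm (fst x) \<le> \<rho> \<and> norm (snd x) \<le> \<rho>" and \<rho>: "0 \<le> \<rho>"
    and e: "e \<longlonglongrightarrow> 0" "\<And>n. 0 < e n" "\<And>n. e n \<le> 1"
  shows "(\<lambda>n. \<integral>\<^sup>+\<eta>4. ennreal (fact (DIM('a) - 1)) * (\<integral>\<^sup>+\<eta>2. ennreal (sqrt (mgap s a \<eta>2) / phi s (norm \<eta>2)) * (ennreal (v (\<eta>2, \<eta>4)) * delta (e n) (resU s a \<eta>2 \<eta>4)) \<partial>lborel) \<partial>lborel) \<longlonglongrightarrow>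
    (\<integral>\<^sup>+\<eta>4. \<integral>\<^sup>+z. ennreal (wtB s a \<eta>4 0 z * v (ptB s a \<eta>4 0 z, \<eta>4)) \<partial>lborel \<partial>lborel)"
proof -
  have vm[measurable]: "v \<in> borel_measurable borel" using c by (rule borel_measurable_continuous_onI)
  have [measurable]: "v \<in> borel_measurable (borel \<Otimes>\<^sub>M borel)" by (simp add: borel_prod)
  have [measurable]: "cball (0::'a) r \<in> sets borel" for r by simp
  define F where "F t = (\<lambda>(\<eta>4::'a, z, \<sigma>). wtB s a \<eta>4 (t * \<sigma>) z * v (ptB s a \<eta>4 (t * \<sigma>) z, \<eta>4))" for t
  have [measurable]: "F t \<in> borel_measurable borel" for t unfolding F_def borel_prod[symmetric] by measurable
  define I where "I = (\<lambda>(\<eta>2::'a, \<eta>::'a, \<sigma>::real). indicator {0<..1} \<sigma> :: ennreal)"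
  have [measurable]: "I \<in> borel_measurable borel" unfolding I_def borel_prod[symmetric] by measurable
  have seq: "(\<integral>\<^sup>+\<eta>4. ennreal (fact (DIM('a) - 1)) * (\<integral>\<^sup>+\<eta>2. ennreal (sqrt (mgap s a \<eta>2) / phi s (norm \<eta>2)) * (ennreal (v (\<eta>2, \<eta>4)) * delta t (resU s a \<eta>2 \<eta>4)) \<partial>lborel) \<partial>lborel) =
     (\<integral>\<^sup>+p. ennreal (F t p) * I p \<partial>lborel)" if "0 < t" for t
    by (subst nn_integral_lborel_triple, measurable) (simp only: smeared_fibre_spheres[OF s that vm v0(1) d] F_def I_def split_conv)
  have L: "(\<integral>\<^sup>+\<eta>4. \<integral>\<^sup>+z. ennreal (wtB s a \<eta>4 0 z * v (ptB s a \<eta>4 0 z, \<eta>4)) \<partial>lborel \<partial>lborel) = (\<integral>\<^sup>+p. ennreal (F 0 p) * I p \<partial>lborel)"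
    by (subst nn_integral_lborel_triple, measurable) (simp add: F_def I_def nn_integral_cmult)
  define B1 where "B1 = sqrt (2 * (phi s (norm a) * phi s \<rho> + norm a * \<rho>))"
  \<comment> \<open>Bounds the radius: the first summand dominates \<open>cmass\<close> / 2, and 1 /
    (4 s) dominates c / (2 \<open>cmass\<close>) because c \<le> 1 and \<open>cmass\<close> \<ge> 2
    s.\<close>
  define B2 where "B2 = (phi s (norm a) + phi s \<rho>) / 2 + 1 / (4 * s)"
  define B where "B = B2 ^ (DIM('a) - 2) / (4 * s) * B1"
  have fp: "0 < phi s r" for r by (rule phi_pos[OF s])
  have B10: "0 \<le> B1" unfolding B1_def using fp[of "norm a"] fp[of \<rho>] \<rho> by (intro real_sqrt_ge_zero mult_nonneg_nonneg add_nonneg_nonneg) (auto simp: less_imp_le)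
  have B20: "0 \<le> B2" unfolding B2_def using fp[of "norm a"] fp[of \<rho>] s by (intro add_nonneg_nonneg divide_nonneg_nonneg) (auto simp: less_imp_le)
  define W where "W = (\<lambda>(\<eta>4::'a, z::'a, \<sigma>). ennreal B * (indicator (cball 0 \<rho>) \<eta>4 * (ennreal (exp (- norm z)) * indicator {0<..1::real} \<sigma>)))"
  have [measurable]: "W \<in> borel_measurable borel" unfolding W_def borel_prod[symmetric] by measurable
  have bound: "ennreal (F t p) * I p \<le> W p" if t: "0 \<le> t" "t \<le> 1" for t p
  proof -
    obtain \<eta>4 z \<sigma> where p: "p = (\<eta>4, z, \<sigma>)" by (cases p) auto
    define q where "q = ptB s a \<eta>4 (t * \<sigma>) z"
    have F: "F t p = wtB s a \<eta>4 (t * \<sigma>) z * v (q, \<eta>4)" by (simp add: F_def p q_def)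
    show ?thesis
    proof (cases "v (q, \<eta>4) = 0 \<or> \<sigma> \<notin> {0<..1}")
      case False
      then have b: "norm \<eta>4 \<le> \<rho>" "norm q \<le> \<rho>" and \<sigma>: "0 < \<sigma>" "\<sigma> \<le> 1" using bd[of "(q, \<eta>4)"] by auto
      have ts: "0 \<le> t * \<sigma>" "t * \<sigma> \<le> 1" using t \<sigma> by (auto intro: mult_le_one)
      define M where "M = cmass s a \<eta>4"
      have M: "2 * s \<le> M" unfolding M_def by (rule cmass_power2(2)[OF s])
      have M2: "M \<le> phi s (norm a) + phi s \<rho>"
      proof -
        have "M \<le> sqrt ((phi s (norm a) + phi s (norm \<eta>4))\<^sup>2)" unfolding M_def cmass_def by (intro real_sqrt_le_mono) simp
        also have "\<dots> = phi s (norm a) + phi s (norm \<eta>4)" using fp[of "norm a"] fp[of "norm \<eta>4"] by simp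
        also have "phi s (norm \<eta>4) \<le> phi s \<rho>" using b by (intro phi_mono) auto
        finally show ?thesis by simp
      qed
      have r: "0 \<le> radB s a \<eta>4 (t * \<sigma>)" "radB s a \<eta>4 (t * \<sigma>) \<le> B2"
      proof -
        show "0 \<le> radB s a \<eta>4 (t * \<sigma>)" by (rule radB_nonneg(1)[OF s ts(1)])
        have "radB s a \<eta>4 (t * \<sigma>) \<le> M / 2 + (t * \<sigma>) / (2 * M)" unfolding M_def by (rule radB_nonneg(2)[OF s ts(1)])
        also have "(t * \<sigma>) / (2 * M) \<le> 1 / (4 * s)" using ts M s by (intro frac_le) auto
        finally show "radB s a \<eta>4 (t * \<sigma>) \<le> B2" using M2 unfolding B2_def by (simp add: add_divide_distrib)
      qed
      have m: "sqrt (mgap s a q) \<le> B1"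
      proof -
        have "phi s (norm q) \<le> phi s \<rho>" using b by (intro phi_mono) auto
        then have "phi s (norm a) * phi s (norm q) \<le> phi s (norm a) * phi s \<rho>" using fp[of "norm a"] by (intro mult_left_mono) auto
        moreover have "- (a \<bullet> q) \<le> norm a * \<rho>"
        proof -
          have "- (a \<bullet> q) \<le> norm a * norm q" using Cauchy_Schwarz_ineq2[of a q] by linarith
          also have "\<dots> \<le> norm a * \<rho>" using b by (intro mult_left_mono) auto
          finally show ?thesis .
        qed
        moreover have "0 \<le> s\<^sup>2" by simp
        ultimately have "mgap s a q \<le> 2 * (phi s (norm a) * phi s \<rho> + norm a * \<rho>)" unfolding mgap_def by (rule mgap_bound_arith)
        then show ?thesis unfolding B1_def by (rule real_sqrt_le_mono)
      qed
      have "wtB s a \<eta>4 (t * \<sigma>) z \<le> exp (- norm z) * (B2 ^ (DIM('a) - 2) / (4 * s)) * B1"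
      proof -
        have h: "radB s a \<eta>4 (t * \<sigma>) ^ (DIM('a) - 2) / (2 * M) \<le> B2 ^ (DIM('a) - 2) / (4 * s)"
        proof (rule frac_le)
          show "radB s a \<eta>4 (t * \<sigma>) ^ (DIM('a) - 2) \<le> B2 ^ (DIM('a) - 2)" by (rule power_mono[OF r(2) r(1)])
        qed (use M s B20 in auto)
        show ?thesis unfolding wtB_def q_def[symmetric] M_def[symmetric]
          by (rule mult_mono[OF mult_left_mono[OF h] m]) (use mgap_nonneg[OF s, of a q] B20 s in auto)
      qed
      then have "wtB s a \<eta>4 (t * \<sigma>) z * v (q, \<eta>4) \<le> (exp (- norm z) * (B2 ^ (DIM('a) - 2) / (4 * s)) * B1) * 1"
        using B10 B20 s by (intro mult_mono v0) auto
      then have "F t p \<le> B * exp (- norm z)" unfolding F by (simp add: B_def mult_ac)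
      moreover have "0 \<le> B" unfolding B_def using B10 B20 s by simp
      ultimately have "ennreal (F t p) \<le> ennreal B * ennreal (exp (- norm z))" by (subst ennreal_mult[symmetric]) (auto intro: ennreal_leI)
      then show ?thesis using b \<sigma> by (simp add: W_def I_def p)
    next
      case True
      then show ?thesis
      proof
        assume "v (q, \<eta>4) = 0"
        then have "F t p = 0" by (simp add: F)
        then show ?thesis by simp
      next
        assume "\<sigma> \<notin> {0<..1}"
        then have "I p = 0" by (simp add: I_def p)
        then show ?thesis by simp
      qed
    qed
  qed
  have Wfin: "(\<integral>\<^sup>+p. W p \<partial>lborel) < \<infinity>"
  proof -
    have "(\<integral>\<^sup>+p. W p \<partial>lborel) = ennreal B * (emeasure lborel (cball (0::'a) \<rho>) * (\<integral>\<^sup>+z. ennreal (exp (- norm (z::'a))) \<partial>lborel))"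
      by (subst nn_integral_lborel_triple, measurable) (simp add: W_def nn_integral_cmult nn_integral_multc)
    also have "\<dots> < \<infinity>" using nn_integral_exp_norm[where ?'a='a] emeasure_lborel_cball_finite[of "0::'a" \<rho>] by (simp add: ennreal_mult_less_top)
    finally show ?thesis .
  qed
  have Ftend: "(\<lambda>n. F (e n) p) \<longlonglongrightarrow> F 0 p" for p
  proof -
    obtain \<eta>4 z \<sigma> where p: "p = (\<eta>4, z, \<sigma>)" by (cases p) auto
    have r: "(\<lambda>n. radB s a \<eta>4 (e n * \<sigma>)) \<longlonglongrightarrow> radB s a \<eta>4 (0 * \<sigma>)"
      unfolding radB_def divide_inverse by (intro tendsto_intros e)
    have r': "(\<lambda>n. (radB s a \<eta>4 (e n * \<sigma>) / norm z) *\<^sub>R z) \<longlonglongrightarrow> (radB s a \<eta>4 (0 * \<sigma>) / norm z) *\<^sub>R z"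
      unfolding divide_inverse by (intro tendsto_intros r)
    have q: "(\<lambda>n. ptB s a \<eta>4 (e n * \<sigma>) z) \<longlonglongrightarrow> ptB s a \<eta>4 (0 * \<sigma>) z"
      unfolding ptB_def by (rule boost_tendsto[OF r'])
    have mq: "(\<lambda>n. sqrt (mgap s a (ptB s a \<eta>4 (e n * \<sigma>) z))) \<longlonglongrightarrow> sqrt (mgap s a (ptB s a \<eta>4 (0 * \<sigma>) z))"
      unfolding mgap_def phi_def by (intro tendsto_intros q)
    have w: "(\<lambda>n. wtB s a \<eta>4 (e n * \<sigma>) z) \<longlonglongrightarrow> wtB s a \<eta>4 (0 * \<sigma>) z"
      unfolding wtB_def divide_inverse by (intro tendsto_intros r mq)
    have "(\<lambda>n. v (ptB s a \<eta>4 (e n * \<sigma>) z, \<eta>4)) \<longlonglongrightarrow> v (ptB s a \<eta>4 (0 * \<sigma>) z, \<eta>4)"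
      by (rule continuous_on_tendsto_compose[OF c tendsto_Pair[OF q tendsto_const]]) auto
    from tendsto_mult[OF w this] show ?thesis by (simp add: F_def p)
  qed
  have "(\<lambda>n. \<integral>\<^sup>+p. ennreal (F (e n) p) * I p \<partial>lborel) \<longlonglongrightarrow> (\<integral>\<^sup>+p. ennreal (F 0 p) * I p \<partial>lborel)"
  proof (rule nn_integral_dominated_convergence[where w=W])
    show "AE p in lborel. (\<lambda>n. ennreal (F (e n) p) * I p) \<longlonglongrightarrow> ennreal (F 0 p) * I p"
      by (intro AE_I2 tendsto_mult_ennreal tendsto_ennrealI Ftend tendsto_const) (auto simp: I_def indicator_def of_bool_def split: if_splits)
  qed (use bound e Wfin in \<open>auto simp: less_imp_le\<close>)
  then show ?thesis unfolding L by (simp only: seq[OF e(2)])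
qed

text \<open>For fixed \<open>a\<close>, both sides are the measure \<open>\<delta>(resU)\<close> on pairs \<open>(\<eta>2, \<eta>4)\<close>, disintegrated over \<open>\<eta>2\<close> (lines) and over
  \<open>\<eta>4\<close> (spheres). The Dirac mass is approximated by \<open>delta\<close>, for which the identity is Tonelli's theorem.\<close>

lemma fibre_lines_eq_spheres:
  fixes a :: "'a::euclidean_space" and \<Psi> :: "'a \<times> 'a \<Rightarrow> ennreal"
  assumes s: "0 < s" and d: "2 \<le> DIM('a)" and \<Psi>: "\<Psi> \<in> borel_measurable borel"
  shows "ennreal (fact (DIM('a) - 1)) * (\<integral>\<^sup>+\<eta>2. \<integral>\<^sup>+\<eta>. ennreal (wtA s a \<eta>2 \<eta> (- mgap s a \<eta>2 / (2 * sqrt (mgap s a \<eta>2)))) *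
       \<Psi> (\<eta>2, ptA s a \<eta>2 \<eta> (- mgap s a \<eta>2 / (2 * sqrt (mgap s a \<eta>2)))) \<partial>lborel \<partial>lborel) =
     (\<integral>\<^sup>+\<eta>4. \<integral>\<^sup>+z. ennreal (wtB s a \<eta>4 0 z) * \<Psi> (ptB s a \<eta>4 0 z, \<eta>4) \<partial>lborel \<partial>lborel)"
proof -
  define y0 where "y0 \<eta>2 = - mgap s a \<eta>2 / (2 * sqrt (mgap s a \<eta>2))" for \<eta>2
  have [measurable]: "y0 \<in> borel_measurable borel" unfolding y0_def by measurable
  let ?C = "ennreal (fact (DIM('a) - 1))"
  define kA where "kA = (\<lambda>(\<eta>2, \<eta>). ?C * ennreal (wtA s a \<eta>2 \<eta> (y0 \<eta>2)))"
  define TA where "TA = (\<lambda>(\<eta>2, \<eta>). (\<eta>2, ptA s a \<eta>2 \<eta> (y0 \<eta>2)))"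
  define kB where "kB = (\<lambda>(\<eta>4, z). ennreal (wtB s a \<eta>4 0 z))"
  define TB where "TB = (\<lambda>(\<eta>4, z). (ptB s a \<eta>4 0 z, \<eta>4))"
  have [measurable]: "kA \<in> borel_measurable borel" "kB \<in> borel_measurable borel" "TA \<in> borel_measurable borel" "TB \<in> borel_measurable borel"
    unfolding kA_def kB_def TA_def TB_def borel_prod[symmetric] by measurable
  \<comment> \<open>Both sides are integrals of \<Psi> against image measures. Equality for every
    Borel \<Psi> thus follows from equality of two measures, which need only be tested on continuous
    v of bounded support, where the smeared limits are available.\<close>
  define \<mu>A where "\<mu>A = distr (density lborel kA) borel TA"
  define \<mu>B where "\<mu>B = distr (density lborel kB) borel TB"
  have iA: "(\<integral>\<^sup>+x. \<Phi> x \<partial>\<mu>A) = ?C * (\<integral>\<^sup>+\<eta>2. \<integral>\<^sup>+\<eta>. ennreal (wtA s a \<eta>2 \<eta> (y0 \<eta>2)) * \<Phi> (\<eta>2, ptA s a \<eta>2 \<eta> (y0 \<eta>2)) \<partial>lborel \<partial>lborel)"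
    if m: "\<Phi> \<in> borel_measurable borel" for \<Phi>
  proof -
    note [measurable] = m
    have [measurable]: "\<Phi> \<in> borel_measurable (borel \<Otimes>\<^sub>M borel)" using m by (simp add: borel_prod)
    have "(\<integral>\<^sup>+x. \<Phi> x \<partial>\<mu>A) = (\<integral>\<^sup>+p. kA p * \<Phi> (TA p) \<partial>lborel)"
      unfolding \<mu>A_def by (simp add: nn_integral_distr nn_integral_density)
    also have "\<dots> = (\<integral>\<^sup>+\<eta>2. \<integral>\<^sup>+\<eta>. ?C * (ennreal (wtA s a \<eta>2 \<eta> (y0 \<eta>2)) * \<Phi> (\<eta>2, ptA s a \<eta>2 \<eta> (y0 \<eta>2))) \<partial>lborel \<partial>lborel)"
      by (subst nn_integral_lborel_pair, measurable) (simp add: kA_def TA_def mult.assoc)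
    also have "\<dots> = (\<integral>\<^sup>+\<eta>2. ?C * (\<integral>\<^sup>+\<eta>. (ennreal (wtA s a \<eta>2 \<eta> (y0 \<eta>2)) * \<Phi> (\<eta>2, ptA s a \<eta>2 \<eta> (y0 \<eta>2))) \<partial>lborel) \<partial>lborel)"
      by (intro nn_integral_cong nn_integral_cmult) measurable
    also have "\<dots> = ?C * (\<integral>\<^sup>+\<eta>2. \<integral>\<^sup>+\<eta>. ennreal (wtA s a \<eta>2 \<eta> (y0 \<eta>2)) * \<Phi> (\<eta>2, ptA s a \<eta>2 \<eta> (y0 \<eta>2)) \<partial>lborel \<partial>lborel)"
      by (rule nn_integral_cmult) measurable
    finally show ?thesis .
  qed
  have iB: "(\<integral>\<^sup>+x. \<Phi> x \<partial>\<mu>B) = (\<integral>\<^sup>+\<eta>4. \<integral>\<^sup>+z. ennreal (wtB s a \<eta>4 0 z) * \<Phi> (ptB s a \<eta>4 0 z, \<eta>4) \<partial>lborel \<partial>lborel)"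
    if m[measurable]: "\<Phi> \<in> borel_measurable borel" for \<Phi>
  proof -
    have "(\<integral>\<^sup>+x. \<Phi> x \<partial>\<mu>B) = (\<integral>\<^sup>+p. kB p * \<Phi> (TB p) \<partial>lborel)"
      unfolding \<mu>B_def by (simp add: nn_integral_distr nn_integral_density)
    then show ?thesis
      by (subst (asm) nn_integral_lborel_pair, measurable) (simp add: kB_def TB_def)
  qed
  have "\<mu>A = \<mu>B"
  proof (rule nn_integral_Cc_imp_measure_eq)
    show "sets \<mu>A = sets borel" "sets \<mu>B = sets borel" by (simp_all add: \<mu>A_def \<mu>B_def)
    fix v :: "'a \<times> 'a \<Rightarrow> real"
    assume v: "continuous_on UNIV v" "\<And>x. 0 \<le> v x" "\<And>x. v x \<le> 1" "bounded {x. v x \<noteq> 0}"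
    have vm[measurable]: "v \<in> borel_measurable borel" using v(1) by (rule borel_measurable_continuous_onI)
    obtain r where r: "\<And>x. v x \<noteq> 0 \<Longrightarrow> norm x \<le> r" using v(4) unfolding bounded_iff by blast
    define \<rho> where "\<rho> = max 0 r"
    have bd: "norm (fst x) \<le> \<rho> \<and> norm (snd x) \<le> \<rho>" if "v x \<noteq> 0" for x
      using r[OF that] norm_fst_le[of "fst x" "snd x"] norm_snd_le[of "snd x" "fst x"] by (auto simp: \<rho>_def)
    define e where "e n = 1 / real (Suc n)" for n
    have e: "e \<longlonglongrightarrow> 0" "\<And>n. 0 < e n" "\<And>n. e n \<le> 1"
    proof -
      show "e \<longlonglongrightarrow> 0" unfolding e_def using LIMSEQ_inverse_real_of_nat by (simp add: divide_inverse)
    qed (auto simp: e_def)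
    let ?w = "\<lambda>\<eta>2. ennreal (sqrt (mgap s a \<eta>2) / phi s (norm \<eta>2))"
    \<comment> \<open>Before the limit both smeared quantities are the same double integral over
      \<eta>2 and \<eta>4.\<close>
    have sw: "?C * (\<integral>\<^sup>+\<eta>2. ?w \<eta>2 * (\<integral>\<^sup>+\<eta>4. ennreal (v (\<eta>2, \<eta>4)) * delta t (resU s a \<eta>2 \<eta>4) \<partial>lborel) \<partial>lborel) =
      (\<integral>\<^sup>+\<eta>4. ?C * (\<integral>\<^sup>+\<eta>2. ?w \<eta>2 * (ennreal (v (\<eta>2, \<eta>4)) * delta t (resU s a \<eta>2 \<eta>4)) \<partial>lborel) \<partial>lborel)" for t
    proof -
      have [measurable]: "v \<in> borel_measurable (borel \<Otimes>\<^sub>M borel)" using vm by (simp add: borel_prod)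
      have "(\<integral>\<^sup>+\<eta>2. ?w \<eta>2 * (\<integral>\<^sup>+\<eta>4. ennreal (v (\<eta>2, \<eta>4)) * delta t (resU s a \<eta>2 \<eta>4) \<partial>lborel) \<partial>lborel) =
         (\<integral>\<^sup>+\<eta>2. (\<integral>\<^sup>+\<eta>4. ?w \<eta>2 * (ennreal (v (\<eta>2, \<eta>4)) * delta t (resU s a \<eta>2 \<eta>4)) \<partial>lborel) \<partial>lborel)"
        by (intro nn_integral_cong nn_integral_cmult[symmetric]) measurable
      also have "\<dots> = (\<integral>\<^sup>+\<eta>4. (\<integral>\<^sup>+\<eta>2. ?w \<eta>2 * (ennreal (v (\<eta>2, \<eta>4)) * delta t (resU s a \<eta>2 \<eta>4)) \<partial>lborel) \<partial>lborel)"
        by (rule lborel_pair.Fubini') measurable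
      finally have q: "(\<integral>\<^sup>+\<eta>2. ?w \<eta>2 * (\<integral>\<^sup>+\<eta>4. ennreal (v (\<eta>2, \<eta>4)) * delta t (resU s a \<eta>2 \<eta>4) \<partial>lborel) \<partial>lborel) =
        (\<integral>\<^sup>+\<eta>4. (\<integral>\<^sup>+\<eta>2. ?w \<eta>2 * (ennreal (v (\<eta>2, \<eta>4)) * delta t (resU s a \<eta>2 \<eta>4)) \<partial>lborel) \<partial>lborel)" .
      show ?thesis unfolding q by (rule nn_integral_cmult[symmetric]) measurable
    qed
    have mv: "(\<lambda>x. ennreal (v x)) \<in> borel_measurable borel" by measurable
    have "(\<lambda>n. ?C * (\<integral>\<^sup>+\<eta>2. ?w \<eta>2 * (\<integral>\<^sup>+\<eta>4. ennreal (v (\<eta>2, \<eta>4)) * delta (e n) (resU s a \<eta>2 \<eta>4) \<partial>lborel) \<partial>lborel)) \<longlonglongrightarrow>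
       ?C * (\<integral>\<^sup>+\<eta>2. \<integral>\<^sup>+\<eta>. ennreal (wtA s a \<eta>2 \<eta> (y0 \<eta>2) * v (\<eta>2, ptA s a \<eta>2 \<eta> (y0 \<eta>2))) \<partial>lborel \<partial>lborel)"
      unfolding y0_def by (intro ennreal_tendsto_cmult smeared_fibre_lines_limit(1)[OF s v(1-3) bd e(1,2)]) auto
    also have "?C * (\<integral>\<^sup>+\<eta>2. \<integral>\<^sup>+\<eta>. ennreal (wtA s a \<eta>2 \<eta> (y0 \<eta>2) * v (\<eta>2, ptA s a \<eta>2 \<eta> (y0 \<eta>2))) \<partial>lborel \<partial>lborel) = (\<integral>\<^sup>+x. ennreal (v x) \<partial>\<mu>A)"
      by (subst iA[OF mv]) (simp add: ennreal_mult' wtA_nonneg[OF s])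
    finally have limA: "(\<lambda>n. ?C * (\<integral>\<^sup>+\<eta>2. ?w \<eta>2 * (\<integral>\<^sup>+\<eta>4. ennreal (v (\<eta>2, \<eta>4)) * delta (e n) (resU s a \<eta>2 \<eta>4) \<partial>lborel) \<partial>lborel)) \<longlonglongrightarrow> (\<integral>\<^sup>+x. ennreal (v x) \<partial>\<mu>A)" .
    have "(\<lambda>n. \<integral>\<^sup>+\<eta>4. ?C * (\<integral>\<^sup>+\<eta>2. ?w \<eta>2 * (ennreal (v (\<eta>2, \<eta>4)) * delta (e n) (resU s a \<eta>2 \<eta>4)) \<partial>lborel) \<partial>lborel) \<longlonglongrightarrow>
      (\<integral>\<^sup>+\<eta>4. \<integral>\<^sup>+z. ennreal (wtB s a \<eta>4 0 z * v (ptB s a \<eta>4 0 z, \<eta>4)) \<partial>lborel \<partial>lborel)"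
      by (rule smeared_fibre_spheres_limit[OF s v(1-3) d bd _ e]) (auto simp: \<rho>_def)
    also have "(\<integral>\<^sup>+\<eta>4. \<integral>\<^sup>+z. ennreal (wtB s a \<eta>4 0 z * v (ptB s a \<eta>4 0 z, \<eta>4)) \<partial>lborel \<partial>lborel) = (\<integral>\<^sup>+x. ennreal (v x) \<partial>\<mu>B)"
      by (subst iB[OF mv]) (simp add: ennreal_mult'' v(2))
    finally have limB: "(\<lambda>n. \<integral>\<^sup>+\<eta>4. ?C * (\<integral>\<^sup>+\<eta>2. ?w \<eta>2 * (ennreal (v (\<eta>2, \<eta>4)) * delta (e n) (resU s a \<eta>2 \<eta>4)) \<partial>lborel) \<partial>lborel) \<longlonglongrightarrow> (\<integral>\<^sup>+x. ennreal (v x) \<partial>\<mu>B)" .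
    have "(\<integral>\<^sup>+x. ennreal (v x) \<partial>\<mu>A) = (\<integral>\<^sup>+x. ennreal (v x) \<partial>\<mu>B)"
      by (rule LIMSEQ_unique[OF limA limB[folded sw]])
    moreover have "(\<integral>\<^sup>+x. ennreal (v x) \<partial>\<mu>A) < \<infinity>"
    proof -
      have "(\<integral>\<^sup>+\<eta>2. \<integral>\<^sup>+\<eta>. ennreal (wtA s a \<eta>2 \<eta> (y0 \<eta>2) * v (\<eta>2, ptA s a \<eta>2 \<eta> (y0 \<eta>2))) \<partial>lborel \<partial>lborel) < \<infinity>"
        unfolding y0_def by (rule smeared_fibre_lines_limit(2)[OF s v(1-3) bd e(1,2)])
      then show ?thesis by (subst iA[OF mv]) (simp add: ennreal_mult'[symmetric] wtA_nonneg[OF s] ennreal_mult_less_top)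
    qed
    ultimately show "(\<integral>\<^sup>+x. ennreal (v x) \<partial>\<mu>A) = (\<integral>\<^sup>+x. ennreal (v x) \<partial>\<mu>B) \<and> (\<integral>\<^sup>+x. ennreal (v x) \<partial>\<mu>A) < \<infinity>" by simp
  qed
  then show ?thesis using iA[OF \<Psi>] iB[OF \<Psi>] by (simp only: y0_def)
qed

section \<open>The energy difference as a coordinate along a line\<close>

lemma UN_Icc_symmetric:
  assumes R: "0 < (R::real)"
  shows "(\<Union>n. {- (R - R / real (Suc n))..R - R / real (Suc n)}) = {- R<..<R}"
proof (intro equalityI subsetI)
  fix x assume "x \<in> (\<Union>n. {- (R - R / real (Suc n))..R - R / real (Suc n)})"
  then obtain n where "- (R - R / real (Suc n)) \<le> x" "x \<le> R - R / real (Suc n)" by auto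
  moreover have "0 < R / real (Suc n)" using R by simp
  ultimately show "x \<in> {- R<..<R}" by auto
next
  fix x assume x: "x \<in> {- R<..<R}"
  then have "0 < R - \<bar>x\<bar>" by auto
  then obtain n where n: "R < real n * (R - \<bar>x\<bar>)" using reals_Archimedean3 by blast
  have "real n * (R - \<bar>x\<bar>) \<le> real (Suc n) * (R - \<bar>x\<bar>)" using \<open>0 < R - \<bar>x\<bar>\<close> by (intro mult_right_mono) auto
  with n have "R \<le> real (Suc n) * (R - \<bar>x\<bar>)" by linarith
  then have "R / real (Suc n) \<le> R - \<bar>x\<bar>" by (simp add: pos_divide_le_eq mult.commute)
  then show "x \<in> (\<Union>n. {- (R - R / real (Suc n))..R - R / real (Suc n)})" by (intro UN_I[of n]) auto
qed

text \<open>Inverts \<tau> = sqrt(S + (x + 1)^2 R^2) - sqrt(S + x^2 R^2). The sum of the two roots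
  is 2 R \<omega>, and the difference of their squares, (2 x + 1) R^2, equals \<tau> times that sum,
  whence x = \<tau> \<omega> / R - 1 / 2. The difference ranges over the open interval (- R,
  R).\<close>

lemma nn_integral_energy_substitution:
  fixes f :: "real \<Rightarrow> ennreal" and S R :: real
  assumes [measurable]: "f \<in> borel_measurable borel" and S: "0 < S" and R: "0 < R"
  defines "\<omega> \<equiv> \<lambda>\<tau>. sqrt (S / (R\<^sup>2 - \<tau>\<^sup>2) + 1 / 4)"
  shows "(\<integral>\<^sup>+x. f x \<partial>lborel) = (\<integral>\<^sup>+\<tau>. f (\<tau> * \<omega> \<tau> / R - 1 / 2) *
    ennreal ((R\<^sup>2 * (\<omega> \<tau>)\<^sup>2 - \<tau>\<^sup>2 / 4) / ((R\<^sup>2 - \<tau>\<^sup>2) * \<omega> \<tau> * R)) * indicator {- R<..<R} \<tau> \<partial>lborel)"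
proof -
  define I where "I = {- R<..<R}"
  define m where "m \<tau> = R\<^sup>2 - \<tau>\<^sup>2" for \<tau>
  have m: "0 < m \<tau>" if "\<tau> \<in> I" for \<tau>
  proof -
    have "\<tau>\<^sup>2 < R\<^sup>2" using that R by (intro power2_strict_mono) (auto simp: I_def)
    then show ?thesis by (simp add: m_def)
  qed
  have w2: "0 < S / m \<tau> + 1 / 4" if "\<tau> \<in> I" for \<tau> using m[OF that] S by (simp add: add_pos_pos)
  have w: "0 < \<omega> \<tau>" "(\<omega> \<tau>)\<^sup>2 = S / m \<tau> + 1 / 4" if "\<tau> \<in> I" for \<tau> using w2[OF that] by (simp_all add: \<omega>_def m_def)
  define g where "g \<tau> = \<tau> * \<omega> \<tau> / R - 1 / 2" for \<tau>
  define g' where "g' \<tau> = (R\<^sup>2 * (\<omega> \<tau>)\<^sup>2 - \<tau>\<^sup>2 / 4) / (m \<tau> * \<omega> \<tau> * R)" for \<tau>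
  have gm: "g \<in> borel_measurable borel" "g' \<in> borel_measurable borel" unfolding g_def g'_def \<omega>_def m_def by measurable
  have mne: "\<forall>\<tau>\<in>I. R\<^sup>2 - \<tau>\<^sup>2 \<noteq> 0"
  proof
    fix \<tau> assume "\<tau> \<in> I"
    from m[OF this] show "R\<^sup>2 - \<tau>\<^sup>2 \<noteq> 0" by (simp add: m_def)
  qed
  have cw: "continuous_on I \<omega>"
    unfolding \<omega>_def
    by (intro continuous_on_real_sqrt continuous_on_add continuous_on_divide continuous_on_diff continuous_on_power continuous_on_id continuous_on_const mne)
  have dv: "(g has_real_derivative g' \<tau>) (at \<tau>)" if t: "\<tau> \<in> I" for \<tau>
  proof -
    have "((\<lambda>\<tau>. S / (R\<^sup>2 - \<tau>\<^sup>2) + 1 / 4) has_real_derivative 2 * S * \<tau> / (m \<tau>)\<^sup>2) (at \<tau>)"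
    proof -
      have "((\<lambda>\<tau>. R\<^sup>2 - \<tau>\<^sup>2) has_real_derivative - 2 * \<tau>) (at \<tau>)" by (auto intro!: derivative_eq_intros)
      from DERIV_cmult[OF DERIV_inverse'[OF this], of S] m[OF t]
      have "((\<lambda>\<tau>. S * inverse (R\<^sup>2 - \<tau>\<^sup>2)) has_real_derivative S * - (inverse (m \<tau>) * (- 2 * \<tau>) * inverse (m \<tau>))) (at \<tau>)"
        by (simp add: m_def)
      from DERIV_add[OF this DERIV_const[of "1 / 4"]]
      have "((\<lambda>\<tau>. S * inverse (R\<^sup>2 - \<tau>\<^sup>2) + 1 / 4) has_real_derivative S * - (inverse (m \<tau>) * (- 2 * \<tau>) * inverse (m \<tau>)) + 0) (at \<tau>)" .
      moreover have "S * - (inverse (m \<tau>) * (- 2 * \<tau>) * inverse (m \<tau>)) + 0 = 2 * S * \<tau> / (m \<tau>)\<^sup>2"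
        by (simp add: divide_inverse power2_eq_square)
      ultimately show ?thesis by (simp only: divide_inverse)
    qed
    from DERIV_chain2[where f=sqrt and g="\<lambda>\<tau>. S / (R\<^sup>2 - \<tau>\<^sup>2) + 1 / 4", OF DERIV_real_sqrt[OF w2[OF t, unfolded m_def]] this]
    have wd: "(\<omega> has_real_derivative inverse (\<omega> \<tau>) / 2 * (2 * S * \<tau> / (m \<tau>)\<^sup>2)) (at \<tau>)" by (simp only: \<omega>_def)
    have "(g has_real_derivative (1 * \<omega> \<tau> + inverse (\<omega> \<tau>) / 2 * (2 * S * \<tau> / (m \<tau>)\<^sup>2) * \<tau>) / R) (at \<tau>)"
      using DERIV_diff[OF DERIV_cdivide[OF DERIV_mult[OF DERIV_ident wd], of R] DERIV_const[of "1/2"]]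
      by (simp only: g_def[abs_def] diff_zero)
    also have "(1 * \<omega> \<tau> + inverse (\<omega> \<tau>) / 2 * (2 * S * \<tau> / (m \<tau>)\<^sup>2) * \<tau>) / R = g' \<tau>"
    proof -
      define M where "M = m \<tau>"
      define Q where "Q = \<omega> \<tau>"
      have pos: "0 < M" "0 < Q" using m[OF t] w(1)[OF t] by (simp_all add: M_def Q_def)
      have R2: "R\<^sup>2 = M + \<tau>\<^sup>2" by (simp add: M_def m_def)
      have S': "S = M * (Q\<^sup>2 - 1 / 4)" using w(2)[OF t] pos by (simp add: M_def Q_def field_simps)
      have "(1 * Q + inverse Q / 2 * (2 * S * \<tau> / M\<^sup>2) * \<tau>) / R = (R\<^sup>2 * Q\<^sup>2 - \<tau>\<^sup>2 / 4) / (M * Q * R)"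
        unfolding R2 S' using pos R by (simp add: field_simps power2_eq_square)
      then show ?thesis by (simp add: M_def Q_def g'_def)
    qed
    finally show ?thesis .
  qed
  \<comment> \<open>\<omega>^2 is at least 1 / 4 and \<tau>^2 at most R^2, so the numerator, which
    is the product of the two energies, is nonnegative.\<close>
  have nn: "0 \<le> g' \<tau>" if t: "\<tau> \<in> I" for \<tau>
  proof -
    have "\<tau>\<^sup>2 \<le> R\<^sup>2" using m[OF t] by (simp add: m_def)
    moreover have "R\<^sup>2 * (1 / 4) \<le> R\<^sup>2 * (\<omega> \<tau>)\<^sup>2" using w(2)[OF t] m[OF t] S by (intro mult_left_mono) auto
    ultimately have "0 \<le> R\<^sup>2 * (\<omega> \<tau>)\<^sup>2 - \<tau>\<^sup>2 / 4" by linarith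
    then show ?thesis unfolding g'_def using m[OF t] w(1)[OF t] R by (intro divide_nonneg_nonneg mult_nonneg_nonneg) auto
  qed
  have cg': "continuous_on I g'"
    unfolding g'_def m_def
  proof (intro continuous_on_divide continuous_on_diff continuous_on_mult continuous_on_power continuous_on_id continuous_on_const cw)
    show "\<forall>x\<in>I. (R\<^sup>2 - x\<^sup>2) * \<omega> x * R \<noteq> 0" using mne w(1) R by force
  qed auto
  have cg: "continuous_on I g" using dv by (intro continuous_at_imp_continuous_on) (auto intro: DERIV_isCont)
  have big: "\<exists>\<tau>\<in>I. 0 \<le> \<tau> \<and> b \<le> \<tau> * \<omega> \<tau> / R" if b: "0 \<le> b" for b
  proof -
    \<comment> \<open>Chosen so that \<tau>^2 S / m equals (b R)^2, which already forces \<tau>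
      \<omega> / R to be at least b. With the oddness of \<tau> \<omega> and the intermediate value
      theorem this gives surjectivity.\<close>
    define t where "t = b\<^sup>2 * R\<^sup>2 / S"
    have t: "0 \<le> t" using S by (simp add: t_def)
    define \<tau> where "\<tau> = R * sqrt (t / (1 + t))"
    have \<tau>2: "\<tau>\<^sup>2 = R\<^sup>2 * (t / (1 + t))" using t by (simp add: \<tau>_def power_mult_distrib)
    have "sqrt (t / (1 + t)) < 1" using t by (simp add: divide_less_eq)
    then have "\<tau> < R * 1" unfolding \<tau>_def using R by (intro mult_strict_left_mono) auto
    moreover have \<tau>0: "0 \<le> \<tau>" using t R by (simp add: \<tau>_def)
    ultimately have tI: "\<tau> \<in> I" using R by (simp add: I_def)
    have "m \<tau> = R\<^sup>2 / (1 + t)" unfolding m_def \<tau>2 using t by (simp add: field_simps)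
    then have "\<tau>\<^sup>2 * (S / m \<tau>) = t * S" unfolding \<tau>2 using t R by (simp add: field_simps)
    also have "\<dots> = (b * R)\<^sup>2" using S by (simp add: t_def power_mult_distrib)
    finally have "(b * R)\<^sup>2 \<le> (\<tau> * \<omega> \<tau>)\<^sup>2" using w(2)[OF tI] by (simp add: power_mult_distrib distrib_left)
    then have "b * R \<le> \<tau> * \<omega> \<tau>" by (rule power2_le_imp_le) (use \<tau>0 w(1)[OF tI] in simp)
    then have "b \<le> \<tau> * \<omega> \<tau> / R" using R by (simp add: pos_le_divide_eq)
    then show ?thesis using tI \<tau>0 by blast
  qed
  have im: "g ` I = UNIV"
  proof (intro equalityI subsetI UNIV_I)
    fix x :: real
    obtain \<tau> where \<tau>: "\<tau> \<in> I" "0 \<le> \<tau>" "\<bar>x + 1 / 2\<bar> \<le> \<tau> * \<omega> \<tau> / R" using big[of "\<bar>x + 1 / 2\<bar>"] by auto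
    have "\<omega> (- \<tau>) = \<omega> \<tau>" by (simp add: \<omega>_def)
    then have "g (- \<tau>) \<le> x" "x \<le> g \<tau>" using \<tau>(3) unfolding g_def by (simp_all add: abs_le_iff)
    moreover have sub: "{- \<tau>..\<tau>} \<subseteq> I" using \<tau> by (auto simp: I_def)
    moreover have "- \<tau> \<le> \<tau>" using \<tau> by simp
    ultimately obtain y where "y \<in> {- \<tau>..\<tau>}" "g y = x"
      using IVT'[of g "- \<tau>" x \<tau>] continuous_on_subset[OF cg sub] by auto
    then show "x \<in> g ` I" using sub by auto
  qed
  have "(\<integral>\<^sup>+y. f y * indicator (g ` I) y \<partial>lborel) = (\<integral>\<^sup>+x. f (g x) * ennreal (g' x) * indicator I x \<partial>lborel)"
  proof (rule nn_integral_substitution_image[OF _ _ _ _ UN_Icc_symmetric[OF R, folded I_def] dv cg' nn gm])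
    show "- (R - R / real (Suc n)) \<le> R - R / real (Suc n)" for n
    proof -
      have "R / real (Suc n) \<le> R / 1" using R by (intro frac_le) auto
      then show ?thesis by simp
    qed
    have mono: "R - R / real (Suc k) \<le> R - R / real (Suc n)" if "k \<le> n" for k n
      using R that by (intro diff_left_mono frac_le) auto
    then show "decseq (\<lambda>n. - (R - R / real (Suc n)))" "incseq (\<lambda>n. R - R / real (Suc n))"
      unfolding decseq_def incseq_def by (auto intro: le_imp_neg_le)
  qed auto
  then have "(\<integral>\<^sup>+y. f y \<partial>lborel) = (\<integral>\<^sup>+x. f (g x) * ennreal (g' x) * indicator I x \<partial>lborel)" by (simp only: im) simp
  then show ?thesis by (simp only: g_def g'_def m_def I_def)
qed

section \<open>Disintegration over differences of points of the mass shell\<close>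

text \<open>The parameter of \<open>apt\<close> is the one for which \<open>\<phi>(q4 + \<xi>) = \<phi>(q4) + \<tau>\<close>.\<close>

definition q4 :: "real \<Rightarrow> real \<Rightarrow> 'a::euclidean_space \<Rightarrow> 'a \<Rightarrow> 'a" where
  "q4 s \<tau> \<xi> \<eta> = apt s \<xi> \<tau> \<eta> (- (sqrt ((norm \<xi>)\<^sup>2 - \<tau>\<^sup>2) / 2))"

text \<open>\<open>slab\<close> times the Jacobian of
  \<open>nn_integral_energy_substitution\<close>, with its numerator written as the product of the
  energies of the two points. It is 0 where no pair has the difference (\<tau>, \<xi>).\<close>

definition kern :: "real \<Rightarrow> real \<Rightarrow> 'a::euclidean_space \<Rightarrow> 'a \<Rightarrow> real" where
  "kern s \<tau> \<xi> \<eta> = (if \<bar>\<tau>\<bar> < norm \<xi> then slab \<xi> \<eta> * (phi s (norm (q4 s \<tau> \<xi> \<eta>)) * (phi s (norm (q4 s \<tau> \<xi> \<eta>)) + \<tau>)) /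
     (sqrt ((norm \<xi>)\<^sup>2 - \<tau>\<^sup>2) * norm \<xi> * sqrt (s\<^sup>2 + (norm (perp \<xi> \<eta>))\<^sup>2 + ((norm \<xi>)\<^sup>2 - \<tau>\<^sup>2) / 4)) else 0)"

lemma q4_measurable [measurable (raw)]:
  assumes [measurable]: "f \<in> borel_measurable M" "g \<in> borel_measurable M" "h \<in> borel_measurable M"
  shows "(\<lambda>x. q4 s (f x) (g x :: 'a::euclidean_space) (h x)) \<in> borel_measurable M"
  unfolding q4_def by measurable

lemma kern_measurable [measurable (raw)]:
  assumes [measurable]: "f \<in> borel_measurable M" "g \<in> borel_measurable M" "h \<in> borel_measurable M"
  shows "(\<lambda>x. kern s (f x) (g x :: 'a::euclidean_space) (h x)) \<in> borel_measurable M"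
  unfolding kern_def by measurable

lemma timelike_gap:
  assumes \<tau>: "\<bar>\<tau>\<bar> < norm \<xi>" shows "0 < (norm \<xi>)\<^sup>2 - \<tau>\<^sup>2" "0 < norm \<xi>"
proof -
  have "\<tau>\<^sup>2 < (norm \<xi>)\<^sup>2" using \<tau> by (metis abs_ge_zero power2_abs power_strict_mono pos2)
  then show "0 < (norm \<xi>)\<^sup>2 - \<tau>\<^sup>2" by simp
  show "0 < norm \<xi>" by (rule order_le_less_trans[OF abs_ge_zero \<tau>])
qed

text \<open>The Lorentz product of \<open>q4\<close> with (\<tau>, \<xi>) is - m / 2 for m =
  |\<xi>|^2 - \<tau>^2. This is exactly the condition for adding (\<tau>, \<xi>) to lead back to the
  mass shell, with positive energy because |\<tau>| < |\<xi>|.\<close>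

lemma phi_q4_add:
  assumes s: "0 < s" and \<tau>: "\<bar>\<tau>\<bar> < norm \<xi>"
  shows "phi s (norm (q4 s \<tau> \<xi> \<eta> + \<xi>)) = phi s (norm (q4 s \<tau> \<xi> \<eta>)) + \<tau>"
    and "phi s (norm (q4 s \<tau> \<xi> \<eta>)) = norm \<xi> * sqrt ((s\<^sup>2 + (norm (perp \<xi> \<eta>))\<^sup>2) / ((norm \<xi>)\<^sup>2 - \<tau>\<^sup>2) + 1 / 4) - \<tau> / 2"
    and "0 < phi s (norm (q4 s \<tau> \<xi> \<eta>)) + \<tau>"
proof -
  define m where "m = (norm \<xi>)\<^sup>2 - \<tau>\<^sup>2"
  have m: "0 < m" "0 < norm \<xi>" using timelike_gap[OF \<tau>] by (simp_all add: m_def)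
  define S where "S = s\<^sup>2 + (norm (perp \<xi> \<eta>))\<^sup>2"
  have S: "0 < S" using s by (simp add: S_def add_pos_nonneg)
  define f where "f = phi s (norm (q4 s \<tau> \<xi> \<eta>))"
  have sq: "S / m + 1 / 4 = (S + m / 4) / m" using m by (simp add: field_simps)
  have "f = (norm \<xi> * sqrt (S + (- (sqrt m / 2))\<^sup>2) + \<tau> * (- (sqrt m / 2))) / sqrt m"
    unfolding f_def q4_def phi_apt[OF s \<tau>] by (simp add: m_def S_def)
  also have "\<dots> = norm \<xi> * (sqrt (S + m / 4) / sqrt m) - \<tau> / 2"
    using m by (simp add: power_divide field_simps)
  finally have f: "f = norm \<xi> * sqrt (S / m + 1 / 4) - \<tau> / 2" unfolding sq real_sqrt_divide .
  then show "phi s (norm (q4 s \<tau> \<xi> \<eta>)) = norm \<xi> * sqrt ((s\<^sup>2 + (norm (perp \<xi> \<eta>))\<^sup>2) / ((norm \<xi>)\<^sup>2 - \<tau>\<^sup>2) + 1 / 4) - \<tau> / 2"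
    by (simp add: f_def S_def m_def)
  have "sqrt ((1 / 2)\<^sup>2) \<le> sqrt (S / m + 1 / 4)" using S m by (intro real_sqrt_le_mono) (simp add: power2_eq_square)
  then have "1 / 2 \<le> sqrt (S / m + 1 / 4)" by simp
  then have "norm \<xi> * (1 / 2) \<le> norm \<xi> * sqrt (S / m + 1 / 4)" using m by (intro mult_left_mono) auto
  then have pos: "0 < f + \<tau>" using \<tau> unfolding f by linarith
  then show "0 < phi s (norm (q4 s \<tau> \<xi> \<eta>)) + \<tau>" by (simp add: f_def)
  have "q4 s \<tau> \<xi> \<eta> \<bullet> \<xi> - \<tau> * f = sqrt m * (- (sqrt m / 2))"
    unfolding q4_def f_def apt_energy[OF s \<tau>] m_def ..
  also have "\<dots> = - m / 2" using m by simp
  finally have qi: "q4 s \<tau> \<xi> \<eta> \<bullet> \<xi> = \<tau> * f - m / 2" by simp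
  have "(phi s (norm (q4 s \<tau> \<xi> \<eta> + \<xi>)))\<^sup>2 = f\<^sup>2 + 2 * (q4 s \<tau> \<xi> \<eta> \<bullet> \<xi>) + (norm \<xi>)\<^sup>2"
    unfolding f_def phi_norm_power2 by (simp add: inner_add_left inner_add_right inner_commute power2_norm_eq_inner)
  also have "\<dots> = (f + \<tau>)\<^sup>2"
  proof -
    have "(norm \<xi>)\<^sup>2 = m + \<tau>\<^sup>2" by (simp add: m_def)
    then show ?thesis unfolding qi by (simp add: power2_sum algebra_simps)
  qed
  finally show "phi s (norm (q4 s \<tau> \<xi> \<eta> + \<xi>)) = phi s (norm (q4 s \<tau> \<xi> \<eta>)) + \<tau>"
    using pos phi_pos[OF s, of "norm (q4 s \<tau> \<xi> \<eta> + \<xi>)"] by (simp add: f_def[symmetric] power2_eq_iff_nonneg)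
qed

lemma kern_nonneg:
  assumes s: "0 < s" shows "0 \<le> kern s \<tau> \<xi> \<eta>"
proof (cases "\<bar>\<tau>\<bar> < norm \<xi>")
  case True
  then show ?thesis using phi_q4_add(3)[OF s True, of \<eta>] phi_pos[OF s, of "norm (q4 s \<tau> \<xi> \<eta>)"] timelike_gap[OF True] slab_nonneg[of \<xi> \<eta>]
    unfolding kern_def by (auto intro!: divide_nonneg_nonneg mult_nonneg_nonneg)
qed (simp add: kern_def)

text \<open>The coarea formula for the map sending (\<eta>1, \<eta>2) to the differences of energies
  and momenta: \<xi> is split off by translation, the rest is cut into lines parallel to \<xi>, and
  on each line the position is replaced by the energy difference \<tau>.\<close>

lemma pairs_disintegration:
  fixes \<Phi> :: "'a::euclidean_space \<times> 'a \<Rightarrow> ennreal"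
  assumes s: "0 < s" and \<Phi>[measurable]: "\<Phi> \<in> borel_measurable (borel \<Otimes>\<^sub>M borel)"
  shows "(\<integral>\<^sup>+\<eta>1. \<integral>\<^sup>+\<eta>2. \<Phi> (\<eta>1, \<eta>2) \<partial>lborel \<partial>lborel) =
    (\<integral>\<^sup>+\<tau>. \<integral>\<^sup>+\<xi>. \<integral>\<^sup>+\<eta>. ennreal (kern s \<tau> \<xi> \<eta>) * \<Phi> (q4 s \<tau> \<xi> \<eta> + \<xi>, q4 s \<tau> \<xi> \<eta>) \<partial>lborel \<partial>lborel \<partial>lborel)"
proof -
  have "(\<integral>\<^sup>+\<eta>1. \<integral>\<^sup>+\<eta>2. \<Phi> (\<eta>1, \<eta>2) \<partial>lborel \<partial>lborel) = (\<integral>\<^sup>+\<eta>2. \<integral>\<^sup>+\<eta>1. \<Phi> (\<eta>1, \<eta>2) \<partial>lborel \<partial>lborel)"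
    by (rule lborel_pair.Fubini') measurable
  also have "\<dots> = (\<integral>\<^sup>+\<eta>2. \<integral>\<^sup>+\<xi>. \<Phi> (\<eta>2 + \<xi>, \<eta>2) \<partial>lborel \<partial>lborel)"
  proof (rule nn_integral_cong)
    fix \<eta>2 :: 'a
    show "(\<integral>\<^sup>+\<eta>1. \<Phi> (\<eta>1, \<eta>2) \<partial>lborel) = (\<integral>\<^sup>+\<xi>. \<Phi> (\<eta>2 + \<xi>, \<eta>2) \<partial>lborel)"
      by (rule nn_integral_lborel_translate[symmetric]) measurable
  qed
  also have "\<dots> = (\<integral>\<^sup>+\<xi>. \<integral>\<^sup>+z. \<Phi> (z + \<xi>, z) \<partial>lborel \<partial>lborel)"
    by (rule lborel_pair.Fubini') measurable
  also have "\<dots> = (\<integral>\<^sup>+\<xi>. \<integral>\<^sup>+\<tau>. \<integral>\<^sup>+\<eta>. ennreal (kern s \<tau> \<xi> \<eta>) * \<Phi> (q4 s \<tau> \<xi> \<eta> + \<xi>, q4 s \<tau> \<xi> \<eta>) \<partial>lborel \<partial>lborel \<partial>lborel)"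
  proof (rule nn_integral_cong_AE, use AE_lborel_singleton[of 0] in eventually_elim)
    fix \<xi> :: 'a assume \<xi>: "\<xi> \<noteq> 0"
    define R where "R = norm \<xi>"
    have R: "0 < R" using \<xi> by (simp add: R_def)
    have "(\<integral>\<^sup>+z. \<Phi> (z + \<xi>, z) \<partial>lborel) = (\<integral>\<^sup>+\<eta>. ennreal (slab \<xi> \<eta>) * (\<integral>\<^sup>+x. \<Phi> (perp \<xi> \<eta> + x *\<^sub>R \<xi> + \<xi>, perp \<xi> \<eta> + x *\<^sub>R \<xi>) \<partial>lborel) \<partial>lborel)"
      by (rule nn_integral_lines[OF _ \<xi>]) measurable
    also have "\<dots> = (\<integral>\<^sup>+\<eta>. \<integral>\<^sup>+\<tau>. ennreal (kern s \<tau> \<xi> \<eta>) * \<Phi> (q4 s \<tau> \<xi> \<eta> + \<xi>, q4 s \<tau> \<xi> \<eta>) \<partial>lborel \<partial>lborel)"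
    proof (rule nn_integral_cong)
      fix \<eta> :: 'a
      define S where "S = s\<^sup>2 + (norm (perp \<xi> \<eta>))\<^sup>2"
      have S: "0 < S" using s by (simp add: S_def add_pos_nonneg)
      define \<omega> where "\<omega> \<tau> = sqrt (S / (R\<^sup>2 - \<tau>\<^sup>2) + 1 / 4)" for \<tau>
      define f where "f x = \<Phi> (perp \<xi> \<eta> + x *\<^sub>R \<xi> + \<xi>, perp \<xi> \<eta> + x *\<^sub>R \<xi>)" for x
      have [measurable]: "f \<in> borel_measurable borel" unfolding f_def by measurable
      define j where "j \<tau> = (R\<^sup>2 * (\<omega> \<tau>)\<^sup>2 - \<tau>\<^sup>2 / 4) / ((R\<^sup>2 - \<tau>\<^sup>2) * \<omega> \<tau> * R)" for \<tau>
      have [measurable]: "\<omega> \<in> borel_measurable borel" unfolding \<omega>_def by measurable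
      have [measurable]: "j \<in> borel_measurable borel" unfolding j_def by measurable
      have "(\<integral>\<^sup>+x. f x \<partial>lborel) = (\<integral>\<^sup>+\<tau>. f (\<tau> * \<omega> \<tau> / R - 1 / 2) * ennreal (j \<tau>) * indicator {- R<..<R} \<tau> \<partial>lborel)"
        unfolding j_def \<omega>_def by (rule nn_integral_energy_substitution[OF _ S R]) measurable
      then have "ennreal (slab \<xi> \<eta>) * (\<integral>\<^sup>+x. f x \<partial>lborel) = (\<integral>\<^sup>+\<tau>. ennreal (slab \<xi> \<eta>) * (f (\<tau> * \<omega> \<tau> / R - 1 / 2) * ennreal (j \<tau>) * indicator {- R<..<R} \<tau>) \<partial>lborel)"
        by (subst nn_integral_cmult) auto
      also have "\<dots> = (\<integral>\<^sup>+\<tau>. ennreal (kern s \<tau> \<xi> \<eta>) * \<Phi> (q4 s \<tau> \<xi> \<eta> + \<xi>, q4 s \<tau> \<xi> \<eta>) \<partial>lborel)"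
      proof (rule nn_integral_cong)
        fix \<tau> :: real
        show "ennreal (slab \<xi> \<eta>) * (f (\<tau> * \<omega> \<tau> / R - 1 / 2) * ennreal (j \<tau>) * indicator {- R<..<R} \<tau>) = ennreal (kern s \<tau> \<xi> \<eta>) * \<Phi> (q4 s \<tau> \<xi> \<eta> + \<xi>, q4 s \<tau> \<xi> \<eta>)"
        proof (cases "\<bar>\<tau>\<bar> < R")
          case True
          define m where "m = R\<^sup>2 - \<tau>\<^sup>2"
          have m: "0 < m" using timelike_gap[of \<tau> \<xi>] True by (simp add: m_def R_def)
          have w: "\<omega> \<tau> = sqrt (S + m / 4) / sqrt m"
          proof -
            have "S / m + 1 / 4 = (S + m / 4) / m" using m by (simp add: field_simps)
            then show ?thesis by (simp add: \<omega>_def m_def real_sqrt_divide)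
          qed
          have q: "q4 s \<tau> \<xi> \<eta> = perp \<xi> \<eta> + (\<tau> * \<omega> \<tau> / R - 1 / 2) *\<^sub>R \<xi>"
          proof -
            have "(R * - (sqrt m / 2) + \<tau> * sqrt (S + (- (sqrt m / 2))\<^sup>2)) / (sqrt m * R) = \<tau> * \<omega> \<tau> / R - 1 / 2"
              unfolding w using R m by (simp add: power_divide field_simps)
            then show ?thesis by (simp add: q4_def apt_def R_def[symmetric] m_def[symmetric] S_def[symmetric])
          qed
          define F where "F = phi s (norm (q4 s \<tau> \<xi> \<eta>))"
          have F: "F = R * \<omega> \<tau> - \<tau> / 2"
            unfolding F_def R_def \<omega>_def S_def by (rule phi_q4_add(2)[OF s True[unfolded R_def]])
          have k: "kern s \<tau> \<xi> \<eta> = slab \<xi> \<eta> * j \<tau>"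
          proof -
            have "sqrt (S + m / 4) = sqrt m * \<omega> \<tau>" unfolding w using m by simp
            then have "kern s \<tau> \<xi> \<eta> = slab \<xi> \<eta> * (F * (F + \<tau>)) / (sqrt m * R * (sqrt m * \<omega> \<tau>))"
              using True by (simp add: kern_def F_def R_def m_def S_def)
            also have "sqrt m * R * (sqrt m * \<omega> \<tau>) = m * \<omega> \<tau> * R" using m by simp
            also have "F * (F + \<tau>) = R\<^sup>2 * (\<omega> \<tau>)\<^sup>2 - \<tau>\<^sup>2 / 4"
              unfolding F by (simp add: power2_eq_square algebra_simps)
            finally show ?thesis by (simp add: j_def m_def)
          qed
          have "ennreal (kern s \<tau> \<xi> \<eta>) = ennreal (slab \<xi> \<eta>) * ennreal (j \<tau>)"
            unfolding k by (rule ennreal_mult') (rule slab_nonneg)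
          moreover have "indicator {- R<..<R} \<tau> = (1::ennreal)" using True by (auto simp: indicator_def abs_less_iff)
          ultimately show ?thesis by (simp add: q f_def mult_ac)
        next
          case False
          then have "\<tau> \<notin> {- R<..<R}" by auto
          then show ?thesis using False by (simp add: kern_def R_def)
        qed
      qed
      finally show "ennreal (slab \<xi> \<eta>) * (\<integral>\<^sup>+x. \<Phi> (perp \<xi> \<eta> + x *\<^sub>R \<xi> + \<xi>, perp \<xi> \<eta> + x *\<^sub>R \<xi>) \<partial>lborel) =
        (\<integral>\<^sup>+\<tau>. ennreal (kern s \<tau> \<xi> \<eta>) * \<Phi> (q4 s \<tau> \<xi> \<eta> + \<xi>, q4 s \<tau> \<xi> \<eta>) \<partial>lborel)"
        by (simp only: f_def)
    qed
    also have "\<dots> = (\<integral>\<^sup>+\<tau>. \<integral>\<^sup>+\<eta>. ennreal (kern s \<tau> \<xi> \<eta>) * \<Phi> (q4 s \<tau> \<xi> \<eta> + \<xi>, q4 s \<tau> \<xi> \<eta>) \<partial>lborel \<partial>lborel)"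
      by (rule lborel_pair.Fubini') measurable
    finally show "(\<integral>\<^sup>+z. \<Phi> (z + \<xi>, z) \<partial>lborel) = (\<integral>\<^sup>+\<tau>. \<integral>\<^sup>+\<eta>. ennreal (kern s \<tau> \<xi> \<eta>) * \<Phi> (q4 s \<tau> \<xi> \<eta> + \<xi>, q4 s \<tau> \<xi> \<eta>) \<partial>lborel \<partial>lborel)" .
  qed
  also have "\<dots> = (\<integral>\<^sup>+\<tau>. \<integral>\<^sup>+\<xi>. \<integral>\<^sup>+\<eta>. ennreal (kern s \<tau> \<xi> \<eta>) * \<Phi> (q4 s \<tau> \<xi> \<eta> + \<xi>, q4 s \<tau> \<xi> \<eta>) \<partial>lborel \<partial>lborel \<partial>lborel)"
    by (rule lborel_pair.Fubini') measurable
  finally show ?thesis .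
qed

text \<open>The density at (\<tau>, \<xi>) of the image of \<Phi> d\<eta>1 d\<eta>2 under the
  difference map.\<close>

definition dens :: "real \<Rightarrow> ('a::euclidean_space \<Rightarrow> 'a \<Rightarrow> ennreal) \<Rightarrow> real \<Rightarrow> 'a \<Rightarrow> ennreal" where
  "dens s \<Phi> \<tau> \<xi> = (\<integral>\<^sup>+\<eta>. ennreal (kern s \<tau> \<xi> \<eta>) * \<Phi> (q4 s \<tau> \<xi> \<eta> + \<xi>) (q4 s \<tau> \<xi> \<eta>) \<partial>lborel)"

text \<open>The integral of W over the free points for given P1 and P4, up to (d - 1)!. The factor 2
  / sqrt(\<open>mgap\<close>) undoes the prefactor sqrt(\<open>mgap\<close>) that was put into
  \<open>wtB\<close> for convergence.\<close>

definition fibJ :: "real \<Rightarrow> (real \<Rightarrow> ennreal) \<Rightarrow> 'a::euclidean_space \<Rightarrow> 'a \<Rightarrow> ennreal" where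
  "fibJ s W a \<eta>4 = (\<integral>\<^sup>+z. ennreal (wtB s a \<eta>4 0 z) * (ennreal (2 / sqrt (mgap s a (ptB s a \<eta>4 0 z))) * W (mgap s a (ptB s a \<eta>4 0 z))) \<partial>lborel)"

text \<open>Reading \<open>pairs_disintegration\<close> backwards frees the pair (P1, P2) behind the
  first density. The second density is then an integral over P4 on the fibre determined by that
  pair, and \<open>fibre_lines_eq_spheres\<close> exchanges the order, so that P4 becomes free and
  P2 runs over a sphere. W survives because its argument is \<open>mgap\<close> of P1 and
  P2.\<close>

lemma dens_pairing:
  fixes A B :: "'a::euclidean_space \<Rightarrow> ennreal"
  assumes s: "0 < s" and d: "2 \<le> DIM('a)" and [measurable]: "A \<in> borel_measurable borel" "B \<in> borel_measurable borel" "W \<in> borel_measurable borel"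
  shows "ennreal (fact (DIM('a) - 1)) * (\<integral>\<^sup>+\<tau>. \<integral>\<^sup>+\<xi>. W ((norm \<xi>)\<^sup>2 - \<tau>\<^sup>2) * (dens s (\<lambda>x y. A x * ennreal (1 / phi s (norm y))) \<tau> \<xi> *
       dens s (\<lambda>x y. ennreal (1 / phi s (norm x)) * B y) \<tau> \<xi>) \<partial>lborel \<partial>lborel) =
    (\<integral>\<^sup>+\<eta>1. A \<eta>1 * (\<integral>\<^sup>+\<eta>4. B \<eta>4 * fibJ s W \<eta>1 \<eta>4 \<partial>lborel) \<partial>lborel)"
proof -
  let ?C = "ennreal (fact (DIM('a) - 1))"
  define DB where "DB \<tau> \<xi> = dens s (\<lambda>x y. ennreal (1 / phi s (norm x)) * B y) \<tau> \<xi>" for \<tau> and \<xi> :: 'a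
  have [measurable]: "(\<lambda>x. DB (f x) (g x)) \<in> borel_measurable M" if [measurable]: "f \<in> borel_measurable M" "g \<in> borel_measurable M" for f g and M :: "'b measure"
    unfolding DB_def dens_def by measurable
  have "(\<integral>\<^sup>+\<tau>. \<integral>\<^sup>+\<xi>. W ((norm \<xi>)\<^sup>2 - \<tau>\<^sup>2) * (dens s (\<lambda>x y. A x * ennreal (1 / phi s (norm y))) \<tau> \<xi> * DB \<tau> \<xi>) \<partial>lborel \<partial>lborel)
    = (\<integral>\<^sup>+\<tau>. \<integral>\<^sup>+\<xi>. \<integral>\<^sup>+\<eta>. ennreal (kern s \<tau> \<xi> \<eta>) * (case (q4 s \<tau> \<xi> \<eta> + \<xi>, q4 s \<tau> \<xi> \<eta>) of (x, y) \<Rightarrow>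
       A x * (ennreal (1 / phi s (norm y)) * (W (mgap s x y) * DB (phi s (norm x) - phi s (norm y)) (x - y)))) \<partial>lborel \<partial>lborel \<partial>lborel)"
  proof (intro nn_integral_cong)
    fix \<tau> :: real and \<xi> :: 'a
    have "W ((norm \<xi>)\<^sup>2 - \<tau>\<^sup>2) * (dens s (\<lambda>x y. A x * ennreal (1 / phi s (norm y))) \<tau> \<xi> * DB \<tau> \<xi>) =
      (W ((norm \<xi>)\<^sup>2 - \<tau>\<^sup>2) * DB \<tau> \<xi>) * (\<integral>\<^sup>+\<eta>. ennreal (kern s \<tau> \<xi> \<eta>) * (A (q4 s \<tau> \<xi> \<eta> + \<xi>) * ennreal (1 / phi s (norm (q4 s \<tau> \<xi> \<eta>)))) \<partial>lborel)"
      by (simp only: dens_def mult_ac)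
    also have "\<dots> = (\<integral>\<^sup>+\<eta>. (W ((norm \<xi>)\<^sup>2 - \<tau>\<^sup>2) * DB \<tau> \<xi>) * (ennreal (kern s \<tau> \<xi> \<eta>) * (A (q4 s \<tau> \<xi> \<eta> + \<xi>) * ennreal (1 / phi s (norm (q4 s \<tau> \<xi> \<eta>))))) \<partial>lborel)"
      by (rule nn_integral_cmult[symmetric]) measurable
    also have "\<dots> = (\<integral>\<^sup>+\<eta>. ennreal (kern s \<tau> \<xi> \<eta>) * (case (q4 s \<tau> \<xi> \<eta> + \<xi>, q4 s \<tau> \<xi> \<eta>) of (x, y) \<Rightarrow>
       A x * (ennreal (1 / phi s (norm y)) * (W (mgap s x y) * DB (phi s (norm x) - phi s (norm y)) (x - y)))) \<partial>lborel)"
    proof (rule nn_integral_cong)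
      fix \<eta> :: 'a
      show "(W ((norm \<xi>)\<^sup>2 - \<tau>\<^sup>2) * DB \<tau> \<xi>) * (ennreal (kern s \<tau> \<xi> \<eta>) * (A (q4 s \<tau> \<xi> \<eta> + \<xi>) * ennreal (1 / phi s (norm (q4 s \<tau> \<xi> \<eta>))))) =
        ennreal (kern s \<tau> \<xi> \<eta>) * (case (q4 s \<tau> \<xi> \<eta> + \<xi>, q4 s \<tau> \<xi> \<eta>) of (x, y) \<Rightarrow>
       A x * (ennreal (1 / phi s (norm y)) * (W (mgap s x y) * DB (phi s (norm x) - phi s (norm y)) (x - y))))"
      proof (cases "\<bar>\<tau>\<bar> < norm \<xi>")
        case True
        have t: "phi s (norm (q4 s \<tau> \<xi> \<eta> + \<xi>)) - phi s (norm (q4 s \<tau> \<xi> \<eta>)) = \<tau>" using phi_q4_add(1)[OF s True] by simp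
        have g: "mgap s (q4 s \<tau> \<xi> \<eta> + \<xi>) (q4 s \<tau> \<xi> \<eta>) = (norm \<xi>)\<^sup>2 - \<tau>\<^sup>2" unfolding mgap_eq t by simp
        show ?thesis by (simp only: split_conv t g add_diff_cancel_left' mult_ac)
      qed (simp add: kern_def)
    qed
    finally show "W ((norm \<xi>)\<^sup>2 - \<tau>\<^sup>2) * (dens s (\<lambda>x y. A x * ennreal (1 / phi s (norm y))) \<tau> \<xi> * DB \<tau> \<xi>) =
      (\<integral>\<^sup>+\<eta>. ennreal (kern s \<tau> \<xi> \<eta>) * (case (q4 s \<tau> \<xi> \<eta> + \<xi>, q4 s \<tau> \<xi> \<eta>) of (x, y) \<Rightarrow>
       A x * (ennreal (1 / phi s (norm y)) * (W (mgap s x y) * DB (phi s (norm x) - phi s (norm y)) (x - y)))) \<partial>lborel)" .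
  qed
  also have "\<dots> = (\<integral>\<^sup>+\<eta>1. \<integral>\<^sup>+\<eta>2. (case (\<eta>1, \<eta>2) of (x, y) \<Rightarrow> A x * (ennreal (1 / phi s (norm y)) * (W (mgap s x y) * DB (phi s (norm x) - phi s (norm y)) (x - y)))) \<partial>lborel \<partial>lborel)"
    by (rule pairs_disintegration[OF s, symmetric]) measurable
  also have "\<dots> = (\<integral>\<^sup>+\<eta>1. A \<eta>1 * (\<integral>\<^sup>+\<eta>2. ennreal (1 / phi s (norm \<eta>2)) * (W (mgap s \<eta>1 \<eta>2) * DB (phi s (norm \<eta>1) - phi s (norm \<eta>2)) (\<eta>1 - \<eta>2)) \<partial>lborel) \<partial>lborel)"
    unfolding split_conv by (intro nn_integral_cong nn_integral_cmult) measurable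
  finally have 1: "(\<integral>\<^sup>+\<tau>. \<integral>\<^sup>+\<xi>. W ((norm \<xi>)\<^sup>2 - \<tau>\<^sup>2) * (dens s (\<lambda>x y. A x * ennreal (1 / phi s (norm y))) \<tau> \<xi> * DB \<tau> \<xi>) \<partial>lborel \<partial>lborel) =
     (\<integral>\<^sup>+\<eta>1. A \<eta>1 * (\<integral>\<^sup>+\<eta>2. ennreal (1 / phi s (norm \<eta>2)) * (W (mgap s \<eta>1 \<eta>2) * DB (phi s (norm \<eta>1) - phi s (norm \<eta>2)) (\<eta>1 - \<eta>2)) \<partial>lborel) \<partial>lborel)" .
  have rearrange: "(a' * w') * (k' * (c' * b')) = v' * ((t' * w') * b')" if "a' * (k' * c') = v' * t'" for a' w' k' c' b' v' t' :: ennreal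
  proof -
    have "(a' * w') * (k' * (c' * b')) = (a' * (k' * c')) * (w' * b')" by (simp only: mult_ac)
    then show ?thesis unfolding that by (simp only: mult.assoc)
  qed
  have 2: "?C * (\<integral>\<^sup>+\<eta>2. ennreal (1 / phi s (norm \<eta>2)) * (W (mgap s a \<eta>2) * DB (phi s (norm a) - phi s (norm \<eta>2)) (a - \<eta>2)) \<partial>lborel) =
    (\<integral>\<^sup>+\<eta>4. B \<eta>4 * fibJ s W a \<eta>4 \<partial>lborel)" for a :: 'a
  proof -
    define y0 where "y0 \<eta>2 = - mgap s a \<eta>2 / (2 * sqrt (mgap s a \<eta>2))" for \<eta>2
    define \<Psi> where "\<Psi> = (\<lambda>(\<eta>2, \<eta>4). (ennreal (2 / sqrt (mgap s a \<eta>2)) * W (mgap s a \<eta>2)) * B \<eta>4)"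
    have \<Psi>: "\<Psi> \<in> borel_measurable borel" unfolding \<Psi>_def borel_prod[symmetric] by measurable
    have "(\<integral>\<^sup>+\<eta>2. ennreal (1 / phi s (norm \<eta>2)) * (W (mgap s a \<eta>2) * DB (phi s (norm a) - phi s (norm \<eta>2)) (a - \<eta>2)) \<partial>lborel) =
      (\<integral>\<^sup>+\<eta>2. \<integral>\<^sup>+\<eta>. ennreal (wtA s a \<eta>2 \<eta> (y0 \<eta>2)) * \<Psi> (\<eta>2, ptA s a \<eta>2 \<eta> (y0 \<eta>2)) \<partial>lborel \<partial>lborel)"
    proof (rule nn_integral_cong)
      fix \<eta>2 :: 'a
      define \<xi> where "\<xi> = a - \<eta>2"
      define \<tau> where "\<tau> = phi s (norm a) - phi s (norm \<eta>2)"
      define m where "m = mgap s a \<eta>2"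
      have m_eq: "(norm \<xi>)\<^sup>2 - \<tau>\<^sup>2 = m" by (simp add: m_def mgap_eq \<xi>_def \<tau>_def)
      have y: "y0 \<eta>2 = - (sqrt m / 2)" unfolding y0_def m_def[symmetric]
        using mgap_nonneg[OF s, of a \<eta>2] by (cases "m = 0") (auto simp: m_def field_simps)
      have q: "q4 s \<tau> \<xi> \<eta> = ptA s a \<eta>2 \<eta> (y0 \<eta>2)" for \<eta>
        by (simp add: q4_def ptA_def \<xi>_def \<tau>_def y m_eq[unfolded \<xi>_def \<tau>_def])
      have "ennreal (1 / phi s (norm \<eta>2)) * (W m * DB \<tau> \<xi>) = (ennreal (1 / phi s (norm \<eta>2)) * W m) *
         (\<integral>\<^sup>+\<eta>. ennreal (kern s \<tau> \<xi> \<eta>) * (ennreal (1 / phi s (norm (q4 s \<tau> \<xi> \<eta> + \<xi>))) * B (q4 s \<tau> \<xi> \<eta>)) \<partial>lborel)"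
        by (simp only: DB_def dens_def mult.assoc)
      also have "\<dots> = (\<integral>\<^sup>+\<eta>. (ennreal (1 / phi s (norm \<eta>2)) * W m) * (ennreal (kern s \<tau> \<xi> \<eta>) * (ennreal (1 / phi s (norm (q4 s \<tau> \<xi> \<eta> + \<xi>))) * B (q4 s \<tau> \<xi> \<eta>))) \<partial>lborel)"
        by (rule nn_integral_cmult[symmetric]) measurable
      also have "\<dots> = (\<integral>\<^sup>+\<eta>. ennreal (wtA s a \<eta>2 \<eta> (y0 \<eta>2)) * \<Psi> (\<eta>2, ptA s a \<eta>2 \<eta> (y0 \<eta>2)) \<partial>lborel)"
      proof (rule nn_integral_cong)
        fix \<eta> :: 'a
        \<comment> \<open>The product of energies in \<open>kern\<close> cancels the invariant
          weight 1 / \<open>phi\<close> of P3 = P4 + (\<tau>, \<xi>); what remains differs from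
          \<open>wtA\<close> by 2 / sqrt(m), the factor kept in \<open>fibJ\<close>.\<close>
        have "ennreal (1 / phi s (norm \<eta>2)) * (ennreal (kern s \<tau> \<xi> \<eta>) * ennreal (1 / phi s (norm (q4 s \<tau> \<xi> \<eta> + \<xi>)))) = ennreal (wtA s a \<eta>2 \<eta> (y0 \<eta>2)) * ennreal (2 / sqrt m)"
        proof (cases "\<eta>2 = a")
          case True
          then show ?thesis by (simp add: kern_def \<xi>_def \<tau>_def wtA_def slab_def)
        next
          case False
          have \<tau>: "\<bar>\<tau>\<bar> < norm \<xi>" unfolding \<tau>_def \<xi>_def by (rule phi_diff_less[OF s]) (use False in auto)
          have m: "0 < m" "0 < norm \<xi>" using timelike_gap[OF \<tau>] m_eq by auto
          define F where "F = phi s (norm (q4 s \<tau> \<xi> \<eta>))"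
          have F3: "phi s (norm (q4 s \<tau> \<xi> \<eta> + \<xi>)) = F + \<tau>" "0 < F + \<tau>" using phi_q4_add(1,3)[OF s \<tau>, of \<eta>] by (simp_all add: F_def)
          have f2: "0 < phi s (norm \<eta>2)" by (rule phi_pos[OF s])
          define D where "D = sqrt (s\<^sup>2 + (norm (perp \<xi> \<eta>))\<^sup>2 + m / 4)"
          have D: "0 < D" unfolding D_def using s m by (intro real_sqrt_gt_zero add_pos_pos add_pos_nonneg) auto
          have k: "kern s \<tau> \<xi> \<eta> = slab \<xi> \<eta> * (F * (F + \<tau>)) / (sqrt m * norm \<xi> * D)"
            using \<tau> by (simp add: kern_def F_def m_eq D_def)
          have "s\<^sup>2 + (norm (perp \<xi> \<eta>))\<^sup>2 + (y0 \<eta>2)\<^sup>2 = s\<^sup>2 + (norm (perp \<xi> \<eta>))\<^sup>2 + m / 4" unfolding y using m by (simp add: power_divide)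
          then have w: "wtA s a \<eta>2 \<eta> (y0 \<eta>2) = slab \<xi> \<eta> / (2 * phi s (norm \<eta>2)) * (F / (norm \<xi> * D))"
            by (simp add: wtA_def \<xi>_def[symmetric] D_def F_def q)
          have "1 / phi s (norm \<eta>2) * (kern s \<tau> \<xi> \<eta> * (1 / (F + \<tau>))) = wtA s a \<eta>2 \<eta> (y0 \<eta>2) * (2 / sqrt m)"
          proof -
            define H where "H = F + \<tau>"
            have "0 < H" using F3(2) by (simp add: H_def)
            then show ?thesis unfolding k w H_def[symmetric] using m D f2 by (simp add: field_simps)
          qed
          then show ?thesis
            unfolding F3(1) using f2 F3(2) m kern_nonneg[OF s, of \<tau> \<xi> \<eta>] wtA_nonneg[OF s, of a \<eta>2 \<eta> "y0 \<eta>2"]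
            by (subst ennreal_mult[symmetric], simp, simp, subst ennreal_mult[symmetric], simp, simp, subst ennreal_mult[symmetric], simp_all)
        qed
        then show "(ennreal (1 / phi s (norm \<eta>2)) * W m) * (ennreal (kern s \<tau> \<xi> \<eta>) * (ennreal (1 / phi s (norm (q4 s \<tau> \<xi> \<eta> + \<xi>))) * B (q4 s \<tau> \<xi> \<eta>))) =
          ennreal (wtA s a \<eta>2 \<eta> (y0 \<eta>2)) * \<Psi> (\<eta>2, ptA s a \<eta>2 \<eta> (y0 \<eta>2))"
          unfolding \<Psi>_def split_conv q[symmetric] m_def[symmetric] by (rule rearrange)
      qed
      finally show "ennreal (1 / phi s (norm \<eta>2)) * (W (mgap s a \<eta>2) * DB (phi s (norm a) - phi s (norm \<eta>2)) (a - \<eta>2)) =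
        (\<integral>\<^sup>+\<eta>. ennreal (wtA s a \<eta>2 \<eta> (y0 \<eta>2)) * \<Psi> (\<eta>2, ptA s a \<eta>2 \<eta> (y0 \<eta>2)) \<partial>lborel)" by (simp only: m_def \<tau>_def \<xi>_def)
    qed
    then have "?C * (\<integral>\<^sup>+\<eta>2. ennreal (1 / phi s (norm \<eta>2)) * (W (mgap s a \<eta>2) * DB (phi s (norm a) - phi s (norm \<eta>2)) (a - \<eta>2)) \<partial>lborel) =
      (\<integral>\<^sup>+\<eta>4. \<integral>\<^sup>+z. ennreal (wtB s a \<eta>4 0 z) * \<Psi> (ptB s a \<eta>4 0 z, \<eta>4) \<partial>lborel \<partial>lborel)"
      using fibre_lines_eq_spheres[OF s d \<Psi>, of a] by (simp only: y0_def)
    also have "\<dots> = (\<integral>\<^sup>+\<eta>4. B \<eta>4 * fibJ s W a \<eta>4 \<partial>lborel)"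
    proof (rule nn_integral_cong)
      fix \<eta>4 :: 'a
      have "B \<eta>4 * fibJ s W a \<eta>4 = (\<integral>\<^sup>+z. B \<eta>4 * (ennreal (wtB s a \<eta>4 0 z) * (ennreal (2 / sqrt (mgap s a (ptB s a \<eta>4 0 z))) * W (mgap s a (ptB s a \<eta>4 0 z)))) \<partial>lborel)"
        unfolding fibJ_def by (rule nn_integral_cmult[symmetric]) measurable
      then show "(\<integral>\<^sup>+z. ennreal (wtB s a \<eta>4 0 z) * \<Psi> (ptB s a \<eta>4 0 z, \<eta>4) \<partial>lborel) = B \<eta>4 * fibJ s W a \<eta>4"
        by (simp only: \<Psi>_def split_conv mult_ac)
    qed
    finally show ?thesis .
  qed
  have "?C * (\<integral>\<^sup>+\<eta>1. A \<eta>1 * (\<integral>\<^sup>+\<eta>2. ennreal (1 / phi s (norm \<eta>2)) * (W (mgap s \<eta>1 \<eta>2) * DB (phi s (norm \<eta>1) - phi s (norm \<eta>2)) (\<eta>1 - \<eta>2)) \<partial>lborel) \<partial>lborel) =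
    (\<integral>\<^sup>+\<eta>1. ?C * (A \<eta>1 * (\<integral>\<^sup>+\<eta>2. ennreal (1 / phi s (norm \<eta>2)) * (W (mgap s \<eta>1 \<eta>2) * DB (phi s (norm \<eta>1) - phi s (norm \<eta>2)) (\<eta>1 - \<eta>2)) \<partial>lborel)) \<partial>lborel)"
    by (rule nn_integral_cmult[symmetric]) measurable
  also have "\<dots> = (\<integral>\<^sup>+\<eta>1. A \<eta>1 * (\<integral>\<^sup>+\<eta>4. B \<eta>4 * fibJ s W \<eta>1 \<eta>4 \<partial>lborel) \<partial>lborel)"
    by (rule nn_integral_cong) (simp only: 2[symmetric] mult_ac)
  finally show ?thesis unfolding 1[symmetric] by (simp only: DB_def)
qed

section \<open>The spectral density of the product\<close>

text \<open>The spherical integral of \<open>nn_integral_sphere_power\<close> at exponent 2 \<beta>,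
  times 2^(- (d - 1) / 2), which comes from writing the radius and \<open>cmass\<close> through the
  two bases of the kernel.\<close>

definition fibC :: "real \<Rightarrow> nat \<Rightarrow> real" where
  "fibC \<beta> d = 2 powr (- (real d - 1) / 2) * ((2 * pi) powr ((real d - 1) / 2) *
     (Gamma (2 * \<beta> + (real d - 1) / 2) * 2 powr (2 * \<beta> + (real d - 1) / 2)) / Gamma (real d - 1 + 2 * \<beta>))"

text \<open>In the rest frame of P1 + P4, both P1 and the points P2 of the fibre have energy M / 2
  and momentum of length \<rho>. Hence \<open>mgap\<close> is the squared distance of two points on
  a sphere, 2 \<rho>^2 (1 - cos), and e is the direction opposite to the momentum of P1.\<close>

lemma mgap_fibre_sphere:
  assumes s: "0 < s" and ne: "a \<noteq> \<eta>4"
  shows "\<exists>e. norm (e::'a::euclidean_space) = 1 \<and> (\<forall>z. z \<noteq> 0 \<longrightarrow> mgap s a (ptB s a \<eta>4 0 z) = (mgap s a \<eta>4 / 2) * (1 + e \<bullet> (z /\<^sub>R norm z)))"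
    and "(radB s a \<eta>4 0)\<^sup>2 = mgap s a \<eta>4 / 4"
proof -
  define mg where "mg = mgap s a \<eta>4"
  have mg: "0 < mg" unfolding mg_def by (rule mgap_pos[OF s ne])
  define M where "M = cmass s a \<eta>4"
  have M2: "M\<^sup>2 = 4 * s\<^sup>2 + mg" unfolding M_def mg_def by (rule cmass_power2(1)[OF s])
  have M0: "0 < M" using cmass_power2(2)[OF s, of a \<eta>4] s by (simp add: M_def)
  define \<rho> where "\<rho> = radB s a \<eta>4 0"
  have \<rho>: "\<rho> = sqrt (mg / 4)"
  proof -
    have "(M / 2 + 0 / (2 * M))\<^sup>2 - s\<^sup>2 = M\<^sup>2 / 4 - s\<^sup>2" by (simp add: power_divide)
    also have "\<dots> = mg / 4" unfolding M2 by (simp add: add_divide_distrib)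
    finally have "(M / 2 + 0 / (2 * M))\<^sup>2 - s\<^sup>2 = mg / 4" .
    then show ?thesis by (simp add: \<rho>_def radB_def M_def)
  qed
  have \<rho>2: "\<rho>\<^sup>2 = mg / 4" "0 < \<rho>" using mg by (simp_all add: \<rho>)
  show "(radB s a \<eta>4 0)\<^sup>2 = mgap s a \<eta>4 / 4" using \<rho>2 by (simp add: \<rho>_def mg_def)
  define E where "E = phi s (norm a) + phi s (norm \<eta>4)"
  define p where "p = a + \<eta>4"
  have pE: "norm p < E" unfolding p_def E_def by (rule norm_add_less_phi[OF s])
  have Md: "M = sqrt (E\<^sup>2 - (norm p)\<^sup>2)" by (simp add: M_def cmass_def E_def p_def)
  have Mh: "E * phi s (norm a) - p \<bullet> a = M\<^sup>2 / 2"
  proof -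
    have "E * phi s (norm a) - p \<bullet> a = (phi s (norm a))\<^sup>2 - a \<bullet> a + (phi s (norm a) * phi s (norm \<eta>4) - a \<bullet> \<eta>4)"
      by (simp add: E_def p_def inner_add_left inner_commute algebra_simps power2_eq_square)
    then show ?thesis by (simp add: phi_norm_power2 M2 mg_def mgap_def)
  qed
  \<comment> \<open>The boost with - p is inverse to the boost with p, so this is the momentum of P1
    in the rest frame.\<close>
  define k1 where "k1 = boost s E (- p) a"
  have "phi s (norm k1) = (E * phi s (norm a) + (- p) \<bullet> a) / M"
    unfolding k1_def by (rule phi_boost) (use pE Md in simp_all)
  then have fk1: "phi s (norm k1) = M / 2" using Mh M0 by (simp add: power2_eq_square)
  have "(norm k1)\<^sup>2 = (M / 2)\<^sup>2 - s\<^sup>2" using fk1 by (metis add_diff_cancel_left' phi_power2)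
  then have "(norm k1)\<^sup>2 = mg / 4" using M2 by (simp add: power_divide add_divide_distrib)
  then have "(norm k1)\<^sup>2 = \<rho>\<^sup>2" by (simp only: \<rho>2(1))
  then have nk1: "norm k1 = \<rho>" using less_imp_le[OF \<rho>2(2)] by (simp add: power2_eq_iff_nonneg)
  define e where "e = - (k1 /\<^sub>R \<rho>)"
  have e: "norm e = 1" using nk1 \<rho>2 by (simp add: e_def)
  have "mgap s a (ptB s a \<eta>4 0 z) = (mg / 2) * (1 + e \<bullet> (z /\<^sub>R norm z))" if z: "z \<noteq> 0" for z
  proof -
    define K where "K = (\<rho> / norm z) *\<^sub>R z"
    have nK: "norm K = \<rho>" using z \<rho>2 by (simp add: K_def)
    have fK: "phi s (norm K) = M / 2"
    proof -
      have "s\<^sup>2 + \<rho>\<^sup>2 = (M / 2)\<^sup>2" using M2 \<rho>2 by (simp add: power_divide add_divide_distrib)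
      then show ?thesis using M0 by (simp add: phi_def nK)
    qed
    have pt: "ptB s a \<eta>4 0 z = boost s E p K" by (simp add: ptB_def E_def p_def K_def \<rho>_def)
    \<comment> \<open>Invariance of the Lorentz product of P1 and P2: original frame on the left,
      rest frame on the right. It is verified by expanding the boosts of both points.\<close>
    have "phi s (norm a) * phi s (norm (boost s E p K)) - a \<bullet> boost s E p K = phi s (norm K) * ((E * phi s (norm a) - p \<bullet> a) / M) - k1 \<bullet> K"
    proof -
      define N where "N = M * (E + M)"
      define f where "f = phi s (norm K)"
      define fa where "fa = phi s (norm a)"
      have b1: "boost s E p K = K + ((p \<bullet> K) / N + f / M) *\<^sub>R p" by (simp add: boost_def Let_def Md N_def f_def)
      have b2: "k1 = a + ((- (p \<bullet> a)) / N + fa / M) *\<^sub>R (- p)" by (simp add: k1_def boost_def Let_def Md N_def fa_def)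
      have b3: "phi s (norm (boost s E p K)) = (E * f + p \<bullet> K) / M" unfolding f_def by (rule phi_boost[OF pE Md])
      have x1: "a \<bullet> boost s E p K = a \<bullet> K + ((p \<bullet> K) / N + f / M) * (p \<bullet> a)"
        unfolding b1 by (simp add: inner_add_right inner_commute)
      have x2: "k1 \<bullet> K = a \<bullet> K - ((- (p \<bullet> a)) / N + fa / M) * (p \<bullet> K)"
        unfolding b2 by (simp add: inner_add_left inner_diff_left)
      have "fa * ((E * f + p \<bullet> K) / M) - (a \<bullet> K + ((p \<bullet> K) / N + f / M) * (p \<bullet> a)) = f * ((E * fa - p \<bullet> a) / M) - (a \<bullet> K - ((- (p \<bullet> a)) / N + fa / M) * (p \<bullet> K))"
        by (simp add: add_divide_distrib diff_divide_distrib algebra_simps)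
      then show ?thesis unfolding b3 x1 x2 by (simp add: f_def fa_def)
    qed
    also have "\<dots> = (M / 2)\<^sup>2 - k1 \<bullet> K" unfolding fK Mh using M0 by (simp add: power2_eq_square)
    finally have "mgap s a (ptB s a \<eta>4 0 z) = 2 * ((M / 2)\<^sup>2 - k1 \<bullet> K - s\<^sup>2)" by (simp add: mgap_def pt)
    also have "k1 \<bullet> K = - \<rho>\<^sup>2 * (e \<bullet> (z /\<^sub>R norm z))"
      using \<rho>2(2) by (simp add: K_def e_def power2_eq_square field_simps)
    also have "2 * ((M / 2)\<^sup>2 - (- \<rho>\<^sup>2 * (e \<bullet> (z /\<^sub>R norm z))) - s\<^sup>2) = (mg / 2) * (1 + e \<bullet> (z /\<^sub>R norm z))"
      unfolding \<rho>2(1) using M2 by (simp add: power_divide algebra_simps)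
    finally show ?thesis .
  qed
  then show "\<exists>e. norm (e::'a) = 1 \<and> (\<forall>z. z \<noteq> 0 \<longrightarrow> mgap s a (ptB s a \<eta>4 0 z) = (mgap s a \<eta>4 / 2) * (1 + e \<bullet> (z /\<^sub>R norm z)))"
    using e by (auto simp: mg_def)
qed

text \<open>By \<open>mgap_fibre_sphere\<close> the integrand is a constant times the power of 1 + e
  \<bullet> \<omega> handled by \<open>nn_integral_sphere_power\<close>. The constant is \<rho>^(d -
  2) / M times a power of \<open>mgap\<close>; since the bases of the kernel are \<open>mgap\<close>
  / 2 and M^2 / 2, it is a multiple of \<open>KG_kernel\<close>.\<close>

lemma fibJ_power:
  fixes a :: "'a::euclidean_space"
  assumes s: "0 < s" and d: "2 \<le> DIM('a)" and b: "- (real DIM('a) - 1) / 2 < 2 * \<beta>" and ne: "a \<noteq> \<eta>4"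
  shows "fibJ s (\<lambda>m. ennreal (m powr (2 * \<beta>))) a \<eta>4 = ennreal (fact (DIM('a) - 1)) *
    ennreal (fibC \<beta> DIM('a) * KG_kernel s (1/2) ((real DIM('a) - 2) / 2 + 2 * \<beta>) a \<eta>4)"
proof -
  let ?d = "DIM('a)"
  define mg where "mg = mgap s a \<eta>4"
  have mg: "0 < mg" unfolding mg_def by (rule mgap_pos[OF s ne])
  define M where "M = cmass s a \<eta>4"
  have M2: "M\<^sup>2 = 4 * s\<^sup>2 + mg" unfolding M_def mg_def by (rule cmass_power2(1)[OF s])
  have M0: "0 < M" using cmass_power2(2)[OF s, of a \<eta>4] s by (simp add: M_def)
  define \<rho> where "\<rho> = radB s a \<eta>4 0"
  have \<rho>2: "\<rho>\<^sup>2 = mg / 4" "0 \<le> \<rho>" using mgap_fibre_sphere(2)[OF s ne] radB_nonneg(1)[OF s, of 0 a \<eta>4] by (simp_all add: \<rho>_def mg_def)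
  have \<rho>0: "0 < \<rho>" using \<rho>2 mg by (cases "\<rho> = 0") auto
  obtain e :: 'a where e: "norm e = 1" and em: "\<And>z. z \<noteq> 0 \<Longrightarrow> mgap s a (ptB s a \<eta>4 0 z) = (mg / 2) * (1 + e \<bullet> (z /\<^sub>R norm z))"
    using mgap_fibre_sphere(1)[OF s ne] unfolding mg_def by blast
  define c1 where "c1 = \<rho> ^ (?d - 2) / M * (mg / 2) powr (2 * \<beta>)"
  have c1: "0 \<le> c1" using \<rho>0 M0 by (simp add: c1_def)
  have "fibJ s (\<lambda>m. ennreal (m powr (2 * \<beta>))) a \<eta>4 = (\<integral>\<^sup>+z. ennreal c1 * (ennreal (exp (- norm z)) * ennreal ((1 + e \<bullet> (z /\<^sub>R norm z)) powr (2 * \<beta>))) \<partial>lborel)"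
    unfolding fibJ_def
  proof (rule nn_integral_cong_AE, use AE_lborel_singleton[of 0] in eventually_elim)
    fix z :: 'a assume z: "z \<noteq> 0"
    define m where "m = mgap s a (ptB s a \<eta>4 0 z)"
    define t where "t = 1 + e \<bullet> (z /\<^sub>R norm z)"
    have m0: "0 \<le> m" unfolding m_def by (rule mgap_nonneg[OF s])
    have mt: "m = (mg / 2) * t" unfolding m_def t_def by (rule em[OF z])
    have w: "wtB s a \<eta>4 0 z = exp (- norm z) * (\<rho> ^ (?d - 2) / (2 * M)) * sqrt m" by (simp add: wtB_def \<rho>_def M_def m_def)
    have "wtB s a \<eta>4 0 z * (2 / sqrt m * m powr (2 * \<beta>)) = c1 * (exp (- norm z) * t powr (2 * \<beta>))"
    proof (cases "m = 0")
      \<comment> \<open>Here 2 / sqrt(0) = 0 by convention, and t = 0 makes the right-hand side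
        vanish as well.\<close>
      case True
      then have "t = 0" using mt mg by simp
      then show ?thesis using True by simp
    next
      case False
      then have "sqrt m * (2 / sqrt m * m powr (2 * \<beta>)) = 2 * m powr (2 * \<beta>)" using m0 by simp
      then have "wtB s a \<eta>4 0 z * (2 / sqrt m * m powr (2 * \<beta>)) = exp (- norm z) * (\<rho> ^ (?d - 2) / (2 * M)) * (2 * m powr (2 * \<beta>))"
        unfolding w by (simp only: mult.assoc)
      moreover have "m powr (2 * \<beta>) = (mg / 2) powr (2 * \<beta>) * t powr (2 * \<beta>)" unfolding mt by (rule powr_mult)
      ultimately have "wtB s a \<eta>4 0 z * (2 / sqrt m * m powr (2 * \<beta>)) = exp (- norm z) * (\<rho> ^ (?d - 2) / (2 * M)) * (2 * ((mg / 2) powr (2 * \<beta>) * t powr (2 * \<beta>)))"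
        by (simp only:)
      then show ?thesis by (simp only: c1_def) simp
    qed
    moreover have "0 \<le> wtB s a \<eta>4 0 z" unfolding w using \<rho>0 M0 m0 by (intro mult_nonneg_nonneg divide_nonneg_nonneg) auto
    moreover have "0 \<le> 2 / sqrt m" using m0 by simp
    ultimately show "ennreal (wtB s a \<eta>4 0 z) * (ennreal (2 / sqrt (mgap s a (ptB s a \<eta>4 0 z))) * ennreal (mgap s a (ptB s a \<eta>4 0 z) powr (2 * \<beta>))) =
      ennreal c1 * (ennreal (exp (- norm z)) * ennreal ((1 + e \<bullet> (z /\<^sub>R norm z)) powr (2 * \<beta>)))"
      unfolding m_def[symmetric] t_def[symmetric] by (simp only: ennreal_mult'[symmetric] c1 exp_ge_zero)
  qed
  also have "\<dots> = ennreal c1 * (\<integral>\<^sup>+z. (ennreal (exp (- norm z)) * ennreal ((1 + e \<bullet> (z /\<^sub>R norm z)) powr (2 * \<beta>))) \<partial>lborel)"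
    by (rule nn_integral_cmult) measurable
  also have "\<dots> = ennreal c1 * (ennreal (fact (?d - 1)) * ennreal ((2 * pi) powr ((real ?d - 1) / 2) *
      (Gamma (2 * \<beta> + (real ?d - 1) / 2) * 2 powr (2 * \<beta> + (real ?d - 1) / 2)) / Gamma (real ?d - 1 + 2 * \<beta>)))"
    by (simp only: nn_integral_sphere_power[OF e b d])
  also have "\<dots> = ennreal (fact (?d - 1)) * ennreal (c1 * ((2 * pi) powr ((real ?d - 1) / 2) *
      (Gamma (2 * \<beta> + (real ?d - 1) / 2) * 2 powr (2 * \<beta> + (real ?d - 1) / 2)) / Gamma (real ?d - 1 + 2 * \<beta>)))"
    by (simp only: ennreal_mult'[OF c1] mult.left_commute)
  also have "c1 * ((2 * pi) powr ((real ?d - 1) / 2) *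
      (Gamma (2 * \<beta> + (real ?d - 1) / 2) * 2 powr (2 * \<beta> + (real ?d - 1) / 2)) / Gamma (real ?d - 1 + 2 * \<beta>)) =
     fibC \<beta> ?d * KG_kernel s (1/2) ((real ?d - 2) / 2 + 2 * \<beta>) a \<eta>4"
  proof -
    define h where "h = mg / 2"
    have h: "0 < h" using mg by (simp add: h_def)
    define \<mu> where "\<mu> = (real ?d - 2) / 2"
    have k1: "phi s (norm a) * phi s (norm \<eta>4) - a \<bullet> \<eta>4 - s\<^sup>2 = h" by (simp add: h_def mg_def mgap_def)
    have k2: "phi s (norm a) * phi s (norm \<eta>4) - a \<bullet> \<eta>4 + s\<^sup>2 = M\<^sup>2 / 2" unfolding M2 by (simp add: mg_def mgap_def)
    have "(M\<^sup>2 / 2) powr (1/2) = M / sqrt 2" using M0 by (simp add: powr_half_sqrt real_sqrt_divide)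
    then have K: "KG_kernel s (1/2) (\<mu> + 2 * \<beta>) a \<eta>4 = h powr \<mu> * h powr (2 * \<beta>) * (sqrt 2 / M)"
      unfolding KG_kernel_def k1 k2 by (simp add: powr_add)
    have "\<rho> ^ (?d - 2) = (h / 2) powr \<mu>"
    proof -
      have "\<rho> ^ (?d - 2) = \<rho> powr (real (?d - 2))" using \<rho>0 by (simp add: powr_realpow)
      also have "\<dots> = (\<rho> powr 2) powr \<mu>" using d by (simp add: powr_powr \<mu>_def of_nat_diff diff_divide_distrib)
      also have "\<rho> powr 2 = h / 2" using \<rho>0 \<rho>2 by (simp add: h_def)
      finally show ?thesis .
    qed
    also have "\<dots> = h powr \<mu> * 2 powr (- \<mu>)" using h by (simp add: powr_divide powr_minus_divide)
    finally have r: "\<rho> ^ (?d - 2) = h powr \<mu> * 2 powr (- \<mu>)" .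
    have "2 powr (- (real ?d - 1) / 2) * sqrt 2 = 2 powr (- (real ?d - 1) / 2 + 1 / 2)" by (simp add: powr_add powr_half_sqrt)
    also have "- (real ?d - 1) / 2 + 1 / 2 = - \<mu>" by (simp add: \<mu>_def field_simps)
    finally have "c1 = 2 powr (- (real ?d - 1) / 2) * KG_kernel s (1/2) (\<mu> + 2 * \<beta>) a \<eta>4"
      unfolding c1_def r K h_def[symmetric] by (simp add: field_simps)
    then show ?thesis by (simp add: fibC_def \<mu>_def)
  qed
  finally show ?thesis .
qed

section \<open>The product of two waves as the transform of a density\<close>

definition densC :: "real \<Rightarrow> ('a::euclidean_space \<Rightarrow> 'a \<Rightarrow> complex) \<Rightarrow> real \<times> 'a \<Rightarrow> complex" where
  "densC s \<Phi> = (\<lambda>(\<tau>, \<xi>). LINT \<eta>|lborel. of_real (kern s \<tau> \<xi> \<eta>) * \<Phi> (q4 s \<tau> \<xi> \<eta> + \<xi>) (q4 s \<tau> \<xi> \<eta>))"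

text \<open>Stating \<open>pairs_disintegration\<close> as an equality of measures transports
  Bochner integrals too. A test function of the differences is constant on each fibre and can be
  pulled out of the fibre integral.\<close>

lemma pushforward_densC:
  fixes \<Phi> :: "'a::euclidean_space \<Rightarrow> 'a \<Rightarrow> complex" and \<psi> :: "real \<times> 'a \<Rightarrow> complex"
  assumes s: "0 < s" and \<Phi>: "integrable lborel (\<lambda>(x, y). \<Phi> x y)" and \<psi>: "\<psi> \<in> borel_measurable borel" and C: "\<And>p. norm (\<psi> p) \<le> C"
  shows "(LINT q|lborel. \<Phi> (fst q) (snd q) * \<psi> (phi s (norm (fst q)) - phi s (norm (snd q)), fst q - snd q)) = (LINT p|lborel. densC s \<Phi> p * \<psi> p)"
    and "integrable lborel (\<lambda>p. densC s \<Phi> p * \<psi> p)"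
proof -
  define T where "T = (\<lambda>(p :: real \<times> 'a, \<eta> :: 'a). (q4 s (fst p) (snd p) \<eta> + snd p, q4 s (fst p) (snd p) \<eta>))"
  define k where "k = (\<lambda>(p :: real \<times> 'a, \<eta> :: 'a). kern s (fst p) (snd p) \<eta>)"
  have [measurable]: "T \<in> borel_measurable borel" "k \<in> borel_measurable borel"
    unfolding T_def k_def borel_prod[symmetric] by measurable
  have k0: "0 \<le> k y" for y unfolding k_def using kern_nonneg[OF s] by (cases y) auto
  \<comment> \<open>Lebesgue measure on pairs is the image of the measure with density k on triples
    (\<tau>, \<xi>, \<eta>).\<close>
  have D: "distr (density lborel (\<lambda>y. ennreal (k y))) borel T = (lborel :: ('a \<times> 'a) measure)"
  proof (rule measure_eqI)
    fix X assume "X \<in> sets (distr (density lborel (\<lambda>y. ennreal (k y))) borel T)"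
    then have X[measurable]: "X \<in> sets borel" by simp
    have iX: "indicator X \<in> borel_measurable (borel \<Otimes>\<^sub>M borel)" using X by (simp add: borel_prod)
    have "emeasure (distr (density lborel (\<lambda>y. ennreal (k y))) borel T) X = (\<integral>\<^sup>+y. indicator X y \<partial>distr (density lborel (\<lambda>y. ennreal (k y))) borel T)"
      by (rule nn_integral_indicator[symmetric]) simp
    also have "\<dots> = (\<integral>\<^sup>+y. ennreal (k y) * indicator X (T y) \<partial>lborel)"
      by (subst nn_integral_distr, simp, simp, subst nn_integral_density) auto
    also have "\<dots> = (\<integral>\<^sup>+p. \<integral>\<^sup>+\<eta>. ennreal (k (p, \<eta>)) * indicator X (T (p, \<eta>)) \<partial>lborel \<partial>lborel)"
      by (rule nn_integral_lborel_pair) measurable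
    also have "\<dots> = (\<integral>\<^sup>+\<tau>. \<integral>\<^sup>+\<xi>. \<integral>\<^sup>+\<eta>. ennreal (kern s \<tau> \<xi> \<eta>) * indicator X (q4 s \<tau> \<xi> \<eta> + \<xi>, q4 s \<tau> \<xi> \<eta>) \<partial>lborel \<partial>lborel \<partial>lborel)"
    proof (subst nn_integral_lborel_pair)
      show "(\<lambda>p. \<integral>\<^sup>+\<eta>. ennreal (k (p, \<eta>)) * indicator X (T (p, \<eta>)) \<partial>lborel) \<in> borel_measurable borel"
        unfolding k_def T_def split_conv borel_prod[symmetric] using iX by measurable
    qed (simp add: k_def T_def)
    also have "\<dots> = (\<integral>\<^sup>+x. \<integral>\<^sup>+y. indicator X (x, y) \<partial>lborel \<partial>lborel)" by (rule pairs_disintegration[OF s iX, symmetric])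
    also have "\<dots> = (\<integral>\<^sup>+q. indicator X q \<partial>lborel)" by (rule nn_integral_lborel_pair[symmetric]) simp
    finally show "emeasure (distr (density lborel (\<lambda>y. ennreal (k y))) borel T) X = emeasure lborel X" by simp
  qed simp
  define P where "P q = (phi s (norm (fst q)) - phi s (norm (snd q)), fst q - snd q)" for q :: "'a \<times> 'a"
  have P[measurable]: "P \<in> borel_measurable borel" unfolding P_def borel_prod[symmetric] by measurable
  define \<Psi> where "\<Psi> q = \<Phi> (fst q) (snd q) * \<psi> (P q)" for q
  have iPsi: "integrable lborel \<Psi>"
    unfolding \<Psi>_def
  proof (rule integrable_mult_bounded(1))
    show "integrable lborel (\<lambda>q. \<Phi> (fst q) (snd q))" using \<Phi> by (simp add: case_prod_beta')
    show "(\<lambda>q. \<psi> (P q)) \<in> borel_measurable borel" using \<psi> by measurable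
  qed (rule C)
  have [measurable]: "\<Psi> \<in> borel_measurable borel" using iPsi by auto
  have kP: "of_real (k y) * \<Psi> (T y) = of_real (k y) * \<Phi> (fst (T y)) (snd (T y)) * \<psi> (fst y)" for y
  proof (cases y)
    case (Pair p \<eta>)
    show ?thesis
    proof (cases "\<bar>fst p\<bar> < norm (snd p)")
      case True
      have "P (T y) = p" using phi_q4_add(1)[OF s True, of \<eta>] by (simp add: P_def T_def Pair)
      then show ?thesis by (simp add: \<Psi>_def Pair)
    qed (simp add: k_def Pair kern_def)
  qed
  have "integrable lborel \<Psi> \<longleftrightarrow> integrable (distr (density lborel (\<lambda>y. ennreal (k y))) borel T) \<Psi>" by (simp only: D)
  also have "\<dots> \<longleftrightarrow> integrable (density lborel (\<lambda>y. ennreal (k y))) (\<lambda>y. \<Psi> (T y))" by (rule integrable_distr_eq) auto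
  also have "\<dots> \<longleftrightarrow> integrable lborel (\<lambda>y. k y *\<^sub>R \<Psi> (T y))" by (rule integrable_density) (auto simp: k0)
  finally have i1: "integrable lborel (\<lambda>y. k y *\<^sub>R \<Psi> (T y))" using iPsi by simp
  have "(LINT q|lborel. \<Psi> q) = (LINT q|distr (density lborel (\<lambda>y. ennreal (k y))) borel T. \<Psi> q)" by (simp only: D)
  also have "\<dots> = (LINT y|density lborel (\<lambda>y. ennreal (k y)). \<Psi> (T y))" by (rule integral_distr) auto
  also have "\<dots> = (LINT y|lborel. k y *\<^sub>R \<Psi> (T y))" by (rule integral_density) (auto simp: k0)
  finally have v1: "(LINT q|lborel. \<Psi> q) = (LINT y|lborel. k y *\<^sub>R \<Psi> (T y))" .
  have eqs: "(LINT \<eta>|lborel. k (p, \<eta>) *\<^sub>R \<Psi> (T (p, \<eta>))) = densC s \<Phi> p * \<psi> p" for p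
  proof -
    have "(LINT \<eta>|lborel. k (p, \<eta>) *\<^sub>R \<Psi> (T (p, \<eta>))) = (LINT \<eta>|lborel. of_real (kern s (fst p) (snd p) \<eta>) * \<Phi> (q4 s (fst p) (snd p) \<eta> + snd p) (q4 s (fst p) (snd p) \<eta>) * \<psi> p)"
      unfolding scaleR_conv_of_real kP by (simp add: k_def T_def)
    also have "\<dots> = (LINT \<eta>|lborel. of_real (kern s (fst p) (snd p) \<eta>) * \<Phi> (q4 s (fst p) (snd p) \<eta> + snd p) (q4 s (fst p) (snd p) \<eta>)) * \<psi> p"
      by (rule integral_mult_left_zero)
    finally show ?thesis by (simp add: densC_def case_prod_beta)
  qed
  have i2: "integrable (lborel \<Otimes>\<^sub>M lborel) (\<lambda>y. k y *\<^sub>R \<Psi> (T y))" using i1 by (simp add: lborel_prod)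
  have "(LINT y|lborel. k y *\<^sub>R \<Psi> (T y)) = (LINT p|lborel. LINT \<eta>|lborel. k (p, \<eta>) *\<^sub>R \<Psi> (T (p, \<eta>)))"
    using lborel_pair.integral_fst'[OF i2] by (simp add: lborel_prod)
  then have "(LINT q|lborel. \<Psi> q) = (LINT p|lborel. densC s \<Phi> p * \<psi> p)"
    using v1 by (simp only: eqs)
  then show "(LINT q|lborel. \<Phi> (fst q) (snd q) * \<psi> (phi s (norm (fst q)) - phi s (norm (snd q)), fst q - snd q)) = (LINT p|lborel. densC s \<Phi> p * \<psi> p)"
    by (simp only: \<Psi>_def P_def)
  show "integrable lborel (\<lambda>p. densC s \<Phi> p * \<psi> p)"
    using lborel_pair.integrable_fst'[OF i2] by (simp only: eqs)
qed

lemma lborel_pair_product: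
  fixes u :: "'a::euclidean_space \<Rightarrow> complex" and w :: "'b::euclidean_space \<Rightarrow> complex"
  assumes u: "integrable lborel u" and w: "integrable lborel w"
  shows "integrable lborel (\<lambda>q. u (fst q) * w (snd q))"
    and "(LINT q|lborel. u (fst q) * w (snd q)) = (LINT x|lborel. u x) * (LINT y|lborel. w y)"
proof -
  have [measurable]: "u \<in> borel_measurable borel" "w \<in> borel_measurable borel" using u w by auto
  have i: "integrable (lborel \<Otimes>\<^sub>M lborel) (\<lambda>q. u (fst q) * w (snd q))"
  proof (rule lborel_pair.Fubini_integrable)
    show "(\<lambda>q. u (fst q) * w (snd q)) \<in> borel_measurable (lborel \<Otimes>\<^sub>M lborel)" by measurable
    show "integrable lborel (\<lambda>x. LINT y|lborel. norm (u (fst (x, y)) * w (snd (x, y))))"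
      using u by (simp add: norm_mult)
    show "AE x in lborel. integrable lborel (\<lambda>y. u (fst (x, y)) * w (snd (x, y)))" using w by simp
  qed
  then show "integrable lborel (\<lambda>q. u (fst q) * w (snd q))" by (simp add: lborel_prod)
  show "(LINT q|lborel. u (fst q) * w (snd q)) = (LINT x|lborel. u x) * (LINT y|lborel. w y)"
    using lborel_pair.integral_fst'[OF i] by (simp add: lborel_prod)
qed

text \<open>The product is a superposition of plane waves with frequencies P q, the differences of
  points of the mass shell. Paired with the transform of \<psi>, Fubini and Schwartz inversion
  evaluate \<psi> at P q, and \<open>pushforward_densC\<close> collects equal frequencies.\<close>

lemma KG_product_has_fourier:
  fixes f g :: "'a::euclidean_space \<Rightarrow> complex"
  assumes s: "0 < s" and f: "integrable lborel (fourier f)" and g: "integrable lborel (fourier g)"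
  shows "has_fourier (KG_product s f g) (\<lambda>p. of_real ((2 * pi) powr (1 - real DIM('a))) * densC s (\<lambda>x y. fourier f x * cnj (fourier g y)) p)"
proof -
  let ?F = "fourier f" and ?G = "fourier g"
  have [measurable]: "?F \<in> borel_measurable borel" "?G \<in> borel_measurable borel" using f g by auto
  define c where "c = 1 / (2 * pi) ^ DIM('a)"
  define \<Phi> where "\<Phi> x y = ?F x * cnj (?G y)" for x y
  define P where "P q = (phi s (norm (fst q)) - phi s (norm (snd q)), fst q - snd q)" for q :: "'a \<times> 'a"
  have P[measurable]: "P \<in> borel_measurable borel" unfolding P_def borel_prod[symmetric] by measurable
  have \<Phi>m: "(\<lambda>q. \<Phi> (fst q) (snd q)) \<in> borel_measurable borel" unfolding \<Phi>_def borel_prod[symmetric] by measurable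
  have g': "integrable lborel (\<lambda>y. cnj (?G y))" using g by simp
  have i\<Phi>: "integrable lborel (\<lambda>(x, y). \<Phi> x y)"
    using lborel_pair_product(1)[OF f g'] by (simp add: \<Phi>_def case_prod_beta')
  have i\<Phi>': "integrable lborel (\<lambda>q. \<Phi> (fst q) (snd q))" using i\<Phi> by (simp add: case_prod_beta')
  have prodint: "(LINT q|lborel. u (fst q) * w (snd q)) = (LINT x|lborel. u x) * (LINT y|lborel. w y)"
    if "integrable lborel u" "integrable lborel w" for u w :: "'a \<Rightarrow> complex"
    by (rule lborel_pair_product(2)[OF that])
  have KGf: "KG_product s f g p = of_real (c\<^sup>2) * (LINT q|lborel. exp (\<i> * of_real (p \<bullet> P q)) * \<Phi> (fst q) (snd q))" for p
  proof (cases p)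
    case (Pair t x)
    define u where "u \<eta> = exp (\<i> * complex_of_real (x \<bullet> \<eta> + t * phi s (norm \<eta>))) * ?F \<eta>" for \<eta>
    define w where "w \<eta> = exp (\<i> * complex_of_real (x \<bullet> \<eta> + t * phi s (norm \<eta>))) * ?G \<eta>" for \<eta>
    have ui: "integrable lborel u" unfolding u_def by (rule integrable_exp_mult[OF f]) auto
    have wi: "integrable lborel w" unfolding w_def by (rule integrable_exp_mult[OF g]) auto
    have "KG_product s f g p = of_real (c\<^sup>2) * ((LINT \<eta>|lborel. u \<eta>) * (LINT \<eta>|lborel. cnj (w \<eta>)))"
    proof -
      have e: "(LINT \<eta>|lborel. cnj (w \<eta>)) = cnj (LINT \<eta>|lborel. w \<eta>)" by simp
      show ?thesis unfolding e unfolding KG_product_def KG_propagator_def Pair split_conv u_def w_def c_def by (simp add: power2_eq_square)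
    qed
    also have "(LINT \<eta>|lborel. u \<eta>) * (LINT \<eta>|lborel. cnj (w \<eta>)) = (LINT q|lborel. u (fst q) * cnj (w (snd q)))"
      by (rule prodint[symmetric]) (use ui wi in auto)
    also have "\<dots> = (LINT q|lborel. exp (\<i> * of_real (p \<bullet> P q)) * \<Phi> (fst q) (snd q))"
    proof (intro Bochner_Integration.integral_cong refl)
      fix q :: "'a \<times> 'a"
      have "exp (\<i> * complex_of_real (x \<bullet> fst q + t * phi s (norm (fst q)))) * cnj (exp (\<i> * complex_of_real (x \<bullet> snd q + t * phi s (norm (snd q))))) = exp (\<i> * of_real (p \<bullet> P q))"
        by (simp add: exp_cnj exp_add[symmetric] P_def Pair inner_diff_right algebra_simps)
      then show "u (fst q) * cnj (w (snd q)) = exp (\<i> * of_real (p \<bullet> P q)) * \<Phi> (fst q) (snd q)"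
        by (simp add: u_def w_def \<Phi>_def)
    qed
    finally show ?thesis .
  qed
  have KGm: "KG_product s f g \<in> borel_measurable borel"
  proof -
    have "(\<lambda>(p, q). exp (\<i> * complex_of_real (p \<bullet> P q)) * \<Phi> (fst q) (snd q)) \<in> borel_measurable (borel \<Otimes>\<^sub>M lborel)"
      using \<Phi>m by measurable
    then have "(\<lambda>p. LINT q|lborel. exp (\<i> * of_real (p \<bullet> P q)) * \<Phi> (fst q) (snd q)) \<in> borel_measurable borel"
      by (rule lborel.borel_measurable_lebesgue_integral)
    then show ?thesis unfolding KGf[abs_def] by measurable
  qed
  have KGb: "norm (KG_product s f g p) \<le> c\<^sup>2 * (LINT q|lborel. norm (\<Phi> (fst q) (snd q)))" for p
    unfolding KGf norm_mult
    by (intro mult_mono order_trans[OF integral_norm_bound]) (auto simp: norm_mult norm_exp_eq_Re norm_power)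
  define G0 where "G0 p = of_real ((2 * pi) powr (1 - real DIM('a))) * densC s \<Phi> p" for p
  \<comment> \<open>(2 pi)^(- 2 d) from the two propagators against (2 pi)^(d + 1) from inversion in
    space-time.\<close>
  have cc: "c\<^sup>2 * (2 * pi) ^ DIM(real \<times> 'a) = (2 * pi) powr (1 - real DIM('a))"
  proof -
    have "c\<^sup>2 * (2 * pi) ^ DIM(real \<times> 'a) = 2 * pi / (2 * pi) ^ DIM('a)"
      unfolding c_def by (simp add: power2_eq_square field_simps)
    also have "\<dots> = (2 * pi) powr 1 / (2 * pi) powr (real DIM('a))" by (simp only: powr_realpow[of "2 * pi", simplified] powr_one) simp
    also have "\<dots> = (2 * pi) powr (1 - real DIM('a))" by (rule powr_diff[symmetric])
    finally show ?thesis .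
  qed
  have "has_fourier (KG_product s f g) G0"
    unfolding has_fourier_def tempered_fun_def
  proof (intro conjI allI impI)
    fix \<psi> :: "real \<times> 'a \<Rightarrow> complex" assume sc: "schwartz \<psi>"
    note [measurable] = schwartz_measurable[OF sc]
    obtain C where C: "\<And>x. norm (\<psi> x) \<le> C" using schwartz_decay[OF sc, of 0] by auto
    show "integrable lborel (\<lambda>x. KG_product s f g x * \<psi> x)"
      by (rule integrable_mult_bounded(2)[OF schwartz_integrable[OF sc]]) (use KGm KGb in auto)
    show "integrable lborel (\<lambda>x. KG_product s f g x * fourier \<psi> x)"
      by (rule integrable_mult_bounded(2)[OF fourier_schwartz_integrable[OF sc]]) (use KGm KGb in auto)
    have dp: "(LINT q|lborel. \<Phi> (fst q) (snd q) * \<psi> (P q)) = (LINT p|lborel. densC s \<Phi> p * \<psi> p)" "integrable lborel (\<lambda>p. densC s \<Phi> p * \<psi> p)"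
      unfolding P_def by (rule pushforward_densC[OF s i\<Phi> schwartz_measurable[OF sc] C])+
    show "integrable lborel (\<lambda>x. G0 x * \<psi> x)" unfolding G0_def mult.assoc using dp(2) by (rule integrable_mult_right)
    let ?h = "\<lambda>(p, q). (exp (\<i> * of_real (p \<bullet> P q)) * \<Phi> (fst q) (snd q)) * fourier \<psi> p"
    have fm: "fourier \<psi> \<in> borel_measurable borel" by measurable
    have ih: "integrable (lborel \<Otimes>\<^sub>M lborel) ?h"
    proof (rule lborel_pair.Fubini_integrable)
      show "?h \<in> borel_measurable (lborel \<Otimes>\<^sub>M lborel)" using \<Phi>m fm by measurable
      show "integrable lborel (\<lambda>p. LINT q|lborel. norm (?h (p, q)))"
        using fourier_schwartz_integrable[OF sc] by (simp add: norm_mult norm_exp_eq_Re integrable_norm)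
      show "AE p in lborel. integrable lborel (\<lambda>q. ?h (p, q))"
      proof (rule AE_I2)
        fix p :: "real \<times> 'a"
        have "integrable lborel (\<lambda>q. exp (\<i> * of_real (p \<bullet> P q)) * \<Phi> (fst q) (snd q))"
          by (rule integrable_exp_mult[OF i\<Phi>']) auto
        then show "integrable lborel (\<lambda>q. ?h (p, q))" by simp
      qed
    qed
    have "(LINT p|lborel. KG_product s f g p * fourier \<psi> p) = (LINT p|lborel. of_real (c\<^sup>2) * (LINT q|lborel. ?h (p, q)))"
      unfolding KGf split_conv integral_mult_left_zero by (simp only: mult.assoc)
    also have "\<dots> = of_real (c\<^sup>2) * (LINT p|lborel. LINT q|lborel. ?h (p, q))" by (rule integral_mult_right_zero)
    also have "(LINT p|lborel. LINT q|lborel. ?h (p, q)) = (LINT q|lborel. LINT p|lborel. ?h (p, q))"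
      using lborel_pair.Fubini_integral[OF ih] by simp
    also have "\<dots> = (LINT q|lborel. of_real ((2 * pi) ^ DIM(real \<times> 'a)) * (\<Phi> (fst q) (snd q) * \<psi> (P q)))"
    proof (intro Bochner_Integration.integral_cong refl)
      fix q :: "'a \<times> 'a"
      have "(LINT p|lborel. ?h (p, q)) = (LINT p|lborel. \<Phi> (fst q) (snd q) * (exp (\<i> * of_real (p \<bullet> P q)) * fourier \<psi> p))"
        by (intro Bochner_Integration.integral_cong refl) (simp add: mult_ac)
      also have "\<dots> = \<Phi> (fst q) (snd q) * (of_real ((2 * pi) ^ DIM(real \<times> 'a)) * \<psi> (P q))"
        unfolding integral_mult_right_zero by (simp only: fourier_inversion_schwartz[OF sc])
      finally show "(LINT p|lborel. ?h (p, q)) = of_real ((2 * pi) ^ DIM(real \<times> 'a)) * (\<Phi> (fst q) (snd q) * \<psi> (P q))" by (simp only: mult_ac)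
    qed
    also have "\<dots> = of_real ((2 * pi) ^ DIM(real \<times> 'a)) * (LINT p|lborel. densC s \<Phi> p * \<psi> p)"
      unfolding integral_mult_right_zero dp(1) ..
    finally have "(LINT p|lborel. KG_product s f g p * fourier \<psi> p) = of_real (c\<^sup>2 * (2 * pi) ^ DIM(real \<times> 'a)) * (LINT p|lborel. densC s \<Phi> p * \<psi> p)"
      by (simp only: of_real_mult mult.assoc)
    then show "(LINT p|lborel. KG_product s f g p * fourier \<psi> p) = (LINT p|lborel. G0 p * \<psi> p)"
      unfolding cc G0_def mult.assoc integral_mult_right_zero .
  qed
  then show ?thesis by (simp only: G0_def[abs_def] \<Phi>_def[abs_def])
qed

text \<open>The integral of the squared factor U in \<open>densC_norm_le\<close>, in the form A(x) /
  \<open>phi\<close>(y) that \<open>dens_pairing\<close> expects. \<open>densR\<close> is its mirror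
  image, with the two points exchanged.\<close>

definition densL :: "real \<Rightarrow> ('a::euclidean_space \<Rightarrow> complex) \<Rightarrow> real \<times> 'a \<Rightarrow> ennreal" where
  "densL s F p = dens s (\<lambda>x y. ennreal ((norm (F x))\<^sup>2 * phi s (norm x)) * ennreal (1 / phi s (norm y))) (fst p) (snd p)"

definition densR :: "real \<Rightarrow> ('a::euclidean_space \<Rightarrow> complex) \<Rightarrow> real \<times> 'a \<Rightarrow> ennreal" where
  "densR s G p = dens s (\<lambda>x y. ennreal (1 / phi s (norm x)) * ennreal ((norm (G y))\<^sup>2 * phi s (norm y))) (fst p) (snd p)"

lemma densLR_measurable [measurable]:
  fixes F :: "'a::euclidean_space \<Rightarrow> complex"
  assumes [measurable]: "F \<in> borel_measurable borel"
  shows "densL s F \<in> borel_measurable borel" "densR s F \<in> borel_measurable borel"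
  unfolding densL_def densR_def dens_def borel_prod[symmetric] by measurable

lemma densC_measurable:
  fixes F G :: "'a::euclidean_space \<Rightarrow> complex"
  assumes [measurable]: "F \<in> borel_measurable borel" "G \<in> borel_measurable borel"
  shows "densC s (\<lambda>x y. F x * cnj (G y)) \<in> borel_measurable borel"
  unfolding densC_def borel_prod[symmetric] by measurable

lemma densC_norm_le:
  fixes F G :: "'a::euclidean_space \<Rightarrow> complex"
  assumes s: "0 < s" and [measurable]: "F \<in> borel_measurable borel" "G \<in> borel_measurable borel"
  shows "ennreal ((norm (densC s (\<lambda>x y. F x * cnj (G y)) p))\<^sup>2) \<le> densL s F p * densR s G p"
proof -
  define \<tau> \<xi> where "\<tau> = fst p" and "\<xi> = snd p"
  define k where "k \<eta> = kern s \<tau> \<xi> \<eta>" for \<eta>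
  define x where "x \<eta> = q4 s \<tau> \<xi> \<eta> + \<xi>" for \<eta>
  define y where "y \<eta> = q4 s \<tau> \<xi> \<eta>" for \<eta>
  have [measurable]: "k \<in> borel_measurable borel" "x \<in> borel_measurable borel" "y \<in> borel_measurable borel"
    unfolding k_def x_def y_def by measurable
  have k0: "0 \<le> k \<eta>" for \<eta> unfolding k_def by (rule kern_nonneg[OF s])
  have ph: "0 < phi s (norm v)" for v :: 'a by (rule phi_pos[OF s])
  define h where "h \<eta> = of_real (k \<eta>) * (F (x \<eta>) * cnj (G (y \<eta>)))" for \<eta>
  define U where "U \<eta> = sqrt (k \<eta>) * norm (F (x \<eta>)) * sqrt (phi s (norm (x \<eta>)) / phi s (norm (y \<eta>)))" for \<eta>
  define V where "V \<eta> = sqrt (k \<eta>) * norm (G (y \<eta>)) * sqrt (phi s (norm (y \<eta>)) / phi s (norm (x \<eta>)))" for \<eta>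
  have [measurable]: "U \<in> borel_measurable borel" "V \<in> borel_measurable borel" unfolding U_def V_def by measurable
  have UV0: "0 \<le> U \<eta>" "0 \<le> V \<eta>" for \<eta> unfolding U_def V_def using k0[of \<eta>] ph[of "x \<eta>"] ph[of "y \<eta>"] by auto
  have UV: "norm (h \<eta>) = U \<eta> * V \<eta>" for \<eta>
  proof -
    have "sqrt (phi s (norm (x \<eta>)) / phi s (norm (y \<eta>))) * sqrt (phi s (norm (y \<eta>)) / phi s (norm (x \<eta>))) = 1"
      using ph[of "x \<eta>"] ph[of "y \<eta>"] by (simp add: real_sqrt_mult[symmetric])
    moreover have "sqrt (k \<eta>) * sqrt (k \<eta>) = k \<eta>" using k0[of \<eta>] by simp
    moreover have "U \<eta> * V \<eta> = (sqrt (k \<eta>) * sqrt (k \<eta>)) * (norm (F (x \<eta>)) * norm (G (y \<eta>))) * (sqrt (phi s (norm (x \<eta>)) / phi s (norm (y \<eta>))) * sqrt (phi s (norm (y \<eta>)) / phi s (norm (x \<eta>))))"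
      by (simp only: U_def V_def mult_ac)
    ultimately show ?thesis using k0[of \<eta>] by (simp add: h_def norm_mult)
  qed
  have U2: "(U \<eta>)\<^sup>2 = k \<eta> * ((norm (F (x \<eta>)))\<^sup>2 * phi s (norm (x \<eta>)) * (1 / phi s (norm (y \<eta>))))" for \<eta>
    using k0[of \<eta>] ph[of "x \<eta>"] ph[of "y \<eta>"] by (simp add: U_def power_mult_distrib)
  have V2: "(V \<eta>)\<^sup>2 = k \<eta> * (1 / phi s (norm (x \<eta>)) * ((norm (G (y \<eta>)))\<^sup>2 * phi s (norm (y \<eta>))))" for \<eta>
    using k0[of \<eta>] ph[of "x \<eta>"] ph[of "y \<eta>"] by (simp add: V_def power_mult_distrib)
  have dC: "densC s (\<lambda>x y. F x * cnj (G y)) p = (LINT \<eta>|lborel. h \<eta>)"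
    by (simp add: densC_def case_prod_beta h_def k_def x_def y_def \<tau>_def \<xi>_def)
  have "ennreal (norm (LINT \<eta>|lborel. h \<eta>)) \<le> (\<integral>\<^sup>+\<eta>. ennreal (norm (h \<eta>)) \<partial>lborel)"
  \<comment> \<open>If the fibre integrand is not integrable, its Bochner integral is 0 by
    convention and the bound is trivial.\<close>
  proof (cases "integrable lborel h")
    case True then show ?thesis by (rule integral_norm_bound_ennreal)
  qed (simp add: not_integrable_integral_eq)
  also have "\<dots> = (\<integral>\<^sup>+\<eta>. ennreal (U \<eta>) * ennreal (V \<eta>) \<partial>lborel)"
    by (simp only: UV ennreal_mult'[OF UV0(1)])
  finally have "(ennreal (norm (LINT \<eta>|lborel. h \<eta>)))\<^sup>2 \<le> (\<integral>\<^sup>+\<eta>. ennreal (U \<eta>) * ennreal (V \<eta>) \<partial>lborel)\<^sup>2"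
    by (rule power_mono) simp
  also have "\<dots> \<le> (\<integral>\<^sup>+\<eta>. (ennreal (U \<eta>))\<^sup>2 \<partial>lborel) * (\<integral>\<^sup>+\<eta>. (ennreal (V \<eta>))\<^sup>2 \<partial>lborel)"
    by (rule Cauchy_Schwarz_nn_integral) measurable
  also have "(\<integral>\<^sup>+\<eta>. (ennreal (U \<eta>))\<^sup>2 \<partial>lborel) = densL s F p"
    unfolding densL_def dens_def
  proof (rule nn_integral_cong)
    fix \<eta>
    have "(ennreal (U \<eta>))\<^sup>2 = ennreal ((U \<eta>)\<^sup>2)" by (rule ennreal_power[OF UV0(1)])
    also have "\<dots> = ennreal (k \<eta>) * (ennreal ((norm (F (x \<eta>)))\<^sup>2 * phi s (norm (x \<eta>))) * ennreal (1 / phi s (norm (y \<eta>))))"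
      unfolding U2 using k0[of \<eta>] ph[of "x \<eta>"] ph[of "y \<eta>"] by (simp only: ennreal_mult' mult_nonneg_nonneg zero_le_power2 less_imp_le)
    finally show "(ennreal (U \<eta>))\<^sup>2 = ennreal (kern s (fst p) (snd p) \<eta>) * (ennreal ((norm (F (q4 s (fst p) (snd p) \<eta> + snd p)))\<^sup>2 * phi s (norm (q4 s (fst p) (snd p) \<eta> + snd p))) * ennreal (1 / phi s (norm (q4 s (fst p) (snd p) \<eta>))))"
      by (simp only: k_def x_def y_def \<tau>_def \<xi>_def)
  qed
  also have "(\<integral>\<^sup>+\<eta>. (ennreal (V \<eta>))\<^sup>2 \<partial>lborel) = densR s G p"
    unfolding densR_def dens_def
  proof (rule nn_integral_cong)
    fix \<eta>
    have i0: "0 \<le> 1 / phi s (norm (x \<eta>))" using ph[of "x \<eta>"] by simp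
    have "(ennreal (V \<eta>))\<^sup>2 = ennreal ((V \<eta>)\<^sup>2)" by (rule ennreal_power[OF UV0(2)])
    also have "\<dots> = ennreal (k \<eta>) * (ennreal (1 / phi s (norm (x \<eta>))) * ennreal ((norm (G (y \<eta>)))\<^sup>2 * phi s (norm (y \<eta>))))"
      unfolding V2 ennreal_mult'[OF k0] ennreal_mult'[OF i0] ..
    finally show "(ennreal (V \<eta>))\<^sup>2 = ennreal (kern s (fst p) (snd p) \<eta>) * (ennreal (1 / phi s (norm (q4 s (fst p) (snd p) \<eta> + snd p))) * ennreal ((norm (G (q4 s (fst p) (snd p) \<eta>)))\<^sup>2 * phi s (norm (q4 s (fst p) (snd p) \<eta>))))"
      by (simp only: k_def x_def y_def \<tau>_def \<xi>_def)
  qed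
  finally show ?thesis unfolding dC by (simp only: ennreal_power[OF norm_ge_zero])
qed

lemma fibC_pos:
  assumes "2 \<le> d" and "- (real d - 1) / 2 < 2 * \<beta>"
  shows "0 < fibC \<beta> d"
proof -
  have "0 < 2 * \<beta> + (real d - 1) / 2" using assms(2) by (simp add: field_simps)
  moreover have "0 < real d - 1 + 2 * \<beta>" using assms by (simp add: field_simps)
  ultimately show ?thesis unfolding fibC_def by (intro mult_pos_pos divide_pos_pos Gamma_real_pos) auto
qed

lemma KG_density_measurable:
  fixes f g :: "'a::euclidean_space \<Rightarrow> complex"
  assumes [measurable]: "fourier f \<in> borel_measurable borel" "fourier g \<in> borel_measurable borel"
  shows "KG_density s \<beta> f g \<in> borel_measurable borel"
  unfolding KG_density_def KG_kernel_def borel_prod[symmetric] by measurable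

lemma KG_kernel_nonneg: "0 \<le> KG_kernel s a b x y"
  unfolding KG_kernel_def by (intro divide_nonneg_nonneg powr_ge_zero)

lemma KG_density_nonneg: "0 < s \<Longrightarrow> 0 \<le> KG_density s \<beta> f g q"
  unfolding KG_density_def case_prod_beta by (intro mult_nonneg_nonneg KG_kernel_nonneg less_imp_le[OF phi_pos]) auto

text \<open>An identity rather than a bound: the right-hand side of the estimate appears exactly,
  and the inequality of the theorem enters only through \<open>densC_norm_le\<close>. The factor (d
  - 1)! from the weighted polar coordinates stands on both sides and cancels.\<close>

lemma densLR_pairing:
  fixes f g :: "'a::euclidean_space \<Rightarrow> complex"
  assumes s: "0 < s" and d: "2 \<le> DIM('a)" and b: "- (real DIM('a) - 1) / 2 < 2 * \<beta>"
    and [measurable]: "fourier f \<in> borel_measurable borel" "fourier g \<in> borel_measurable borel"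
  shows "(\<integral>\<^sup>+p. ennreal (((norm (snd p))\<^sup>2 - (fst p)\<^sup>2) powr (2 * \<beta>)) * (densL s (fourier f) p * densR s (fourier g) p) \<partial>lborel) =
    ennreal (fibC \<beta> DIM('a)) * (\<integral>\<^sup>+q. ennreal (KG_density s \<beta> f g q) \<partial>lborel)"
proof -
  let ?C = "ennreal (fact (DIM('a) - 1))"
  let ?K = "KG_kernel s (1/2) ((real DIM('a) - 2) / 2 + 2 * \<beta>)"
  define A where "A x = ennreal ((norm (fourier f x))\<^sup>2 * phi s (norm x))" for x
  define B where "B x = ennreal ((norm (fourier g x))\<^sup>2 * phi s (norm x))" for x
  have [measurable]: "A \<in> borel_measurable borel" "B \<in> borel_measurable borel" unfolding A_def B_def by measurable
  have [measurable]: "(\<lambda>y. ?K x y) \<in> borel_measurable borel" for x :: 'a unfolding KG_kernel_def by measurable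
  have [measurable]: "(\<lambda>x. \<integral>\<^sup>+y. B y * ennreal (?K x y) \<partial>lborel) \<in> borel_measurable borel" unfolding KG_kernel_def by measurable
  have fp: "0 < fibC \<beta> DIM('a)" by (rule fibC_pos[OF d b])
  have wm: "(\<lambda>m::real. ennreal (m powr (2 * \<beta>))) \<in> borel_measurable borel" by measurable
  have "(\<lambda>p :: real \<times> 'a. ennreal (((norm (snd p))\<^sup>2 - (fst p)\<^sup>2) powr (2 * \<beta>))) \<in> borel_measurable borel"
    unfolding borel_prod[symmetric] by measurable
  then have "(\<integral>\<^sup>+p. ennreal (((norm (snd p))\<^sup>2 - (fst p)\<^sup>2) powr (2 * \<beta>)) * (densL s (fourier f) p * densR s (fourier g) p) \<partial>lborel)
    = (\<integral>\<^sup>+\<tau>. \<integral>\<^sup>+\<xi>. ennreal (((norm \<xi>)\<^sup>2 - \<tau>\<^sup>2) powr (2 * \<beta>)) * (densL s (fourier f) (\<tau>, \<xi>) * densR s (fourier g) (\<tau>, \<xi>)) \<partial>lborel \<partial>lborel)"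
    by (subst nn_integral_lborel_pair) (auto intro!: borel_measurable_times densLR_measurable)
  then have "?C * (\<integral>\<^sup>+p. ennreal (((norm (snd p))\<^sup>2 - (fst p)\<^sup>2) powr (2 * \<beta>)) * (densL s (fourier f) p * densR s (fourier g) p) \<partial>lborel)
    = (\<integral>\<^sup>+x. A x * (\<integral>\<^sup>+y. B y * fibJ s (\<lambda>m. ennreal (m powr (2 * \<beta>))) x y \<partial>lborel) \<partial>lborel)"
    using dens_pairing[OF s d _ _ wm, of A B] by (simp add: A_def B_def densL_def densR_def)
  also have "\<dots> = (\<integral>\<^sup>+x. (?C * ennreal (fibC \<beta> DIM('a))) * (A x * (\<integral>\<^sup>+y. B y * ennreal (?K x y) \<partial>lborel)) \<partial>lborel)"
  proof (rule nn_integral_cong)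
    fix x :: 'a
    have "(\<integral>\<^sup>+y. B y * fibJ s (\<lambda>m. ennreal (m powr (2 * \<beta>))) x y \<partial>lborel) = (\<integral>\<^sup>+y. (?C * ennreal (fibC \<beta> DIM('a))) * (B y * ennreal (?K x y)) \<partial>lborel)"
    \<comment> \<open>\<open>fibJ_power\<close> needs distinct points; the exception is a null set
      in y.\<close>
    proof (rule nn_integral_cong_AE, use AE_lborel_singleton[of x] in eventually_elim)
      fix y assume "y \<noteq> x"
      then have "x \<noteq> y" by simp
      from fibJ_power[OF s d b this] show "B y * fibJ s (\<lambda>m. ennreal (m powr (2 * \<beta>))) x y = (?C * ennreal (fibC \<beta> DIM('a))) * (B y * ennreal (?K x y))"
        by (simp only: ennreal_mult'[OF less_imp_le[OF fp]] mult_ac)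
    qed
    also have "\<dots> = (?C * ennreal (fibC \<beta> DIM('a))) * (\<integral>\<^sup>+y. (B y * ennreal (?K x y)) \<partial>lborel)"
      by (rule nn_integral_cmult) measurable
    finally show "A x * (\<integral>\<^sup>+y. B y * fibJ s (\<lambda>m. ennreal (m powr (2 * \<beta>))) x y \<partial>lborel) = (?C * ennreal (fibC \<beta> DIM('a))) * (A x * (\<integral>\<^sup>+y. B y * ennreal (?K x y) \<partial>lborel))"
      by (simp only: mult_ac)
  qed
  also have "\<dots> = (?C * ennreal (fibC \<beta> DIM('a))) * (\<integral>\<^sup>+x. A x * (\<integral>\<^sup>+y. B y * ennreal (?K x y) \<partial>lborel) \<partial>lborel)"
    by (rule nn_integral_cmult) measurable
  also have "(\<integral>\<^sup>+x. A x * (\<integral>\<^sup>+y. B y * ennreal (?K x y) \<partial>lborel) \<partial>lborel) = (\<integral>\<^sup>+x. \<integral>\<^sup>+y. ennreal (KG_density s \<beta> f g (x, y)) \<partial>lborel \<partial>lborel)"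
  proof (rule nn_integral_cong)
    fix x :: 'a
    have "A x * (\<integral>\<^sup>+y. B y * ennreal (?K x y) \<partial>lborel) = (\<integral>\<^sup>+y. A x * (B y * ennreal (?K x y)) \<partial>lborel)"
      by (rule nn_integral_cmult[symmetric]) measurable
    also have "\<dots> = (\<integral>\<^sup>+y. ennreal (KG_density s \<beta> f g (x, y)) \<partial>lborel)"
    proof (rule nn_integral_cong)
      fix y :: 'a
      have a0: "0 \<le> (norm (fourier f x))\<^sup>2 * phi s (norm x)" "0 \<le> (norm (fourier g y))\<^sup>2 * phi s (norm y)"
        using phi_pos[OF s] by (simp_all add: less_imp_le)
      have "KG_density s \<beta> f g (x, y) = ((norm (fourier f x))\<^sup>2 * phi s (norm x)) * (((norm (fourier g y))\<^sup>2 * phi s (norm y)) * ?K x y)"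
        unfolding KG_density_def split_conv by (simp only: mult_ac)
      then show "A x * (B y * ennreal (?K x y)) = ennreal (KG_density s \<beta> f g (x, y))"
        by (simp only: A_def B_def ennreal_mult'[OF a0(1)] ennreal_mult'[OF a0(2)])
    qed
    finally show "A x * (\<integral>\<^sup>+y. B y * ennreal (?K x y) \<partial>lborel) = (\<integral>\<^sup>+y. ennreal (KG_density s \<beta> f g (x, y)) \<partial>lborel)" .
  qed
  also have "\<dots> = (\<integral>\<^sup>+q. ennreal (KG_density s \<beta> f g q) \<partial>lborel)"
    by (rule nn_integral_lborel_pair[symmetric]) (use KG_density_measurable[of f g s \<beta>] in simp)
  finally have "?C * (\<integral>\<^sup>+p. ennreal (((norm (snd p))\<^sup>2 - (fst p)\<^sup>2) powr (2 * \<beta>)) * (densL s (fourier f) p * densR s (fourier g) p) \<partial>lborel)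
    = ?C * (ennreal (fibC \<beta> DIM('a)) * (\<integral>\<^sup>+q. ennreal (KG_density s \<beta> f g q) \<partial>lborel))" by (simp only: mult.assoc)
  moreover have "?C \<noteq> 0" "?C \<noteq> \<infinity>" by auto
  ultimately show ?thesis by (simp add: ennreal_mult_cancel_left)
qed

section \<open>The estimate with the constant \<open>KG_const\<close>\<close>

lemma box_symbol_measurable [measurable]:
  "box_symbol \<beta> \<in> borel_measurable (borel :: (real \<times> 'a::euclidean_space) measure)"
  unfolding box_symbol_def borel_prod[symmetric] by measurable

lemma densC_spacelike: "\<not> \<bar>fst p\<bar> < norm (snd p) \<Longrightarrow> densC s \<Phi> p = 0"
  unfolding densC_def by (cases p) (simp add: kern_def)

lemma box_symbol_timelike:
  assumes "\<bar>fst p\<bar> < norm (snd p)"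
  shows "(box_symbol \<beta> p)\<^sup>2 = ((norm (snd p))\<^sup>2 - (fst p)\<^sup>2) powr (2 * \<beta>)"
proof -
  have "0 < (norm (snd p))\<^sup>2 - (fst p)\<^sup>2" by (rule timelike_gap[OF assms])
  then have "box_symbol \<beta> p = ((norm (snd p))\<^sup>2 - (fst p)\<^sup>2) powr \<beta>" by (simp add: box_symbol_def case_prod_beta)
  then show ?thesis by (simp add: power2_eq_square powr_add[symmetric])
qed

text \<open>Where the density does not vanish, |\<tau>| < |\<xi>|, so the absolute value in the
  symbol may be opened with a fixed sign. Elsewhere both sides are 0.\<close>

lemma spectral_density_norm:
  assumes c: "0 \<le> (c::real)"
  shows "ennreal ((norm (of_real (box_symbol \<beta> p) * (of_real c * densC s \<Phi> p)))\<^sup>2) =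
    ennreal (c\<^sup>2) * (ennreal (((norm (snd p))\<^sup>2 - (fst p)\<^sup>2) powr (2 * \<beta>)) * ennreal ((norm (densC s \<Phi> p))\<^sup>2))"
proof (cases "\<bar>fst p\<bar> < norm (snd p)")
  case True
  have "(norm (of_real (box_symbol \<beta> p) * (of_real c * densC s \<Phi> p)))\<^sup>2 = c\<^sup>2 * ((box_symbol \<beta> p)\<^sup>2 * (norm (densC s \<Phi> p))\<^sup>2)"
    by (simp add: norm_mult power_mult_distrib)
  then show ?thesis unfolding box_symbol_timelike[OF True] by (simp add: ennreal_mult')
qed (simp add: densC_spacelike)

text \<open>Origin of the constant: the squared factor of \<open>KG_product_has_fourier\<close>, the
  fibre constant, and the Plancherel factor of space-time, whose dimension is d + 1.\<close>

lemma KG_const_eq_fibC: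
  "((2 * pi) powr (1 - real d))\<^sup>2 * fibC \<beta> d / (2 * pi) ^ Suc d = KG_const \<beta> d"
proof -
  define g1 g2 where "g1 = Gamma (2 * \<beta> + (real d - 1) / 2)" and "g2 = Gamma (real d - 1 + 2 * \<beta>)"
  have p: "(2 * pi) ^ Suc d = (2 * pi) powr (real d + 1)" using powr_realpow[of "2 * pi" "Suc d"] by (simp add: add.commute)
  have q: "((2 * pi) powr (1 - real d))\<^sup>2 = (2 * pi) powr (2 - 2 * real d)" by (simp add: power2_eq_square powr_add[symmetric])
  have r: "(2 * pi) powr (2 - 2 * real d) * (2 * pi) powr ((real d - 1) / 2) / (2 * pi) powr (real d + 1) = (2 * pi) powr ((- 5 * real d + 1) / 2)"
  proof -
    have "(2 - 2 * real d) + (real d - 1) / 2 - (real d + 1) = (- 5 * real d + 1) / 2" by (simp add: field_simps)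
    then show ?thesis by (simp only: powr_add[symmetric] powr_diff[symmetric])
  qed
  have t: "2 powr (- (real d - 1) / 2) * 2 powr (2 * \<beta> + (real d - 1) / 2) = (2::real) powr (2 * \<beta>)"
    by (simp add: powr_add[symmetric] field_simps)
  have "((2 * pi) powr (1 - real d))\<^sup>2 * fibC \<beta> d / (2 * pi) ^ Suc d =
    ((2 * pi) powr (2 - 2 * real d) * (2 * pi) powr ((real d - 1) / 2) / (2 * pi) powr (real d + 1)) * (2 powr (- (real d - 1) / 2) * 2 powr (2 * \<beta> + (real d - 1) / 2)) * (g1 / g2)"
    unfolding p q fibC_def g1_def[symmetric] g2_def[symmetric] by (simp add: mult_ac)
  also have "\<dots> = 2 powr ((- 5 * real d + 1) / 2) * pi powr ((- 5 * real d + 1) / 2) * 2 powr (2 * \<beta>) * (g1 / g2)"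
    unfolding r t by (simp add: powr_mult)
  also have "\<dots> = KG_const \<beta> d"
    unfolding KG_const_def g1_def g2_def by (simp add: powr_add add.commute mult_ac)
  finally show ?thesis .
qed

lemma KG_density_nn_integral:
  assumes "0 < s" "KG_admissible s \<beta> f g"
  shows "(\<integral>\<^sup>+q. ennreal (KG_density s \<beta> f g q) \<partial>lborel) = ennreal (LINT q|lborel. KG_density s \<beta> f g q)"
proof (rule nn_integral_eq_integral)
  show "integrable lborel (KG_density s \<beta> f g)" using assms(2) by (simp add: KG_admissible_def)
  show "AE q in lborel. 0 \<le> KG_density s \<beta> f g q" by (rule AE_I2) (rule KG_density_nonneg[OF assms(1)])
qed

text \<open>The symbol times the spectral density is square integrable by Cauchy-Schwarz and
  \<open>densLR_pairing\<close>, so \<open>L2_has_fourier\<close> supplies an H having it as its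
  transform. This H is a box power of the product by construction.\<close>

lemma KG_estimate_holds:
  fixes f g :: "'a::euclidean_space \<Rightarrow> complex"
  assumes s: "0 < s" and d: "2 \<le> DIM('a)" and b: "- (real DIM('a) - 1) / 2 < 2 * \<beta>"
    and adm: "KG_admissible s \<beta> f g"
  shows "KG_estimate s \<beta> (KG_const \<beta> DIM('a)) f g"
proof -
  have fi: "integrable lborel (fourier f)" "integrable lborel (fourier g)" using adm by (auto simp: KG_admissible_def)
  then have [measurable]: "fourier f \<in> borel_measurable borel" "fourier g \<in> borel_measurable borel" by auto
  define c where "c = (2 * pi) powr (1 - real DIM('a))"
  have c0: "0 \<le> c" by (simp add: c_def)
  define \<Phi> where "\<Phi> = (\<lambda>x y. fourier f x * cnj (fourier g y))"
  define K where "K p = of_real (box_symbol \<beta> p) * (of_real c * densC s \<Phi> p)" for p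
  define D where "D = (LINT q|lborel. KG_density s \<beta> f g q)"
  have D0: "0 \<le> D" unfolding D_def by (rule Bochner_Integration.integral_nonneg) (rule KG_density_nonneg[OF s])
  have fp: "0 < fibC \<beta> DIM('a)" by (rule fibC_pos[OF d b])
  have dm[measurable]: "densC s \<Phi> \<in> borel_measurable borel" unfolding \<Phi>_def by (rule densC_measurable) auto
  have Km: "K \<in> borel_measurable borel" unfolding K_def by measurable
  have mm[measurable]: "(\<lambda>p :: real \<times> 'a. ennreal (((norm (snd p))\<^sup>2 - (fst p)\<^sup>2) powr (2 * \<beta>))) \<in> borel_measurable borel"
    unfolding borel_prod[symmetric] by measurable
  have "(\<integral>\<^sup>+p. ennreal ((norm (K p))\<^sup>2) \<partial>lborel) \<le> (\<integral>\<^sup>+p. ennreal (c\<^sup>2) * (ennreal (((norm (snd p))\<^sup>2 - (fst p)\<^sup>2) powr (2 * \<beta>)) * (densL s (fourier f) p * densR s (fourier g) p)) \<partial>lborel)"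
    unfolding K_def spectral_density_norm[OF c0] \<Phi>_def
    by (intro nn_integral_mono mult_left_mono densC_norm_le[OF s]) auto
  also have "\<dots> = ennreal (c\<^sup>2) * (\<integral>\<^sup>+p. ennreal (((norm (snd p))\<^sup>2 - (fst p)\<^sup>2) powr (2 * \<beta>)) * (densL s (fourier f) p * densR s (fourier g) p) \<partial>lborel)"
    by (rule nn_integral_cmult) measurable
  also have "\<dots> = ennreal (c\<^sup>2 * (fibC \<beta> DIM('a) * D))"
    using densLR_pairing[OF s d b, of f g] KG_density_nn_integral[OF s adm] fp
    by (simp add: ennreal_mult' D_def)
  finally have K2: "(\<integral>\<^sup>+p. ennreal ((norm (K p))\<^sup>2) \<partial>lborel) \<le> ennreal (c\<^sup>2 * (fibC \<beta> DIM('a) * D))" .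
  then have Kf: "(\<integral>\<^sup>+p. ennreal ((norm (K p))\<^sup>2) \<partial>lborel) < \<infinity>" by (rule le_less_trans) simp
  from L2_has_fourier[OF Km Kf] obtain H where H[measurable]: "H \<in> borel_measurable borel" and hH: "has_fourier H K" and
    H2: "(\<integral>\<^sup>+x. ennreal ((norm (H x))\<^sup>2) \<partial>lborel) \<le> ennreal (1 / (2 * pi) ^ DIM(real \<times> 'a)) * (\<integral>\<^sup>+p. ennreal ((norm (K p))\<^sup>2) \<partial>lborel)" by blast
  have box: "is_box_power \<beta> (KG_product s f g) H"
    unfolding is_box_power_def
    using KG_product_has_fourier[OF s fi] hH unfolding K_def[abs_def] \<Phi>_def c_def by blast
  have "(\<integral>\<^sup>+x. ennreal ((norm (H x))\<^sup>2) \<partial>lborel) \<le> ennreal (1 / (2 * pi) ^ Suc DIM('a)) * ennreal (c\<^sup>2 * (fibC \<beta> DIM('a) * D))"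
    using order_trans[OF H2 mult_left_mono[OF K2]] by simp
  also have "\<dots> = ennreal (1 / (2 * pi) ^ Suc DIM('a) * (c\<^sup>2 * (fibC \<beta> DIM('a) * D)))"
    by (rule ennreal_mult'[symmetric]) simp
  also have "1 / (2 * pi) ^ Suc DIM('a) * (c\<^sup>2 * (fibC \<beta> DIM('a) * D)) = KG_const \<beta> DIM('a) * D"
    unfolding KG_const_eq_fibC[symmetric] c_def by simp
  finally have H3: "(\<integral>\<^sup>+x. ennreal ((norm (H x))\<^sup>2) \<partial>lborel) \<le> ennreal (KG_const \<beta> DIM('a) * D)" .
  have k0: "0 \<le> KG_const \<beta> DIM('a)" unfolding KG_const_eq_fibC[symmetric] using fp by simp
  have Hi: "integrable lborel (\<lambda>p. (norm (H p))\<^sup>2)"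
    by (rule integrableI_nonneg) (use le_less_trans[OF H3 ennreal_less_top] in auto)
  have "ennreal (LINT p|lborel. (norm (H p))\<^sup>2) \<le> ennreal (KG_const \<beta> DIM('a) * D)"
    using H3 nn_integral_eq_integral[OF Hi] by simp
  then have "(LINT p|lborel. (norm (H p))\<^sup>2) \<le> KG_const \<beta> DIM('a) * D" using k0 D0 by (simp add: ennreal_le_iff)
  then show ?thesis using box Hi unfolding KG_estimate_def D_def by (intro exI[of _ H]) auto
qed

section \<open>Sharpness\<close>

text \<open>In polar coordinates the singularity lowers the radial power to d - 2, whose Gamma
  integral Gamma(d - 1) is finite for d at least 2.\<close>

lemma nn_integral_exp_norm_div:
  assumes d: "2 \<le> DIM('a::euclidean_space)"
  shows "(\<integral>\<^sup>+z. ennreal (exp (- norm (z::'a)) / norm z) \<partial>lborel) < \<infinity>"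
proof -
  let ?d = "DIM('a)" and ?\<Phi> = "\<lambda>z::'a. ennreal (exp (- norm z) / norm z)"
  have "ennreal (fact (?d - 1)) * (\<integral>\<^sup>+z. ?\<Phi> z \<partial>lborel) =
    (\<integral>\<^sup>+v. ennreal (exp (- norm v) * norm v ^ ?d) * (\<integral>\<^sup>+l. ennreal (l ^ (?d - 1)) * ?\<Phi> (l *\<^sub>R v) * indicator {0<..} l \<partial>lborel) \<partial>lborel)"
    by (rule nn_integral_radial) measurable
  also have "\<dots> = (\<integral>\<^sup>+v. ennreal (Gamma (real ?d - 1)) * ennreal (exp (- norm (v::'a))) \<partial>lborel)"
  proof (rule nn_integral_cong_AE, use AE_lborel_singleton[of "0::'a"] in eventually_elim)
    fix v :: 'a assume "v \<noteq> 0"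
    define r where "r = norm v"
    have r: "0 < r" using \<open>v \<noteq> 0\<close> by (simp add: r_def)
    have "(\<integral>\<^sup>+l. ennreal (l ^ (?d - 1)) * ?\<Phi> (l *\<^sub>R v) * indicator {0<..} l \<partial>lborel)
      = (\<integral>\<^sup>+l. ennreal (1 / r) * (ennreal (l powr (real ?d - 1 - 1) * exp (- r * l)) * indicator {0<..} l) \<partial>lborel)"
    proof (rule nn_integral_cong)
      fix l :: real
      show "ennreal (l ^ (?d - 1)) * ?\<Phi> (l *\<^sub>R v) * indicator {0<..} l = ennreal (1 / r) * (ennreal (l powr (real ?d - 1 - 1) * exp (- r * l)) * indicator {0<..} l)"
      proof (cases "0 < l")
        case True
        have "l powr (real ?d - 1 - 1) = l powr (real (?d - 2))" using d by (simp add: of_nat_diff)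
        also have "\<dots> = l ^ (?d - 2)" using True by (rule powr_realpow)
        finally have e: "l powr (real ?d - 1 - 1) = l ^ (?d - 2)" .
        have "?d - 1 = Suc (?d - 2)" using d by simp
        then have "l ^ (?d - 1) * (exp (- (l * r)) / (l * r)) = 1 / r * (l ^ (?d - 2) * exp (- r * l))"
          using True by (simp only: power_Suc) (simp add: mult.commute)
        then have "ennreal (l ^ (?d - 1)) * ennreal (exp (- (l * r)) / (l * r)) = ennreal (1 / r) * ennreal (l powr (real ?d - 1 - 1) * exp (- r * l))"
          using True r unfolding e by (subst (1 2) ennreal_mult'[symmetric]) auto
        then show ?thesis using True by (simp add: r_def[symmetric])
      qed simp
    qed
    also have "\<dots> = ennreal (1 / r) * (\<integral>\<^sup>+l. ennreal (l powr (real ?d - 1 - 1) * exp (- r * l)) * indicator {0<..} l \<partial>lborel)"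
      by (rule nn_integral_cmult) measurable
    also have "\<dots> = ennreal (1 / r) * ennreal (Gamma (real ?d - 1) / r powr (real ?d - 1))"
      using nn_integral_Gamma[of "real ?d - 1" r] d r by simp
    finally have i: "(\<integral>\<^sup>+l. ennreal (l ^ (?d - 1)) * ?\<Phi> (l *\<^sub>R v) * indicator {0<..} l \<partial>lborel) = ennreal (1 / r * (Gamma (real ?d - 1) / r powr (real ?d - 1)))"
      using r by (simp add: ennreal_mult'[symmetric])
    have g: "0 \<le> Gamma (real ?d - 1)" using d by (intro less_imp_le Gamma_real_pos) simp
    have "r powr (real ?d - 1) = r ^ ?d / r" using r by (simp add: powr_diff powr_realpow)
    then have "exp (- r) * r ^ ?d * (1 / r * (Gamma (real ?d - 1) / r powr (real ?d - 1))) = Gamma (real ?d - 1) * exp (- r)"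
      using r by simp
    then show "ennreal (exp (- norm v) * norm v ^ ?d) * (\<integral>\<^sup>+l. ennreal (l ^ (?d - 1)) * ?\<Phi> (l *\<^sub>R v) * indicator {0<..} l \<partial>lborel) =
      ennreal (Gamma (real ?d - 1)) * ennreal (exp (- norm v))"
      unfolding i unfolding r_def[symmetric] using r by (simp only: ennreal_mult'[OF g, symmetric]) (simp add: ennreal_mult'[symmetric])
  qed
  also have "\<dots> = ennreal (Gamma (real ?d - 1)) * (\<integral>\<^sup>+v. ennreal (exp (- norm (v::'a))) \<partial>lborel)"
    by (rule nn_integral_cmult) measurable
  also have "\<dots> < \<infinity>" using nn_integral_exp_norm[where 'a='a] by (simp add: ennreal_mult_less_top)
  finally show ?thesis by (auto simp: ennreal_mult_less_top)
qed

text \<open>A quantitative form of \<open>mgap_pos\<close>, needed because the exponent of the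
  kernel may be negative. With a and b the energies, (a - b)^2 (a + b)^2 is at most |x - y|^2 (|x| +
  |y|)^2, and (a + b)^2 exceeds (|x| + |y|)^2 by at least 2 s^2.\<close>

lemma mgap_lower:
  assumes s: "0 < s"
  shows "2 * s\<^sup>2 * (norm (x - y))\<^sup>2 \<le> mgap s x y * (phi s (norm x) + phi s (norm (y::'a::euclidean_space)))\<^sup>2"
proof -
  define a b where "a = phi s (norm x)" and "b = phi s (norm y)"
  have p: "0 < a" "0 < b" unfolding a_def b_def by (rule phi_pos[OF s])+
  have ab: "norm x \<le> a" "norm y \<le> b" unfolding a_def b_def by (rule phi_ge, simp)+
  have sq: "a\<^sup>2 = s\<^sup>2 + (norm x)\<^sup>2" "b\<^sup>2 = s\<^sup>2 + (norm y)\<^sup>2" by (simp_all add: a_def b_def phi_power2)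
  have "\<bar>norm x - norm y\<bar> * (norm x + norm y) \<le> norm (x - y) * (norm x + norm y)"
    by (intro mult_right_mono norm_triangle_ineq3) simp
  moreover have "\<bar>a - b\<bar> * (a + b) = \<bar>norm x - norm y\<bar> * (norm x + norm y)"
  proof -
    have "(a - b) * (a + b) = (norm x - norm y) * (norm x + norm y)" using sq by (simp add: algebra_simps power2_eq_square)
    then have "\<bar>(a - b) * (a + b)\<bar> = \<bar>(norm x - norm y) * (norm x + norm y)\<bar>" by simp
    then show ?thesis using p by (simp add: abs_mult)
  qed
  ultimately have "\<bar>a - b\<bar> * (a + b) \<le> norm (x - y) * (norm x + norm y)" by simp
  then have "(\<bar>a - b\<bar> * (a + b))\<^sup>2 \<le> (norm (x - y) * (norm x + norm y))\<^sup>2" using p by (intro power_mono) auto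
  then have 1: "(a - b)\<^sup>2 * (a + b)\<^sup>2 \<le> (norm (x - y))\<^sup>2 * (norm x + norm y)\<^sup>2" by (simp add: power_mult_distrib)
  have "norm x * norm y \<le> a * b" using ab p by (intro mult_mono) auto
  then have "2 * s\<^sup>2 + (norm x + norm y)\<^sup>2 \<le> (a + b)\<^sup>2" unfolding power2_sum sq by simp
  then have "(norm (x - y))\<^sup>2 * (2 * s\<^sup>2 + (norm x + norm y)\<^sup>2) \<le> (norm (x - y))\<^sup>2 * (a + b)\<^sup>2" by (rule mult_left_mono) simp
  then have "2 * s\<^sup>2 * (norm (x - y))\<^sup>2 \<le> (norm (x - y))\<^sup>2 * (a + b)\<^sup>2 - (a - b)\<^sup>2 * (a + b)\<^sup>2" using 1 by (simp add: algebra_simps)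
  then show ?thesis unfolding mgap_eq a_def[symmetric] b_def[symmetric] by (simp only: left_diff_distrib)
qed

text \<open>Separates growth from singularity: for h \<ge> 1 a natural power dominates, for h < 1
  the borderline power - 1 / 2.\<close>

lemma powr_le_split:
  assumes h: "0 < (h::real)" and b: "- 1 / 2 < b" and N: "b \<le> real N"
  shows "h powr b \<le> h ^ N + h powr (- 1 / 2)"
proof (cases "1 \<le> h")
  case True
  then have "h powr b \<le> h powr real N" using N by (rule powr_mono[rotated])
  then show ?thesis using h by (simp add: powr_realpow add_increasing2)
next
  case False
  then have "h powr b \<le> h powr (- 1 / 2)" using h b by (intro powr_mono') auto
  then show ?thesis using h by (simp add: add_increasing)
qed

text \<open>Moves the singularity of 1 / r to an integrable function of r, leaving only a constant
  at infinity.\<close>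

lemma inverse_le_exp: "0 < (r::real) \<Longrightarrow> 1 / r \<le> 1 + exp 1 * (exp (- r) / r)"
proof -
  assume r: "0 < r"
  show ?thesis
  proof (cases "1 \<le> r")
    case True
    then have "1 / r \<le> 1" by simp
    moreover have "0 \<le> exp 1 * (exp (- r) / r)" using r by simp
    ultimately show ?thesis by linarith
  next
    case False
    then have "1 \<le> exp 1 * exp (- r)" using exp_ge_zero by (simp add: exp_add[symmetric])
    then have "1 / r \<le> exp 1 * exp (- r) / r" using r by (intro divide_right_mono) auto
    then show ?thesis by simp
  qed
qed

section \<open>The extremiser and optimality of the constant\<close>

definition extremal :: "real \<Rightarrow> 'a::euclidean_space \<Rightarrow> real" where
  "extremal s x = exp (- phi s (norm x)) / phi s (norm x)"

text \<open>Let E be the sum of the two energies. The squared extremal factors decay like exp(- 2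
  E); one factor exp(- E) pays for the growth of the kernel, the other remains. Near the diagonal
  \<open>mgap_lower\<close> bounds the kernel by a multiple of 1 / |x - y|, which is locally
  integrable for d at least 2.\<close>

lemma extremal_density_bound:
  assumes s: "0 < s" and b: "- (real DIM('a::euclidean_space) - 1) / 2 < 2 * \<beta>"
  shows "\<exists>C. \<forall>x y::'a. (extremal s x)\<^sup>2 * (extremal s y)\<^sup>2 * phi s (norm x) * phi s (norm y) * KG_kernel s (1/2) ((real DIM('a) - 2) / 2 + 2 * \<beta>) x y
    \<le> C * (exp (- norm x) * exp (- norm y) + exp (- norm x) * (exp (- norm (y - x)) / norm (y - x))) \<and> 0 \<le> C"
proof -
  define e where "e = (real DIM('a) - 2) / 2 + 2 * \<beta>"
  \<comment> \<open>The hypothesis on \<beta> says exactly that the exponent of the numerator of the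
    kernel exceeds - 1 / 2.\<close>
  have e: "- 1 / 2 < e" using b by (simp add: e_def field_simps)
  define N where "N = nat \<lceil>e\<rceil>"
  have N: "e \<le> real N" unfolding N_def by linarith
  define c where "c = 1 / (s\<^sup>2 * (2 * s\<^sup>2) powr (1/2))"
  have c0: "0 < c" using s by (simp add: c_def)
  define A where "A = fact (2 * N) + 1 / s"
  have A0: "0 < A" using s by (simp add: A_def add_pos_pos)
  have fA: "fact (2 * N) \<le> A" "1 / s \<le> A" using s by (simp_all add: A_def)
  have main: "(extremal s x)\<^sup>2 * (extremal s y)\<^sup>2 * phi s (norm x) * phi s (norm y) * KG_kernel s (1/2) e x y
    \<le> c * A * (2 + exp 1) * (exp (- norm x) * exp (- norm y) + exp (- norm x) * (exp (- norm (y - x)) / norm (y - x)))" for x y :: 'a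
  proof (cases "x = y")
    case True
    have "phi s (norm x) * phi s (norm x) - x \<bullet> x - s\<^sup>2 = 0" using phi_norm_power2[of s x] by (simp add: power2_eq_square)
    then have "KG_kernel s (1/2) e x y = 0" unfolding KG_kernel_def True by simp
    moreover have "0 \<le> c * A * (2 + exp 1) * (exp (- norm x) * exp (- norm y) + exp (- norm x) * (exp (- norm (y - x)) / norm (y - x)))"
      using c0 A0 by (intro mult_nonneg_nonneg add_nonneg_nonneg divide_nonneg_nonneg) auto
    ultimately show ?thesis by simp
  next
    case False
    define p q where "p = phi s (norm x)" and "q = phi s (norm y)"
    have pq: "s \<le> p" "s \<le> q" "0 < p" "0 < q" unfolding p_def q_def by (intro phi_ge_mass phi_pos s)+
    have npq: "norm x \<le> p" "norm y \<le> q" unfolding p_def q_def by (rule phi_ge, simp)+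
    define E where "E = p + q"
    have E0: "0 < E" using pq by (simp add: E_def)
    define h where "h = p * q - x \<bullet> y - s\<^sup>2"
    have hm: "mgap s x y = 2 * h" by (simp add: mgap_def h_def p_def q_def)
    have h0: "0 < h" using mgap_pos[OF s False] hm by simp
    define r where "r = norm (y - x)"
    have r0: "0 < r" using False by (simp add: r_def)
    have "(s * r)\<^sup>2 \<le> h * E\<^sup>2"
      using mgap_lower[OF s, of x y] unfolding hm p_def[symmetric] q_def[symmetric] E_def[symmetric] by (simp add: power_mult_distrib r_def norm_minus_commute)
    then have "sqrt ((s * r)\<^sup>2) \<le> sqrt (h * E\<^sup>2)" by (rule real_sqrt_le_mono)
    then have "s * r \<le> sqrt h * E" using s r0 E0 by (simp add: real_sqrt_mult)
    then have "1 / sqrt h \<le> E * (1 / s * (1 / r))" using s r0 h0 by (simp add: field_simps)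
    then have hh: "h powr (- 1 / 2) \<le> E * (1 / s * (1 / r))" using h0 by (simp add: powr_minus_divide powr_half_sqrt)
    have "\<bar>x \<bullet> y\<bar> \<le> p * q" using order_trans[OF Cauchy_Schwarz_ineq2 mult_mono[OF npq]] pq by simp
    \<comment> \<open>Polynomial growth of the kernel base in E, absorbed by exp(E) through
      \<open>power_le_fact_exp\<close>.\<close>
    then have "h \<le> E\<^sup>2" unfolding h_def E_def power2_sum using zero_le_power2[of s] zero_le_power2[of p] zero_le_power2[of q] by linarith
    then have "h ^ N \<le> (E\<^sup>2) ^ N" using h0 by (intro power_mono) auto
    also have "\<dots> = E ^ (2 * N)" by (simp add: power_mult)
    also have "\<dots> \<le> fact (2 * N) * exp E" using E0 by (intro power_le_fact_exp) simp
    also have "\<dots> \<le> A * exp E" by (intro mult_right_mono fA) simp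
    finally have h1: "h ^ N \<le> A * exp E" .
    have "E \<le> exp E" using exp_ge_add_one_self[of E] by linarith
    then have "E * (1 / s * (1 / r)) \<le> exp E * (A * (1 / r))"
      using E0 s r0 fA A0 by (intro mult_mono) auto
    then have h2: "h powr (- 1 / 2) \<le> A * exp E * (1 / r)" using hh by (simp add: mult_ac)
    have "h powr e \<le> A * exp E + A * exp E * (1 / r)"
      using powr_le_split[OF h0 e N] h1 h2 by linarith
    then have h3: "h powr e \<le> A * exp E * (1 + 1 / r)" by (simp add: distrib_left)
    have K: "KG_kernel s (1/2) e x y \<le> h powr e / (2 * s\<^sup>2) powr (1/2)"
    proof -
      have eq: "p * q - x \<bullet> y + s\<^sup>2 = h + 2 * s\<^sup>2" by (simp add: h_def)
      have "(2 * s\<^sup>2) powr (1/2) \<le> (h + 2 * s\<^sup>2) powr (1/2)" using h0 by (intro powr_mono2) auto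
      moreover have "0 < 2 * s\<^sup>2" "0 < h + 2 * s\<^sup>2" using s h0 by (simp_all add: add_pos_pos)
      ultimately show ?thesis unfolding KG_kernel_def p_def[symmetric] q_def[symmetric] eq h_def[symmetric]
        by (intro divide_left_mono mult_pos_pos) (auto simp del: zero_less_mult_iff)
    qed
    have W: "(extremal s x)\<^sup>2 * (extremal s y)\<^sup>2 * p * q \<le> (exp (- E))\<^sup>2 / s\<^sup>2"
    proof -
      have "(extremal s x)\<^sup>2 * (extremal s y)\<^sup>2 * p * q = (exp (- E))\<^sup>2 / (p * q)"
        using pq unfolding extremal_def p_def[symmetric] q_def[symmetric] E_def by (simp add: power_divide exp_add exp_minus exp_diff power_mult_distrib power2_eq_square field_simps)
      also have "\<dots> \<le> (exp (- E))\<^sup>2 / s\<^sup>2"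
        unfolding power2_eq_square[of s] using pq s by (intro divide_left_mono mult_mono) auto
      finally show ?thesis .
    qed
    have "(extremal s x)\<^sup>2 * (extremal s y)\<^sup>2 * p * q * KG_kernel s (1/2) e x y \<le> ((exp (- E))\<^sup>2 / s\<^sup>2) * (h powr e / (2 * s\<^sup>2) powr (1/2))"
      using W K pq s by (intro mult_mono KG_kernel_nonneg) auto
    also have "\<dots> = (exp (- E))\<^sup>2 * c * h powr e" by (simp add: c_def)
    also have "\<dots> \<le> (exp (- E))\<^sup>2 * c * (A * exp E * (1 + 1 / r))" using h3 c0 by (intro mult_left_mono) auto
    also have "\<dots> = c * A * (exp (- E) * (1 + 1 / r))" by (simp add: power2_eq_square exp_minus field_simps)
    also have "\<dots> \<le> c * A * ((2 + exp 1) * (exp (- norm x) * exp (- norm y) + exp (- norm x) * (exp (- r) / r)))"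
    proof (intro mult_left_mono)
      have x1: "exp (- E) \<le> exp (- norm x) * exp (- norm y)" using npq by (simp add: E_def exp_add[symmetric])
      also have "\<dots> \<le> exp (- norm x) * 1" by (intro mult_left_mono) auto
      finally have x2: "exp (- E) \<le> exp (- norm x)" by simp
      have "1 + 1 / r \<le> 2 + exp 1 * (exp (- r) / r)" using inverse_le_exp[OF r0] by simp
      then have "exp (- E) * (1 + 1 / r) \<le> exp (- E) * (2 + exp 1 * (exp (- r) / r))" by (intro mult_left_mono) auto
      also have "\<dots> = 2 * exp (- E) + exp 1 * (exp (- E) * (exp (- r) / r))" by (simp add: distrib_left)
      also have "\<dots> \<le> 2 * (exp (- norm x) * exp (- norm y)) + exp 1 * (exp (- norm x) * (exp (- r) / r))"
        using x1 x2 r0 by (intro add_mono mult_left_mono mult_right_mono) auto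
      also have "\<dots> \<le> (2 + exp 1) * (exp (- norm x) * exp (- norm y)) + (2 + exp 1) * (exp (- norm x) * (exp (- r) / r))"
        using r0 by (intro add_mono mult_right_mono) auto
      also have "\<dots> = (2 + exp 1) * (exp (- norm x) * exp (- norm y) + exp (- norm x) * (exp (- r) / r))" by (rule distrib_left[symmetric])
      finally show "exp (- E) * (1 + 1 / r) \<le> (2 + exp 1) * (exp (- norm x) * exp (- norm y) + exp (- norm x) * (exp (- r) / r))" .
    qed (use c0 A0 in simp)
    finally show ?thesis unfolding p_def q_def r_def by (simp only: mult.assoc)
  qed
  have "0 \<le> c * A * (2 + exp 1)" using c0 A0 by simp
  then show ?thesis using main unfolding e_def by blast
qed

text \<open>The inverse transform of a Schwartz function, with inversion applied after a
  reflection.\<close>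

lemma extremal_profile:
  assumes s: "0 < s"
  shows "\<exists>f. integrable lborel f \<and> integrable lborel (fourier f) \<and> (\<forall>x::'a::euclidean_space. fourier f x = of_real (extremal s x))"
proof -
  define \<psi> where "\<psi> = (\<lambda>x::'a. complex_of_real (extremal s x))"
  have sc: "schwartz \<psi>" unfolding \<psi>_def extremal_def by (rule schwartz_exp_phi[OF s])
  note [measurable] = schwartz_measurable[OF sc]
  let ?c = "(2 * pi) ^ DIM('a)"
  define f where "f x = of_real (1 / ?c) * fourier \<psi> (- x)" for x
  have "integrable lborel (\<lambda>x. fourier \<psi> (- x))"
  proof -
    have "integrable lborel (fourier \<psi>)" by (rule fourier_schwartz_integrable[OF sc])
    moreover have "lborel = distr lborel borel (uminus :: 'a \<Rightarrow> 'a)"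
      using lborel_affine[of "-1" "0::'a"] by (simp add: density_1)
    ultimately show ?thesis
      using integrable_distr_eq[of "uminus :: 'a \<Rightarrow> 'a" lborel borel "fourier \<psi>"] by simp
  qed
  then have fi: "integrable lborel f" unfolding f_def by (rule integrable_mult_right)
  have ff: "fourier f p = \<psi> p" for p
  proof -
    have "fourier f p = (LINT x|lborel. of_real (1 / ?c) * (exp (\<i> * of_real (x \<bullet> p)) * fourier \<psi> x))"
      unfolding fourier_def[of f] f_def
      by (subst integral_lborel_affine[where c="-1" and t=0]) (auto simp: mult_ac)
    also have "\<dots> = of_real (1 / ?c) * (of_real ?c * \<psi> p)"
      unfolding integral_mult_right_zero fourier_inversion_schwartz[OF sc] ..
    finally show ?thesis by simp
  qed
  have "integrable lborel (fourier f)" using schwartz_integrable[OF sc] unfolding ff[abs_def] by simp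
  then show ?thesis using fi ff unfolding \<psi>_def by blast
qed

text \<open>The majorant of \<open>extremal_density_bound\<close> is a product plus a
  convolution-type term; translation in y decouples the latter, and all factors have finite
  integrals.\<close>

lemma extremal_admissible:
  fixes f :: "'a::euclidean_space \<Rightarrow> complex"
  assumes s: "0 < s" and d: "2 \<le> DIM('a)" and b: "- (real DIM('a) - 1) / 2 < 2 * \<beta>"
    and f: "integrable lborel f" "integrable lborel (fourier f)" "\<And>x. fourier f x = of_real (extremal s x)"
  shows "KG_admissible s \<beta> f f"
proof -
  have [measurable]: "fourier f \<in> borel_measurable borel" using f(2) by auto
  let ?D = "KG_density s \<beta> f f"
  have D: "?D (x, y) = (extremal s x)\<^sup>2 * (extremal s y)\<^sup>2 * phi s (norm x) * phi s (norm y) * KG_kernel s (1/2) ((real DIM('a) - 2) / 2 + 2 * \<beta>) x y" for x y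
    unfolding KG_density_def by (simp add: f(3))
  define u where "u z = ennreal (exp (- norm z))" for z :: 'a
  define w where "w z = ennreal (exp (- norm z) / norm z)" for z :: 'a
  have [measurable]: "u \<in> borel_measurable borel" "w \<in> borel_measurable borel" unfolding u_def w_def by measurable
  from extremal_density_bound[OF s b] obtain C where C: "0 \<le> C"
    "\<And>x y. ?D (x, y) \<le> C * (exp (- norm x) * exp (- norm y) + exp (- norm x) * (exp (- norm (y - x)) / norm (y - x)))"
    unfolding D by blast
  have Dm: "?D \<in> borel_measurable borel" by (rule KG_density_measurable) auto
  have "(\<integral>\<^sup>+q. ennreal (?D q) \<partial>lborel) = (\<integral>\<^sup>+x. \<integral>\<^sup>+y. ennreal (?D (x, y)) \<partial>lborel \<partial>lborel)"
    by (rule nn_integral_lborel_pair) (use Dm in simp)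
  also have "\<dots> \<le> (\<integral>\<^sup>+x. \<integral>\<^sup>+y. (ennreal C * u x) * (u y + w (- x + y)) \<partial>lborel \<partial>lborel)"
  proof (intro nn_integral_mono)
    fix x y :: 'a
    have "ennreal (?D (x, y)) \<le> ennreal (C * (exp (- norm x) * exp (- norm y) + exp (- norm x) * (exp (- norm (y - x)) / norm (y - x))))"
      by (rule ennreal_leI[OF C(2)])
    also have "\<dots> = ennreal (C * exp (- norm x) * (exp (- norm y) + exp (- norm (- x + y)) / norm (- x + y)))"
      by (simp add: algebra_simps)
    also have "\<dots> = (ennreal C * u x) * (u y + w (- x + y))"
      unfolding u_def w_def using C(1) by (simp only: ennreal_mult' ennreal_plus exp_ge_zero norm_ge_zero divide_nonneg_nonneg mult_nonneg_nonneg)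
    finally show "ennreal (?D (x, y)) \<le> (ennreal C * u x) * (u y + w (- x + y))" .
  qed
  also have "\<dots> = (\<integral>\<^sup>+x. (ennreal C * u x) * ((\<integral>\<^sup>+y. u y \<partial>lborel) + (\<integral>\<^sup>+y. w y \<partial>lborel)) \<partial>lborel)"
  proof (rule nn_integral_cong)
    fix x :: 'a
    have "(\<integral>\<^sup>+y. (ennreal C * u x) * (u y + w (- x + y)) \<partial>lborel) = (ennreal C * u x) * (\<integral>\<^sup>+y. u y + w (- x + y) \<partial>lborel)"
      by (rule nn_integral_cmult) measurable
    also have "(\<integral>\<^sup>+y. u y + w (- x + y) \<partial>lborel) = (\<integral>\<^sup>+y. u y \<partial>lborel) + (\<integral>\<^sup>+y. w (- x + y) \<partial>lborel)"
      by (rule nn_integral_add) measurable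
    also have "(\<integral>\<^sup>+y. w (- x + y) \<partial>lborel) = (\<integral>\<^sup>+y. w y \<partial>lborel)" by (rule nn_integral_lborel_translate) measurable
    finally show "(\<integral>\<^sup>+y. (ennreal C * u x) * (u y + w (- x + y)) \<partial>lborel) = (ennreal C * u x) * ((\<integral>\<^sup>+y. u y \<partial>lborel) + (\<integral>\<^sup>+y. w y \<partial>lborel))" .
  qed
  also have "\<dots> = ennreal C * (\<integral>\<^sup>+x. u x \<partial>lborel) * ((\<integral>\<^sup>+y. u y \<partial>lborel) + (\<integral>\<^sup>+y. w y \<partial>lborel))"
    by (simp add: nn_integral_multc nn_integral_cmult)
  also have "\<dots> < \<infinity>"
    using nn_integral_exp_norm[where 'a='a] nn_integral_exp_norm_div[OF d] unfolding u_def w_def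
    by (simp add: ennreal_mult_less_top)
  finally have "(\<integral>\<^sup>+q. ennreal (?D q) \<partial>lborel) < \<infinity>" .
  then have "integrable lborel ?D"
    by (intro integrableI_nonneg) (use Dm in \<open>auto intro!: AE_I2 KG_density_nonneg[OF s]\<close>)
  then show ?thesis using f by (simp add: KG_admissible_def)
qed

text \<open>Let a and b be the energies of the two points of a fibre, and X the integral of
  \<open>kern\<close> times exp(- a - b) / (a b). As a - b = \<tau>, the left density is exp(-
  \<tau>) X, the right one exp(\<tau>) X, and the complex density is X itself.\<close>

lemma extremal_equality:
  fixes s :: real and p :: "real \<times> 'a::euclidean_space"
  defines "F \<equiv> \<lambda>x::'a. complex_of_real (extremal s x)"
  assumes s: "0 < s" and fin: "densL s F p * densR s F p < \<infinity>"
  shows "ennreal ((norm (densC s (\<lambda>x y. F x * cnj (F y)) p))\<^sup>2) = densL s F p * densR s F p"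
proof (cases "\<bar>fst p\<bar> < norm (snd p)")
  case False
  then show ?thesis by (simp add: densC_spacelike densL_def dens_def kern_def)
next
  case True
  define \<tau> where "\<tau> = fst p"
  define k where "k \<eta> = kern s \<tau> (snd p) \<eta>" for \<eta>
  define b where "b \<eta> = phi s (norm (q4 s \<tau> (snd p) \<eta>))" for \<eta>
  define a where "a \<eta> = phi s (norm (q4 s \<tau> (snd p) \<eta> + snd p))" for \<eta>
  have k0: "0 \<le> k \<eta>" for \<eta> unfolding k_def by (rule kern_nonneg[OF s])
  have ab: "0 < a \<eta>" "0 < b \<eta>" for \<eta> unfolding a_def b_def by (rule phi_pos[OF s])+
  have a: "a \<eta> = b \<eta> + \<tau>" for \<eta> unfolding a_def b_def \<tau>_def by (rule phi_q4_add(1)[OF s True])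
  define w where "w \<eta> = k \<eta> * (exp (- a \<eta> - b \<eta>) / (a \<eta> * b \<eta>))" for \<eta>
  have w0: "0 \<le> w \<eta>" for \<eta> unfolding w_def using k0[of \<eta>] ab[of \<eta>] by simp
  have [measurable]: "w \<in> borel_measurable borel" unfolding w_def k_def a_def b_def by measurable
  define X where "X = (\<integral>\<^sup>+\<eta>. ennreal (w \<eta>) \<partial>lborel)"
  have ex: "extremal s (q4 s \<tau> (snd p) \<eta> + snd p) = exp (- a \<eta>) / a \<eta>" "extremal s (q4 s \<tau> (snd p) \<eta>) = exp (- b \<eta>) / b \<eta>" for \<eta>
    by (simp_all add: extremal_def a_def b_def)
  have L: "densL s F p = ennreal (exp (- \<tau>)) * X"
  proof -
    have "densL s F p = (\<integral>\<^sup>+\<eta>. ennreal (exp (- \<tau>)) * ennreal (w \<eta>) \<partial>lborel)"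
      unfolding densL_def dens_def
    proof (rule nn_integral_cong)
      fix \<eta>
      have "k \<eta> * (((exp (- a \<eta>) / a \<eta>)\<^sup>2 * a \<eta>) * (1 / b \<eta>)) = exp (- \<tau>) * w \<eta>"
      proof -
        have "exp (- \<tau>) * exp (- a \<eta> - b \<eta>) = (exp (- a \<eta>))\<^sup>2" using a[of \<eta>] by (simp add: power2_eq_square exp_add[symmetric])
        then show ?thesis using ab[of \<eta>] by (simp add: w_def power_divide power2_eq_square mult_ac)
      qed
      then have "ennreal (k \<eta>) * (ennreal ((exp (- a \<eta>) / a \<eta>)\<^sup>2 * a \<eta>) * ennreal (1 / b \<eta>)) = ennreal (exp (- \<tau>)) * ennreal (w \<eta>)"
        using k0[of \<eta>] ab[of \<eta>] by (simp only: ennreal_mult'[symmetric] mult_nonneg_nonneg zero_le_power2 less_imp_le exp_ge_zero)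
      then show "ennreal (kern s (fst p) (snd p) \<eta>) * (ennreal ((norm (F (q4 s (fst p) (snd p) \<eta> + snd p)))\<^sup>2 * phi s (norm (q4 s (fst p) (snd p) \<eta> + snd p))) * ennreal (1 / phi s (norm (q4 s (fst p) (snd p) \<eta>)))) = ennreal (exp (- \<tau>)) * ennreal (w \<eta>)"
        unfolding \<tau>_def[symmetric] k_def[symmetric] a_def[symmetric] b_def[symmetric] F_def ex norm_of_real power2_abs .
    qed
    also have "\<dots> = ennreal (exp (- \<tau>)) * X" unfolding X_def by (rule nn_integral_cmult) measurable
    finally show ?thesis .
  qed
  have R: "densR s F p = ennreal (exp \<tau>) * X"
  proof -
    have "densR s F p = (\<integral>\<^sup>+\<eta>. ennreal (exp \<tau>) * ennreal (w \<eta>) \<partial>lborel)"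
      unfolding densR_def dens_def
    proof (rule nn_integral_cong)
      fix \<eta>
      have i0: "0 \<le> 1 / a \<eta>" using ab[of \<eta>] by simp
      have "k \<eta> * ((1 / a \<eta>) * ((exp (- b \<eta>) / b \<eta>)\<^sup>2 * b \<eta>)) = exp \<tau> * w \<eta>"
      proof -
        have "exp \<tau> * exp (- a \<eta> - b \<eta>) = (exp (- b \<eta>))\<^sup>2" using a[of \<eta>] by (simp add: power2_eq_square exp_add[symmetric])
        then show ?thesis using ab[of \<eta>] by (simp add: w_def power_divide power2_eq_square mult_ac)
      qed
      then have "ennreal (k \<eta>) * (ennreal (1 / a \<eta>) * ennreal ((exp (- b \<eta>) / b \<eta>)\<^sup>2 * b \<eta>)) = ennreal (exp \<tau>) * ennreal (w \<eta>)"
        by (simp only: ennreal_mult'[OF k0, symmetric] ennreal_mult'[OF i0, symmetric] ennreal_mult'[OF exp_ge_zero, symmetric])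
      then show "ennreal (kern s (fst p) (snd p) \<eta>) * (ennreal (1 / phi s (norm (q4 s (fst p) (snd p) \<eta> + snd p))) * ennreal ((norm (F (q4 s (fst p) (snd p) \<eta>)))\<^sup>2 * phi s (norm (q4 s (fst p) (snd p) \<eta>)))) = ennreal (exp \<tau>) * ennreal (w \<eta>)"
        unfolding \<tau>_def[symmetric] k_def[symmetric] a_def[symmetric] b_def[symmetric] F_def ex norm_of_real power2_abs .
    qed
    also have "\<dots> = ennreal (exp \<tau>) * X" unfolding X_def by (rule nn_integral_cmult) measurable
    finally show ?thesis .
  qed
  have LR: "densL s F p * densR s F p = X * X"
  proof -
    have "densL s F p * densR s F p = (ennreal (exp (- \<tau>)) * ennreal (exp \<tau>)) * (X * X)" unfolding L R by (simp only: mult_ac)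
    also have "ennreal (exp (- \<tau>)) * ennreal (exp \<tau>) = 1" by (simp add: ennreal_mult'[symmetric] exp_add[symmetric])
    finally show ?thesis by simp
  qed
  \<comment> \<open>Here the hypothesis \<open>fin\<close> enters: only for finite X is the Bochner
    integral in \<open>densC\<close> equal to X, since otherwise it is 0 by convention.\<close>
  then have "X \<noteq> \<infinity>" using fin by (auto simp: ennreal_top_mult)
  then have wi: "integrable lborel w" by (intro integrableI_nonneg) (auto simp: w0 X_def less_top[symmetric])
  have X: "X = ennreal (LINT \<eta>|lborel. w \<eta>)" unfolding X_def by (rule nn_integral_eq_integral[OF wi]) (simp add: w0)
  have I0: "0 \<le> (LINT \<eta>|lborel. w \<eta>)" by (simp add: w0)
  have "densC s (\<lambda>x y. F x * cnj (F y)) p = (LINT \<eta>|lborel. of_real (w \<eta>))"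
    unfolding densC_def case_prod_beta
  proof (intro Bochner_Integration.integral_cong refl)
    fix \<eta>
    have "w \<eta> = k \<eta> * ((exp (- a \<eta>) / a \<eta>) * (exp (- b \<eta>) / b \<eta>))" by (simp add: w_def exp_diff exp_minus field_simps)
    then show "complex_of_real (kern s (fst p) (snd p) \<eta>) * (F (q4 s (fst p) (snd p) \<eta> + snd p) * cnj (F (q4 s (fst p) (snd p) \<eta>))) = of_real (w \<eta>)"
      unfolding \<tau>_def[symmetric] k_def[symmetric] F_def ex complex_cnj_complex_of_real by (simp only: of_real_mult)
  qed
  also have "\<dots> = of_real (LINT \<eta>|lborel. w \<eta>)" by (rule integral_complex_of_real)
  finally have "(norm (densC s (\<lambda>x y. F x * cnj (F y)) p))\<^sup>2 = (LINT \<eta>|lborel. w \<eta>) * (LINT \<eta>|lborel. w \<eta>)" by (simp add: power2_eq_square)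
  then show ?thesis unfolding LR X by (simp only: ennreal_mult'[OF I0])
qed

lemma not_AE_lborel_False: "\<not> (AE x in lborel. x \<notin> (UNIV :: 'a::euclidean_space set))"
proof
  assume "AE x in lborel. x \<notin> (UNIV :: 'a set)"
  then have "(UNIV :: 'a set) \<in> null_sets lborel" by (subst AE_iff_null_sets) (simp_all only: sets_lborel sets.top space_borel[symmetric])
  then show False by (simp add: null_sets_def)
qed

text \<open>Allows the right-hand side to be cancelled when constants are compared. The density is
  strictly positive off the diagonal, so a vanishing integral would make the whole space a null
  set.\<close>

lemma extremal_density_pos:
  fixes f :: "'a::euclidean_space \<Rightarrow> complex"
  assumes s: "0 < s" and f: "\<And>x. fourier f x = of_real (extremal s x)" and adm: "KG_admissible s \<beta> f f"
  shows "0 < (LINT q|lborel. KG_density s \<beta> f f q)"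
proof (rule ccontr)
  let ?D = "KG_density s \<beta> f f"
  have [measurable]: "?D \<in> borel_measurable borel" using adm by (auto simp: KG_admissible_def)
  have Dm: "?D \<in> borel_measurable (borel \<Otimes>\<^sub>M borel)" by (simp add: borel_prod)
  assume "\<not> 0 < (LINT q|lborel. ?D q)"
  then have "(\<integral>\<^sup>+q. ennreal (?D q) \<partial>lborel) = 0"
    unfolding KG_density_nn_integral[OF s adm] by (simp add: ennreal_eq_0_iff)
  then have "(\<integral>\<^sup>+x. \<integral>\<^sup>+y. ennreal (?D (x, y)) \<partial>lborel \<partial>lborel) = 0"
    by (subst nn_integral_lborel_pair[symmetric]) auto
  moreover have "(\<lambda>x. \<integral>\<^sup>+y. ennreal (?D (x, y)) \<partial>lborel) \<in> borel_measurable lborel" using Dm by measurable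
  ultimately have "AE x in lborel. (\<integral>\<^sup>+y. ennreal (?D (x, y)) \<partial>lborel) = 0" by (subst (asm) nn_integral_0_iff_AE)
  then have "AE x in lborel. x \<notin> (UNIV :: 'a set)"
  proof eventually_elim
    case (elim x)
    have "(\<lambda>y. ennreal (?D (x, y))) \<in> borel_measurable lborel" using Dm by measurable
    with elim have "AE y in lborel. ennreal (?D (x, y)) = 0" by (subst (asm) nn_integral_0_iff_AE)
    then have "AE y in lborel. y \<notin> (UNIV :: 'a set)" using AE_lborel_singleton[of x]
    proof eventually_elim
      case (elim y)
      have "0 < mgap s x y" by (rule mgap_pos[OF s]) (use elim(2) in blast)
      then have h: "0 < phi s (norm x) * phi s (norm y) - x \<bullet> y - s\<^sup>2" by (simp add: mgap_def)
      then have "0 < phi s (norm x) * phi s (norm y) - x \<bullet> y + s\<^sup>2" using zero_le_power2[of s] by linarith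
      then have "0 < KG_kernel s (1/2) ((real DIM('a) - 2) / 2 + 2 * \<beta>) x y"
        using h unfolding KG_kernel_def by (intro divide_pos_pos powr_gt_zero[THEN iffD2]) auto
      moreover have "0 < extremal s z" for z :: 'a unfolding extremal_def using phi_pos[OF s] by simp
      ultimately have "0 < ?D (x, y)" unfolding KG_density_def split_conv f norm_of_real power2_abs
        by (intro mult_pos_pos zero_less_power phi_pos[OF s])
      then show ?case using elim(1) by (simp add: ennreal_eq_0_iff)
    qed
    then show ?case using not_AE_lborel_False by blast
  qed
  then show False using not_AE_lborel_False by blast
qed

text \<open>Whatever H witnesses the estimate, its transform is the symbol times the spectral
  density by uniqueness. Its squared norm is known exactly from \<open>extremal_equality\<close> and
  \<open>densLR_pairing\<close>, and \<open>has_fourier_L2_bound\<close> turns this into a lower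
  bound for H.\<close>

lemma KG_const_le:
  fixes f :: "'a::euclidean_space \<Rightarrow> complex"
  assumes s: "0 < s" and d: "2 \<le> DIM('a)" and b: "- (real DIM('a) - 1) / 2 < 2 * \<beta>"
    and f: "\<And>x. fourier f x = of_real (extremal s x)" and adm: "KG_admissible s \<beta> f f" and est: "KG_estimate s \<beta> C f f"
  shows "KG_const \<beta> DIM('a) \<le> C"
proof -
  have fi: "integrable lborel (fourier f)" using adm by (auto simp: KG_admissible_def)
  then have [measurable]: "fourier f \<in> borel_measurable borel" by auto
  have fe: "fourier f = (\<lambda>x. of_real (extremal s x))" by (rule ext) (rule f)
  define c where "c = (2 * pi) powr (1 - real DIM('a))"
  have c0: "0 \<le> c" by (simp add: c_def)
  define \<Phi> where "\<Phi> = (\<lambda>x y. fourier f x * cnj (fourier f y))"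
  define D where "D = (LINT q|lborel. KG_density s \<beta> f f q)"
  have D0: "0 < D" unfolding D_def by (rule extremal_density_pos[OF s f adm])
  have fp: "0 < fibC \<beta> DIM('a)" by (rule fibC_pos[OF d b])
  let ?m = "\<lambda>p :: real \<times> 'a. ennreal (((norm (snd p))\<^sup>2 - (fst p)\<^sup>2) powr (2 * \<beta>))"
  let ?LR = "\<lambda>p. densL s (fourier f) p * densR s (fourier f) p"
  have mm[measurable]: "?m \<in> borel_measurable borel" unfolding borel_prod[symmetric] by measurable
  have val: "(\<integral>\<^sup>+p. ?m p * ?LR p \<partial>lborel) = ennreal (fibC \<beta> DIM('a) * D)"
    using densLR_pairing[OF s d b, of f f] KG_density_nn_integral[OF s adm] fp by (simp add: ennreal_mult' D_def)
  have "AE p in lborel. ?m p * ?LR p \<noteq> \<infinity>"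
    by (rule nn_integral_PInf_AE) (simp_all add: val)
  \<comment> \<open>Finiteness of the weighted integral makes the product of the two densities
    finite almost everywhere in |\<tau>| < |\<xi>|, where the weight is positive; elsewhere all
    densities vanish.\<close>
  then have AEe: "AE p in lborel. ?m p * ennreal ((norm (densC s \<Phi> p))\<^sup>2) = ?m p * ?LR p"
  proof eventually_elim
    case (elim p)
    show ?case
    proof (cases "\<bar>fst p\<bar> < norm (snd p)")
      case True
      then have "0 < ((norm (snd p))\<^sup>2 - (fst p)\<^sup>2) powr (2 * \<beta>)" using timelike_gap(1)[OF True] by simp
      then have "?LR p < \<infinity>" using elim by (auto simp: ennreal_mult_eq_top_iff less_top[symmetric])
      then show ?thesis using extremal_equality[OF s, of p] unfolding \<Phi>_def fe by simp
    qed (simp add: densC_spacelike densL_def dens_def kern_def)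
  qed
  from est obtain H where box: "is_box_power \<beta> (KG_product s f f) H" and Hm: "H \<in> borel_measurable lborel"
    and Hi: "integrable lborel (\<lambda>p. (norm (H p))\<^sup>2)" and Hle: "(LINT p|lborel. (norm (H p))\<^sup>2) \<le> C * D"
    unfolding KG_estimate_def D_def by blast
  from box obtain G where G: "has_fourier (KG_product s f f) G" "has_fourier H (\<lambda>p. complex_of_real (box_symbol \<beta> p) * G p)"
    unfolding is_box_power_def by blast
  have HI: "(\<integral>\<^sup>+p. ennreal ((norm (H p))\<^sup>2) \<partial>lborel) = ennreal (LINT p|lborel. (norm (H p))\<^sup>2)"
    by (rule nn_integral_eq_integral[OF Hi]) simp
  have AEg: "AE p in lborel. G p = of_real c * densC s \<Phi> p"
    unfolding c_def \<Phi>_def by (rule has_fourier_unique[OF G(1) KG_product_has_fourier[OF s fi fi]])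
  have "(\<integral>\<^sup>+p. ennreal ((norm (complex_of_real (box_symbol \<beta> p) * G p))\<^sup>2) \<partial>lborel) = (\<integral>\<^sup>+p. ennreal (c\<^sup>2) * (?m p * ?LR p) \<partial>lborel)"
    by (rule nn_integral_cong_AE, use AEg AEe in eventually_elim) (simp only: spectral_density_norm[OF c0])
  also have "\<dots> = ennreal (c\<^sup>2) * (\<integral>\<^sup>+p. ?m p * ?LR p \<partial>lborel)" by (rule nn_integral_cmult) measurable
  also have "\<dots> = ennreal (c\<^sup>2 * (fibC \<beta> DIM('a) * D))" unfolding val by (rule ennreal_mult'[symmetric]) simp
  finally have "ennreal (c\<^sup>2 * (fibC \<beta> DIM('a) * D)) \<le> ennreal ((2 * pi) ^ Suc DIM('a)) * ennreal (LINT p|lborel. (norm (H p))\<^sup>2)"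
    using has_fourier_L2_bound[OF _ _ G(2)] Hm HI by simp
  also have "\<dots> = ennreal ((2 * pi) ^ Suc DIM('a) * (LINT p|lborel. (norm (H p))\<^sup>2))" by (rule ennreal_mult'[symmetric]) simp
  finally have "c\<^sup>2 * (fibC \<beta> DIM('a) * D) \<le> (2 * pi) ^ Suc DIM('a) * (LINT p|lborel. (norm (H p))\<^sup>2)"
    by (subst (asm) ennreal_le_iff) (auto intro!: mult_nonneg_nonneg Bochner_Integration.integral_nonneg)
  also have "\<dots> \<le> (2 * pi) ^ Suc DIM('a) * (C * D)" by (rule mult_left_mono[OF Hle]) simp
  finally have "(c\<^sup>2 * fibC \<beta> DIM('a)) * D \<le> ((2 * pi) ^ Suc DIM('a) * C) * D" by (simp only: mult.assoc)
  then have "c\<^sup>2 * fibC \<beta> DIM('a) \<le> (2 * pi) ^ Suc DIM('a) * C" using D0 by simp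
  moreover have "0 < (2 * pi) ^ Suc DIM('a)" by (intro zero_less_power) simp
  ultimately have "c\<^sup>2 * fibC \<beta> DIM('a) / (2 * pi) ^ Suc DIM('a) \<le> C" by (simp only: pos_divide_le_eq mult.commute)
  then show ?thesis unfolding c_def KG_const_eq_fibC .
qed

theorem theorem1p1:
  fixes s \<beta> :: real
  assumes "CARD('n::{finite,wellorder}) \<ge> 2"
    and "s > 0"
    and "\<beta> > (1 - real CARD('n)) / 4"
  shows "(\<forall>f g :: real ^ 'n::{finite,wellorder} \<Rightarrow> complex. KG_admissible s \<beta> f g \<longrightarrow>
            KG_estimate s \<beta> (KG_const \<beta> CARD('n)) f g) \<and>
         (\<forall>C < KG_const \<beta> CARD('n).
            \<not> (\<forall>f g :: real ^ 'n::{finite,wellorder} \<Rightarrow> complex. KG_admissible s \<beta> f g \<longrightarrow>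
                 KG_estimate s \<beta> C f g))"
proof -
  have dim: "DIM(real ^ 'n::{finite,wellorder}) = CARD('n)" by simp
  have d: "2 \<le> DIM(real ^ 'n::{finite,wellorder})" using assms(1) by simp
  have b: "- (real DIM(real ^ 'n::{finite,wellorder}) - 1) / 2 < 2 * \<beta>" using assms(3) by (simp add: field_simps)
  \<comment> \<open>Optimality needs a single pair of data, with f in both places.\<close>
  obtain f :: "real ^ 'n::{finite,wellorder} \<Rightarrow> complex" where f: "integrable lborel f" "integrable lborel (fourier f)" "\<And>x. fourier f x = of_real (extremal s x)"
    using extremal_profile[OF assms(2)] by blast
  have "KG_admissible s \<beta> f f" by (rule extremal_admissible[OF assms(2) d b f])
  then have "KG_const \<beta> CARD('n) \<le> C" if "KG_estimate s \<beta> C f f" for C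
    using KG_const_le[OF assms(2) d b f(3) _ that] unfolding dim by blast
  then have "\<forall>C < KG_const \<beta> CARD('n). \<not> (\<forall>f g :: real ^ 'n::{finite,wellorder} \<Rightarrow> complex. KG_admissible s \<beta> f g \<longrightarrow> KG_estimate s \<beta> C f g)"
    using \<open>KG_admissible s \<beta> f f\<close> by (meson linorder_not_less)
  moreover have "KG_estimate s \<beta> (KG_const \<beta> CARD('n)) u v" if "KG_admissible s \<beta> u v" for u v :: "real ^ 'n::{finite,wellorder} \<Rightarrow> complex"
    using KG_estimate_holds[OF assms(2) d b that] unfolding dim .
  ultimately show ?thesis by blast
qed

end
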